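(* Let $(X,\mathbb R^d,\mu)$ be an $m$-coloured uniformly discrete stationary ergodic point process. For each system of weights $w=(w_1,\dots,w_m)\in\mathbb R^m$, the mapping $$\hat f\mapsto N^w_f,$$ defined for all $f\in\mathbb S$ (the space of rapidly decreasing functions on $\mathbb R^d$), extends uniquely to an isometric embedding $$\theta^w: L^2(\mathbb R^d,\widehat{\dot\mu^w_1})\longrightarrow L^2(X,\mu)$$ which intertwines the representations $U$ and $T$ of $\mathbb R^d$, i.e. $\theta^w(U_tf)=T_t\theta^w(f)$ for all $t\in\mathbb R^d$ and all $f\in L^2(\mathbb R^d,\widehat{\dot\mu^w_1})$.
   Context: Fix $d,m\ge1$ and let $\mathbb E=\mathbb R^d\times\{1,\dots,m\}$ (second factor discrete), with $t+(x,i):=(t+x,i)$ for $t\in\mathbb R^d$. $C_R$ is the open cube of edge length $R$ centred at $0$ in $\mathbb R^d$; $\ell$ is Lebesgue measure. $M_p$ is the set of positive Radon measures $\lambda$ on $\mathbb E$ with $\lambda(A)\in\{0,1,2,\dots\}$ for every relatively compact Borel set $A$, with the vague topology ($\lambda_n\to\lambda$ iff $\lambda_n(f)\to\lambda(f)$ for all $f\in C_c(\mathbb E)$) and its Borel $\sigma$-algebra; $\mathbb R^d$ acts by $(T_t\lambda)(A)=\lambda(-t+A)$. For $r>0$, $M_p(C_r^{(m)},1)$ is the (compact) set of $\lambda\in M_p$ with $\lambda((a+C_r)\times\{1,\dots,m\})\le1$ for all $a\in\mathbb R^d$. An $m$-coloured uniformly discrete stationary ergodic point process $(X,\mu)$ (or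 $(X,\mathbb R^d,\mu)$) is a Borel probability measure $\mu$ on $M_p$, invariant and ergodic under all $T_t$, whose support $X$ is a closed subset of $M_p(C_r^{(m)},1)$ for some $r>0$. For $\lambda\in X$ let $\lambda^i$ be the measure on $\mathbb R^d$ given by $\lambda^i(A)=\lambda(A\times\{i\})$; it is assumed throughout that for each $i$ the constant $I^{(i)}$ with $\int_X\lambda^i(A)\,d\mu(\lambda)=I^{(i)}\ell(A)$ is positive. For a system of weights $w=(w_1,\dots,w_m)\in\mathbb R^m$ put $\lambda^w=\sum_i w_i\lambda^i$ (a signed measure on $\mathbb R^d$). The $w$-weighted Palm measure $\dot\mu^w$ is the finite signed measure on $X$ given by $\dot\mu^w(D)=\frac1{\ell(B)}\int_X\sum_{x\in B}\lambda^w(\{x\})\mathbf 1_D(T_{-x}\lambda)\,d\mu(\lambda)$, which does not depend on the choice of bounded Borel $B\subset\mathbb R^d$ with $\ell(B)>0$. For $f$ bounded measurable with compact support, or $f\in\mathbb S$, $N^w_f:X\to\mathbb C$ is $N^w_f(\lambda)=\lambda^w(f)=\sum_{x\in\mathbb R^d}\lambda^w(\{x\})f(x)$. The weighted first moment of $\dot\mu^w$ is the measure $\dot\mu^w_1$ on $\mathbb R^d$ with $\dot\mu^w_1(f)=\dot\mu^w(N^w_f)$, $f\in C_c(\mathbb R^d)$. It is positive definite and Fourier transformable; its Fourier transform, determined by $\widehat{\dot\mu^w_1}(f)=\dot\mu^w_1(\hat f)$ for $f\in\mathbb S$ with $\hat f(y)=\int e^{-2\pi i x\cdot y}f(x)\,dx$,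 is a positive translation bounded measure on $\mathbb R^d$. $U$ is the unitary representation of $\mathbb R^d$ on $L^2(\mathbb R^d,\widehat{\dot\mu^w_1})$ given by $U_tf(x)=e^{-2\pi i t\cdot x}f(x)$, and $T$ is the unitary representation on $L^2(X,\mu)$ given by $(T_tF)(\lambda)=F(T_{-t}\lambda)$. *)

theory Defs
  imports "HOL-Probability.Probability"
begin

section \<open>Coloured point configurations\<close>

type_synonym 'd config = "((real ^ 'd) \<times> nat) measure"

definition coloured_space :: "nat \<Rightarrow> ((real ^ 'd) \<times> nat) set" where
  "coloured_space m = UNIV \<times> {1..m}"

definition open_cube :: "real \<Rightarrow> (real ^ 'd) set" where
  "open_cube R = {x. \<forall>i. \<bar>x $ i\<bar> < R / 2}"

text \<open>A Borel measure on this locally compact second countable space that is finite on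
  relatively compact sets is automatically Radon. The coloured space is closed in the ambient
  product, so closures may be taken there.\<close>

definition point_measures :: "nat \<Rightarrow> 'd::finite config set" where
  "point_measures m =
    {\<xi>. sets \<xi> = sets (restrict_space borel (coloured_space m)) \<and>
         (\<forall>A \<in> sets \<xi>. compact (closure A) \<longrightarrow> (\<exists>n::nat. emeasure \<xi> A = of_nat n))}"

definition test_functions :: "nat \<Rightarrow> ((real ^ 'd::finite) \<times> nat \<Rightarrow> real) set" where
  "test_functions m =
    {f. continuous_on (coloured_space m) f \<and>
        compact (closure {z \<in> coloured_space m. f z \<noteq> 0})}"

definition vague_topology :: "nat \<Rightarrow> 'd::finite config topology" where
  "vague_topology m = topology_generated_by
     {{\<xi> \<in> point_measures m. (LINT z|\<xi>. f z) \<in> V} | f V. f \<in> test_functions m \<and> open V}"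

definition vague_borel :: "nat \<Rightarrow> 'd::finite config measure" where
  "vague_borel m = sigma (point_measures m) {V. openin (vague_topology m) V}"

definition translate :: "real ^ 'd \<Rightarrow> 'd::finite config \<Rightarrow> 'd config" where
  "translate t \<xi> = distr \<xi> \<xi> (\<lambda>(x, i). (t + x, i))"

definition uniformly_discrete_measures :: "nat \<Rightarrow> real \<Rightarrow> 'd::finite config set" where
  "uniformly_discrete_measures m r =
    {\<xi> \<in> point_measures m. \<forall>a. emeasure \<xi> (((+) a ` open_cube r) \<times> {1..m}) \<le> 1}"


section \<open>Stationary ergodic point processes\<close>

definition is_support :: "nat \<Rightarrow> 'd::finite config set \<Rightarrow> 'd config measure \<Rightarrow> bool" where
  "is_support m X \<mu> \<longleftrightarrow>
     closedin (vague_topology m) X \<and> emeasure \<mu> (point_measures m - X) = 0 \<and>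
     (\<forall>C. closedin (vague_topology m) C \<and> emeasure \<mu> (point_measures m - C) = 0 \<longrightarrow> X \<subseteq> C)"

definition stationary :: "nat \<Rightarrow> 'd::finite config measure \<Rightarrow> bool" where
  "stationary m \<mu> \<longleftrightarrow> (\<forall>t. distr \<mu> (vague_borel m) (translate t) = \<mu>)"

definition ergodic :: "'d::finite config measure \<Rightarrow> bool" where
  "ergodic \<mu> \<longleftrightarrow>
     (\<forall>A \<in> sets \<mu>. (\<forall>t. translate t -` A \<inter> space \<mu> = A) \<longrightarrow> measure \<mu> A = 0 \<or> measure \<mu> A = 1)"

definition uniformly_discrete_ergodic_process ::
    "nat \<Rightarrow> 'd::finite config set \<Rightarrow> 'd config measure \<Rightarrow> bool" where
  "uniformly_discrete_ergodic_process m X \<mu> \<longleftrightarrow>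
     prob_space \<mu> \<and> sets \<mu> = sets (vague_borel m) \<and> stationary m \<mu> \<and> ergodic \<mu> \<and>
     is_support m X \<mu> \<and> (\<exists>r>0. X \<subseteq> uniformly_discrete_measures m r) \<and>
     (\<forall>i \<in> {1..m}. \<exists>I>0. \<forall>A \<in> sets borel.
        (\<integral>\<^sup>+\<xi>\<in>X. emeasure \<xi> (A \<times> {i}) \<partial>\<mu>) = ennreal I * emeasure lborel A)"


section \<open>Weighted Palm measure and its first moment\<close>

definition weighted_mass :: "nat \<Rightarrow> (nat \<Rightarrow> real) \<Rightarrow> 'd::finite config \<Rightarrow> real ^ 'd \<Rightarrow> real" where
  "weighted_mass m w \<xi> x = (\<Sum>i = 1..m. w i * measure \<xi> ({x} \<times> {i}))"

definition weighted_count ::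
    "nat \<Rightarrow> (nat \<Rightarrow> real) \<Rightarrow> (real ^ 'd \<Rightarrow> complex) \<Rightarrow> 'd::finite config \<Rightarrow> complex" where
  "weighted_count m w f \<xi> = (\<Sum>\<^sub>\<infinity>x\<in>UNIV. of_real (weighted_mass m w \<xi> x) * f x)"

definition palm_measure ::
    "nat \<Rightarrow> 'd::finite config set \<Rightarrow> 'd config measure \<Rightarrow> (real ^ 'd) set \<Rightarrow> (nat \<Rightarrow> real)
      \<Rightarrow> 'd config set \<Rightarrow> real" where
  "palm_measure m X \<mu> B w D =
     (1 / measure lborel B) *
     (LINT \<xi>:X|\<mu>. (\<Sum>\<^sub>\<infinity>x\<in>B. weighted_mass m w \<xi> x * indicator D (translate (- x) \<xi>)))"

text \<open>A finite signed measure on the measurable space of \<open>M\<close> is given by its values on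
  \<open>sets M\<close>. Integration against it uses its Jordan decomposition; note that \<open>ennreal\<close> sends
  negative numbers to 0, and that the empty set contributes the value 0 to the supremum.\<close>

definition positive_variation :: "'a measure \<Rightarrow> ('a set \<Rightarrow> real) \<Rightarrow> 'a measure" where
  "positive_variation M \<sigma> =
     measure_of (space M) (sets M) (\<lambda>A. SUP D \<in> {D \<in> sets M. D \<subseteq> A}. ennreal (\<sigma> D))"

definition signed_integral :: "'a measure \<Rightarrow> ('a set \<Rightarrow> real) \<Rightarrow> ('a \<Rightarrow> complex) \<Rightarrow> complex" where
  "signed_integral M \<sigma> F =
     integral\<^sup>L (positive_variation M \<sigma>) F - integral\<^sup>L (positive_variation M (\<lambda>D. - \<sigma> D)) F"

text \<open>The first moment is a signed Radon measure of possibly infinite total variation, so it is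
  represented by the linear functional \<open>f \<mapsto> \<integral> f\<close> that it induces. The formula defining it
  on continuous functions with compact support is used for rapidly decreasing \<open>f\<close> as well.\<close>

definition palm_first_moment ::
    "nat \<Rightarrow> 'd::finite config set \<Rightarrow> 'd config measure \<Rightarrow> (real ^ 'd) set \<Rightarrow> (nat \<Rightarrow> real)
      \<Rightarrow> (real ^ 'd \<Rightarrow> complex) \<Rightarrow> complex" where
  "palm_first_moment m X \<mu> B w f =
     signed_integral (restrict_space \<mu> X) (palm_measure m X \<mu> B w) (weighted_count m w f)"


section \<open>Rapidly decreasing functions and Fourier transforms\<close>

fun iterated_partial ::
    "'d list \<Rightarrow> (real ^ 'd::finite \<Rightarrow> complex) \<Rightarrow> real ^ 'd \<Rightarrow> complex" where
  "iterated_partial [] f = f"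
| "iterated_partial (i # is) f =
     (\<lambda>x. frechet_derivative (iterated_partial is f) (at x) (axis i 1))"

definition rapidly_decreasing :: "(real ^ 'd::finite \<Rightarrow> complex) set" where
  "rapidly_decreasing =
    {f. \<forall>is. (\<forall>x. iterated_partial is f differentiable at x) \<and>
             (\<forall>k::nat. bounded (range (\<lambda>x. norm x ^ k *\<^sub>R iterated_partial is f x)))}"

definition fourier :: "(real ^ 'd::finite \<Rightarrow> complex) \<Rightarrow> real ^ 'd \<Rightarrow> complex" where
  "fourier f y = (LINT x|lborel. cis (- 2 * pi * (x \<bullet> y)) * f x)"

definition is_fourier_transform ::
    "((real ^ 'd::finite \<Rightarrow> complex) \<Rightarrow> complex) \<Rightarrow> (real ^ 'd) measure \<Rightarrow> bool" where
  "is_fourier_transform \<gamma> \<nu> \<longleftrightarrow>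
     sets \<nu> = sets borel \<and> (\<forall>K. compact K \<longrightarrow> emeasure \<nu> K < \<infinity>) \<and>
     (\<forall>f \<in> rapidly_decreasing. integrable \<nu> f \<and> integral\<^sup>L \<nu> f = \<gamma> (fourier f))"

text \<open>At most one positive Radon measure satisfies the predicate.\<close>

definition fourier_transform_measure ::
    "((real ^ 'd::finite \<Rightarrow> complex) \<Rightarrow> complex) \<Rightarrow> (real ^ 'd) measure" where
  "fourier_transform_measure \<gamma> = (THE \<nu>. is_fourier_transform \<gamma> \<nu>)"


section \<open>Isometric embeddings of complex L2 spaces\<close>

definition square_integrable :: "'a measure \<Rightarrow> ('a \<Rightarrow> complex) set" where
  "square_integrable M = {f \<in> borel_measurable M. integrable M (\<lambda>x. (cmod (f x))\<^sup>2)}"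

text \<open>Elements of L2 are represented by square integrable functions, equality being equality
  almost everywhere; the second clause says that the map is well defined on classes.\<close>

definition L2_isometric_embedding ::
    "'a measure \<Rightarrow> 'b measure \<Rightarrow> (('a \<Rightarrow> complex) \<Rightarrow> 'b \<Rightarrow> complex) \<Rightarrow> bool" where
  "L2_isometric_embedding M N \<theta> \<longleftrightarrow>
     (\<forall>f \<in> square_integrable M. \<theta> f \<in> square_integrable N) \<and>
     (\<forall>f \<in> square_integrable M. \<forall>g \<in> square_integrable M.
        (AE x in M. f x = g x) \<longrightarrow> (AE y in N. \<theta> f y = \<theta> g y)) \<and>
     (\<forall>f \<in> square_integrable M. \<forall>g \<in> square_integrable M.
        AE y in N. \<theta> (\<lambda>x. f x + g x) y = \<theta> f y + \<theta> g y) \<and>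
     (\<forall>c. \<forall>f \<in> square_integrable M. AE y in N. \<theta> (\<lambda>x. c * f x) y = c * \<theta> f y) \<and>
     (\<forall>f \<in> square_integrable M.
        (LINT y|N. (cmod (\<theta> f y))\<^sup>2) = (LINT x|M. (cmod (f x))\<^sup>2))"

definition extends_count_map ::
    "nat \<Rightarrow> (nat \<Rightarrow> real) \<Rightarrow> (real ^ 'd) measure \<Rightarrow> 'd config measure
      \<Rightarrow> ((real ^ 'd::finite \<Rightarrow> complex) \<Rightarrow> 'd config \<Rightarrow> complex) \<Rightarrow> bool" where
  "extends_count_map m w \<nu> P \<theta> \<longleftrightarrow>
     (\<forall>f \<in> rapidly_decreasing.
        fourier f \<in> square_integrable \<nu> \<and> weighted_count m w f \<in> square_integrable P \<and>
        (AE \<xi> in P. \<theta> (fourier f) \<xi> = weighted_count m w f \<xi>))"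

definition rep_U :: "real ^ 'd \<Rightarrow> (real ^ 'd::finite \<Rightarrow> complex) \<Rightarrow> real ^ 'd \<Rightarrow> complex" where
  "rep_U t f x = cis (- 2 * pi * (t \<bullet> x)) * f x"

definition rep_T :: "real ^ 'd \<Rightarrow> ('d::finite config \<Rightarrow> complex) \<Rightarrow> 'd config \<Rightarrow> complex" where
  "rep_T t F \<xi> = F (translate (- t) \<xi>)"

definition intertwines_U_T ::
    "(real ^ 'd) measure \<Rightarrow> 'd config measure
      \<Rightarrow> ((real ^ 'd::finite \<Rightarrow> complex) \<Rightarrow> 'd config \<Rightarrow> complex) \<Rightarrow> bool" where
  "intertwines_U_T \<nu> P \<theta> \<longleftrightarrow>
     (\<forall>t. \<forall>f \<in> square_integrable \<nu>. AE \<xi> in P. \<theta> (rep_U t f) \<xi> = rep_T t (\<theta> f) \<xi>)"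

end

(*
  Averaging the number of weighted pairs of points over the first point turns the Palm first moment
  into the correlation functional psi |-> E sum_{x in B, y} w(x) w(y) psi(y - x) / vol B, and
  stationarity gives E |N_f|^2 = corr(f * f~) for the autocorrelation f * f~. Hence corr is positive
  definite. A Bochner argument (Gaussian regularisation, then vague compactness, obtained from a
  space-filling curve and Helly's theorem) yields its spectral measure, so that f^ |-> N_f preserves
  norms. Modulated Gaussians are total in L2 of the spectral measure, and the isometry extends to
  the closure of its graph.
*)
theory Submission
  imports Defs
begin

text \<open>Configurations, the first moment and its Fourier transform may all have infinite mass,
  and the first moment is signed besides. One weight controls them: \<open>decay\<close> is
  integrable, changes under a translation by a bounded factor only, and its sums over the points of
  uniformly discrete configurations are uniformly bounded. It supplies most of the majorants for
  interchanging sums, expectations and integrals. It also normalises the Bochner argument: the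
  regularised spectral densities are bounded only against \<open>decay\<close>, so the limit is
  taken after multiplication by the square of \<open>decay\<close>, where one factor gives bounded
  mass and the other tightness.

  The other obstacle is measurability. A sum over the points of a random configuration becomes a sum
  of random variables only once the points are named measurably; half-open grid cells of edge r/2
  hold at most one point each and serve as names. Moreover the Palm measure translates a
  configuration by one of its own points, so translation must be measurable jointly in the vector
  and the configuration.\<close>

lemmas lint_cong = Bochner_Integration.integral_cong
lemmas lint_diff = Bochner_Integration.integral_diff
lemmas lint_add = Bochner_Integration.integral_add
lemmas integrable_bound_AE = Bochner_Integration.integrable_bound
lemmas integrable_cong_lint = Bochner_Integration.integrable_cong

section \<open>A space-filling curve and weak compactness\<close>

text \<open>The even function of period 2 that is the identity on [0, 1]. The closed form makes
  periodicity and continuity immediate.\<close>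

definition triangle_wave :: "real => real" where
 "triangle_wave t = arccos (cos (pi * t)) / pi"

lemma triangle_wave_id: "0 <= t ==> t <= 1 ==> triangle_wave t = t"
 unfolding triangle_wave_def by (subst arccos_cos) auto

lemma triangle_wave_shift: "triangle_wave (2 * of_int k + t) = triangle_wave t"
proof -
 have "cos (pi * (2 * of_int k + t)) = cos (pi * t + (2 * pi) * of_int k)"
  by (simp add: algebra_simps)
 also have "\<dots> = cos (pi * t)"
  by (simp only: cos_add sin_int_2pin cos_int_2pin mult_1_right mult_zero_right diff_zero)
 finally show ?thesis unfolding triangle_wave_def by simp
qed

lemma continuous_triangle_wave: "continuous_on UNIV triangle_wave"
 unfolding triangle_wave_def by (intro continuous_intros) auto

text \<open>Schoenberg's auxiliary function: 0 on [0, 1/3], 1 on [2/3, 1], linear in between,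
  extended evenly with period 2. On a ternary expansion with digits 0 and 2 it reads off half of the
  first digit.\<close>

definition ternary_digit :: "real => real" where
 "ternary_digit t = min 1 (max 0 (3 * triangle_wave t - 1))"

lemma continuous_ternary_digit: "continuous_on UNIV ternary_digit"
 unfolding ternary_digit_def
 by (intro continuous_intros continuous_on_subset[OF continuous_triangle_wave]) auto

lemma ternary_digit_bounds: "0 <= ternary_digit t" "ternary_digit t <= 1"
 unfolding ternary_digit_def by auto

lemma ternary_digit_shift: "ternary_digit (2 * of_int k + t) = ternary_digit t"
 unfolding ternary_digit_def triangle_wave_shift ..

text \<open>Multiplication by \<open>3 ^ k\<close> shifts the ternary expansion of \<open>u\<close>,
  so the first digit of the shifted number is the one to be read. Using the digits 0 and 2 only
  keeps \<open>u\<close> in the Cantor set, where \<open>ternary_digit\<close> takes no intermediate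
  values.\<close>

lemma ternary_digit_expansion:
 fixes a :: "nat => nat"
 assumes a: "\<And>j. a j <= 1"
 defines "u \<equiv> (\<Sum>j. 2 * real (a j) / 3 ^ Suc j)"
 shows "0 <= u" "u <= 1" "ternary_digit (3 ^ k * u) = real (a k)"
proof -
 have geo: "(%j. 2 / 3 ^ Suc j :: real) sums 1"
  using sums_mult[OF geometric_sums[of "1/3::real"], of "2/3"] by (simp add: power_divide)
 have ind: "(\<Sum>j. 2 * real (b j) / 3 ^ Suc j) \<in> {0..1} \<and> summable (%j. 2 * real (b j) / 3 ^ Suc j)"
  if b: "\<And>j. b j <= 1" for b :: "nat => nat"
 proof -
  have s: "summable (%j. 2 * real (b j) / 3 ^ Suc j)"
   by (rule summable_comparison_test'[OF sums_summable[OF geo], of 0])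
   (use b in \<open>auto simp: divide_simps\<close>)
  have "(\<Sum>j. 2 * real (b j) / 3 ^ Suc j) <= (\<Sum>j. 2 / 3 ^ Suc j :: real)"
   by (rule suminf_le[OF _ s sums_summable[OF geo]]) (use b in \<open>auto simp: divide_simps\<close>)
  moreover have "0 <= (\<Sum>j. 2 * real (b j) / 3 ^ Suc j)"
   by (rule suminf_nonneg[OF s]) auto
  ultimately show ?thesis using s sums_unique[OF geo] by simp
 qed
 show "0 <= u" "u <= 1" using ind[of a] a unfolding u_def by auto
 let ?v = "%k. (\<Sum>j. 2 * real (a (j + k)) / 3 ^ Suc j)"
 \<comment> \<open>\<open>?v k\<close> is the number formed by the digits from position
   \<open>k\<close> on; a factor 3 releases its leading digit.\<close>
 have v_rec: "3 * ?v k = 2 * real (a k) + ?v (Suc k)" for k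
 proof -
  have s: "summable (%j. 2 * real (a (j + k)) / 3 ^ Suc j)"
   using ind[of "%j. a (j + k)"] a by blast
  have s1: "summable (%j. 2 * real (a (j + Suc k)) / 3 ^ Suc j)"
   using ind[of "%j. a (j + Suc k)"] a by blast
  have "?v k = 2 * real (a k) / 3 + (\<Sum>j. 2 * real (a (Suc j + k)) / 3 ^ Suc (Suc j))"
   using suminf_split_head[OF s] by simp
  also have "(\<Sum>j. 2 * real (a (Suc j + k)) / 3 ^ Suc (Suc j)) = (\<Sum>j. (2 * real (a (j + Suc k)) / 3 ^ Suc j) / 3)"
   by (intro arg_cong[where f=suminf] ext) simp
  also have "\<dots> = ?v (Suc k) / 3" by (rule suminf_divide[OF s1])
  finally show ?thesis by simp
 qed
 \<comment> \<open>The digits that have moved in front of the point are all even, so they form an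
   even integer, which the period 2 discards.\<close>
 have "\<exists>n::int. 3 ^ k * u = 2 * of_int n + ?v k" for k
 proof (induction k)
  case 0 then show ?case by (auto simp: u_def intro: exI[of _ 0])
 next
  case (Suc k)
  then obtain n :: int where n: "3 ^ k * u = 2 * of_int n + ?v k" by blast
  have "3 ^ Suc k * u = 3 * (2 * of_int n + ?v k)" using n by simp
  also have "\<dots> = 6 * of_int n + 3 * ?v k" by simp
  also have "\<dots> = 2 * of_int (3 * n + int (a k)) + ?v (Suc k)"
   unfolding v_rec by simp
  finally show ?case by blast
 qed
 then obtain n :: int where n: "3 ^ k * u = 2 * of_int n + ?v k" by blast
 have v01: "?v k \<in> {0..1}" "?v (Suc k) \<in> {0..1}"
  using ind[of "%j. a (j + k)"] ind[of "%j. a (j + Suc k)"] a by blast+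
 have "ternary_digit (3 ^ k * u) = ternary_digit (?v k)" unfolding n ternary_digit_shift ..
 also have "\<dots> = min 1 (max 0 (3 * ?v k - 1))"
  using v01 unfolding ternary_digit_def by (subst triangle_wave_id) auto
 \<comment> \<open>Leading digit 0 puts the tail into [0, 1/3] and leading digit 2 into [2/3, 1];
   there the truncation yields 0 and 1.\<close>
 also have "\<dots> = real (a k)"
 proof -
  have "a k = 0 \<or> a k = 1" using a[of k] by linarith
  then show ?thesis using v01 unfolding v_rec by auto
 qed
 finally show "ternary_digit (3 ^ k * u) = real (a k)" .
qed

text \<open>The digits are differences of consecutive dyadic roundings, so the partial sums
  telescope to the rounding of \<open>y\<close> at level \<open>n\<close>, which misses
  \<open>y\<close> by at most \<open>2 ^ (- n)\<close>.\<close>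

lemma binary_expansion_exists:
 fixes y :: real
 assumes "0 <= y" "y < 1"
 shows "\<exists>b :: nat => nat. (\<forall>k. b k <= 1) \<and> (%k. real (b k) / 2 ^ Suc k) sums y"
proof (intro exI conjI allI)
 define b :: "nat => nat" where "b k = nat (\<lfloor>2 ^ Suc k * y\<rfloor> - 2 * \<lfloor>2 ^ k * y\<rfloor>)" for k
 have b: "\<lfloor>2 ^ Suc k * y\<rfloor> - 2 * \<lfloor>2 ^ k * y\<rfloor> \<in> {0, 1}" for k
 proof -
  have "2 ^ Suc k * y = 2 * (2 ^ k * y)" by simp
  moreover define z where "z = 2 ^ k * y"
  ultimately have e: "\<lfloor>2 ^ Suc k * y\<rfloor> = \<lfloor>2 * z\<rfloor>" by (simp only:)
  have "\<lfloor>2 * z\<rfloor> - 2 * \<lfloor>z\<rfloor> \<in> {0, 1}" by (auto simp: floor_eq_iff) linarith+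
  then show ?thesis using e z_def by simp
 qed
 show "b k <= 1" for k using b[of k] unfolding b_def by auto
 have br: "real (b k) = of_int (\<lfloor>2 ^ Suc k * y\<rfloor>) - 2 * of_int \<lfloor>2 ^ k * y\<rfloor>" for k
  using b[of k] unfolding b_def by auto
 have partial: "(\<Sum>k<n. real (b k) / 2 ^ Suc k) = of_int \<lfloor>2 ^ n * y\<rfloor> / 2 ^ n" for n
 proof (induction n)
  \<comment> \<open>Here \<open>y < 1\<close> matters: the integer part of \<open>y\<close> must
    vanish.\<close>
  case 0 then show ?case using assms by (simp add: floor_eq_iff)
 next
  case (Suc n)
  then show ?case by (simp add: br field_simps)
 qed
 have "(%n. of_int \<lfloor>2 ^ n * y\<rfloor> / 2 ^ n) \<longlonglongrightarrow> y"
 proof (rule tendsto_sandwich[of "%n. y - (1/2)^n" _ _ "%_. y"])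
  show "\<forall>\<^sub>F n in sequentially. y - (1 / 2) ^ n <= of_int \<lfloor>2 ^ n * y\<rfloor> / 2 ^ n"
  proof (intro always_eventually allI)
   fix n
   have "2 ^ n * y - 1 <= of_int \<lfloor>2 ^ n * y\<rfloor>" by linarith
   then have "(2 ^ n * y - 1) / 2 ^ n <= of_int \<lfloor>2 ^ n * y\<rfloor> / 2 ^ n" by (intro divide_right_mono) auto
   then show "y - (1 / 2) ^ n <= of_int \<lfloor>2 ^ n * y\<rfloor> / 2 ^ n"
   by (simp add: diff_divide_distrib power_one_over)
  qed
  show "\<forall>\<^sub>F n in sequentially. of_int \<lfloor>2 ^ n * y\<rfloor> / 2 ^ n <= y"
  proof (intro always_eventually allI)
   fix n
   have "of_int \<lfloor>2 ^ n * y\<rfloor> <= 2 ^ n * y" by linarith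
   then show "of_int \<lfloor>2 ^ n * y\<rfloor> / 2 ^ n <= y" by (simp add: field_simps)
  qed
  have "(%n. (1/2::real)^n) \<longlonglongrightarrow> 0" by (rule LIMSEQ_power_zero) simp
  from tendsto_diff[OF tendsto_const this] show "(%n. y - (1 / 2) ^ n) \<longlonglongrightarrow> y" by simp
 qed simp
 then show "(%k. real (b k) / 2 ^ Suc k) sums y" unfolding sums_def partial .
qed

text \<open>Schoenberg's curve: the ternary digits of the parameter, dealt out cyclically among the
 coordinates, are the binary digits of the point. It runs over the cube of half side \<open>2 * k\<close> while
 the parameter is in \<open>[2 * k, 2 * k + 1]\<close>, where the factor in front is constant.\<close>

lemma space_filling_curve_exists:
 "\<exists>c :: real => real ^ 'd::finite. continuous_on UNIV c \<and>
   (\<forall>k::nat. \<forall>x. (\<forall>i. \<bar>x $ i\<bar> < 2 * real k) --> (\<exists>t\<in>{0..2 * real k + 1}. c t = x))"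
proof -
 obtain \<iota> :: "'d => nat" where \<iota>: "bij_betw \<iota> UNIV {0..<CARD('d)}"
  using ex_bij_betw_finite_nat[of "UNIV :: 'd set"] by auto
 have \<iota>_less: "\<iota> i < CARD('d)" for i using \<iota> unfolding bij_betw_def by auto
 let ?D = "CARD('d)"
 define S where "S i t = (\<Sum>k. ternary_digit (3 ^ (?D * k + \<iota> i) * t) / 2 ^ Suc k)" for i t
 have half: "(%k. 1 / 2 ^ Suc k :: real) sums 1"
  using sums_mult[OF geometric_sums[of "1/2::real"], of "1/2"] by (simp add: power_divide)
 have cS: "continuous_on UNIV (S i)" for i
 proof -
  have "uniform_limit UNIV (%n t. \<Sum>k<n. ternary_digit (3 ^ (?D * k + \<iota> i) * t) / 2 ^ Suc k)
   (%t. \<Sum>k. ternary_digit (3 ^ (?D * k + \<iota> i) * t) / 2 ^ Suc k) sequentially"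
   by (rule Weierstrass_m_test[OF _ sums_summable[OF half]])
   (auto simp: abs_of_nonneg ternary_digit_bounds divide_simps)
  then have "continuous_on UNIV (%t. \<Sum>k. ternary_digit (3 ^ (?D * k + \<iota> i) * t) / 2 ^ Suc k)"
   by (rule uniform_limit_theorem[rotated])
   (auto intro!: always_eventually continuous_intros
   continuous_on_compose2[OF continuous_ternary_digit])
  then show ?thesis unfolding S_def[abs_def] .
 qed
 \<comment> \<open>On \<open>[2 * k, 2 * k + 1]\<close> the wave equals \<open>t - 2 * k\<close>, so
   the first factor is \<open>2 * k\<close>, while \<open>2 * S i t - 1\<close> turns a value in
   [0, 1] into one in [-1, 1].\<close>
 define c :: "real => real ^ 'd" where "c t = (\<chi> i. (t - triangle_wave t) * (2 * S i t - 1))" for t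
 have "continuous_on UNIV c" unfolding c_def
  by (intro continuous_intros cS continuous_triangle_wave)
 moreover have "\<exists>t\<in>{0..2 * real k + 1}. c t = x" if x: "\<forall>i. \<bar>x $ i\<bar> < 2 * real k" for k x
 proof -
  have k0: "0 < real k" using spec[OF x, of undefined] by (smt (verit) abs_ge_zero)
  define y where "y i = (x $ i / (2 * real k) + 1) / 2" for i
  have y2: "2 * y i = x $ i / (2 * real k) + 1" for i unfolding y_def by (simp only: times_divide_eq_right nonzero_mult_div_cancel_left zero_neq_numeral[symmetric] not_False_eq_True)
  have y: "0 <= y i" "y i < 1" for i
  proof -
   have "\<bar>x $ i / (2 * real k)\<bar> < 1" using x k0 by (simp add: abs_divide divide_less_eq)
   then have "-1 < x $ i / (2 * real k)" "x $ i / (2 * real k) < 1" by linarith+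
   then show "0 <= y i" "y i < 1" unfolding y_def by auto
  qed
  have "\<forall>i. \<exists>b :: nat => nat. (\<forall>k. b k <= 1) \<and> (%k. real (b k) / 2 ^ Suc k) sums y i"
   using binary_expansion_exists y by blast
  then obtain b :: "'d => nat => nat" where b: "\<And>i k. b i k <= 1"
   and sums: "\<And>i. (%k. real (b i k) / 2 ^ Suc k) sums y i" by metis
  define a where "a n = b (inv \<iota> (n mod ?D)) (n div ?D)" for n
  have a1: "a n <= 1" for n unfolding a_def by (rule b)
  have inj: "inj \<iota>" using \<iota> unfolding bij_betw_def by blast
  have a_eq: "a (?D * k + \<iota> i) = b i k" for i k
   unfolding a_def using \<iota>_less[of i] inj by (simp add: div_mult2_eq)
  define u where "u = (\<Sum>j. 2 * real (a j) / 3 ^ Suc j)"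
  note u = ternary_digit_expansion[of a, OF a1, folded u_def]
  \<comment> \<open>The summand \<open>2 * real k\<close> stays an even integer after multiplication
    by \<open>3 ^ n\<close>, so the digits read are those of \<open>u\<close>.\<close>
  have shift: "ternary_digit (3 ^ n * (2 * real k + u)) = real (a n)" for n
  proof -
   have "3 ^ n * (2 * real k + u) = 2 * of_int (3 ^ n * int k) + 3 ^ n * u"
   by (simp add: algebra_simps)
   then show ?thesis using u(3) by (simp only: ternary_digit_shift)
  qed
  have S: "S i (2 * real k + u) = y i" for i
   unfolding S_def shift a_eq using sums_unique[OF sums[of i]] by simp
  have "triangle_wave (2 * real k + u) = u"
   using triangle_wave_shift[of "int k" u] triangle_wave_id[of u] u by simp
  moreover have "(2 * real k) * (2 * y i - 1) = x $ i" for i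
  proof -
   have "2 * y i - 1 = x $ i / (2 * real k)" using y2[of i] by linarith
   then show ?thesis using k0 by simp
  qed
  ultimately have "c (2 * real k + u) = x" unfolding c_def vec_eq_iff by (simp add: S)
  then show ?thesis using u by (intro bexI[of _ "2 * real k + u"]) auto
 qed
 ultimately show ?thesis by blast
qed

text \<open>The section picks the least parameter at which a point is visited. It need not be
  continuous, but its sublevel sets are the images of the compact intervals \<open>{0..a}\<close>,
  hence compact and Borel. The bound on bounded sets is what carries tightness over to the
  line.\<close>

lemma borel_section_exists:
 "\<exists>(c :: real => real ^ 'd::finite) e. continuous_on UNIV c \<and> e \<in> borel_measurable borel \<and>
   (\<forall>x. c (e x) = x \<and> 0 <= e x) \<and> (\<forall>k::nat. \<forall>x. norm x < 2 * real k --> e x <= 2 * real k + 1)"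
proof -
 obtain c :: "real => real ^ 'd" where c: "continuous_on UNIV c"
  and surj: "\<And>k::nat. \<And>x. (\<forall>i. \<bar>x $ i\<bar> < 2 * real k) ==> (\<exists>t\<in>{0..2 * real k + 1}. c t = x)"
  using space_filling_curve_exists by blast
 have surj': "\<exists>t\<in>{0..2 * real k + 1}. c t = x" if "norm x < 2 * real k" for k :: nat and x
  using surj that component_le_norm_cart[of x] by (meson order_le_less_trans)
 define T where "T x = {t. 0 <= t \<and> c t = x}" for x
 define e where "e x = Inf (T x)" for x
 have ne: "T x \<noteq> {}" for x
 proof -
  obtain k :: nat where "norm x / 2 < real k" using reals_Archimedean2 by blast
  then show ?thesis using surj'[of x k] unfolding T_def by auto
 qed
 have cl: "closed (T x)" for x
 proof -
  have "closed (c -` {x})" using c by (intro closed_vimage) auto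
  moreover have "T x = {0..} \<inter> c -` {x}" unfolding T_def by auto
  ultimately show ?thesis by (auto intro: closed_Int)
 qed
 have bb: "bdd_below (T x)" for x unfolding T_def by (intro bdd_belowI[of _ 0]) auto
 have e_in: "e x \<in> T x" for x unfolding e_def by (rule closed_contains_Inf[OF ne bb cl])
 have e_le: "e x <= t" if "t \<in> T x" for x t unfolding e_def by (rule cInf_lower[OF that bb])
 have lvl: "{x. e x <= a} = c ` {0..a}" for a
 proof (intro set_eqI iffI)
  fix x assume "x \<in> {x. e x <= a}"
  then show "x \<in> c ` {0..a}" using e_in[of x] unfolding T_def by (intro image_eqI[of _ _ "e x"]) auto
 next
  fix x assume "x \<in> c ` {0..a}"
  then show "x \<in> {x. e x <= a}" using e_le[of _ x] unfolding T_def by force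
 qed
 have "{x. e x <= a} \<in> sets borel" for a
  unfolding lvl by (intro borel_compact compact_continuous_image continuous_on_subset[OF c]) auto
 then have "e \<in> borel_measurable borel" by (simp add: borel_measurable_iff_le)
 moreover have "c (e x) = x \<and> 0 <= e x" for x using e_in[of x] unfolding T_def by auto
 moreover have "e x <= 2 * real k + 1" if "norm x < 2 * real k" for k :: nat and x
 proof -
  from surj'[OF that] obtain t where "t \<in> {0..2 * real k + 1}" "c t = x" by blast
  then show ?thesis using e_le[of t x] unfolding T_def by auto
 qed
 ultimately show ?thesis using c by blast
qed

text \<open>Tight measures are sent to the line along \<open>e\<close>, have a convergent
  subsequence there, and the limit returns along \<open>c\<close>. Integrals are preserved because
  \<open>c (e x) = x\<close>, and converge because \<open>F\<close> composed with the continuous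
  curve \<open>c\<close> is bounded and continuous; continuity of \<open>e\<close> is not asked
  for.\<close>

lemma prob_weak_compactness:
 fixes \<tau> :: "nat => (real ^ 'd::finite) measure"
 assumes sets: "\<And>n. sets (\<tau> n) = sets borel" and prob: "\<And>n. prob_space (\<tau> n)"
  and tight: "\<And>\<epsilon>. \<epsilon> > 0 ==> \<exists>R. \<forall>n. measure (\<tau> n) {x. norm x \<ge> R} < \<epsilon>"
 shows "\<exists>r \<rho>. strict_mono (r :: nat => nat) \<and> sets \<rho> = sets borel \<and> finite_measure \<rho> \<and>
  (\<forall>F :: real ^ 'd => complex. \<forall>C. continuous_on UNIV F --> (\<forall>x. norm (F x) <= C) -->
   (%n. integral\<^sup>L (\<tau> (r n)) F) \<longlonglongrightarrow> integral\<^sup>L \<rho> F)"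
proof -
 note [measurable_cong] = sets
 obtain c :: "real => real ^ 'd" and e where c: "continuous_on UNIV c"
  and e[measurable]: "e \<in> borel_measurable borel" and ce: "\<And>x. c (e x) = x" and e0: "\<And>x. 0 <= e x"
  and ebd: "\<And>(k::nat) x. norm x < 2 * real k ==> e x <= 2 * real k + 1"
  using borel_section_exists by metis
 have [measurable]: "c \<in> borel_measurable borel" using c by (rule borel_measurable_continuous_onI)
 have sp: "space (\<tau> n) = UNIV" for n using sets_eq_imp_space_eq[OF sets] by simp
 define \<sigma> where "\<sigma> n = distr (\<tau> n) borel e" for n
 have rd: "real_distribution (\<sigma> n)" for n
  unfolding \<sigma>_def
  by (intro prob_space.real_distribution_distr[OF prob]) measurable
 have "tight \<sigma>"
  unfolding tight_def
 proof (intro conjI allI impI rd)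
  fix \<epsilon> :: real assume "\<epsilon> > 0"
  from tight[OF this] obtain R where R: "\<And>n. measure (\<tau> n) {x. norm x \<ge> R} < \<epsilon>" by blast
  obtain k :: nat where k: "R / 2 < real k" using reals_Archimedean2 by blast
  show "\<exists>a b. a < b \<and> (\<forall>n. 1 - \<epsilon> < measure (\<sigma> n) {a<..b})"
  \<comment> \<open>The left end -1 keeps the possible value 0 of \<open>e\<close> inside the
    half-open interval.\<close>
  proof (rule exI[of _ "-1"], rule exI[of _ "2 * real k + 1"], intro conjI allI)
   fix n
   interpret prob_space "\<tau> n" by (rule prob)
   have "1 - \<epsilon> < 1 - measure (\<tau> n) {x. norm x \<ge> R}" using R[of n] by simp
   also have "\<dots> = measure (\<tau> n) (space (\<tau> n) - {x. norm x \<ge> R})"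
   by (subst prob_compl) (auto simp: sets)
   also have "\<dots> <= measure (\<tau> n) (e -` {-1<..2 * real k + 1} \<inter> space (\<tau> n))"
   proof (intro finite_measure_mono)
   show "space (\<tau> n) - {x. R <= norm x} \<subseteq> e -` {- 1<..2 * real k + 1} \<inter> space (\<tau> n)"
   proof (rule subsetI)
   fix x :: "real ^ 'd" assume "x \<in> space (\<tau> n) - {x. R <= norm x}"
   then have "norm x < 2 * real k" using k by simp
   from ebd[OF this] e0[of x] show "x \<in> e -` {-1<..2 * real k + 1} \<inter> space (\<tau> n)"
   by (auto simp: sp)
   qed
   qed measurable
   also have "\<dots> = measure (\<sigma> n) {-1<..2 * real k + 1}"
   unfolding \<sigma>_def by (subst measure_distr) auto
   finally show "1 - \<epsilon> < measure (\<sigma> n) {-1<..2 * real k + 1}" .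
  qed simp
 qed
 then have "\<exists>r M. strict_mono (r :: nat => nat) \<and> real_distribution M \<and> weak_conv_m (\<sigma> \<circ> (%n. n) \<circ> r) M"
  by (rule tight_imp_convergent_subsubsequence) (simp add: strict_mono_def)
 then obtain r \<sigma>' where r: "strict_mono (r :: nat => nat)" and rd': "real_distribution \<sigma>'"
  and conv: "weak_conv_m (\<sigma> \<circ> (%n. n) \<circ> r) \<sigma>'"
  by blast
 interpret S: real_distribution \<sigma>' by (rule rd')
 define \<rho> where "\<rho> = distr \<sigma>' borel c"
 have "finite_measure \<rho>" unfolding \<rho>_def
  by (intro prob_space.finite_measure S.prob_space_distr) measurable
 moreover have "(%n. integral\<^sup>L (\<tau> (r n)) F) \<longlonglongrightarrow> integral\<^sup>L \<rho> F"
  if F: "continuous_on UNIV F" "\<And>x. norm (F x) <= C" for F :: "real ^ 'd => complex" and C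
 proof -
  have [measurable]: "F \<in> borel_measurable borel" using F(1) by (rule borel_measurable_continuous_onI)
  have cont: "continuous_on UNIV (%t. F (c t))"
   by (rule continuous_on_compose2[OF F(1) c]) auto
  have "(%n. integral\<^sup>L ((\<sigma> \<circ> (%n. n) \<circ> r) n) (%t. F (c t))) \<longlonglongrightarrow> integral\<^sup>L \<sigma>' (%t. F (c t))"
  proof (rule weak_conv_imp_integral_bdd_continuous_conv[OF _ rd' conv, where B=C])
   show "real_distribution ((\<sigma> \<circ> (%n. n) \<circ> r) n)" for n by (simp add: rd)
   show "isCont (%t. F (c t)) x" for x using cont by (simp add: continuous_on_eq_continuous_at)
   show "norm (F (c x)) <= C" for x by (rule F(2))
  qed
  then show ?thesis
   unfolding \<rho>_def \<sigma>_def comp_def by (simp add: integral_distr ce)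
 qed
 moreover have "sets \<rho> = sets borel" unfolding \<rho>_def by simp
 ultimately show ?thesis using r by blast
qed

text \<open>Along a subsequence the total masses converge to some \<open>l\<close>. If
  \<open>l = 0\<close> the limit is the null measure; otherwise the measures are normalised to
  probability measures and the limit is scaled back by \<open>l\<close>.\<close>

lemma finite_measure_weak_compactness:
 fixes \<tau> :: "nat => (real ^ 'd::finite) measure"
 assumes sets: "\<And>n. sets (\<tau> n) = sets borel" and fin: "\<And>n. finite_measure (\<tau> n)"
  and mass: "\<And>n. measure (\<tau> n) UNIV <= M"
  and tight: "\<And>\<epsilon>. \<epsilon> > 0 ==> \<exists>R. \<forall>n. measure (\<tau> n) {x. norm x \<ge> R} < \<epsilon>"
 shows "\<exists>r \<rho>. strict_mono (r :: nat => nat) \<and> sets \<rho> = sets borel \<and> finite_measure \<rho> \<and>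
  (\<forall>F :: real ^ 'd => complex. \<forall>C. continuous_on UNIV F --> (\<forall>x. norm (F x) <= C) -->
   (%n. integral\<^sup>L (\<tau> (r n)) F) \<longlonglongrightarrow> integral\<^sup>L \<rho> F)"
proof -
 have sp: "space (\<tau> n) = UNIV" for n using sets_eq_imp_space_eq[OF sets] by simp
 define s where "s n = measure (\<tau> n) UNIV" for n
 have s0: "0 <= s n" "s n <= M" for n unfolding s_def by (rule measure_nonneg, rule mass)
 have "bounded (range s)" using s0 by (intro boundedI[of _ M]) auto
 then obtain l r0 where r0: "strict_mono (r0 :: nat => nat)" and l: "(s \<circ> r0) \<longlonglongrightarrow> l"
  using bounded_imp_convergent_subsequence by blast
 have l0: "0 <= l" by (rule LIMSEQ_le_const[OF l]) (auto simp: s0)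
 have bd: "norm (integral\<^sup>L (\<tau> n) F) <= C * s n"
  if F: "continuous_on UNIV F" "\<And>x. norm (F x) <= C" for F :: "real ^ 'd => complex" and C n
 proof -
  interpret finite_measure "\<tau> n" by (rule fin)
  have m[measurable]: "F \<in> borel_measurable (\<tau> n)"
   using borel_measurable_continuous_onI[OF F(1)] by (simp add: measurable_cong_sets[OF sets refl])
  have "norm (integral\<^sup>L (\<tau> n) F) <= (\<integral>x. norm (F x) \<partial>\<tau> n)" by (rule integral_norm_bound)
  also have "\<dots> <= (\<integral>x. C \<partial>\<tau> n)"
   by (intro integral_mono integrable_norm integrable_const_bound[of _ C]) (use F(2) order_trans[OF norm_ge_zero F(2)] in auto)
  finally show ?thesis by (simp add: s_def sp mult.commute)
 qed
 show ?thesis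
 proof (cases "l = 0")
  case True
  have "(%n. integral\<^sup>L (\<tau> (r0 n)) F) \<longlonglongrightarrow> integral\<^sup>L (null_measure borel) F"
   if F: "continuous_on UNIV F" "\<And>x. norm (F x) <= C" for F :: "real ^ 'd => complex" and C
  proof -
   have lim: "(%n. C * (s \<circ> r0) n) \<longlonglongrightarrow> 0"
   using tendsto_mult[OF tendsto_const l[unfolded True], of C] by simp
   have "(%n. integral\<^sup>L (\<tau> (r0 n)) F) \<longlonglongrightarrow> 0"
   proof (rule Lim_null_comparison[OF _ lim], intro always_eventually allI)
   show "norm (integral\<^sup>L (\<tau> (r0 n)) F) <= C * (s \<circ> r0) n" for n
   using bd[OF F, of "r0 n"] unfolding comp_apply .
   qed
   moreover have "integral\<^sup>L (null_measure borel) F = 0"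
   by (intro integral_eq_zero_AE AE_I'[of UNIV]) (auto simp: null_sets_def)
   ultimately show ?thesis by simp
  qed
  moreover have "finite_measure (null_measure borel :: (real ^ 'd) measure)"
   by (rule finite_measureI) simp
  moreover have "sets (null_measure borel :: (real ^ 'd) measure) = sets borel" by simp
  ultimately show ?thesis using r0 by blast
 next
  case False
  with l0 have lpos: "l > 0" by simp
  \<comment> \<open>Dropping the indices with mass at most \<open>l / 2\<close> keeps the
    normalising factors bounded, so that division does not destroy tightness.\<close>
  from order_tendstoD(1)[OF l, of "l/2"] lpos obtain N where N: "\<And>n. n \<ge> N ==> s (r0 n) > l / 2"
   by (auto simp: eventually_sequentially)
  define q where "q n = r0 (n + N)" for n
  have q: "s (q n) > l / 2" for n unfolding q_def by (rule N) simp
  define \<tau>' where "\<tau>' n = scale_measure (ennreal (1 / s (q n))) (\<tau> (q n))" for n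
  have sp0: "s (q n) > 0" for n using q[of n] lpos by linarith
  have meas: "measure (\<tau>' n) A = measure (\<tau> (q n)) A / s (q n)" for n A
   using sp0[of n] unfolding \<tau>'_def by (simp add: measure_scale_measure)
  have sets': "sets (\<tau>' n) = sets borel" for n unfolding \<tau>'_def by (simp only: sets_scale_measure sets)
  have sp': "space (\<tau>' n) = UNIV" for n using sets_eq_imp_space_eq[OF sets'] by simp
  have prob': "prob_space (\<tau>' n)" for n
  proof (rule prob_spaceI)
   interpret finite_measure "\<tau> (q n)" by (rule fin)
   have "emeasure (\<tau>' n) (space (\<tau>' n)) = ennreal (1 / s (q n)) * ennreal (s (q n))"
   unfolding sp' unfolding \<tau>'_def s_def by (simp only: emeasure_scale_measure emeasure_eq_measure)
   also have "\<dots> = 1" using sp0[of n] by (subst ennreal_mult'[symmetric]) auto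
   finally show "emeasure (\<tau>' n) (space (\<tau>' n)) = 1" .
  qed
  have tight': "\<exists>R. \<forall>n. measure (\<tau>' n) {x. norm x \<ge> R} < \<epsilon>" if "\<epsilon> > 0" for \<epsilon>
  proof -
   obtain R where R: "\<And>n. measure (\<tau> n) {x. norm x \<ge> R} < \<epsilon> * (l / 2)"
   using tight[of "\<epsilon> * (l/2)"] \<open>\<epsilon> > 0\<close> lpos by auto
   have "measure (\<tau>' n) {x. norm x \<ge> R} < \<epsilon>" for n
   proof -
   have "measure (\<tau> (q n)) {x. norm x \<ge> R} < \<epsilon> * s (q n)"
   using R[of "q n"] mult_strict_left_mono[OF q[of n] \<open>\<epsilon> > 0\<close>] by linarith
   then show ?thesis unfolding meas using sp0[of n] by (simp add: divide_less_eq)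
   qed
   then show ?thesis by blast
  qed
  obtain r \<rho> where r: "strict_mono (r :: nat => nat)" and \<rho>: "sets \<rho> = sets borel" "finite_measure \<rho>"
   and conv: "\<And>F :: real ^ 'd => complex. \<And>C. continuous_on UNIV F ==> (\<And>x. norm (F x) <= C) ==>
   (%n. integral\<^sup>L (\<tau>' (r n)) F) \<longlonglongrightarrow> integral\<^sup>L \<rho> F"
   using prob_weak_compactness[OF sets' prob' tight'] by blast
  have sm: "strict_mono (%n. q (r n))"
   unfolding q_def using r r0 by (auto simp: strict_mono_def)
  have ls: "(%n. s (q (r n))) \<longlonglongrightarrow> l"
  proof -
   have "strict_mono (%n. r n + N)" using r by (auto simp: strict_mono_def)
   from LIMSEQ_subseq_LIMSEQ[OF l this] show ?thesis by (simp add: q_def comp_def)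
  qed
  define \<rho>' where "\<rho>' = scale_measure (ennreal l) \<rho>"
  have "(%n. integral\<^sup>L (\<tau> (q (r n))) F) \<longlonglongrightarrow> integral\<^sup>L \<rho>' F"
   if F: "continuous_on UNIV F" "\<And>x. norm (F x) <= C" for F :: "real ^ 'd => complex" and C
  proof -
   have m: "F \<in> borel_measurable borel" using F(1) by (rule borel_measurable_continuous_onI)
   have m': "F \<in> borel_measurable (\<tau> n)" for n using m by (simp add: measurable_cong_sets[OF sets refl])
   have m'': "F \<in> borel_measurable \<rho>" using m by (simp add: measurable_cong_sets[OF \<rho>(1) refl])
   have i1: "integral\<^sup>L (scale_measure (ennreal a) K) F = a *\<^sub>R integral\<^sup>L K F"
   if "F \<in> borel_measurable K" "0 <= a" for a and K :: "(real ^ 'd) measure"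
   proof -
   have "scale_measure (ennreal a) K = density K (%_. ennreal a)"
   by (rule measure_eqI) (auto simp: emeasure_density nn_integral_cmult_indicator)
   then show ?thesis using that by (simp add: integral_density)
   qed
   have "(%n. s (q (r n)) *\<^sub>R integral\<^sup>L (\<tau>' (r n)) F) \<longlonglongrightarrow> l *\<^sub>R integral\<^sup>L \<rho> F"
   by (intro tendsto_intros ls conv[OF F])
   moreover have "s (q (r n)) *\<^sub>R integral\<^sup>L (\<tau>' (r n)) F = integral\<^sup>L (\<tau> (q (r n))) F" for n
   unfolding \<tau>'_def using sp0[of "r n"] by (subst i1[OF m']) auto
   moreover have "l *\<^sub>R integral\<^sup>L \<rho> F = integral\<^sup>L \<rho>' F"
   unfolding \<rho>'_def using lpos by (subst i1[OF m'']) auto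
   ultimately show ?thesis by simp
  qed
  moreover have "finite_measure \<rho>'"
   using finite_measure.emeasure_finite[OF \<rho>(2)] unfolding \<rho>'_def
   by (intro finite_measureI) (simp add: ennreal_mult_eq_top_iff)
  moreover have "sets \<rho>' = sets borel" unfolding \<rho>'_def by (simp only: sets_scale_measure \<rho>(1))
  ultimately show ?thesis using sm by blast
 qed
qed

section \<open>Integration on Euclidean space and Gaussians\<close>

lemma borel_measurable_cis[measurable (raw)]:
 "f \<in> borel_measurable M ==> (%x. cis (f x)) \<in> borel_measurable M"
 by (rule measurable_compose[OF _ borel_measurable_continuous_onI]) (auto intro: continuous_intros)

lemma borel_measurable_cnj[measurable (raw)]:
 "f \<in> borel_measurable M ==> (%x. cnj (f x)) \<in> borel_measurable M"
 by (rule measurable_compose[OF _ borel_measurable_continuous_onI]) (auto intro: continuous_intros)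

text \<open>Most interchanges of integrals below are justified by a majorant that splits into
  integrable functions of one variable each.\<close>

lemma Fubini_dominated:
 fixes F :: "'a => 'b => complex"
 assumes sf: "sigma_finite_measure M1" "sigma_finite_measure M2"
  and F[measurable]: "case_prod F \<in> borel_measurable (M1 \<Otimes>\<^sub>M M2)"
  and f: "integrable M1 f" and g: "integrable M2 g"
  and bound: "\<And>x y. x \<in> space M1 ==> y \<in> space M2 ==> norm (F x y) <= f x * g y"
 shows "integrable (M1 \<Otimes>\<^sub>M M2) (case_prod F)"
  and "(\<integral>y. (\<integral>x. F x y \<partial>M1) \<partial>M2) = (\<integral>x. (\<integral>y. F x y \<partial>M2) \<partial>M1)"
  and "integrable M1 (%x. \<integral>y. F x y \<partial>M2)"
  and "integrable M2 (%y. \<integral>x. F x y \<partial>M1)"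
proof -
 interpret pair_sigma_finite M1 M2 by (intro pair_sigma_finite.intro sf)
 have [measurable]: "f \<in> borel_measurable M1" "g \<in> borel_measurable M2" using f g by auto
 have fg: "integrable (M1 \<Otimes>\<^sub>M M2) (%(x, y). f x * g y)"
 proof (rule Fubini_integrable)
  show "integrable M1 (%x. \<integral>y. norm (case (x, y) of (x, y) => f x * g y) \<partial>M2)"
   using f by (simp add: abs_mult integrable_abs)
  show "AE x in M1. integrable M2 (%y. case (x, y) of (x, y) => f x * g y)"
   using g by (simp add: integrable_mult_right)
 qed measurable
 show i: "integrable (M1 \<Otimes>\<^sub>M M2) (case_prod F)"
  by (rule integrable_bound_AE[OF fg])
   (auto intro!: AE_I2 order_trans[OF bound] simp: space_pair_measure split: prod.splits)
 show "(\<integral>y. (\<integral>x. F x y \<partial>M1) \<partial>M2) = (\<integral>x. (\<integral>y. F x y \<partial>M2) \<partial>M1)"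
  by (rule Fubini_integral[OF i])
 show "integrable M1 (%x. \<integral>y. F x y \<partial>M2)" using integrable_fst[OF i] .
 show "integrable M2 (%y. \<integral>x. F x y \<partial>M1)" using integrable_snd[OF i] .
qed

lemma lborel_integral_affine:
 fixes f :: "'a::euclidean_space => 'b::{banach, second_countable_topology}"
 assumes [measurable]: "f \<in> borel_measurable borel" and "c \<noteq> 0"
 shows "(\<integral>x. f x \<partial>lborel) = \<bar>c\<bar> ^ DIM('a) *\<^sub>R (\<integral>x. f (t + c *\<^sub>R x) \<partial>lborel)"
proof -
 have "(\<integral>x. f x \<partial>lborel) = integral\<^sup>L (density (distr lborel borel (%x. t + c *\<^sub>R x)) (%_. ennreal (\<bar>c\<bar> ^ DIM('a)))) f"
  using lborel_affine[OF assms(2), of t] by simp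
 also have "\<dots> = \<bar>c\<bar> ^ DIM('a) *\<^sub>R (\<integral>x. f (t + c *\<^sub>R x) \<partial>lborel)"
  by (subst integral_density) (auto simp: integral_distr)
 finally show ?thesis .
qed

lemma lborel_integrable_affine:
 fixes f :: "'a::euclidean_space => 'b::{banach, second_countable_topology}"
 assumes f: "integrable lborel f" and "c \<noteq> 0"
 shows "integrable lborel (%x. f (t + c *\<^sub>R x))"
proof -
 have [measurable]: "f \<in> borel_measurable borel" using f by auto
 have "integrable (density (distr lborel borel (%x. t + c *\<^sub>R x)) (%_. ennreal (\<bar>c\<bar> ^ DIM('a)))) f"
  using lborel_affine[OF assms(2), of t] f by simp
 then have "integrable lborel (%x. \<bar>c\<bar> ^ DIM('a) *\<^sub>R f (t + c *\<^sub>R x))"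
  by (subst (asm) integrable_density) (auto simp: integrable_distr_eq)
 then have "integrable lborel (%x. (1 / \<bar>c\<bar> ^ DIM('a)) *\<^sub>R (\<bar>c\<bar> ^ DIM('a) *\<^sub>R f (t + c *\<^sub>R x)))"
  by (rule integrable_scaleR_right)
 then show ?thesis using assms(2) by simp
qed

lemma lborel_integral_shift:
 fixes f :: "'a::euclidean_space => 'b::{banach, second_countable_topology}"
 assumes "f \<in> borel_measurable borel"
 shows "(\<integral>x. f (t + x) \<partial>lborel) = (\<integral>x. f x \<partial>lborel)"
 using lborel_integral_affine[OF assms, of 1 t] by simp

lemma lborel_integral_reflect:
 fixes f :: "'a::euclidean_space => 'b::{banach, second_countable_topology}"
 assumes "f \<in> borel_measurable borel"
 shows "(\<integral>x. f (t - x) \<partial>lborel) = (\<integral>x. f x \<partial>lborel)"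
 using lborel_integral_affine[OF assms, of "-1" t] by simp

section \<open>A submultiplicative integrable weight\<close>

definition decay :: "real ^ 'd::finite => real" where
 "decay x = 1 / (1 + norm x) ^ (2 * CARD('d))"

lemma decay_pos: "0 < decay x" unfolding decay_def by (simp add: add_pos_nonneg)

lemma decay_nonneg[simp]: "0 <= decay x" using decay_pos[of x] by simp

lemma decay_le_1: "decay x <= 1" unfolding decay_def by (simp add: divide_le_eq one_le_power)

lemma decay_minus[simp]: "decay (- x) = decay x" unfolding decay_def by simp

text \<open>Rests on \<open>1 + norm (x + y) <= (1 + norm x) * (1 + norm y)\<close>. Applied to
  \<open>- x\<close> and \<open>x + y\<close>, it says that a translation by \<open>x\<close> costs
  at most the factor \<open>1 / decay x\<close>.\<close>

lemma decay_submult: "decay x * decay y <= decay (x + y)"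
proof -
 have "1 + norm (x + y) <= 1 + (norm x + norm y) + norm x * norm y"
  using norm_triangle_ineq[of x y] mult_nonneg_nonneg[OF norm_ge_zero norm_ge_zero, of x y] by linarith
 also have "\<dots> = (1 + norm x) * (1 + norm y)" by (simp add: algebra_simps)
 finally have "1 + norm (x + y) <= (1 + norm x) * (1 + norm y)" .
 then have "(1 + norm (x + y)) ^ (2 * CARD('a)) <= ((1 + norm x) * (1 + norm y)) ^ (2 * CARD('a))"
  by (intro power_mono) auto
 then show ?thesis unfolding decay_def
  by (simp add: power_mult_distrib frac_le add_pos_nonneg)
qed

lemma continuous_decay: "continuous_on A decay"
 unfolding decay_def by (intro continuous_intros) (auto simp: add_nonneg_eq_0_iff)

lemma borel_measurable_decay[measurable]: "decay \<in> borel_measurable borel"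
 by (rule borel_measurable_continuous_onI[OF continuous_decay])

text \<open>The exponent is chosen for this: each coordinate receives one factor
  \<open>(1 + norm x)^-2\<close>, which is at most \<open>1 / (1 + t^2)\<close> with
  \<open>t\<close> that coordinate, and a product of integrable functions of the single coordinates
  is integrable.\<close>

lemma integrable_decay: "integrable lborel (decay :: real ^ 'd::finite => real)"
proof (rule integrableI_nonneg)
 have "integrable lborel (%x::real. inverse (1 + x\<^sup>2))"
  using integrable_inverse_1_plus_square by (simp add: set_integrable_def)
 then have fin: "(\<integral>\<^sup>+x. ennreal (inverse (1 + (x::real)\<^sup>2)) \<partial>lborel) < \<infinity>"
  by (simp add: integrable_iff_bounded add_nonneg_nonneg)
 have le: "decay x <= (\<Prod>b\<in>Basis. inverse (1 + (x \<bullet> b)\<^sup>2))" for x :: "real ^ 'd"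
 proof -
  have "decay x = (\<Prod>b\<in>(Basis :: (real ^ 'd) set). inverse ((1 + norm x)\<^sup>2))"
   unfolding decay_def by (simp add: power_mult inverse_eq_divide power_divide)
  also have "\<dots> <= (\<Prod>b\<in>Basis. inverse (1 + (x \<bullet> b)\<^sup>2))"
  proof (intro prod_mono conjI)
   fix b :: "real ^ 'd" assume b: "b \<in> Basis"
   have "\<bar>x \<bullet> b\<bar> <= norm x" using b by (rule Basis_le_norm)
   then have "(x \<bullet> b)\<^sup>2 <= (norm x)\<^sup>2" by (metis abs_le_square_iff abs_norm_cancel)
   then have "1 + (x \<bullet> b)\<^sup>2 <= (1 + norm x)\<^sup>2" by (simp add: power2_sum add_increasing2)
   then show "inverse ((1 + norm x)\<^sup>2) <= inverse (1 + (x \<bullet> b)\<^sup>2)"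
   by (rule le_imp_inverse_le) (simp add: add_pos_nonneg)
  qed simp
  finally show ?thesis .
 qed
 have "(\<integral>\<^sup>+x. ennreal (decay x) \<partial>(lborel :: (real ^ 'd) measure)) <= (\<integral>\<^sup>+x. (\<Prod>b\<in>Basis. ennreal (inverse (1 + (x \<bullet> b)\<^sup>2))) \<partial>(lborel :: (real ^ 'd) measure))"
  by (intro nn_integral_mono) (simp add: prod_ennreal add_nonneg_nonneg ennreal_leI le)
 also have "\<dots> = (\<Prod>b\<in>(Basis :: (real ^ 'd) set). \<integral>\<^sup>+x. ennreal (inverse (1 + (x::real)\<^sup>2)) \<partial>lborel)"
  by (rule nn_integral_lborel_prod) auto
 also have "\<dots> < \<infinity>" using fin by (simp add: power_less_top_ennreal)
 finally show "(\<integral>\<^sup>+x. ennreal (decay (x :: real ^ 'd)) \<partial>lborel) < \<infinity>" .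
qed auto

lemma integrable_decay_bound:
 fixes f :: "real ^ 'd::finite => 'b::{banach, second_countable_topology}"
 assumes "f \<in> borel_measurable borel" "\<And>x. norm (f x) <= C * decay x"
 shows "integrable lborel f"
proof (rule integrable_bound_AE[of _ "%x. C * decay x"])
 show "AE x in lborel. norm (f x) <= norm (C * decay x)"
  using assms(2) by (intro AE_I2) (metis abs_ge_self order_trans real_norm_def)
qed (use assms(1) in \<open>auto intro!: integrable_mult_right integrable_decay\<close>)

section \<open>The Gaussian that is its own Fourier transform\<close>

definition gauss :: "real ^ 'd::finite => real" where
 "gauss x = exp (- pi * (norm x)\<^sup>2)"

lemma gauss_pos: "0 < gauss x" unfolding gauss_def by simp

lemma gauss_nonneg[simp]: "0 <= gauss x" unfolding gauss_def by simp

lemma gauss_le_1: "gauss x <= 1" unfolding gauss_def by simp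

lemma gauss_0[simp]: "gauss 0 = 1" unfolding gauss_def by simp

lemma gauss_minus[simp]: "gauss (- x) = gauss x" unfolding gauss_def by simp

lemma continuous_gauss: "continuous_on A gauss"
 unfolding gauss_def by (intro continuous_intros)

lemma borel_measurable_gauss[measurable]: "gauss \<in> borel_measurable borel"
 by (rule borel_measurable_continuous_onI[OF continuous_gauss])

text \<open>One term of the exponential series is at most its sum.\<close>

lemma power_le_fact_exp:
 fixes u :: real assumes "0 <= u" shows "u ^ k <= fact k * exp u"
proof -
 have "u ^ k / fact k <= exp u"
  using assms sum_le_suminf[OF summable_exp, of "{k}" u] unfolding exp_def
  by (simp add: divide_inverse mult.commute scaleR_conv_of_real)
 then show ?thesis by (simp add: divide_le_eq mult.commute)
qed

lemma gauss_le_decay_power: "\<exists>C>0. \<forall>x :: real ^ 'd::finite. gauss x <= C * decay x ^ k"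
proof -
 let ?N = "2 * CARD('d) * k"
 have "gauss x <= (fact ?N * exp 2) * decay x ^ k" for x :: "real ^ 'd"
 proof -
  have "(1 + norm x) ^ ?N * gauss x <= (fact ?N * exp (1 + norm x)) * exp (- pi * (norm x)\<^sup>2)"
   unfolding gauss_def by (intro mult_right_mono power_le_fact_exp) auto
  also have "\<dots> = fact ?N * exp (1 + norm x - pi * (norm x)\<^sup>2)"
   by (simp add: exp_add exp_diff exp_minus field_simps)
  \<comment> \<open>With \<open>t = norm x\<close> the exponent is at most
    \<open>1 + t - t^2\<close>, and completing the square bounds this by 5/4.\<close>
  also have "\<dots> <= fact ?N * exp 2"
  proof -
   have "(norm x)\<^sup>2 * 1 <= (norm x)\<^sup>2 * pi" using pi_gt3 by (intro mult_left_mono) auto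
   moreover have "0 <= (1/2 - norm x)\<^sup>2" by simp
   moreover have "(1/2 - norm x)\<^sup>2 = 1/4 - norm x + (norm x)\<^sup>2" by (simp add: power2_diff power_divide)
   ultimately have "1 + norm x - pi * (norm x)\<^sup>2 <= 2"
   by (simp only: mult.commute[of "(norm x)\<^sup>2" pi] mult_1_right)
   then show ?thesis by simp
  qed
  finally show ?thesis
   unfolding decay_def by (simp add: power_divide power_mult[symmetric] pos_le_divide_eq add_pos_nonneg mult.commute)
 qed
 then show ?thesis by (intro exI[of _ "fact ?N * exp 2"]) auto
qed

lemma gauss_scale_le_decay_power:
 assumes "\<epsilon> \<noteq> 0"
 shows "\<exists>C>0. \<forall>x :: real ^ 'd::finite. gauss (\<epsilon> *\<^sub>R x) <= C * decay x ^ k"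
proof -
 obtain C where C: "C > 0" "\<And>x :: real ^ 'd. gauss x <= C * decay x ^ k"
  using gauss_le_decay_power[of k] by blast
 let ?N = "2 * CARD('d)"
 \<comment> \<open>Both 1 and \<open>1 / \<bar>\<epsilon>\<bar>\<close> must be covered, so that
   \<open>1 + norm x <= a * (1 + norm (\<epsilon> *\<^sub>R x))\<close>.\<close>
 define a where "a = max 1 (1 / \<bar>\<epsilon>\<bar>)"
 have a: "a > 0" unfolding a_def by simp
 have le: "decay (\<epsilon> *\<^sub>R x) <= a ^ ?N * decay x" for x :: "real ^ 'd"
 proof -
  have "norm x = 1 / \<bar>\<epsilon>\<bar> * (\<bar>\<epsilon>\<bar> * norm x)" using assms by simp
  also have "\<dots> <= a * (\<bar>\<epsilon>\<bar> * norm x)" unfolding a_def by (intro mult_right_mono) auto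
  finally have "1 + norm x <= a * (1 + norm (\<epsilon> *\<^sub>R x))" unfolding a_def by (simp add: algebra_simps)
  then have "(1 + norm x) ^ ?N <= (a * (1 + norm (\<epsilon> *\<^sub>R x))) ^ ?N" by (intro power_mono) auto
  then have "(1 + norm x) ^ ?N <= a ^ ?N * (1 + norm (\<epsilon> *\<^sub>R x)) ^ ?N" unfolding power_mult_distrib .
  then show ?thesis unfolding decay_def using a
   by (simp add: divide_le_eq pos_divide_le_eq pos_le_divide_eq add_pos_nonneg field_simps)
 qed
 have "gauss (\<epsilon> *\<^sub>R x) <= (C * (a ^ ?N) ^ k) * decay x ^ k" for x :: "real ^ 'd"
 proof -
  have "gauss (\<epsilon> *\<^sub>R x) <= C * decay (\<epsilon> *\<^sub>R x) ^ k" by (rule C)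
  also have "\<dots> <= C * (a ^ ?N * decay x) ^ k" using C(1) le by (intro mult_left_mono power_mono) auto
  finally show ?thesis by (simp add: power_mult_distrib mult.assoc)
 qed
 then show ?thesis using C a by (intro exI[of _ "C * (a ^ ?N) ^ k"]) auto
qed

lemma integrable_gauss: "integrable lborel (gauss :: real ^ 'd::finite => real)"
proof -
 obtain C where "\<And>x :: real ^ 'd. gauss x <= C * decay x ^ 1" using gauss_le_decay_power[of 1] by blast
 then show ?thesis by (intro integrable_decay_bound[of _ C]) auto
qed

text \<open>\<open>exp (- pi * x^2)\<close> is \<open>c\<close> times the standard normal density at
  \<open>c * x\<close> for \<open>c = sqrt (2 * pi)\<close>, so its transform at \<open>y\<close> is
  the characteristic function of the normal distribution at \<open>- c * y\<close>.\<close>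

lemma gauss_fourier_real:
 fixes y :: real
 shows "integrable lborel (%x. cis (- 2 * pi * (x * y)) * of_real (exp (- pi * x\<^sup>2)))"
  and "(\<integral>x. cis (- 2 * pi * (x * y)) * of_real (exp (- pi * x\<^sup>2)) \<partial>lborel) = of_real (exp (- pi * y\<^sup>2))"
proof -
 define c where "c = sqrt (2 * pi)"
 have c: "c > 0" "c * c = 2 * pi" unfolding c_def by (auto simp flip: power2_eq_square)
 have "integrable lborel (%x. std_normal_density (0 + c * x))"
  by (rule lborel_integrable_real_affine) (use c in \<open>auto intro: integrable_normal_density\<close>)
 then have i: "integrable lborel (%x. c * std_normal_density (c * x))"
  by (intro integrable_mult_right) simp
 have dens: "c * std_normal_density (c * x) = exp (- pi * x\<^sup>2)" for x
  using c by (simp add: normal_density_def power_mult_distrib power2_eq_square c_def[symmetric])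
 show "integrable lborel (%x. cis (- 2 * pi * (x * y)) * of_real (exp (- pi * x\<^sup>2)))"
  by (rule integrable_bound_AE[OF i]) (auto simp: dens norm_mult)
 have "complex_of_real (exp (- ((- c * y)\<^sup>2) / 2)) = char std_normal_distribution (- c * y)"
  by (simp add: char_std_normal_distribution)
 also have "\<dots> = (\<integral>x. std_normal_density x *\<^sub>R iexp (- c * y * x) \<partial>lborel)"
  unfolding char_def by (subst integral_density) (auto simp: normal_density_nonneg)
 also have "\<dots> = \<bar>c\<bar> *\<^sub>R (\<integral>x. std_normal_density (0 + c * x) *\<^sub>R iexp (- c * y * (0 + c * x)) \<partial>lborel)"
  by (rule lborel_integral_real_affine) (use c in auto)
 also have "\<dots> = (\<integral>x. c *\<^sub>R (std_normal_density (c * x) *\<^sub>R iexp (- c * y * (c * x))) \<partial>lborel)"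
  using c by (subst integral_scaleR_right) simp
 also have "\<dots> = (\<integral>x. cis (- 2 * pi * (x * y)) * of_real (exp (- pi * x\<^sup>2)) \<partial>lborel)"
 proof (intro lint_cong refl)
  fix x
  have "- c * y * (c * x) = - (c * c) * (x * y)" by (simp add: algebra_simps)
  also have "\<dots> = - 2 * pi * (x * y)" using c by simp
  finally have "iexp (- c * y * (c * x)) = cis (- 2 * pi * (x * y))" by (simp only: cis_conv_exp)
  then show "c *\<^sub>R (std_normal_density (c * x) *\<^sub>R iexp (- c * y * (c * x))) = cis (- 2 * pi * (x * y)) * of_real (exp (- pi * x\<^sup>2))"
   unfolding dens[symmetric] by (simp add: scaleR_conv_of_real mult.commute mult.left_commute)
 qed
 also have "- ((- c * y)\<^sup>2) / 2 = - pi * y\<^sup>2" using c by (simp add: power_mult_distrib power2_eq_square)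
 finally show "(\<integral>x. cis (- 2 * pi * (x * y)) * of_real (exp (- pi * x\<^sup>2)) \<partial>lborel) = of_real (exp (- pi * y\<^sup>2))"
  by simp
qed

lemma lborel_integral_prod:
 fixes f :: "'a::euclidean_space => real => complex"
 assumes i: "\<And>b. b \<in> Basis ==> integrable lborel (f b)"
 shows "(\<integral>x. (\<Prod>b\<in>Basis. f b (x \<bullet> b)) \<partial>lborel) = (\<Prod>b\<in>(Basis :: 'a set). \<integral>x. f b x \<partial>lborel)"
proof -
 interpret product_sigma_finite "%_ :: 'a. lborel :: real measure" by standard
 have [measurable]: "f b \<in> borel_measurable borel" if "b \<in> Basis" for b using i[OF that] by auto
 have "(\<integral>x. (\<Prod>b\<in>Basis. f b (x \<bullet> b)) \<partial>(lborel :: 'a measure)) =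
   (\<integral>x. (\<Prod>b\<in>Basis. f b (x b)) \<partial>(\<Pi>\<^sub>M b\<in>Basis. lborel))"
  unfolding lborel_eq[where 'a='a]
  by (subst integral_distr)
   (auto intro!: lint_cong prod.cong borel_measurable_prod simp: inner_sum_left inner_Basis if_distrib cong: if_cong)
 then show ?thesis using product_integral_prod[OF finite_Basis i] by simp
qed

lemma cis_sum: "finite A ==> cis (sum f A) = (\<Prod>a\<in>A. cis (f a))"
 by (induction A rule: finite_induct) (auto simp: cis_mult[symmetric])

lemma gauss_fourier:
 fixes y :: "real ^ 'd::finite"
 shows "(\<integral>x. cis (- 2 * pi * (x \<bullet> y)) * of_real (gauss x) \<partial>lborel) = of_real (gauss y)"
proof -
 have norm2: "(norm x)\<^sup>2 = (\<Sum>b\<in>Basis. (x \<bullet> b)\<^sup>2)" for x :: "real ^ 'd"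
  unfolding power2_norm_eq_inner euclidean_inner[of x x] by (simp add: power2_eq_square)
 have g: "gauss x = (\<Prod>b\<in>Basis. exp (- pi * (x \<bullet> b)\<^sup>2))" for x :: "real ^ 'd"
  unfolding gauss_def norm2 by (simp add: exp_sum sum_distrib_left flip: sum_negf)
 have c: "cis (- 2 * pi * (x \<bullet> y)) = (\<Prod>b\<in>Basis. cis (- 2 * pi * ((x \<bullet> b) * (y \<bullet> b))))" for x
  unfolding euclidean_inner[of x y] by (simp only: sum_distrib_left cis_sum[OF finite_Basis])
 have "(\<integral>x. cis (- 2 * pi * (x \<bullet> y)) * of_real (gauss x) \<partial>lborel) =
   (\<integral>x. (\<Prod>b\<in>Basis. cis (- 2 * pi * ((x \<bullet> b) * (y \<bullet> b))) * of_real (exp (- pi * (x \<bullet> b)\<^sup>2))) \<partial>lborel)"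
  unfolding g c by (simp only: of_real_prod prod.distrib)
 also have "\<dots> = (\<Prod>b\<in>(Basis :: (real ^ 'd) set). of_real (exp (- pi * (y \<bullet> b)\<^sup>2)))"
  by (subst lborel_integral_prod) (use gauss_fourier_real in auto)
 also have "\<dots> = of_real (gauss y)" unfolding g by simp
 finally show ?thesis .
qed

lemma integral_gauss: "(\<integral>x. gauss x \<partial>(lborel :: (real ^ 'd::finite) measure)) = 1"
proof -
 have "complex_of_real (\<integral>x. gauss x \<partial>(lborel :: (real ^ 'd) measure)) = 1"
  using gauss_fourier[of "0 :: real ^ 'd"] by simp
 then show ?thesis using of_real_eq_1_iff by blast
qed

lemma gauss_scaled_fourier:
 fixes v :: "real ^ 'd::finite"
 assumes "\<epsilon> > 0"
 shows "(\<integral>k. cis (- 2 * pi * (k \<bullet> v)) * of_real (gauss (\<epsilon> *\<^sub>R k)) \<partial>lborel)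
  = of_real ((1 / \<epsilon>) ^ CARD('d) * gauss (v /\<^sub>R \<epsilon>))"
proof -
 have "(\<integral>k. cis (- 2 * pi * (k \<bullet> v)) * of_real (gauss (\<epsilon> *\<^sub>R k)) \<partial>lborel)
  = \<bar>1 / \<epsilon>\<bar> ^ DIM(real ^ 'd) *\<^sub>R (\<integral>k. cis (- 2 * pi * ((0 + (1 / \<epsilon>) *\<^sub>R k) \<bullet> v)) * of_real (gauss (\<epsilon> *\<^sub>R (0 + (1 / \<epsilon>) *\<^sub>R k))) \<partial>lborel)"
  by (rule lborel_integral_affine) (use assms in auto)
 also have "\<dots> = (1 / \<epsilon>) ^ CARD('d) *\<^sub>R (\<integral>k. cis (- 2 * pi * (k \<bullet> (v /\<^sub>R \<epsilon>))) * of_real (gauss k) \<partial>lborel)"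
  using assms by (simp add: inverse_eq_divide)
 finally show ?thesis unfolding gauss_fourier by (simp add: scaleR_conv_of_real)
qed

section \<open>Fourier inversion and autocorrelation\<close>

lemma borel_measurable_fourier:
 fixes f :: "real ^ 'd::finite => complex"
 assumes [measurable]: "f \<in> borel_measurable borel"
 shows "fourier f \<in> borel_measurable borel"
 unfolding fourier_def[abs_def] by measurable

lemma integrable_cis_mult:
 fixes f :: "'a => complex"
 assumes f: "integrable M f" and [measurable]: "h \<in> borel_measurable M"
 shows "integrable M (%x. cis (h x) * f x)"
proof -
 have [measurable]: "f \<in> borel_measurable M" using f by auto
 show ?thesis by (rule integrable_bound_AE[OF f]) (auto simp: norm_mult)
qed

lemma norm_fourier_le:
 fixes f :: "real ^ 'd::finite => complex"
 shows "norm (fourier f y) <= (\<integral>x. norm (f x) \<partial>lborel)"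
 unfolding fourier_def by (rule order_trans[OF integral_norm_bound]) (simp add: norm_mult)

lemma continuous_fourier:
 fixes f :: "real ^ 'd::finite => complex"
 assumes f: "integrable lborel f"
 shows "continuous_on A (fourier f)"
 unfolding continuous_on_def
proof (intro ballI)
 fix y
 have [measurable]: "f \<in> borel_measurable borel" using f by auto
 show "(fourier f \<longlongrightarrow> fourier f y) (at y within A)"
  unfolding tendsto_at_iff_sequentially
 proof (intro allI impI)
  fix X assume X: "X \<longlonglongrightarrow> y"
  show "(fourier f \<circ> X) \<longlonglongrightarrow> fourier f y"
   unfolding comp_def fourier_def
  proof (rule integral_dominated_convergence[where w="%x. norm (f x)"])
   show "AE x in lborel. (%i. cis (- 2 * pi * (x \<bullet> X i)) * f x) \<longlonglongrightarrow> cis (- 2 * pi * (x \<bullet> y)) * f x"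
   proof (intro AE_I2 tendsto_mult tendsto_const)
   fix x
   have "isCont (%z. cis (- 2 * pi * (x \<bullet> z))) y"
   by (intro continuous_on_interior[of UNIV]) (auto intro!: continuous_intros)
   from isCont_tendsto_compose[OF this X] show "(%i. cis (- 2 * pi * (x \<bullet> X i))) \<longlonglongrightarrow> cis (- 2 * pi * (x \<bullet> y))" .
   qed
  qed (use f in \<open>auto simp: norm_mult\<close>)
 qed
qed

text \<open>The inverse integral is damped by a wide Gaussian. The damping disappears in the limit
  by dominated convergence, since \<open>fourier f\<close> is integrable; on the other hand the
  damped integral is a Gaussian average of \<open>f\<close> that concentrates at
  \<open>x\<close>.\<close>

lemma fourier_inversion:
 fixes f :: "real ^ 'd::finite => complex"
 assumes c: "continuous_on UNIV f" and bd: "\<And>x. norm (f x) <= C"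
  and f: "integrable lborel f" and ff: "integrable lborel (fourier f)"
 shows "(\<integral>k. cis (2 * pi * (k \<bullet> x)) * fourier f k \<partial>lborel) = f x"
proof -
 have [measurable]: "f \<in> borel_measurable borel" using f by auto
 have [measurable]: "fourier f \<in> borel_measurable borel" using ff by auto
 define e :: "nat => real" where "e n = 1 / real (Suc n)" for n
 have e: "e n > 0" for n unfolding e_def by simp
 have e_lim: "e \<longlonglongrightarrow> 0" unfolding e_def using LIMSEQ_Suc[OF lim_1_over_n] by simp
 have cf: "isCont f z" for z using c by (simp add: continuous_on_eq_continuous_at)
 have cg: "isCont (gauss :: real ^ 'd => real) z" for z
  using continuous_gauss[of "UNIV :: (real ^ 'd) set"] by (simp add: continuous_on_eq_continuous_at)
 define A where "A n = (\<integral>k. of_real (gauss (e n *\<^sub>R k)) * (cis (2 * pi * (k \<bullet> x)) * fourier f k) \<partial>lborel)" for n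
 have lim: "A \<longlonglongrightarrow> (\<integral>k. cis (2 * pi * (k \<bullet> x)) * fourier f k \<partial>lborel)"
  unfolding A_def
 proof (rule integral_dominated_convergence[where w="%x. norm (fourier f x)"])
  show "AE k in lborel. (%n. of_real (gauss (e n *\<^sub>R k)) * (cis (2 * pi * (k \<bullet> x)) * fourier f k))
   \<longlonglongrightarrow> cis (2 * pi * (k \<bullet> x)) * fourier f k"
  proof (intro AE_I2)
   fix k :: "real ^ 'd"
   have "(%n. e n *\<^sub>R k) \<longlonglongrightarrow> 0 *\<^sub>R k" by (intro tendsto_intros e_lim)
   from isCont_tendsto_compose[OF cg this] have "(%n. gauss (e n *\<^sub>R k)) \<longlonglongrightarrow> 1" by simp
   from tendsto_mult[OF tendsto_of_real[OF this] tendsto_const]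
   show "(%n. of_real (gauss (e n *\<^sub>R k)) * (cis (2 * pi * (k \<bullet> x)) * fourier f k))
   \<longlonglongrightarrow> cis (2 * pi * (k \<bullet> x)) * fourier f k" by simp
  qed
 qed (use ff gauss_le_1 in \<open>auto simp: norm_mult intro!: AE_I2 mult_left_le_one_le\<close>)
 \<comment> \<open>Fubini turns the Gaussian cutoff in frequency into an average of \<open>f\<close>
   around \<open>x\<close> at the scale \<open>e n\<close>.\<close>
 have A_eq: "A n = (\<integral>s. f (x + e n *\<^sub>R s) * of_real (gauss s) \<partial>lborel)" for n
 proof -
  obtain K where K: "\<And>z :: real ^ 'd. gauss (e n *\<^sub>R z) <= K * decay z ^ 1"
   using gauss_scale_le_decay_power[of "e n" 1] e[of n] by auto
  have gi: "integrable lborel (%z :: real ^ 'd. gauss (e n *\<^sub>R z))"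
   using K by (intro integrable_decay_bound[of _ K]) auto
  have "A n = (\<integral>k. (\<integral>t. of_real (gauss (e n *\<^sub>R k)) * cis (- 2 * pi * (k \<bullet> (t - x))) * f t \<partial>lborel) \<partial>lborel)"
   unfolding A_def fourier_def
  proof (intro lint_cong refl)
   fix k
   have "of_real (gauss (e n *\<^sub>R k)) * cis (- 2 * pi * (k \<bullet> (t - x))) * f t
   = (of_real (gauss (e n *\<^sub>R k)) * cis (2 * pi * (k \<bullet> x))) * (cis (- 2 * pi * (t \<bullet> k)) * f t)" for t
   by (simp add: inner_diff_right cis_mult algebra_simps inner_commute)
   then show "of_real (gauss (e n *\<^sub>R k)) * (cis (2 * pi * (k \<bullet> x)) * (\<integral>xa. cis (- 2 * pi * (xa \<bullet> k)) * f xa \<partial>lborel))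
   = (\<integral>t. of_real (gauss (e n *\<^sub>R k)) * cis (- 2 * pi * (k \<bullet> (t - x))) * f t \<partial>lborel)"
   by (simp only: integral_mult_right_zero mult.assoc)
  qed
  also have "\<dots> = (\<integral>t. (\<integral>k. of_real (gauss (e n *\<^sub>R k)) * cis (- 2 * pi * (k \<bullet> (t - x))) * f t \<partial>lborel) \<partial>lborel)"
   by (rule Fubini_dominated(2)[where f="%t. norm (f t)" and g="%z. gauss (e n *\<^sub>R z)"])
   (use f gi in \<open>auto simp: norm_mult sigma_finite_lborel\<close>)
  also have "\<dots> = (\<integral>t. of_real ((1 / e n) ^ CARD('d)) * (of_real (gauss ((t - x) /\<^sub>R e n)) * f t) \<partial>lborel)"
  proof (intro lint_cong refl)
   fix t
   show "(\<integral>k. of_real (gauss (e n *\<^sub>R k)) * cis (- 2 * pi * (k \<bullet> (t - x))) * f t \<partial>lborel)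
   = of_real ((1 / e n) ^ CARD('d)) * (of_real (gauss ((t - x) /\<^sub>R e n)) * f t)"
   using gauss_scaled_fourier[OF e[of n], of "t - x"] by (simp add: mult.commute mult.left_commute)
  qed
  \<comment> \<open>The substitution \<open>t = x + e n *\<^sub>R s\<close> produces the volume
    factor that cancels \<open>(1 / e n) ^ CARD('d)\<close>.\<close>
  also have "\<dots> = \<bar>e n\<bar> ^ DIM(real ^ 'd) *\<^sub>R (\<integral>s. of_real ((1 / e n) ^ CARD('d)) * (of_real (gauss ((x + e n *\<^sub>R s - x) /\<^sub>R e n)) * f (x + e n *\<^sub>R s)) \<partial>lborel)"
   by (rule lborel_integral_affine) (use e[of n] in auto)
  also have "\<dots> = (e n ^ CARD('d) * (1 / e n) ^ CARD('d)) *\<^sub>R (\<integral>s. f (x + e n *\<^sub>R s) * of_real (gauss s) \<partial>lborel)"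
  proof -
   have s: "(x + e n *\<^sub>R s - x) /\<^sub>R e n = s" for s using e[of n] by simp
   show ?thesis using e[of n]
   unfolding s integral_mult_right_zero mult.commute[of "complex_of_real (gauss _)"]
   by (simp add: scaleR_conv_of_real[where 'a=complex])
  qed
  also have "e n ^ CARD('d) * (1 / e n) ^ CARD('d) = 1"
   using e[of n] by (simp flip: power_mult_distrib)
  finally show ?thesis by simp
 qed
 have lim': "(%n. \<integral>s. f (x + e n *\<^sub>R s) * of_real (gauss s) \<partial>lborel) \<longlonglongrightarrow> (\<integral>s. f x * of_real (gauss s) \<partial>(lborel :: (real ^ 'd) measure))"
 proof (rule integral_dominated_convergence[where w="%s. C * gauss s"])
  show "AE s in lborel. (%n. f (x + e n *\<^sub>R s) * of_real (gauss s)) \<longlonglongrightarrow> f x * of_real (gauss s)"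
  proof (intro AE_I2 tendsto_mult tendsto_const)
   fix s
   have "(%n. x + e n *\<^sub>R s) \<longlonglongrightarrow> x + 0 *\<^sub>R s" by (intro tendsto_intros e_lim)
   from isCont_tendsto_compose[OF cf this] show "(%n. f (x + e n *\<^sub>R s)) \<longlonglongrightarrow> f x" by simp
  qed
 qed (use integrable_gauss bd in \<open>auto simp: norm_mult intro!: AE_I2 mult_right_mono\<close>)
 have val: "(\<integral>s. f x * of_real (gauss s) \<partial>(lborel :: (real ^ 'd) measure)) = f x"
 proof -
  have "(\<integral>s. f x * of_real (gauss s) \<partial>(lborel :: (real ^ 'd) measure)) = f x * of_real (\<integral>s. gauss s \<partial>(lborel :: (real ^ 'd) measure))"
   by (simp only: integral_mult_right_zero integral_complex_of_real)
  then show ?thesis by (simp add: integral_gauss)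
 qed
 have "A \<longlonglongrightarrow> f x" using lim' unfolding val A_eq[symmetric] .
 with lim show ?thesis by (rule LIMSEQ_unique)
qed

section \<open>Autocorrelation and power spectrum\<close>

definition autocorrelation :: "(real ^ 'd::finite => complex) => real ^ 'd => complex" where
 "autocorrelation f y = (\<integral>t. f t * cnj (f (t + y)) \<partial>lborel)"

lemma borel_measurable_autocorrelation:
 assumes [measurable]: "f \<in> borel_measurable borel"
 shows "autocorrelation f \<in> borel_measurable borel"
 unfolding autocorrelation_def[abs_def] by measurable

text \<open>Two powers of \<open>decay\<close> are assumed because they are spent separately:
  \<open>decay (- t) * decay (t + y)\<close> yields \<open>decay y\<close>, and the remaining
  \<open>decay t\<close> makes the integral over \<open>t\<close> finite.\<close>

lemma autocorrelation_bound:
 fixes f :: "real ^ 'd::finite => complex"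
 assumes [measurable]: "f \<in> borel_measurable borel" and bd: "\<And>x. norm (f x) <= C * (decay x)\<^sup>2"
 shows "norm (autocorrelation f y) <= C\<^sup>2 * (\<integral>t. decay t \<partial>(lborel :: (real ^ 'd) measure)) * decay y"
proof -
 have "0 <= C * (decay (0 :: real ^ 'd))\<^sup>2" by (rule order_trans[OF norm_ge_zero bd])
 then have C: "0 <= C" using decay_pos[of "0 :: real ^ 'd"] by (simp add: zero_le_mult_iff)
 have le: "norm (f t * cnj (f (t + y))) <= C\<^sup>2 * decay y * decay t" for t
 proof -
  have "norm (f t * cnj (f (t + y))) <= (C * (decay t)\<^sup>2) * (C * (decay (t + y))\<^sup>2)"
   unfolding norm_mult complex_mod_cnj by (intro mult_mono bd) (use C in auto)
  also have "\<dots> = C\<^sup>2 * (decay t * (decay (- t) * decay (t + y)) * decay (t + y))"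
   by (simp add: power2_eq_square algebra_simps)
  also have "\<dots> <= C\<^sup>2 * (decay t * decay (- t + (t + y)) * 1)"
   by (intro mult_left_mono mult_mono decay_submult decay_le_1) auto
  finally show ?thesis by (simp add: mult.assoc mult.commute)
 qed
 have "norm (autocorrelation f y) <= (\<integral>t. norm (f t * cnj (f (t + y))) \<partial>lborel)"
  unfolding autocorrelation_def by (rule integral_norm_bound)
 also have "\<dots> <= (\<integral>t. C\<^sup>2 * decay y * decay t \<partial>(lborel :: (real ^ 'd) measure))"
  by (intro integral_mono' integrable_mult_right integrable_decay le) auto
 finally show ?thesis by (simp add: mult.commute mult.left_commute mult.assoc)
qed

text \<open>The Wiener-Khinchin relation. One factor of
  \<open>fourier f k * cnj (fourier f k)\<close> is written as an integral over \<open>t\<close>,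
  the integrals are exchanged, and inversion at \<open>t - y\<close> recovers
  \<open>f\<close>.\<close>

lemma fourier_power_spectrum:
 fixes f :: "real ^ 'd::finite => complex"
 assumes c: "continuous_on UNIV f" and bd: "\<And>x. norm (f x) <= C * (decay x)\<^sup>2"
  and bdf: "\<And>y. norm (fourier f y) <= C' * decay y"
 shows "fourier (%k. of_real ((cmod (fourier f k))\<^sup>2)) y = autocorrelation f y"
proof -
 have [measurable]: "f \<in> borel_measurable borel" using c by (rule borel_measurable_continuous_onI)
 have [measurable]: "fourier f \<in> borel_measurable borel" by (rule borel_measurable_fourier) measurable
 have "0 <= C * (decay (0 :: real ^ 'd))\<^sup>2" by (rule order_trans[OF norm_ge_zero bd])
 then have C: "0 <= C" using decay_pos[of "0 :: real ^ 'd"] by (simp add: zero_le_mult_iff)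
 have bd1: "norm (f x) <= C * decay x" for x
 proof (rule order_trans[OF bd mult_left_mono[OF _ C]])
  show "(decay x)\<^sup>2 <= decay x"
   unfolding power2_eq_square by (intro mult_left_le_one_le decay_le_1 decay_nonneg)
 qed
 have bd0: "norm (f x) <= C" for x
  by (rule order_trans[OF bd1]) (use C decay_le_1[of x] in \<open>simp add: mult_left_le\<close>)
 have fi: "integrable lborel f" by (rule integrable_decay_bound[OF _ bd1]) measurable
 have ffi: "integrable lborel (fourier f)" by (rule integrable_decay_bound[OF _ bdf]) measurable
 have "fourier (%k. of_real ((cmod (fourier f k))\<^sup>2)) y
   = (\<integral>k. (\<integral>t. cis (2 * pi * (k \<bullet> (t - y))) * fourier f k * cnj (f t) \<partial>lborel) \<partial>lborel)"
  unfolding fourier_def[of "%k. of_real ((cmod (fourier f k))\<^sup>2)"]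
 proof (intro lint_cong refl)
  fix k
  have "cnj (fourier f k) = (\<integral>t. cnj (cis (- 2 * pi * (t \<bullet> k)) * f t) \<partial>lborel)"
   unfolding fourier_def by (rule Bochner_Integration.integral_cnj[symmetric])
  also have "\<dots> = (\<integral>t. cis (2 * pi * (t \<bullet> k)) * cnj (f t) \<partial>lborel)"
   by (simp add: cis_cnj)
  finally have "cis (- 2 * pi * (k \<bullet> y)) * of_real ((cmod (fourier f k))\<^sup>2)
   = cis (- 2 * pi * (k \<bullet> y)) * fourier f k * (\<integral>t. cis (2 * pi * (t \<bullet> k)) * cnj (f t) \<partial>lborel)"
   by (simp add: complex_norm_square del: of_real_power)
  also have "\<dots> = (\<integral>t. cis (- 2 * pi * (k \<bullet> y)) * fourier f k * (cis (2 * pi * (t \<bullet> k)) * cnj (f t)) \<partial>lborel)"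
   by (simp only: integral_mult_right_zero)
  also have "\<dots> = (\<integral>t. cis (2 * pi * (k \<bullet> (t - y))) * fourier f k * cnj (f t) \<partial>lborel)"
  proof (intro lint_cong refl)
   fix t
   have "cis (- 2 * pi * (k \<bullet> y)) * cis (2 * pi * (t \<bullet> k)) = cis (2 * pi * (k \<bullet> (t - y)))"
   by (simp add: cis_mult inner_diff_right algebra_simps inner_commute)
   moreover have "cis (- 2 * pi * (k \<bullet> y)) * fourier f k * (cis (2 * pi * (t \<bullet> k)) * cnj (f t))
   = (cis (- 2 * pi * (k \<bullet> y)) * cis (2 * pi * (t \<bullet> k))) * fourier f k * cnj (f t)"
   by (simp only: mult.assoc mult.commute mult.left_commute)
   ultimately show "cis (- 2 * pi * (k \<bullet> y)) * fourier f k * (cis (2 * pi * (t \<bullet> k)) * cnj (f t))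
   = cis (2 * pi * (k \<bullet> (t - y))) * fourier f k * cnj (f t)" by (simp only:)
  qed
  finally show "cis (- 2 * pi * (k \<bullet> y)) * of_real ((cmod (fourier f k))\<^sup>2) = \<dots>" .
 qed
 also have "\<dots> = (\<integral>t. (\<integral>k. cis (2 * pi * (k \<bullet> (t - y))) * fourier f k * cnj (f t) \<partial>lborel) \<partial>lborel)"
  by (rule Fubini_dominated(2)[where f="%t. norm (f t)" and g="%k. norm (fourier f k)"])
   (use fi ffi in \<open>auto simp: norm_mult sigma_finite_lborel\<close>)
 also have "\<dots> = (\<integral>t. f (t - y) * cnj (f t) \<partial>lborel)"
  by (simp add: fourier_inversion[OF c bd0 fi ffi])
 also have "\<dots> = (\<integral>t. f (y + t - y) * cnj (f (y + t)) \<partial>lborel)"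
  by (rule lborel_integral_shift[symmetric]) measurable
 finally show ?thesis unfolding autocorrelation_def by (simp add: add.commute)
qed

text \<open>Exhibits a Gaussian-damped character, up to a positive factor, as an autocorrelation.
  This is how positive definiteness will reach the regularised spectral densities.\<close>

lemma gauss_autocorrelation:
 assumes \<epsilon>: "\<epsilon> > 0"
 shows "\<exists>c>0. \<forall>k y :: real ^ 'd::finite.
  autocorrelation (%t. of_real (gauss ((sqrt 2 * \<epsilon>) *\<^sub>R t)) * cis (2 * pi * (k \<bullet> t))) y
   = of_real c * (cis (- 2 * pi * (y \<bullet> k)) * of_real (gauss (\<epsilon> *\<^sub>R y)))"
proof -
 define c where "c = (\<integral>t. gauss ((2 * \<epsilon>) *\<^sub>R t) \<partial>(lborel :: (real ^ 'd) measure))"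
 \<comment> \<open>Rescaling the normalised Gaussian integral evaluates \<open>c\<close> up to a
   positive factor, whence \<open>c > 0\<close>.\<close>
 have "1 = \<bar>2 * \<epsilon>\<bar> ^ DIM(real ^ 'd) *\<^sub>R (\<integral>t. gauss (0 + (2 * \<epsilon>) *\<^sub>R t) \<partial>(lborel :: (real ^ 'd) measure))"
  unfolding integral_gauss[symmetric, where 'd='d] by (rule lborel_integral_affine) (use \<epsilon> in auto)
 then have cc: "\<bar>2 * \<epsilon>\<bar> ^ DIM(real ^ 'd) * c = 1" unfolding c_def by simp
 have "c > 0"
 proof (rule ccontr)
  assume "\<not> c > 0"
  then have "\<bar>2 * \<epsilon>\<bar> ^ DIM(real ^ 'd) * c <= 0" by (intro mult_nonneg_nonpos) auto
  then show False using cc by simp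
 qed
 moreover have "autocorrelation (%t. of_real (gauss ((sqrt 2 * \<epsilon>) *\<^sub>R t)) * cis (2 * pi * (k \<bullet> t))) y
   = of_real c * (cis (- 2 * pi * (y \<bullet> k)) * of_real (gauss (\<epsilon> *\<^sub>R y)))" for k y :: "real ^ 'd"
 proof -
  have gg: "gauss ((sqrt 2 * \<epsilon>) *\<^sub>R t) * gauss ((sqrt 2 * \<epsilon>) *\<^sub>R (t + y))
   = gauss ((2 * \<epsilon>) *\<^sub>R (y /\<^sub>R 2 + t)) * gauss (\<epsilon> *\<^sub>R y)" for t
  proof -
   have 1: "(sqrt 2 * \<epsilon>)\<^sup>2 = 2 * \<epsilon>\<^sup>2" by (simp add: power_mult_distrib)
   have 2: "(norm (a *\<^sub>R v))\<^sup>2 = a\<^sup>2 * (v \<bullet> v)" for v :: "real ^ 'd" and a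
   by (simp add: power_mult_distrib power2_norm_eq_inner)
   \<comment> \<open>The parallelogram law for \<open>t\<close> and \<open>t + y\<close>: the
     half-sum is \<open>t + y /\<^sub>R 2\<close> and the difference is \<open>y\<close>.\<close>
   have "2 * \<epsilon>\<^sup>2 * (t \<bullet> t) + 2 * \<epsilon>\<^sup>2 * ((t + y) \<bullet> (t + y))
   = (2 * \<epsilon>)\<^sup>2 * ((y /\<^sub>R 2 + t) \<bullet> (y /\<^sub>R 2 + t)) + \<epsilon>\<^sup>2 * (y \<bullet> y)"
   by (simp add: inner_add_left inner_add_right inner_commute power_mult_distrib) (simp add: algebra_simps)
   then have "- pi * (2 * \<epsilon>\<^sup>2 * (t \<bullet> t)) + - pi * (2 * \<epsilon>\<^sup>2 * ((t + y) \<bullet> (t + y)))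
   = - pi * ((2 * \<epsilon>)\<^sup>2 * ((y /\<^sub>R 2 + t) \<bullet> (y /\<^sub>R 2 + t))) + - pi * (\<epsilon>\<^sup>2 * (y \<bullet> y))"
   by (simp only: distrib_left[symmetric])
   then show ?thesis unfolding gauss_def 2 1 exp_add[symmetric] by (simp only:)
  qed
  have cc: "cis (2 * pi * (k \<bullet> t)) * cnj (cis (2 * pi * (k \<bullet> (t + y)))) = cis (- 2 * pi * (y \<bullet> k))" for t
   by (simp add: cis_cnj cis_mult inner_add_right algebra_simps inner_commute)
  have "autocorrelation (%t. of_real (gauss ((sqrt 2 * \<epsilon>) *\<^sub>R t)) * cis (2 * pi * (k \<bullet> t))) y
   = (\<integral>t. cis (- 2 * pi * (y \<bullet> k)) * of_real (gauss (\<epsilon> *\<^sub>R y)) * of_real (gauss ((2 * \<epsilon>) *\<^sub>R (y /\<^sub>R 2 + t))) \<partial>lborel)"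
   unfolding autocorrelation_def
  proof (intro lint_cong refl)
   fix t
   have "complex_of_real (gauss ((sqrt 2 * \<epsilon>) *\<^sub>R t)) * cis (2 * pi * (k \<bullet> t)) *
   cnj (complex_of_real (gauss ((sqrt 2 * \<epsilon>) *\<^sub>R (t + y))) * cis (2 * pi * (k \<bullet> (t + y))))
   = of_real (gauss ((sqrt 2 * \<epsilon>) *\<^sub>R t) * gauss ((sqrt 2 * \<epsilon>) *\<^sub>R (t + y)))
   * (cis (2 * pi * (k \<bullet> t)) * cnj (cis (2 * pi * (k \<bullet> (t + y)))))"
   by simp
   then show "complex_of_real (gauss ((sqrt 2 * \<epsilon>) *\<^sub>R t)) * cis (2 * pi * (k \<bullet> t)) *
   cnj (complex_of_real (gauss ((sqrt 2 * \<epsilon>) *\<^sub>R (t + y))) * cis (2 * pi * (k \<bullet> (t + y))))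
   = cis (- 2 * pi * (y \<bullet> k)) * of_real (gauss (\<epsilon> *\<^sub>R y)) * of_real (gauss ((2 * \<epsilon>) *\<^sub>R (y /\<^sub>R 2 + t)))"
   unfolding gg cc by simp
  qed
  also have "\<dots> = cis (- 2 * pi * (y \<bullet> k)) * of_real (gauss (\<epsilon> *\<^sub>R y)) * of_real (\<integral>t. gauss ((2 * \<epsilon>) *\<^sub>R (y /\<^sub>R 2 + t)) \<partial>lborel)"
   by (simp only: integral_mult_right_zero integral_complex_of_real)
  also have "(\<integral>t. gauss ((2 * \<epsilon>) *\<^sub>R (y /\<^sub>R 2 + t)) \<partial>lborel) = c"
   unfolding c_def by (rule lborel_integral_shift[where f="%t. gauss ((2 * \<epsilon>) *\<^sub>R t)"]) measurable
  finally show ?thesis by (simp only: mult.commute)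
 qed
 ultimately show ?thesis by blast
qed

section \<open>Rapidly decreasing functions\<close>

text \<open>Integration by parts without a boundary: the difference quotients of \<open>H\<close> in
  direction \<open>j\<close> have integral 0 by translation invariance, and the mean value
  inequality dominates them by a multiple of \<open>decay\<close>, so the limit has integral 0 as
  well.\<close>

lemma integral_partial_eq_0:
 fixes H H' :: "real ^ 'd::finite => complex"
 assumes der: "\<And>x. (H has_derivative D x) (at x)" and H': "\<And>x. H' x = D x (axis j 1)"
  and bd: "\<And>x. norm (H x) <= C * decay x" and bd': "\<And>x. norm (H' x) <= C * decay x"
 shows "H' \<in> borel_measurable borel" and "(\<integral>x. H' x \<partial>lborel) = 0"
proof -
 have cH: "continuous_on UNIV H"
  by (rule has_derivative_continuous_on) (use der in \<open>auto intro: has_derivative_at_withinI\<close>)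
 have [measurable]: "H \<in> borel_measurable borel" using cH by (rule borel_measurable_continuous_onI)
 have C: "0 <= C"
 proof -
  have "0 <= C * decay (0 :: real ^ 'd)" by (rule order_trans[OF norm_ge_zero bd])
  then show ?thesis using decay_pos[of "0 :: real ^ 'd"] by (simp add: zero_le_mult_iff)
 qed
 define v :: "real ^ 'd" where "v = axis j 1"
 have v: "norm v = 1" unfolding v_def by simp
 define h :: "nat => real" where "h n = 1 / real (Suc n)" for n
 have h: "0 < h n" "h n <= 1" for n unfolding h_def by auto
 have h_lim: "h \<longlonglongrightarrow> 0" unfolding h_def using LIMSEQ_Suc[OF lim_1_over_n] by simp
 define Q where "Q n x = (H (x + h n *\<^sub>R v) - H x) /\<^sub>R h n" for n x
 have line: "((%s. H (x + s *\<^sub>R v)) has_vector_derivative H' (x + s *\<^sub>R v)) (at s)" for x s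
 proof -
  have "((%s. x + s *\<^sub>R v) has_derivative (%s. s *\<^sub>R v)) (at s)"
   by (auto intro!: derivative_eq_intros)
  from diff_chain_at[OF this der]
  have "((%s. H (x + s *\<^sub>R v)) has_derivative (%a. D (x + s *\<^sub>R v) (a *\<^sub>R v))) (at s)"
   by (simp add: comp_def)
  moreover have "D (x + s *\<^sub>R v) (a *\<^sub>R v) = a *\<^sub>R H' (x + s *\<^sub>R v)" for a
   using linear_scale[OF has_derivative_linear[OF der]] by (simp add: H' v_def)
  ultimately show ?thesis unfolding has_vector_derivative_def by simp
 qed
 have Q_lim: "(%n. Q n x) \<longlonglongrightarrow> H' x" for x
 proof -
  have "(%s. norm (H (x + s *\<^sub>R v) - H x - s *\<^sub>R H' x) / norm s) \<midarrow>0\<rightarrow> 0"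
   using line[of x 0] unfolding has_vector_derivative_def has_derivative_at by simp
  moreover have "filterlim h (at 0) sequentially"
   using h_lim h by (auto simp: filterlim_at less_imp_neq[symmetric])
  ultimately have "(%n. norm (H (x + h n *\<^sub>R v) - H x - h n *\<^sub>R H' x) / norm (h n)) \<longlonglongrightarrow> 0"
   by (rule filterlim_compose)
  moreover have "norm (H (x + h n *\<^sub>R v) - H x - h n *\<^sub>R H' x) / norm (h n) = norm (Q n x - H' x)" for n
  proof -
   have "H (x + h n *\<^sub>R v) - H x - h n *\<^sub>R H' x = h n *\<^sub>R (Q n x - H' x)"
   unfolding Q_def using h(1)[of n] by (simp add: scaleR_diff_right)
   then show ?thesis using h(1)[of n] by simp
  qed
  ultimately show ?thesis by (simp add: tendsto_norm_zero_iff LIM_zero_iff)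
 qed
 have [measurable]: "Q n \<in> borel_measurable borel" for n unfolding Q_def[abs_def] by measurable
 show m[measurable]: "H' \<in> borel_measurable borel"
  by (rule borel_measurable_LIMSEQ_metric[of Q]) (use Q_lim in auto)
 let ?K = "2 ^ (2 * CARD('d))"
 \<comment> \<open>A step of length at most 1 costs at most \<open>1 / decay (y - x)\<close>, and
   \<open>1 + norm (y - x) <= 2\<close> makes this \<open>2 ^ (2 * CARD('d))\<close> at
   worst.\<close>
 have decay_near: "decay y <= ?K * decay x" if "norm (y - x) <= 1" for x y :: "real ^ 'd"
 proof -
  have "1 / ?K <= decay (y - x)" unfolding decay_def using that
   by (intro divide_left_mono power_mono mult_pos_pos zero_less_power) (auto simp: add_pos_nonneg)
  then have "decay y <= ?K * (decay (y - x) * decay y)"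
   using mult_right_mono[of "1 / ?K" "decay (y - x)" "decay y"] by (simp add: divide_le_eq mult.commute mult.left_commute)
  also have "decay (y - x) * decay y = decay (x - y) * decay y" using decay_minus[of "x - y"] by simp
  also have "?K * (decay (x - y) * decay y) <= ?K * decay (x - y + y)" by (intro mult_left_mono decay_submult) auto
  finally show ?thesis by simp
 qed
 have Q_bd: "norm (Q n x) <= (C * ?K) * decay x" for n x
 proof -
  have "norm (H (x + h n *\<^sub>R v) - H (x + 0 *\<^sub>R v)) <= (C * ?K * decay x) * norm (h n - 0)"
  proof (rule differentiable_bound[where S="{0..h n}" and f="%s. H (x + s *\<^sub>R v)"
   and f'="%s a. a *\<^sub>R H' (x + s *\<^sub>R v)"])
   fix s assume s: "s \<in> {0..h n}"
   show "((%s. H (x + s *\<^sub>R v)) has_derivative (%a. a *\<^sub>R H' (x + s *\<^sub>R v))) (at s within {0..h n})"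
   using line[of x s] unfolding has_vector_derivative_def by (rule has_derivative_at_withinI)
   show "onorm (%a. a *\<^sub>R H' (x + s *\<^sub>R v)) <= C * ?K * decay x"
   proof (rule onorm_le)
   fix a :: real
   have "norm (H' (x + s *\<^sub>R v)) <= C * decay (x + s *\<^sub>R v)" by (rule bd')
   also have "\<dots> <= C * (?K * decay x)"
   using s h[of n] C v by (intro mult_left_mono decay_near) auto
   finally have "norm a * norm (H' (x + s *\<^sub>R v)) <= norm a * (C * (?K * decay x))"
   by (rule mult_left_mono) simp
   then show "norm (a *\<^sub>R H' (x + s *\<^sub>R v)) <= C * ?K * decay x * norm a"
   by (simp only: norm_scaleR real_norm_def mult.assoc mult.commute mult.left_commute)
   qed
  qed (use h[of n] in auto)
  then have "inverse (h n) * norm (H (x + h n *\<^sub>R v) - H x) <= inverse (h n) * ((C * ?K * decay x) * h n)"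
   using h(1)[of n] by (intro mult_left_mono) auto
  also have "\<dots> = C * ?K * decay x" using h(1)[of n] by simp
  finally show ?thesis unfolding Q_def norm_scaleR using h(1)[of n] by simp
 qed
 have Hi: "integrable lborel H" by (rule integrable_decay_bound[OF _ bd]) measurable
 have "integral\<^sup>L lborel (Q n) = 0" for n
 proof -
  have "integrable lborel (%x. H (h n *\<^sub>R v + 1 *\<^sub>R x))" by (rule lborel_integrable_affine[OF Hi]) simp
  then have i: "integrable lborel (%x. H (x + h n *\<^sub>R v))" by (simp add: add.commute)
  have "(\<integral>x. H (x + h n *\<^sub>R v) \<partial>lborel) = (\<integral>x. H x \<partial>lborel)"
   using lborel_integral_shift[of H "h n *\<^sub>R v"] by (simp add: add.commute)
  then show ?thesis unfolding Q_def[abs_def] using i Hi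
   by (simp add: lint_diff)
 qed
 moreover have "(%n. integral\<^sup>L lborel (Q n)) \<longlonglongrightarrow> (\<integral>x. H' x \<partial>lborel)"
  by (rule integral_dominated_convergence[where w="%x. (C * ?K) * decay x"])
   (use Q_lim Q_bd in \<open>auto intro!: integrable_mult_right integrable_decay simp del: mult_numeral_left_semiring_numeral\<close>)
 ultimately show "(\<integral>x. H' x \<partial>lborel) = 0" by (simp add: LIMSEQ_const_iff)
qed

text \<open>Bounds by powers of \<open>norm x\<close> become bounds by powers of
  \<open>decay\<close> through \<open>(1 + t)^N <= 2^N * (1 + t^N)\<close>, so only the exponents 0
  and \<open>?N\<close> of the definition are consulted.\<close>

lemma rapidly_decreasing_bound:
 fixes f :: "real ^ 'd::finite => complex"
 assumes f: "f \<in> rapidly_decreasing"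
 shows "\<exists>C>0. \<forall>x. norm (iterated_partial is f x) <= C * decay x ^ k"
proof -
 let ?N = "2 * CARD('d) * k" and ?F = "iterated_partial is f"
 have "bounded (range (%x. norm x ^ n *\<^sub>R ?F x))" for n using f unfolding rapidly_decreasing_def by auto
 then have "\<forall>n. \<exists>B>0. \<forall>x. norm x ^ n * norm (?F x) <= B"
  by (force simp: bounded_pos)
 then obtain B where B: "\<And>n. B n > 0" "\<And>n x. norm x ^ n * norm (?F x) <= B n" by metis
 have "norm (?F x) <= (2 ^ ?N * (B 0 + B ?N)) * decay x ^ k" for x
 proof -
  have "(1 + norm x) ^ ?N <= (2 * max 1 (norm x)) ^ ?N" by (intro power_mono) auto
  also have "\<dots> = 2 ^ ?N * max 1 (norm x) ^ ?N" by (rule power_mult_distrib)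
  also have "max 1 (norm x) ^ ?N <= 1 + norm x ^ ?N" by (auto simp: max_def)
  finally have "(1 + norm x) ^ ?N * norm (?F x) <= 2 ^ ?N * (1 + norm x ^ ?N) * norm (?F x)"
   by (intro mult_right_mono) auto
  also have "\<dots> = 2 ^ ?N * (norm x ^ 0 * norm (?F x) + norm x ^ ?N * norm (?F x))"
   by (simp add: algebra_simps)
  also have "\<dots> <= 2 ^ ?N * (B 0 + B ?N)" by (intro mult_left_mono add_mono B) auto
  finally show ?thesis
   unfolding decay_def by (simp add: power_divide power_mult[symmetric] pos_le_divide_eq add_pos_nonneg mult.commute)
 qed
 then show ?thesis using B(1)[of 0] B(1)[of ?N] by (intro exI[of _ "2 ^ ?N * (B 0 + B ?N)"]) auto
qed

lemma rapidly_decreasing_has_derivative: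
 fixes f :: "real ^ 'd::finite => complex"
 assumes "f \<in> rapidly_decreasing"
 shows "(iterated_partial is f has_derivative frechet_derivative (iterated_partial is f) (at x)) (at x)"
 using assms unfolding rapidly_decreasing_def by (auto simp: frechet_derivative_works)

lemma rapidly_decreasing_continuous:
 fixes f :: "real ^ 'd::finite => complex"
 assumes f: "f \<in> rapidly_decreasing"
 shows "continuous_on A (iterated_partial is f)"
 by (rule has_derivative_continuous_on)
   (rule has_derivative_at_withinI, rule rapidly_decreasing_has_derivative[OF f])

text \<open>The product of the character with \<open>iterated_partial is f\<close> has a partial
  derivative of integral 0; the product rule splits that derivative into the two sides.\<close>

lemma fourier_iterated_partial:
 fixes f :: "real ^ 'd::finite => complex"
 assumes f: "f \<in> rapidly_decreasing"
 shows "fourier (iterated_partial (j # is) f) y = (2 * pi * \<i> * of_real (y $ j)) * fourier (iterated_partial is f) y"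
proof -
 let ?F = "iterated_partial is f" and ?G = "iterated_partial (j # is) f"
 have [measurable]: "?F \<in> borel_measurable borel" "?G \<in> borel_measurable borel"
  by (rule borel_measurable_continuous_onI, rule rapidly_decreasing_continuous[OF f])+
 obtain C1 where C1: "C1 > 0" "\<And>x. norm (?F x) <= C1 * decay x ^ 1"
  using rapidly_decreasing_bound[OF f] by blast
 obtain C2 where C2: "C2 > 0" "\<And>x. norm (?G x) <= C2 * decay x ^ 1"
  using rapidly_decreasing_bound[OF f] by blast
 define H where "H x = cis (- 2 * pi * (x \<bullet> y)) * ?F x" for x
 define H' where "H' x = cis (- 2 * pi * (x \<bullet> y)) * ?G x - (2 * pi * \<i> * of_real (y $ j)) * (cis (- 2 * pi * (x \<bullet> y)) * ?F x)" for x
 define D where "D x v = cis (- 2 * pi * (x \<bullet> y)) * frechet_derivative ?F (at x) v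
  - (2 * pi * \<i> * of_real (v \<bullet> y)) * (cis (- 2 * pi * (x \<bullet> y)) * ?F x)" for x v
 have D: "(H has_derivative D x) (at x)" for x
 proof -
  have "((%x. cis (- 2 * pi * (x \<bullet> y))) has_derivative
   (%v. (- 2 * pi * (v \<bullet> y)) *\<^sub>R (\<i> * cis (- 2 * pi * (x \<bullet> y))))) (at x)"
  proof (rule has_derivative_compose[where g=cis])
   show "((%x. - 2 * pi * (x \<bullet> y)) has_derivative (%v. - 2 * pi * (v \<bullet> y))) (at x)"
   by (auto intro!: derivative_eq_intros)
   have "(cis has_vector_derivative (\<i> * cis t)) (at t)" for t
   proof -
   have "((%z. exp (\<i> * of_real z)) has_vector_derivative (\<i> * exp (\<i> * of_real t))) (at t)"
   by (rule has_vector_derivative_real_field[of "%z. exp (\<i> * z)"]) (auto intro!: derivative_eq_intros)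
   then show ?thesis by (simp add: cis_conv_exp[abs_def])
   qed
   then show "(cis has_derivative (%a. a *\<^sub>R (\<i> * cis (- 2 * pi * (x \<bullet> y))))) (at (- 2 * pi * (x \<bullet> y)))"
   unfolding has_vector_derivative_def .
  qed
  from has_derivative_mult[OF this rapidly_decreasing_has_derivative[OF f]]
  show ?thesis unfolding H_def[abs_def] D_def[abs_def]
   by (rule has_derivative_eq_rhs) (auto simp: fun_eq_iff scaleR_conv_of_real algebra_simps)
 qed
 define C where "C = max (C1 + C2) (C2 + 2 * pi * \<bar>y $ j\<bar> * C1)"
 have n2: "norm (2 * pi * \<i> * complex_of_real (y $ j)) = 2 * pi * \<bar>y $ j\<bar>" by (simp add: norm_mult)
 have bd: "norm (H x) <= C * decay x" for x
 proof -
  have "norm (H x) <= C1 * decay x" unfolding H_def using C1(2)[of x] by (simp add: norm_mult)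
  also have "\<dots> <= C * decay x" unfolding C_def using C2(1) by (intro mult_right_mono) auto
  finally show ?thesis .
 qed
 have bd': "norm (H' x) <= C * decay x" for x
 proof -
  have "norm (H' x) <= norm (?G x) + 2 * pi * \<bar>y $ j\<bar> * norm (?F x)"
   unfolding H'_def using norm_triangle_ineq4[of "cis (- 2 * pi * (x \<bullet> y)) * ?G x" "(2 * pi * \<i> * of_real (y $ j)) * (cis (- 2 * pi * (x \<bullet> y)) * ?F x)"]
   unfolding norm_mult[of "2 * pi * \<i> * of_real (y $ j)"] n2 by (simp add: norm_mult)
  also have "\<dots> <= C2 * decay x + 2 * pi * \<bar>y $ j\<bar> * (C1 * decay x)"
   using C1(2)[of x] C2(2)[of x] by (intro add_mono mult_left_mono) auto
  also have "\<dots> = (C2 + 2 * pi * \<bar>y $ j\<bar> * C1) * decay x" by (simp add: algebra_simps)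
  also have "\<dots> <= C * decay x" unfolding C_def by (intro mult_right_mono) auto
  finally show ?thesis .
 qed
 have Fi: "integrable lborel ?F" by (rule integrable_decay_bound[of _ C1]) (use C1(2) in \<open>auto simp del: iterated_partial.simps\<close>)
 have Gi: "integrable lborel ?G" by (rule integrable_decay_bound[of _ C2]) (use C2(2) in \<open>auto simp del: iterated_partial.simps\<close>)
 have "(\<integral>x. H' x \<partial>lborel) = 0"
  by (rule integral_partial_eq_0(2)[OF D _ bd bd', of j])
   (simp add: H'_def D_def inner_axis' )
 also have "(\<integral>x. H' x \<partial>lborel) = fourier ?G y - (2 * pi * \<i> * of_real (y $ j)) * fourier ?F y"
  unfolding H'_def fourier_def
  by (subst lint_diff)
   (auto intro!: integrable_mult_right integrable_cis_mult Fi Gi simp del: iterated_partial.simps)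
 finally show ?thesis by simp
qed

text \<open>Differentiating \<open>2 * CARD('d)\<close> times in a direction \<open>j\<close> gains
  the power \<open>\<bar>y $ j\<bar> ^ (2 * CARD('d))\<close>. One factor \<open>decay\<close> is
  all that the spectral measure asks of a transform.\<close>

lemma fourier_rapidly_decreasing_bound:
 fixes f :: "real ^ 'd::finite => complex"
 assumes f: "f \<in> rapidly_decreasing"
 shows "\<exists>C>0. \<forall>y. norm (fourier f y) <= C * decay y"
proof -
 let ?N = "2 * CARD('d)"
 have four: "fourier (iterated_partial (replicate n j) f) y = (2 * pi * \<i> * of_real (y $ j)) ^ n * fourier f y" for n j y
 proof (induction n)
  case (Suc n)
  then show ?case unfolding replicate_Suc fourier_iterated_partial[OF f] by simp
 qed simp
 define B where "B n j = (\<integral>x. norm (iterated_partial (replicate n j) f x) \<partial>lborel)" for n j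
 have Bn: "0 <= B n j" for n j unfolding B_def by simp
 have le: "\<bar>y $ j\<bar> ^ n * norm (fourier f y) <= B n j" for n j y
 proof -
  have "norm (fourier (iterated_partial (replicate n j) f) y) <= B n j" unfolding B_def by (rule norm_fourier_le)
  then have 1: "(2 * pi * \<bar>y $ j\<bar>) ^ n * norm (fourier f y) <= B n j"
   unfolding four by (simp add: norm_mult norm_power)
  have "1 * \<bar>y $ j\<bar> <= (2 * pi) * \<bar>y $ j\<bar>" using pi_gt3 by (intro mult_right_mono) auto
  then have "\<bar>y $ j\<bar> ^ n <= (2 * pi * \<bar>y $ j\<bar>) ^ n" by (intro power_mono) auto
  then have "\<bar>y $ j\<bar> ^ n * norm (fourier f y) <= (2 * pi * \<bar>y $ j\<bar>) ^ n * norm (fourier f y)"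
   by (intro mult_right_mono) auto
  with 1 show ?thesis by simp
 qed
 define M where "M = (\<Sum>j\<in>UNIV. B 0 j + B ?N j)"
 have "norm (fourier f y) <= ((2 * real CARD('d)) ^ ?N * M + 1) * decay y" for y
 proof -
  \<comment> \<open>The direction of differentiation depends on \<open>y\<close>: a largest
    coordinate controls the norm up to the factor \<open>CARD('d)\<close>. Summing the constants
    over all directions in \<open>M\<close> removes the dependence.\<close>
  obtain j where j: "\<And>i. \<bar>y $ i\<bar> <= \<bar>y $ j\<bar>"
  proof -
   have "Max (range (%i. \<bar>y $ i\<bar>)) \<in> range (%i. \<bar>y $ i\<bar>)" by (intro Max_in) auto
   then obtain j where "Max (range (%i. \<bar>y $ i\<bar>)) = \<bar>y $ j\<bar>" by blast
   then show ?thesis using that[of j] Max_ge[of "range (%i. \<bar>y $ i\<bar>)"] by (metis finite rangeI finite_imageI)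
  qed
  have "norm y <= (\<Sum>i\<in>UNIV. \<bar>y $ i\<bar>)" by (rule norm_le_l1_cart)
  also have "\<dots> <= real CARD('d) * \<bar>y $ j\<bar>" using sum_bounded_above[of UNIV "%i. \<bar>y $ i\<bar>" "\<bar>y $ j\<bar>"] j by simp
  finally have "1 + norm y <= (2 * real CARD('d)) * max 1 \<bar>y $ j\<bar>"
  proof -
   assume a: "norm y <= real CARD('d) * \<bar>y $ j\<bar>"
   have c1: "1 <= real CARD('d)" by (simp add: Suc_leI)
   have "real CARD('d) * \<bar>y $ j\<bar> <= real CARD('d) * max 1 \<bar>y $ j\<bar>" by (intro mult_left_mono) auto
   moreover have "1 * 1 <= real CARD('d) * max 1 \<bar>y $ j\<bar>" using c1 by (intro mult_mono) auto
   ultimately show ?thesis using a by linarith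
  qed
  then have "(1 + norm y) ^ ?N <= ((2 * real CARD('d)) * max 1 \<bar>y $ j\<bar>) ^ ?N" by (intro power_mono) auto
  also have "\<dots> = (2 * real CARD('d)) ^ ?N * max 1 \<bar>y $ j\<bar> ^ ?N" by (rule power_mult_distrib)
  also have "\<dots> <= (2 * real CARD('d)) ^ ?N * (1 + \<bar>y $ j\<bar> ^ ?N)"
   by (intro mult_left_mono) (auto simp: max_def)
  finally have "(1 + norm y) ^ ?N * norm (fourier f y) <= (2 * real CARD('d)) ^ ?N * (1 + \<bar>y $ j\<bar> ^ ?N) * norm (fourier f y)"
   by (rule mult_right_mono) simp
  also have "\<dots> = (2 * real CARD('d)) ^ ?N * (\<bar>y $ j\<bar> ^ 0 * norm (fourier f y) + \<bar>y $ j\<bar> ^ ?N * norm (fourier f y))"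
   by (simp add: algebra_simps)
  also have "\<dots> <= (2 * real CARD('d)) ^ ?N * (B 0 j + B ?N j)" by (intro mult_left_mono add_mono le) auto
  also have "\<dots> <= (2 * real CARD('d)) ^ ?N * M"
   unfolding M_def using Bn by (intro mult_left_mono member_le_sum) auto
  finally have "norm (fourier f y) <= (2 * real CARD('d)) ^ ?N * M * decay y"
   unfolding decay_def by (simp add: pos_le_divide_eq add_pos_nonneg mult.commute)
  then show ?thesis using decay_nonneg[of y] unfolding distrib_right mult_1_left by linarith
 qed
 moreover have "M \<ge> 0" unfolding M_def using Bn by (intro sum_nonneg) auto
 ultimately show ?thesis by (intro exI[of _ "(2 * real CARD('d)) ^ ?N * M + 1"]) (auto intro: add_nonneg_pos)
qed

section \<open>Translated and modulated Gaussians are rapidly decreasing\<close>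

text \<open>Polynomial multiples of \<open>exp (- pi * (x - c)\<^sup>2)\<close> with a complex centre \<open>c\<close>: translates as well as
 modulations of the Gaussian are of this form.\<close>

definition complex_gauss :: "('d => complex) => real ^ 'd::finite => complex" where
 "complex_gauss c x = exp (- of_real pi * (\<Sum>i\<in>UNIV. (of_real (x $ i) - c i)\<^sup>2))"

inductive_set gauss_polynomials :: "('d::finite => complex) => (real ^ 'd => complex) set" for c where
 base: "complex_gauss c \<in> gauss_polynomials c"
| coord: "h \<in> gauss_polynomials c ==> (%x. of_real (x $ j) * h x) \<in> gauss_polynomials c"
| scale: "h \<in> gauss_polynomials c ==> (%x. a * h x) \<in> gauss_polynomials c"
| add: "h \<in> gauss_polynomials c ==> g \<in> gauss_polynomials c ==> (%x. h x + g x) \<in> gauss_polynomials c"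

lemma complex_gauss_has_derivative:
 "(complex_gauss c has_derivative (%v. - 2 * of_real pi * (\<Sum>i\<in>UNIV. (of_real (x $ i) - c i) * of_real (v $ i)) * complex_gauss c x)) (at x)"
proof -
 have 1: "((%x :: real ^ 'a. (complex_of_real (x $ i) - c i)\<^sup>2) has_derivative (%v. 2 * (of_real (x $ i) - c i) * of_real (v $ i))) (at x)" for i
  unfolding power2_eq_square
  by (rule has_derivative_eq_rhs, rule has_derivative_mult)
   (auto intro!: derivative_eq_intros bounded_linear_imp_has_derivative bounded_linear_vec_nth simp: fun_eq_iff algebra_simps)
 have 2: "((%x :: real ^ 'a. - of_real pi * (\<Sum>i\<in>UNIV. (complex_of_real (x $ i) - c i)\<^sup>2)) has_derivative
   (%v. - of_real pi * (\<Sum>i\<in>UNIV. 2 * (of_real (x $ i) - c i) * of_real (v $ i)))) (at x)"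
  by (intro has_derivative_mult_right has_derivative_sum 1)
 have "(exp has_field_derivative exp z) (at z)" for z :: complex by (rule DERIV_exp)
 from has_derivative_compose[OF 2 this[unfolded has_field_derivative_def]]
 show ?thesis unfolding complex_gauss_def[abs_def]
  by (rule has_derivative_eq_rhs) (auto simp: fun_eq_iff sum_distrib_left mult.assoc mult.left_commute mult.commute)
qed

text \<open>Differentiating the exponential brings down a polynomial of degree one, so the class is
  closed under partial derivatives. It is therefore enough to bound its members themselves.\<close>

lemma gauss_polynomials_derivative:
 assumes "h \<in> gauss_polynomials c"
 shows "\<exists>D. (\<forall>x. (h has_derivative D x) (at x)) \<and> (\<forall>j. (%x. D x (axis j 1)) \<in> gauss_polynomials c)"
 using assms
proof induction
 case base
 let ?D = "%x v. - 2 * of_real pi * (\<Sum>i\<in>UNIV. (of_real (x $ i) - c i) * of_real (v $ i)) * complex_gauss c x"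
 have "(%x. ?D x (axis j 1)) \<in> gauss_polynomials c" for j
 proof -
  have "(\<Sum>i\<in>UNIV. (of_real (x $ i) - c i) * complex_of_real (axis j 1 $ i)) = of_real (x $ j) - c j" for x
   by (simp add: axis_def if_distrib cong: if_cong)
  then have "(%x. ?D x (axis j 1)) = (%x. (- 2 * of_real pi) * (of_real (x $ j) * complex_gauss c x) + (2 * of_real pi * c j) * complex_gauss c x)"
   by (intro ext) (simp only:, simp add: algebra_simps)
  then show ?thesis by (simp only:) (intro gauss_polynomials.intros)
 qed
 then show ?case using complex_gauss_has_derivative by (intro exI[of _ ?D] conjI allI)
next
 case (coord h k)
 then obtain D where D: "\<And>x. (h has_derivative D x) (at x)" "\<And>j. (%x. D x (axis j 1)) \<in> gauss_polynomials c" by blast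
 have "((%x. of_real (x $ k) * h x) has_derivative (%v. of_real (x $ k) * D x v + of_real (v $ k) * h x)) (at x)" for x
  by (intro has_derivative_mult D(1) bounded_linear_imp_has_derivative
   bounded_linear_compose[OF bounded_linear_of_real bounded_linear_vec_nth])
 moreover have "(%x. of_real (x $ k) * D x (axis j 1) + complex_of_real (axis j 1 $ k) * h x) \<in> gauss_polynomials c" for j
  by (intro gauss_polynomials.intros D(2) coord)
 ultimately show ?case
  by (intro exI[of _ "%x v. of_real (x $ k) * D x v + of_real (v $ k) * h x"]) auto
next
 case (scale h a)
 then obtain D where D: "\<And>x. (h has_derivative D x) (at x)" "\<And>j. (%x. D x (axis j 1)) \<in> gauss_polynomials c" by blast
 then show ?case
  by (intro exI[of _ "%x v. a * D x v"]) (auto intro!: has_derivative_mult_right gauss_polynomials.scale)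
next
 case (add h g)
 then obtain D D' where D: "\<And>x. (h has_derivative D x) (at x)" "\<And>j. (%x. D x (axis j 1)) \<in> gauss_polynomials c"
  "\<And>x. (g has_derivative D' x) (at x)" "\<And>j. (%x. D' x (axis j 1)) \<in> gauss_polynomials c" by metis
 then show ?case
  by (intro exI[of _ "%x v. D x v + D' x v"]) (auto intro!: has_derivative_add gauss_polynomials.add)
qed

text \<open>The real part of the centre translates the Gaussian and the imaginary part only
  contributes a constant factor, because \<open>Re ((t - z)^2) = (t - Re z)^2 - (Im z)^2\<close> for
  real \<open>t\<close>.\<close>

lemma norm_complex_gauss:
 fixes x :: "real ^ 'd::finite"
 shows "norm (complex_gauss c x) = exp (pi * (\<Sum>i\<in>UNIV. (Im (c i))\<^sup>2)) * gauss (x - (\<chi> i. Re (c i)))"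
proof -
 have "Re ((of_real t - z)\<^sup>2) = (t - Re z)\<^sup>2 - (Im z)\<^sup>2" for t z by (simp add: power2_eq_square)
 then have "norm (complex_gauss c x) = exp (- pi * (\<Sum>i\<in>UNIV. (x $ i - Re (c i))\<^sup>2 - (Im (c i))\<^sup>2))"
  unfolding complex_gauss_def by simp
 also have "(\<Sum>i\<in>UNIV. (x $ i - Re (c i))\<^sup>2 - (Im (c i))\<^sup>2) = (norm (x - (\<chi> i. Re (c i))))\<^sup>2 - (\<Sum>i\<in>UNIV. (Im (c i))\<^sup>2)"
  by (simp add: sum_subtractf norm_vec_def L2_set_def sum_nonneg)
 finally show ?thesis by (simp add: gauss_def exp_add[symmetric] algebra_simps)
qed

lemma gauss_polynomials_bounded:
 assumes "h \<in> gauss_polynomials c"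
 shows "\<exists>B. \<forall>x. norm x ^ k * norm (h x) <= B"
 using assms
proof (induction arbitrary: k)
 case base
 let ?a = "(\<chi> i. Re (c i)) :: real ^ 'a" and ?E = "exp (pi * (\<Sum>i\<in>UNIV. (Im (c i))\<^sup>2))"
 have "norm x ^ k * gauss (x - ?a) <= fact k * exp (norm ?a + 1)" for x
 proof -
  have "norm x ^ k * gauss (x - ?a) <= (fact k * exp (norm x)) * gauss (x - ?a)"
   by (intro mult_right_mono power_le_fact_exp) auto
  also have "\<dots> = fact k * exp (norm x - pi * (norm (x - ?a))\<^sup>2)"
   by (simp add: gauss_def exp_diff exp_minus field_simps)
  also have "\<dots> <= fact k * exp (norm ?a + 1)"
  proof -
   let ?u = "norm (x - ?a)"
   have "norm x <= norm ?a + ?u" using norm_triangle_ineq[of ?a "x - ?a"] by simp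
   moreover have "?u\<^sup>2 * 1 <= ?u\<^sup>2 * pi" using pi_gt3 by (intro mult_left_mono) auto
   moreover have "0 <= (1/2 - ?u)\<^sup>2" by simp
   moreover have "(1/2 - ?u)\<^sup>2 = 1/4 - ?u + ?u\<^sup>2" by (simp add: power2_diff power_divide)
   ultimately have "norm x - pi * ?u\<^sup>2 <= norm ?a + 1"
   by (simp only: mult.commute[of "?u\<^sup>2" pi] mult_1_right)
   then show ?thesis by simp
  qed
  finally show ?thesis .
 qed
 then have "norm x ^ k * norm (complex_gauss c x) <= ?E * (fact k * exp (norm ?a + 1))" for x
  unfolding norm_complex_gauss by (subst mult.left_commute) (intro mult_left_mono, auto)
 then show ?case by blast
next
 case (coord h j)
 \<comment> \<open>A coordinate factor is paid for by one more power of the norm; this is why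
   \<open>k\<close> is arbitrary in the induction.\<close>
 obtain B where B: "\<And>x. norm x ^ Suc k * norm (h x) <= B" using coord.IH[of "Suc k"] by blast
 have "norm x ^ k * norm (of_real (x $ j) * h x) <= B" for x
 proof -
  have "norm x ^ k * norm (of_real (x $ j) * h x) = norm x ^ k * norm (h x) * \<bar>x $ j\<bar>" by (simp add: norm_mult)
  also have "\<dots> <= norm x ^ k * norm (h x) * norm x" by (intro mult_left_mono component_le_norm_cart) auto
  also have "\<dots> = norm x ^ Suc k * norm (h x)" by simp
  finally show ?thesis using B[of x] by simp
 qed
 then show ?case by blast
next
 case (scale h a)
 obtain B where B: "\<And>x. norm x ^ k * norm (h x) <= B" using scale.IH by blast
 have "norm x ^ k * norm (a * h x) <= norm a * B" for x
  using mult_left_mono[OF B[of x] norm_ge_zero[of a]] by (simp add: norm_mult mult.left_commute)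
 then show ?case by blast
next
 case (add h g)
 obtain B B' where B: "\<And>x. norm x ^ k * norm (h x) <= B" "\<And>x. norm x ^ k * norm (g x) <= B'" using add.IH by metis
 have "norm x ^ k * norm (h x + g x) <= B + B'" for x
 proof -
  have "norm x ^ k * norm (h x + g x) <= norm x ^ k * (norm (h x) + norm (g x))"
   by (intro mult_left_mono norm_triangle_ineq) auto
  then show ?thesis using B(1)[of x] B(2)[of x] by (simp add: algebra_simps)
 qed
 then show ?case by blast
qed

lemma gauss_polynomials_rapidly_decreasing:
 assumes "h \<in> gauss_polynomials c"
 shows "h \<in> rapidly_decreasing"
proof -
 have it: "iterated_partial is h \<in> gauss_polynomials c" for "is"
 proof (induction "is")
  case (Cons j "is")
  obtain D where D: "\<And>x. (iterated_partial is h has_derivative D x) (at x)" "\<And>j. (%x. D x (axis j 1)) \<in> gauss_polynomials c"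
   using gauss_polynomials_derivative[OF Cons] by blast
  then have "frechet_derivative (iterated_partial is h) (at x) = D x" for x
   using frechet_derivative_at by metis
  then show ?case using D(2)[of j] by simp
 qed (use assms in simp)
 show ?thesis unfolding rapidly_decreasing_def
 proof (intro CollectI allI conjI)
  fix "is" x
  show "iterated_partial is h differentiable at x"
   using gauss_polynomials_derivative[OF it[of "is"]] unfolding differentiable_def by blast
 next
  fix "is" k
  obtain B where "\<And>x. norm x ^ k * norm (iterated_partial is h x) <= B"
   using gauss_polynomials_bounded[OF it[of "is"]] by blast
  then show "bounded (range (%x. norm x ^ k *\<^sub>R iterated_partial is h x))"
   by (intro boundedI[of _ B]) auto
 qed
qed

lemma gauss_translate_rapidly_decreasing:
 "(%x :: real ^ 'd::finite. complex_of_real (gauss (x - a))) \<in> rapidly_decreasing"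
proof -
 have "complex_of_real (gauss (x - a)) = complex_gauss (%i. of_real (a $ i)) x" for x :: "real ^ 'd"
  unfolding complex_gauss_def gauss_def norm_vec_def L2_set_def
  by (simp add: sum_nonneg flip: exp_of_real of_real_diff of_real_power of_real_sum)
 then show ?thesis
  using gauss_polynomials_rapidly_decreasing[OF gauss_polynomials.base, of "%i. of_real (a $ i)"]
  by (simp add: fun_eq_iff[symmetric])
qed

text \<open>Completing the square: the Gaussian with imaginary centre \<open>\<i> * a\<close> is the
  modulated Gaussian times \<open>exp (pi * (norm a)^2)\<close>, a constant that \<open>?e\<close>
  removes.\<close>

lemma gauss_modulate_rapidly_decreasing:
 "(%x :: real ^ 'd::finite. cis (2 * pi * (a \<bullet> x)) * complex_of_real (gauss x)) \<in> rapidly_decreasing"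
proof -
 let ?c = "%i. \<i> * complex_of_real (a $ i)" and ?e = "exp (- of_real pi * (\<Sum>i\<in>UNIV. (complex_of_real (a $ i))\<^sup>2))"
 have "cis (2 * pi * (a \<bullet> x)) * complex_of_real (gauss x) = ?e * complex_gauss ?c x" for x :: "real ^ 'd"
 proof -
  have n: "(norm x)\<^sup>2 = (\<Sum>i\<in>UNIV. (x $ i)\<^sup>2)" by (simp add: norm_vec_def L2_set_def sum_nonneg)
  have i: "a \<bullet> x = (\<Sum>i\<in>UNIV. a $ i * x $ i)" by (simp add: inner_vec_def)
  have s: "(complex_of_real (x $ i) - \<i> * of_real (a $ i))\<^sup>2 = of_real ((x $ i)\<^sup>2) - 2 * \<i> * of_real (a $ i * x $ i) - (of_real (a $ i))\<^sup>2" for i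
   by (simp add: power2_eq_square algebra_simps)
  have "?e * complex_gauss ?c x = exp (- of_real pi * (\<Sum>i\<in>UNIV. (complex_of_real (a $ i))\<^sup>2)
   + - of_real pi * (\<Sum>i\<in>UNIV. (complex_of_real (x $ i) - \<i> * of_real (a $ i))\<^sup>2))"
   unfolding complex_gauss_def exp_add ..
  also have "- of_real pi * (\<Sum>i\<in>UNIV. (complex_of_real (a $ i))\<^sup>2)
   + - of_real pi * (\<Sum>i\<in>UNIV. (complex_of_real (x $ i) - \<i> * of_real (a $ i))\<^sup>2)
   = \<i> * of_real (2 * pi * (a \<bullet> x)) + of_real (- pi * (norm x)\<^sup>2)"
   unfolding s i n sum_subtractf sum_distrib_left[symmetric] of_real_sum[symmetric]
   by (simp add: algebra_simps sum_distrib_left sum_negf)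
  finally show ?thesis unfolding gauss_def cis_conv_exp exp_of_real[symmetric] exp_add by simp
 qed
 then show ?thesis
  using gauss_polynomials_rapidly_decreasing[OF gauss_polynomials.scale[OF gauss_polynomials.base], of ?e ?c]
  by (simp add: fun_eq_iff[symmetric])
qed

section \<open>A monotone class argument for characters\<close>

inductive_set trig_polynomials :: "(real ^ 'd::finite => complex) set" where
 cis: "(%x. cis (a \<bullet> x)) \<in> trig_polynomials"
| scale: "f \<in> trig_polynomials ==> (%x. c * f x) \<in> trig_polynomials"
| add: "f \<in> trig_polynomials ==> g \<in> trig_polynomials ==> (%x. f x + g x) \<in> trig_polynomials"

lemma trig_polynomials_const: "(%x. c) \<in> trig_polynomials"
 using trig_polynomials.scale[OF trig_polynomials.cis[of 0], of c] by simp

lemma trig_polynomials_sum: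
 "finite I ==> (\<And>i. i \<in> I ==> f i \<in> trig_polynomials) ==> (%x. \<Sum>i\<in>I. f i x) \<in> trig_polynomials"
 by (induction I rule: finite_induct) (auto intro: trig_polynomials.add trig_polynomials_const)

lemma trig_polynomials_mult_cis:
 assumes "g \<in> trig_polynomials"
 shows "(%x. cis (a \<bullet> x) * g x) \<in> trig_polynomials"
 using assms
proof (induction rule: trig_polynomials.induct)
 case (cis b)
 show ?case using trig_polynomials.cis[of "a + b"] by (simp only: cis_mult inner_add_left)
next
 case (scale f c)
 from trig_polynomials.scale[OF scale.IH, of c] show ?case by (simp only: mult.left_commute)
next
 case (add f g)
 from trig_polynomials.add[OF add.IH] show ?case by (simp only: distrib_left)
qed

lemma trig_polynomials_mult:
 assumes "f \<in> trig_polynomials" and g: "g \<in> trig_polynomials"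
 shows "(%x. f x * g x) \<in> trig_polynomials"
 using assms(1)
proof (induction rule: trig_polynomials.induct)
 case (cis a)
 show ?case by (rule trig_polynomials_mult_cis[OF g])
next
 case (scale f c)
 from trig_polynomials.scale[OF scale.IH, of c] show ?case by (simp only: mult.assoc)
next
 case (add f h)
 from trig_polynomials.add[OF add.IH] show ?case by (simp only: distrib_right)
qed

lemma trig_polynomials_sin: "(%x. of_real (sin (r * x $ i))) \<in> trig_polynomials"
proof -
 have "complex_of_real (sin (r * x $ i)) = (1 / (2 * \<i>)) * cis (axis i r \<bullet> x) + (- 1 / (2 * \<i>)) * cis (axis i (- r) \<bullet> x)" for x :: "real ^ 'a"
  by (simp add: inner_axis' complex_eq_iff)
 then show ?thesis
  using trig_polynomials.add[OF trig_polynomials.scale[OF trig_polynomials.cis] trig_polynomials.scale[OF trig_polynomials.cis],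
   of "1 / (2 * \<i>)" "axis i r" "- 1 / (2 * \<i>)" "axis i (- r)"]
  by (simp only:)
qed

text \<open>Polynomials are unbounded and cannot be limits of boundedly converging characters. With
  sines in place of the coordinates they are trigonometric polynomials, while
  \<open>sin (r * t) / r\<close> still approaches \<open>t\<close> for small
  \<open>r\<close>.\<close>

lemma real_polynomial_of_sin:
 fixes p :: "real ^ 'd::finite => real"
 assumes "real_polynomial_function p"
 shows "(%x :: real ^ 'd. of_real (p (\<chi> i. sin (r * x $ i)))) \<in> trig_polynomials"
 using assms
proof (induction rule: real_polynomial_function.induct)
 case (linear f)
 have fe: "f v = (\<Sum>i\<in>UNIV. v $ i * f (axis i 1))" for v
 proof -
  have "v = (\<Sum>i\<in>UNIV. v $ i *\<^sub>R axis i 1)" using basis_expansion[of v] by (simp add: scalar_mult_eq_scaleR)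
  then have "f v = f (\<Sum>i\<in>UNIV. v $ i *\<^sub>R axis i 1)" by simp
  then show ?thesis by (simp add: linear_sum[OF bounded_linear.linear[OF linear]] linear_scale[OF bounded_linear.linear[OF linear]])
 qed
 have "(%x :: real ^ 'd. complex_of_real (f (\<chi> i. sin (r * x $ i)))) = (%x. \<Sum>i\<in>UNIV. of_real (f (axis i 1)) * of_real (sin (r * x $ i)))"
  by (rule ext, subst fe) (simp only: vec_lambda_beta of_real_sum of_real_mult mult.commute)
 then show ?case by (simp only:) (intro trig_polynomials_sum trig_polynomials.scale trig_polynomials_sin finite_class.finite_UNIV)
next
 case (const c) then show ?case by (simp add: trig_polynomials_const)
next
 case (add f g)
 from trig_polynomials.add[OF add.IH] show ?case by (simp only: of_real_add)
next
 case (mult f g)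
 from trig_polynomials_mult[OF mult.IH] show ?case by (simp only: of_real_mult)
qed

lemma sin_rescaled_tendsto:
 fixes h :: "nat => real"
 assumes "\<And>n. h n > 0" "h \<longlonglongrightarrow> 0"
 shows "(%n. sin (h n * x) / h n) \<longlonglongrightarrow> x"
proof -
 have "((%s. sin (s * x)) has_field_derivative x) (at 0)" by (auto intro!: derivative_eq_intros)
 then have "(%s. sin (s * x) / s) \<midarrow>0\<rightarrow> x" by (simp add: DERIV_def)
 moreover have "filterlim h (at 0) sequentially"
  using assms by (auto simp: filterlim_at less_imp_neq[symmetric])
 ultimately show ?thesis by (rule filterlim_compose)
qed

text \<open>A monotone class principle: linearity, bounded pointwise limits and the characters
  already force \<open>P\<close> for every bounded Borel function. It serves twice, for the
  uniqueness of the Fourier transform and for the density of transforms in L2.\<close>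

locale character_class =
 fixes P :: "(real ^ 'd::finite => complex) => bool"
 assumes add: "P f ==> P g ==> P (%x. f x + g x)"
  and scale: "P f ==> P (%x. c * f x)"
  and lim: "(\<And>n. P (F n)) ==> (\<And>n x. norm (F n x) <= C) ==> (\<And>x. (%n. F n x) \<longlonglongrightarrow> f x) ==> P f"
  and char: "P (%x. cis (a \<bullet> x))"
begin

lemma trig: "f \<in> trig_polynomials ==> P f"
 by (induction rule: trig_polynomials.induct) (auto intro: char scale add)

lemma const: "P (%x. c)"
 by (rule trig[OF trig_polynomials_const])

lemma sum: "finite I ==> (\<And>i. i \<in> I ==> P (f i)) ==> P (%x. \<Sum>i\<in>I. f i x)"
 by (induction I rule: finite_induct) (auto intro: add const)

text \<open>Two successive limits. With the scales \<open>r\<close> and \<open>s\<close> fixed, the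
  argument \<open>S r x /\<^sub>R s\<close> stays in a compact set, where polynomials approximate
  uniformly; then both scales tend to 0 together and the argument tends to \<open>x\<close>.\<close>

lemma continuous_real:
 fixes F :: "real ^ 'd => real"
 assumes c: "continuous_on UNIV F" and bd: "\<And>x. \<bar>F x\<bar> <= C"
 shows "P (%x. of_real (F x))"
proof -
 define h :: "nat => real" where "h n = 1 / real (Suc n)" for n
 have h: "0 < h n" for n unfolding h_def by auto
 have h_lim: "h \<longlonglongrightarrow> 0" unfolding h_def using LIMSEQ_Suc[OF lim_1_over_n] by simp
 define S :: "real => real ^ 'd => real ^ 'd" where "S r x = (\<chi> i. sin (r * x $ i))" for r x
 have S: "S r x \<in> cball 0 (real CARD('d))" for r x
 proof -
  have "norm (S r x) <= (\<Sum>i\<in>UNIV. \<bar>S r x $ i\<bar>)" by (rule norm_le_l1_cart)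
  also have "\<dots> <= real CARD('d) * 1" using sum_bounded_above[of UNIV "%i. \<bar>S r x $ i\<bar>" 1] by (simp add: S_def)
  finally show ?thesis by simp
 qed
 have step: "P (%x. of_real (F (S r x /\<^sub>R s)))" for r s :: real
 proof -
  have c': "continuous_on (cball 0 (real CARD('d))) (%y. F (y /\<^sub>R s))"
   by (rule continuous_on_compose2[OF c]) (auto intro!: continuous_intros)
  have "\<exists>g. real_polynomial_function g \<and> (\<forall>y\<in>cball 0 (real CARD('d)). \<bar>F (y /\<^sub>R s) - g y\<bar> < h k)" for k
   using Stone_Weierstrass_real_polynomial_function[OF compact_cball c' h[of k]] by metis
  then obtain g where g: "\<And>k. real_polynomial_function (g k)"
   "\<And>k y. y \<in> cball 0 (real CARD('d)) ==> \<bar>F (y /\<^sub>R s) - g k y\<bar> < h k" by metis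
  show ?thesis
  proof (rule lim[where F="%k x. of_real (g k (S r x))" and C="C + 1"])
   show "P (%x. of_real (g k (S r x)))" for k
   unfolding S_def by (rule trig[OF real_polynomial_of_sin[OF g(1)]])
   show "norm (complex_of_real (g k (S r x))) <= C + 1" for k x
   proof -
   have "h k <= 1" unfolding h_def by simp
   then show ?thesis using g(2)[OF S[of r x], of k] bd[of "S r x /\<^sub>R s"] by simp
   qed
   show "(%k. complex_of_real (g k (S r x))) \<longlonglongrightarrow> complex_of_real (F (S r x /\<^sub>R s))" for x
   proof (rule tendsto_of_real, rule LIM_zero_cancel, rule Lim_null_comparison[OF _ h_lim])
   show "\<forall>\<^sub>F k in sequentially. norm (g k (S r x) - F (S r x /\<^sub>R s)) <= h k"
   using g(2)[OF S[of r x]] by (intro always_eventually allI) (simp add: abs_minus_commute less_imp_le)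
   qed
  qed
 qed
 show ?thesis
 proof (rule lim[where F="%n x. of_real (F (S (h n) x /\<^sub>R h n))" and C=C])
  show "P (%x. complex_of_real (F (S (h n) x /\<^sub>R h n)))" for n by (rule step)
  show "norm (complex_of_real (F (S (h n) x /\<^sub>R h n))) <= C" for n x using bd by simp
  fix x
  have "(%n. S (h n) x /\<^sub>R h n) \<longlonglongrightarrow> x"
  proof (rule vec_tendstoI)
   fix i
   show "(%n. (S (h n) x /\<^sub>R h n) $ i) \<longlonglongrightarrow> x $ i"
   using sin_rescaled_tendsto[OF h h_lim, of "x $ i"] by (simp add: S_def divide_inverse mult.commute)
  qed
  moreover have "isCont F x" using c by (simp add: continuous_on_eq_continuous_at)
  ultimately show "(%n. complex_of_real (F (S (h n) x /\<^sub>R h n))) \<longlonglongrightarrow> complex_of_real (F x)"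
   by (rule tendsto_of_real[OF isCont_tendsto_compose[rotated]])
 qed
qed

lemma indicator_open:
 assumes "open U" shows "P (%x. indicator U x)"
\<comment> \<open>The distance to the empty complement is 0 by convention, so the approximation
  below would give 0 instead of 1.\<close>
proof (cases "U = UNIV")
 case True then show ?thesis using const[of 1] by simp
next
 case False
 have c: "continuous_on UNIV (%x. min 1 (real n * infdist x (- U)))" for n
  by (intro continuous_intros)
 show ?thesis
 proof (rule lim[where F="%n x. of_real (min 1 (real n * infdist x (- U)))" and C=1])
  show "P (%x. complex_of_real (min 1 (real n * infdist x (- U))))" for n
   by (rule continuous_real[OF c, of _ 1]) (auto simp: abs_le_iff infdist_nonneg intro: order_trans[of _ 0])
  show "norm (complex_of_real (min 1 (real n * infdist x (- U)))) <= 1" for n x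
   by (auto simp: abs_le_iff infdist_nonneg intro: order_trans[of _ 0])
  fix x
  show "(%n. complex_of_real (min 1 (real n * infdist x (- U)))) \<longlonglongrightarrow> indicator U x"
  proof (cases "x \<in> U")
   case True
   have cl: "closed (- U)" using assms by (simp add: closed_def)
   have "infdist x (- U) \<noteq> 0" using in_closed_iff_infdist_zero[OF cl] False True by auto
   then have pos: "infdist x (- U) > 0" using infdist_nonneg[of x "- U"] by linarith
   obtain N :: nat where N: "1 / infdist x (- U) < real N" using reals_Archimedean2 by blast
   have "complex_of_real (min 1 (real n * infdist x (- U))) = 1" if "n \<ge> N" for n
   proof -
   have "1 / infdist x (- U) < real n" using N that by linarith
   then have "1 < real n * infdist x (- U)" using pos by (simp add: divide_less_eq)
   then show ?thesis by simp
   qed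
   then have "\<forall>\<^sub>F n in sequentially. complex_of_real (min 1 (real n * infdist x (- U))) = indicator U x"
   using True by (auto simp: eventually_sequentially)
   then show ?thesis by (rule tendsto_eventually)
  qed simp
 qed
qed

lemma indicator_borel:
 assumes "A \<in> sets borel" shows "P (%x. indicator A x)"
proof -
 have "Int_stable {S :: (real ^ 'd) set. open S}" by (auto simp: Int_stable_def)
 moreover have "{S :: (real ^ 'd) set. open S} \<subseteq> Pow UNIV" by simp
 moreover have "A \<in> sigma_sets UNIV {S. open S}" using assms by (simp add: borel_def)
 ultimately show ?thesis
 proof (induction rule: sigma_sets_induct_disjoint)
  case (compl A)
  have "(%x. indicator (UNIV - A) x :: complex) = (%x. 1 + (-1) * indicator A x)"
   by (rule ext, split split_indicator, split split_indicator) simp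
  then show ?case using add[OF const scale[OF compl(2)], of 1 "-1"] by (simp only:)
 next
  case (union A)
  show ?case
  proof (rule lim[where F="%n x. \<Sum>i<n. indicator (A i) x" and C=1])
   show "P (%x. \<Sum>i<n. indicator (A i) x)" for n by (rule sum) (use union in auto)
   have eq: "(\<Sum>i<n. indicator (A i) x :: complex) = indicator (\<Union>i<n. A i) x" for n x
   using union(1) by (subst indicator_UN_disjoint) (auto simp: disjoint_family_on_def)
   show "norm (\<Sum>i<n. indicator (A i) x :: complex) <= 1" for n x unfolding eq by (simp add: indicator_def)
   show "(%n. \<Sum>i<n. indicator (A i) x :: complex) \<longlonglongrightarrow> indicator (\<Union> (range A)) x" for x
   unfolding eq using LIMSEQ_indicator_UN[of A x] by simp
  qed
 qed (simp_all add: indicator_open const)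
qed

text \<open>Rounding down to multiples of \<open>1 / real (Suc n)\<close> is uniformly close to
  \<open>F\<close> and takes finitely many values, since \<open>F\<close> is bounded; each rounding
  is a finite combination of indicators.\<close>

lemma borel_real:
 fixes F :: "real ^ 'd => real"
 assumes [measurable]: "F \<in> borel_measurable borel" and bd: "\<And>x. \<bar>F x\<bar> <= C"
 shows "P (%x. of_real (F x))"
proof -
 define q where "q n x = of_int \<lfloor>real (Suc n) * F x\<rfloor> / real (Suc n)" for n x
 have q: "\<bar>q n x - F x\<bar> <= 1 / real (Suc n)" for n x
 proof -
  have "\<bar>of_int \<lfloor>real (Suc n) * F x\<rfloor> - real (Suc n) * F x\<bar> <= 1" by linarith
  then have "\<bar>of_int \<lfloor>real (Suc n) * F x\<rfloor> - real (Suc n) * F x\<bar> / real (Suc n) <= 1 / real (Suc n)"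
   by (intro divide_right_mono) auto
  also have "\<bar>of_int \<lfloor>real (Suc n) * F x\<rfloor> - real (Suc n) * F x\<bar> / real (Suc n) = \<bar>q n x - F x\<bar>"
  proof -
   have "q n x - F x = (of_int \<lfloor>real (Suc n) * F x\<rfloor> - real (Suc n) * F x) / real (Suc n)"
   unfolding q_def diff_divide_distrib by simp
   then show ?thesis by (simp only: abs_divide abs_of_nat)
  qed
  finally show ?thesis .
 qed
 show ?thesis
 proof (rule lim[where F="%n x. of_real (q n x)" and C="C + 1"])
  fix n
  obtain M :: nat where M: "real (Suc n) * C + 1 < real M" using reals_Archimedean2 by blast
  define E where "E k = {x. \<lfloor>real (Suc n) * F x\<rfloor> = k}" for k
  have "complex_of_real (q n x) = (\<Sum>k\<in>{- int M..int M}. of_real (of_int k / real (Suc n)) * indicator (E k) x)" for x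
  proof -
   let ?k = "\<lfloor>real (Suc n) * F x\<rfloor>"
   have "\<bar>real (Suc n) * F x\<bar> <= real (Suc n) * C" using bd[of x] by (simp add: abs_mult mult_left_mono)
   then have "real (Suc n) * F x <= real M" "- real M <= real (Suc n) * F x" using M by linarith+
   then have "?k \<in> {- int M..int M}" unfolding atLeastAtMost_iff by linarith
   moreover have "(\<Sum>k\<in>{- int M..int M}. of_real (of_int k / real (Suc n)) * indicator (E k) x)
   = (\<Sum>k\<in>{- int M..int M}. if k = ?k then complex_of_real (of_int ?k / real (Suc n)) else 0)"
   by (intro sum.cong) (auto simp: E_def indicator_def)
   ultimately show ?thesis by (simp add: q_def)
  qed
  then show "P (%x. complex_of_real (q n x))"
   by (simp only:) (intro sum scale indicator_borel, auto simp: E_def)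
  show "norm (complex_of_real (q n x)) <= C + 1" for x
  proof -
   have "1 / real (Suc n) <= 1" by simp
   then have "\<bar>q n x\<bar> <= C + 1" using q[of n x] bd[of x] by linarith
   then show ?thesis by (simp only: norm_of_real)
  qed
 next
  fix x
  have l: "(%n. 1 / real (Suc n)) \<longlonglongrightarrow> 0" using LIMSEQ_Suc[OF lim_1_over_n] by simp
  show "(%n. complex_of_real (q n x)) \<longlonglongrightarrow> complex_of_real (F x)"
   by (rule tendsto_of_real, rule LIM_zero_cancel, rule Lim_null_comparison[OF _ l])
   (use q in \<open>auto intro!: always_eventually\<close>)
 qed
qed

lemma borel_complex:
 assumes [measurable]: "F \<in> borel_measurable borel" and bd: "\<And>x. norm (F x) <= C"
 shows "P F"
proof -
 have "P (%x. of_real (Re (F x)))"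
  by (rule borel_real[of _ C]) (auto intro: order_trans[OF abs_Re_le_cmod bd])
 moreover have "P (%x. \<i> * of_real (Im (F x)))"
  by (rule scale, rule borel_real[of _ C]) (auto intro: order_trans[OF abs_Im_le_cmod bd])
 ultimately have "P (%x. of_real (Re (F x)) + \<i> * of_real (Im (F x)))" by (rule add)
 then show ?thesis by (simp flip: complex_eq)
qed

end

text \<open>The measures may be infinite, so their densities \<open>gauss\<close> are compared
  instead. Characters times \<open>gauss\<close> are rapidly decreasing and hence integrate equally;
  the monotone class principle extends this to indicators, and dividing by the positive
  \<open>gauss\<close> returns to the measures.\<close>

lemma fourier_transform_measure_unique:
 fixes \<nu>\<^sub>1 \<nu>\<^sub>2 :: "(real ^ 'd::finite) measure"
 assumes 1: "is_fourier_transform \<gamma> \<nu>\<^sub>1" and 2: "is_fourier_transform \<gamma> \<nu>\<^sub>2"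
 shows "\<nu>\<^sub>1 = \<nu>\<^sub>2"
proof -
 have s1[measurable_cong]: "sets \<nu>\<^sub>1 = sets borel" and s2[measurable_cong]: "sets \<nu>\<^sub>2 = sets borel"
  using 1 2 unfolding is_fourier_transform_def by auto
 have cg: "(%x :: real ^ 'd. complex_of_real (gauss x)) \<in> rapidly_decreasing"
  using gauss_translate_rapidly_decreasing[of "0 :: real ^ 'd"] by simp
 have gi: "integrable \<nu> gauss" if "is_fourier_transform \<gamma> \<nu>" for \<nu> :: "(real ^ 'd) measure"
 proof -
  have "integrable \<nu> (%x. complex_of_real (gauss x))" using that cg unfolding is_fourier_transform_def by blast
  then have "integrable \<nu> (%x. Re (complex_of_real (gauss x)))" by (rule integrable_Re)
  then show ?thesis by simp
 qed
 note gi1 = gi[OF 1] and gi2 = gi[OF 2]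
 define Q where "Q h \<longleftrightarrow> h \<in> borel_measurable borel \<and> (\<exists>C. \<forall>x. norm (h x) <= C) \<and>
   (\<integral>x. h x * of_real (gauss x) \<partial>\<nu>\<^sub>1) = (\<integral>x. h x * of_real (gauss x) \<partial>\<nu>\<^sub>2)" for h :: "real ^ 'd => complex"
 have int: "integrable \<nu> (%x. h x * of_real (gauss x))"
  if "sets \<nu> = sets borel" "integrable \<nu> gauss" "h \<in> borel_measurable borel" "\<And>x. norm (h x) <= C" for \<nu> and h :: "real ^ 'd => complex" and C
 proof (rule integrable_bound_AE[of _ "%x. C * gauss x"])
  show "integrable \<nu> (%x. C * gauss x)" using that by (intro integrable_mult_right) auto
  show "(%x. h x * complex_of_real (gauss x)) \<in> borel_measurable \<nu>"
   using that(3) by (simp add: measurable_cong_sets[OF that(1) refl])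
  show "AE x in \<nu>. norm (h x * complex_of_real (gauss x)) <= norm (C * gauss x)"
  proof (intro AE_I2)
   fix x
   have "norm (h x) * gauss x <= C * gauss x" by (intro mult_right_mono that(4)) simp
   then show "norm (h x * complex_of_real (gauss x)) <= norm (C * gauss x)" by (simp add: norm_mult)
  qed
 qed
 interpret character_class Q
 proof
  fix f g assume "Q f" "Q g"
  then obtain C C' where C: "\<And>x. norm (f x) <= C" "\<And>x. norm (g x) <= C'" unfolding Q_def by blast
  have "norm (f x + g x) <= C + C'" for x by (rule order_trans[OF norm_triangle_ineq add_mono[OF C]])
  moreover have "f \<in> borel_measurable borel" "g \<in> borel_measurable borel" using \<open>Q f\<close> \<open>Q g\<close> unfolding Q_def by auto
  ultimately show "Q (%x. f x + g x)"
   using \<open>Q f\<close> \<open>Q g\<close> int[OF s1 gi1 _ C(1)] int[OF s2 gi2 _ C(1)] int[OF s1 gi1 _ C(2)] int[OF s2 gi2 _ C(2)]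
   unfolding Q_def by (auto simp: distrib_right)
 next
  fix f c assume f: "Q f"
  then obtain C where C: "\<And>x. norm (f x) <= C" unfolding Q_def by blast
  have "norm (c * f x) <= norm c * C" for x unfolding norm_mult by (intro mult_left_mono C) simp
  then show "Q (%x. c * f x)" using f unfolding Q_def by (auto simp: mult.assoc)
 next
  fix F f C
  assume F: "\<And>n. Q (F n)" and C: "\<And>n x. norm (F n x) <= C" and l: "\<And>x. (%n. F n x) \<longlonglongrightarrow> f x"
  have Fm[measurable]: "F n \<in> borel_measurable borel" for n using F unfolding Q_def by blast
  have fm[measurable]: "f \<in> borel_measurable borel" by (rule borel_measurable_LIMSEQ_metric[OF Fm l])
  have fC: "norm (f x) <= C" for x
   by (rule LIMSEQ_le_const2[OF tendsto_norm[OF l]]) (use C in auto)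
  have conv: "(%n. \<integral>x. F n x * of_real (gauss x) \<partial>\<nu>) \<longlonglongrightarrow> (\<integral>x. f x * of_real (gauss x) \<partial>\<nu>)"
   if \<nu>[measurable_cong]: "sets \<nu> = sets borel" and "integrable \<nu> gauss" for \<nu>
   by (rule integral_dominated_convergence[where w="%x. C * gauss x"])
   (use that(2) l C in \<open>auto intro!: AE_I2 tendsto_mult mult_right_mono simp: norm_mult\<close>)
  have "(\<integral>x. f x * of_real (gauss x) \<partial>\<nu>\<^sub>1) = (\<integral>x. f x * of_real (gauss x) \<partial>\<nu>\<^sub>2)"
   using LIMSEQ_unique[OF conv[OF s1 gi1]] conv[OF s2 gi2] F unfolding Q_def by simp
  then show "Q f" unfolding Q_def using fC by auto
 next
  fix a :: "real ^ 'd"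
  have "2 * pi * ((a /\<^sub>R (2 * pi)) \<bullet> x) = a \<bullet> x" for x by simp
  then have "(%x. cis (a \<bullet> x) * complex_of_real (gauss x)) \<in> rapidly_decreasing"
   using gauss_modulate_rapidly_decreasing[of "a /\<^sub>R (2 * pi)"] by (simp only:)
  then have "(\<integral>x. cis (a \<bullet> x) * of_real (gauss x) \<partial>\<nu>\<^sub>1) = (\<integral>x. cis (a \<bullet> x) * of_real (gauss x) \<partial>\<nu>\<^sub>2)"
   using 1 2 unfolding is_fourier_transform_def by simp
  then show "Q (%x. cis (a \<bullet> x))" unfolding Q_def by (auto intro!: exI[of _ 1])
 qed
 have dens: "density \<nu>\<^sub>1 (%x. ennreal (gauss x)) = density \<nu>\<^sub>2 (%x. ennreal (gauss x))"
 proof (rule measure_eqI)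
  fix A assume "A \<in> sets (density \<nu>\<^sub>1 (%x. ennreal (gauss x)))"
  then have A[measurable]: "A \<in> sets borel" by (simp add: s1)
  have e: "emeasure (density \<nu> (%x. ennreal (gauss x))) A = ennreal (Re (\<integral>x. indicator A x * of_real (gauss x) \<partial>\<nu>))"
   if \<nu>[measurable_cong]: "sets \<nu> = sets borel" and g: "integrable \<nu> gauss" for \<nu>
  proof -
   have i: "integrable \<nu> (%x. indicator A x * of_real (gauss x) :: complex)"
   by (rule int[OF that, of _ 1]) (auto simp: indicator_def)
   have "emeasure (density \<nu> (%x. ennreal (gauss x))) A = (\<integral>\<^sup>+x. ennreal (gauss x) * indicator A x \<partial>\<nu>)"
   by (rule emeasure_density) (auto simp: \<nu>)
   also have "\<dots> = (\<integral>\<^sup>+x. ennreal (gauss x * indicator A x) \<partial>\<nu>)"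
   by (intro nn_integral_cong) (auto simp: indicator_def)
   also have "\<dots> = ennreal (\<integral>x. gauss x * indicator A x \<partial>\<nu>)"
   by (rule nn_integral_eq_integral[OF integrable_real_mult_indicator[OF _ g]]) (auto simp: \<nu>)
   also have "(\<integral>x. gauss x * indicator A x \<partial>\<nu>) = Re (\<integral>x. indicator A x * of_real (gauss x) \<partial>\<nu>)"
   unfolding integral_Re[OF i, symmetric] by (intro lint_cong) (auto simp: indicator_def)
   finally show ?thesis .
  qed
  show "emeasure (density \<nu>\<^sub>1 (%x. ennreal (gauss x))) A = emeasure (density \<nu>\<^sub>2 (%x. ennreal (gauss x))) A"
   using e[OF s1 gi1] e[OF s2 gi2] indicator_borel[OF A] unfolding Q_def by simp
 qed (simp add: s1 s2)
 have undens: "density (density \<nu> (%x. ennreal (gauss x))) (%x. ennreal (1 / gauss x)) = \<nu>"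
  if \<nu>[measurable_cong]: "sets \<nu> = sets borel" for \<nu> :: "(real ^ 'd) measure"
 proof -
  have "ennreal (gauss x) * ennreal (1 / gauss x) = 1" for x :: "real ^ 'd"
   using gauss_pos[of x] by (subst ennreal_mult[symmetric]) auto
  then show ?thesis by (subst density_density_eq) (auto simp: density_1)
 qed
 show ?thesis by (subst undens[OF s1, symmetric], subst dens, rule undens[OF s2])
qed

section \<open>The Fourier transform of a positive definite measure\<close>

lemma sigma_finite_of_integrable_decay:
 fixes \<kappa> :: "(real ^ 'd::finite) measure"
 assumes \<kappa>: "sets \<kappa> = sets borel" and i: "integrable \<kappa> decay"
 shows "sigma_finite_measure \<kappa>"
proof
 note [measurable_cong] = \<kappa>
 have sp: "space \<kappa> = UNIV" using sets_eq_imp_space_eq[OF \<kappa>] by simp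
 have fin: "(\<integral>\<^sup>+x. ennreal (decay x) \<partial>\<kappa>) < \<infinity>"
  using i by (simp add: integrable_iff_bounded)
 have "emeasure \<kappa> (cball 0 (real n)) \<noteq> \<infinity>" for n
 proof -
  let ?c = "(1 + real n) ^ (2 * CARD('d))"
  have "emeasure \<kappa> (cball 0 (real n)) = (\<integral>\<^sup>+x. indicator (cball 0 (real n)) x \<partial>\<kappa>)"
   by (simp add: \<kappa>)
  also have "\<dots> <= (\<integral>\<^sup>+x. ennreal ?c * ennreal (decay x) \<partial>\<kappa>)"
  proof (intro nn_integral_mono)
   fix x :: "real ^ 'd"
   have "1 <= ?c * decay x" if "norm x <= real n"
   unfolding decay_def using that by (simp add: pos_le_divide_eq add_pos_nonneg power_mono)
   then show "indicator (cball 0 (real n)) x <= ennreal ?c * ennreal (decay x)"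
   by (auto simp: indicator_def ennreal_mult[symmetric])
  qed
  also have "\<dots> = ennreal ?c * (\<integral>\<^sup>+x. ennreal (decay x) \<partial>\<kappa>)" by (rule nn_integral_cmult) measurable
  also have "\<dots> < \<infinity>" using fin by (simp add: ennreal_mult_less_top)
  finally show ?thesis by simp
 qed
 moreover have "(\<Union>n. cball 0 (real n)) = (UNIV :: (real ^ 'd) set)"
  using real_arch_simple by (auto simp: dist_norm)
 ultimately show "\<exists>A. countable A \<and> A \<subseteq> sets \<kappa> \<and> \<Union> A = space \<kappa> \<and> (\<forall>a\<in>A. emeasure \<kappa> a \<noteq> \<infinity>)"
  by (intro exI[of _ "range (%n. cball 0 (real n))"]) (auto simp: \<kappa> sp)
qed

text \<open>The setting of the Bochner argument. The functional is a difference of two positive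
  measures that integrate \<open>decay\<close>, since a signed measure of infinite total variation
  has no integral of its own here. Positivity is required on autocorrelations only.\<close>

locale positive_definite_difference =
 fixes \<kappa>\<^sub>1 \<kappa>\<^sub>2 :: "(real ^ 'd::finite) measure" and \<gamma> :: "(real ^ 'd => complex) => complex"
 assumes sets_\<kappa>\<^sub>1[measurable_cong]: "sets \<kappa>\<^sub>1 = sets borel" and sets_\<kappa>\<^sub>2[measurable_cong]: "sets \<kappa>\<^sub>2 = sets borel"
  and decay_\<kappa>\<^sub>1: "integrable \<kappa>\<^sub>1 decay" and decay_\<kappa>\<^sub>2: "integrable \<kappa>\<^sub>2 decay"
  and difference: "\<psi> \<in> borel_measurable borel ==> (\<And>x. norm (\<psi> x) <= C * decay x) ==>
   \<gamma> \<psi> = integral\<^sup>L \<kappa>\<^sub>1 \<psi> - integral\<^sup>L \<kappa>\<^sub>2 \<psi>"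
  and positive: "f \<in> borel_measurable borel ==> (\<And>x. norm (f x) <= C * (decay x)\<^sup>2) ==>
   \<exists>r\<ge>0. \<gamma> (autocorrelation f) = of_real r"
begin

sublocale \<kappa>\<^sub>1: sigma_finite_measure \<kappa>\<^sub>1 by (rule sigma_finite_of_integrable_decay[OF sets_\<kappa>\<^sub>1 decay_\<kappa>\<^sub>1])
sublocale \<kappa>\<^sub>2: sigma_finite_measure \<kappa>\<^sub>2 by (rule sigma_finite_of_integrable_decay[OF sets_\<kappa>\<^sub>2 decay_\<kappa>\<^sub>2])

lemma integrable_\<kappa>:
 fixes \<psi> :: "real ^ 'd => complex"
 assumes m: "\<psi> \<in> borel_measurable borel" and b: "\<And>x. norm (\<psi> x) <= C * decay x"
 shows "integrable \<kappa>\<^sub>1 \<psi>" "integrable \<kappa>\<^sub>2 \<psi>"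
proof -
 have "integrable \<kappa> \<psi>" if "sets \<kappa> = sets borel" "integrable \<kappa> decay" for \<kappa>
 proof (rule integrable_bound_AE[of _ "%x. C * decay x"])
  show "\<psi> \<in> borel_measurable \<kappa>" using m by (simp add: measurable_cong_sets[OF that(1) refl])
  show "AE x in \<kappa>. norm (\<psi> x) <= norm (C * decay x)"
   using b by (intro AE_I2) (metis abs_ge_self order_trans real_norm_def)
 qed (use that(2) in auto)
 then show "integrable \<kappa>\<^sub>1 \<psi>" "integrable \<kappa>\<^sub>2 \<psi>"
  using sets_\<kappa>\<^sub>1 sets_\<kappa>\<^sub>2 decay_\<kappa>\<^sub>1 decay_\<kappa>\<^sub>2 by auto
qed

definition total_decay :: real where
 "total_decay = integral\<^sup>L \<kappa>\<^sub>1 decay + integral\<^sup>L \<kappa>\<^sub>2 decay"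

lemma norm_\<gamma>_le:
 assumes m: "\<psi> \<in> borel_measurable borel" and b: "\<And>x. norm (\<psi> x) <= C * decay x"
 shows "norm (\<gamma> \<psi>) <= C * total_decay"
proof -
 note i = integrable_\<kappa>[OF assms]
 have "norm (\<gamma> \<psi>) <= norm (integral\<^sup>L \<kappa>\<^sub>1 \<psi>) + norm (integral\<^sup>L \<kappa>\<^sub>2 \<psi>)"
  unfolding difference[OF assms] by (rule norm_triangle_ineq4)
 also have "\<dots> <= (\<integral>x. norm (\<psi> x) \<partial>\<kappa>\<^sub>1) + (\<integral>x. norm (\<psi> x) \<partial>\<kappa>\<^sub>2)"
  by (intro add_mono integral_norm_bound)
 also have "\<dots> <= (\<integral>x. C * decay x \<partial>\<kappa>\<^sub>1) + (\<integral>x. C * decay x \<partial>\<kappa>\<^sub>2)"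
  by (intro add_mono integral_mono integrable_norm i integrable_mult_right decay_\<kappa>\<^sub>1 decay_\<kappa>\<^sub>2 b)
 finally show ?thesis unfolding total_decay_def by (simp add: distrib_left)
qed

lemma \<gamma>_scale:
 assumes m: "\<psi> \<in> borel_measurable borel" and b: "\<And>x. norm (\<psi> x) <= C * decay x"
 shows "\<gamma> (%x. c * \<psi> x) = c * \<gamma> \<psi>"
proof -
 have "norm (c * \<psi> x) <= (norm c * C) * decay x" for x
  using mult_left_mono[OF b[of x] norm_ge_zero[of c]] by (simp add: norm_mult mult.assoc)
 then have "\<gamma> (%x. c * \<psi> x) = integral\<^sup>L \<kappa>\<^sub>1 (%x. c * \<psi> x) - integral\<^sup>L \<kappa>\<^sub>2 (%x. c * \<psi> x)"
  using m by (intro difference[of _ "norm c * C"]) auto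
 then show ?thesis unfolding difference[OF assms] by (simp add: right_diff_distrib)
qed

lemma \<gamma>_tendsto:
 assumes m: "\<And>n. \<psi> n \<in> borel_measurable borel" and b: "\<And>n x. norm (\<psi> n x) <= C * decay x"
  and l: "\<And>x. (%n. \<psi> n x) \<longlonglongrightarrow> \<phi> x"
 shows "(%n. \<gamma> (\<psi> n)) \<longlonglongrightarrow> \<gamma> \<phi>"
proof -
 have m'[measurable]: "\<phi> \<in> borel_measurable borel" by (rule borel_measurable_LIMSEQ_metric[OF m l])
 note [measurable] = m
 have b': "norm (\<phi> x) <= C * decay x" for x
  by (rule LIMSEQ_le_const2[OF tendsto_norm[OF l]]) (use b in auto)
 have conv: "(%n. integral\<^sup>L \<kappa> (\<psi> n)) \<longlonglongrightarrow> integral\<^sup>L \<kappa> \<phi>"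
  if \<kappa>[measurable_cong]: "sets \<kappa> = sets borel" and "integrable \<kappa> decay" for \<kappa>
  by (rule integral_dominated_convergence[where w="%x. C * decay x"]) (use that(2) l b in auto)
 show ?thesis
  unfolding difference[OF m b] difference[OF m' b']
  by (intro tendsto_diff conv sets_\<kappa>\<^sub>1 sets_\<kappa>\<^sub>2 decay_\<kappa>\<^sub>1 decay_\<kappa>\<^sub>2)
qed

text \<open>Fubini moves the integral over the frequency \<open>k\<close> inside the functional,
  where it assembles the characters into \<open>fourier F\<close>.\<close>

lemma \<gamma>_pairing:
 fixes F H :: "real ^ 'd => complex"
 assumes F: "integrable lborel F" and H[measurable]: "H \<in> borel_measurable borel" and b: "\<And>x. norm (H x) <= C * decay x"
 shows "(%k. \<gamma> (%x. cis (- 2 * pi * (x \<bullet> k)) * H x)) \<in> borel_measurable borel"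
  and "integrable lborel (%k. F k * \<gamma> (%x. cis (- 2 * pi * (x \<bullet> k)) * H x))"
  and "(\<integral>k. F k * \<gamma> (%x. cis (- 2 * pi * (x \<bullet> k)) * H x) \<partial>lborel) = \<gamma> (%x. fourier F x * H x)"
proof -
 have [measurable]: "F \<in> borel_measurable borel" using F by auto
 have b1: "norm (cis (- 2 * pi * (x \<bullet> k)) * H x) <= C * decay x" for x k using b by (simp add: norm_mult)
 have \<gamma>eq: "\<gamma> (%x. cis (- 2 * pi * (x \<bullet> k)) * H x) = (\<integral>x. cis (- 2 * pi * (x \<bullet> k)) * H x \<partial>\<kappa>\<^sub>1) - (\<integral>x. cis (- 2 * pi * (x \<bullet> k)) * H x \<partial>\<kappa>\<^sub>2)" for k
  by (rule difference[OF _ b1]) measurable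
 show m: "(%k. \<gamma> (%x. cis (- 2 * pi * (x \<bullet> k)) * H x)) \<in> borel_measurable borel"
  unfolding \<gamma>eq by measurable
 have [measurable]: "fourier F \<in> borel_measurable borel" by (rule borel_measurable_fourier) measurable
 have main: "integrable lborel (%k. F k * (\<integral>x. cis (- 2 * pi * (x \<bullet> k)) * H x \<partial>\<kappa>))"
  "(\<integral>k. F k * (\<integral>x. cis (- 2 * pi * (x \<bullet> k)) * H x \<partial>\<kappa>) \<partial>lborel) = (\<integral>x. fourier F x * H x \<partial>\<kappa>)"
  if \<kappa>[measurable_cong]: "sets \<kappa> = sets borel" and i: "integrable \<kappa> decay" for \<kappa>
 proof -
  define G where "G k x = F k * (cis (- 2 * pi * (x \<bullet> k)) * H x)" for k x
  have Gm: "case_prod G \<in> borel_measurable (lborel \<Otimes>\<^sub>M \<kappa>)" unfolding G_def by measurable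
  have Gb: "norm (G k x) <= norm (F k) * (C * decay x)" for k x
   unfolding G_def norm_mult[of "F k"] by (intro mult_left_mono b1) simp
  have ci: "integrable \<kappa> (%x. C * decay x)" using i by simp
  note F2 = Fubini_dominated[OF sigma_finite_lborel sigma_finite_of_integrable_decay[OF \<kappa> i] Gm integrable_norm[OF F] ci Gb]
  have 1: "(\<integral>x. G k x \<partial>\<kappa>) = F k * (\<integral>x. cis (- 2 * pi * (x \<bullet> k)) * H x \<partial>\<kappa>)" for k
   unfolding G_def by (rule integral_mult_right_zero)
  have 2: "(\<integral>k. G k x \<partial>lborel) = fourier F x * H x" for x
  proof -
   have "(\<integral>k. G k x \<partial>lborel) = (\<integral>k. (cis (- 2 * pi * (k \<bullet> x)) * F k) * H x \<partial>lborel)"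
   unfolding G_def by (simp add: inner_commute mult.assoc mult.left_commute mult.commute)
   then show ?thesis unfolding fourier_def by (simp only: integral_mult_left_zero)
  qed
  show "integrable lborel (%k. F k * (\<integral>x. cis (- 2 * pi * (x \<bullet> k)) * H x \<partial>\<kappa>))" using F2(3) unfolding 1 .
  show "(\<integral>k. F k * (\<integral>x. cis (- 2 * pi * (x \<bullet> k)) * H x \<partial>\<kappa>) \<partial>lborel) = (\<integral>x. fourier F x * H x \<partial>\<kappa>)"
   using F2(2) unfolding 1 2 by simp
 qed
 note m1 = main[OF sets_\<kappa>\<^sub>1 decay_\<kappa>\<^sub>1] and m2 = main[OF sets_\<kappa>\<^sub>2 decay_\<kappa>\<^sub>2]
 show "integrable lborel (%k. F k * \<gamma> (%x. cis (- 2 * pi * (x \<bullet> k)) * H x))"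
  unfolding \<gamma>eq right_diff_distrib by (rule Bochner_Integration.integrable_diff[OF m1(1) m2(1)])
 have "norm (fourier F x * H x) <= ((\<integral>x. norm (F x) \<partial>lborel) * C) * decay x" for x
  unfolding norm_mult mult.assoc by (intro mult_mono norm_fourier_le b) auto
 then have "\<gamma> (%x. fourier F x * H x) = (\<integral>x. fourier F x * H x \<partial>\<kappa>\<^sub>1) - (\<integral>x. fourier F x * H x \<partial>\<kappa>\<^sub>2)"
  by (intro difference) auto
 then show "(\<integral>k. F k * \<gamma> (%x. cis (- 2 * pi * (x \<bullet> k)) * H x) \<partial>lborel) = \<gamma> (%x. fourier F x * H x)"
  unfolding \<gamma>eq right_diff_distrib lint_diff[OF m1(1) m2(1)] m1(2) m2(2) by simp
qed

section \<open>Gaussian regularisation of the functional\<close>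

definition mollifier :: "nat => real ^ 'd => real" where
 "mollifier n x = gauss ((1 / real (Suc n)) *\<^sub>R x)"

lemma borel_measurable_mollifier[measurable]: "mollifier n \<in> borel_measurable borel"
 unfolding mollifier_def[abs_def] by measurable

lemma mollifier_bounds: "0 <= mollifier n x" "mollifier n x <= 1"
 unfolding mollifier_def by (auto intro: gauss_le_1)

lemma mollifier_tendsto: "(%n. mollifier n x) \<longlonglongrightarrow> 1"
proof -
 have "(%n. 1 / real (Suc n)) \<longlonglongrightarrow> 0" using LIMSEQ_Suc[OF lim_1_over_n] by simp
 then have "(%n. (1 / real (Suc n)) *\<^sub>R x) \<longlonglongrightarrow> 0 *\<^sub>R x" by (intro tendsto_intros)
 moreover have "isCont gauss (0 *\<^sub>R x)"
  using continuous_gauss[of "UNIV :: (real ^ 'd) set"] by (simp add: continuous_on_eq_continuous_at)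
 ultimately have "(%n. gauss ((1 / real (Suc n)) *\<^sub>R x)) \<longlonglongrightarrow> gauss (0 *\<^sub>R x)"
  by (rule isCont_tendsto_compose[rotated])
 then show ?thesis unfolding mollifier_def by simp
qed

lemma mollifier_bound: "\<exists>C>0. \<forall>x. mollifier n x <= C * decay x ^ k"
 unfolding mollifier_def by (rule gauss_scale_le_decay_power) simp

text \<open>The Fourier transform of the functional after damping by \<open>mollifier n\<close>,
  which makes it a function. Taking \<open>Re\<close> only fixes the type: the value is real by
  positivity.\<close>

definition spectral_density :: "nat => real ^ 'd => real" where
 "spectral_density n k = Re (\<gamma> (%x. cis (- 2 * pi * (x \<bullet> k)) * of_real (mollifier n x)))"

text \<open>The damped character is a positive multiple of the autocorrelation of a modulated
  Gaussian, on which the functional is real and nonnegative.\<close>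

lemma spectral_density:
 shows "0 <= spectral_density n k"
  and "\<gamma> (%x. cis (- 2 * pi * (x \<bullet> k)) * of_real (mollifier n x)) = of_real (spectral_density n k)"
proof -
 define \<epsilon> where "\<epsilon> = 1 / real (Suc n)"
 have \<epsilon>: "\<epsilon> > 0" unfolding \<epsilon>_def by simp
 let ?f = "%t. of_real (gauss ((sqrt 2 * \<epsilon>) *\<^sub>R t)) * cis (2 * pi * (k \<bullet> t))"
 let ?\<psi> = "%x. cis (- 2 * pi * (x \<bullet> k)) * of_real (mollifier n x)"
 obtain c where c: "c > 0" and ac: "\<And>y. autocorrelation ?f y = of_real c * ?\<psi> y"
  using gauss_autocorrelation[OF \<epsilon>, where 'd='d] unfolding mollifier_def \<epsilon>_def by blast
 obtain C where C: "\<And>t :: real ^ 'd. gauss ((sqrt 2 * \<epsilon>) *\<^sub>R t) <= C * decay t ^ 2"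
  using gauss_scale_le_decay_power[of "sqrt 2 * \<epsilon>" 2] \<epsilon> by auto
 obtain C' where C': "\<And>x. mollifier n x <= C' * decay x ^ 1" using mollifier_bound[of n 1] by blast
 have "\<exists>r\<ge>0. \<gamma> (autocorrelation ?f) = of_real r"
  by (rule positive[of _ C]) (use C in \<open>auto simp: norm_mult\<close>)
 then obtain r where r: "r \<ge> 0" "\<gamma> (autocorrelation ?f) = of_real r" by blast
 have "autocorrelation ?f = (%y. of_real c * ?\<psi> y)" using ac by (intro ext)
 moreover have "\<gamma> (%y. of_real c * ?\<psi> y) = of_real c * \<gamma> ?\<psi>"
  by (rule \<gamma>_scale[of _ C']) (use C' mollifier_bounds in \<open>auto simp: norm_mult\<close>)
 ultimately have "of_real c * \<gamma> ?\<psi> = of_real r" using r(2) by simp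
 then have e: "\<gamma> ?\<psi> = of_real (r / c)" using c by (simp add: field_simps)
 show "0 <= spectral_density n k" "\<gamma> ?\<psi> = of_real (spectral_density n k)"
  unfolding spectral_density_def e using r(1) c by auto
qed

lemma spectral_density_pairing:
 assumes F: "integrable lborel F"
 shows "spectral_density n \<in> borel_measurable borel"
  and "integrable lborel (%k. F k * of_real (spectral_density n k))"
  and "(\<integral>k. F k * of_real (spectral_density n k) \<partial>lborel) = \<gamma> (%x. fourier F x * of_real (mollifier n x))"
proof -
 obtain C where C: "\<And>x. mollifier n x <= C * decay x ^ 1" using mollifier_bound[of n 1] by blast
 then have b: "norm (complex_of_real (mollifier n x)) <= C * decay x" for x
  using mollifier_bounds[of n x] by simp
 have m: "(%x. complex_of_real (mollifier n x)) \<in> borel_measurable borel" by measurable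
 note p = \<gamma>_pairing[OF F m b, unfolded spectral_density(2)]
 have "(%k. Re (complex_of_real (spectral_density n k))) \<in> borel_measurable borel"
  using p(1) by (rule borel_measurable_Re[THEN measurable_compose[rotated], simplified comp_def])
 then show "spectral_density n \<in> borel_measurable borel" by simp
 show "integrable lborel (%k. F k * of_real (spectral_density n k))"
  "(\<integral>k. F k * of_real (spectral_density n k) \<partial>lborel) = \<gamma> (%x. fourier F x * of_real (mollifier n x))"
  by (fact p)+
qed

text \<open>The mollifiers increase the support of the test to everything: they are bounded by 1 and
  tend to 1, so dominated convergence for the functional removes them.\<close>

lemma spectral_density_tendsto:
 assumes F: "integrable lborel F" and b: "\<And>x. norm (fourier F x) <= C * decay x"
 shows "(%n. \<integral>k. F k * of_real (spectral_density n k) \<partial>lborel) \<longlonglongrightarrow> \<gamma> (fourier F)"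
 unfolding spectral_density_pairing(3)[OF F]
proof (rule \<gamma>_tendsto[where C=C])
 have [measurable]: "F \<in> borel_measurable borel" using F by auto
 have [measurable]: "fourier F \<in> borel_measurable borel" by (rule borel_measurable_fourier) measurable
 show "(%x. fourier F x * complex_of_real (mollifier n x)) \<in> borel_measurable borel" for n by measurable
 show "norm (fourier F x * complex_of_real (mollifier n x)) <= C * decay x" for n x
 proof -
  have "norm (fourier F x * complex_of_real (mollifier n x)) <= norm (fourier F x)"
   using mollifier_bounds[of n x] by (simp add: norm_mult mult_left_le)
  then show ?thesis using b[of x] by linarith
 qed
 show "(%n. fourier F x * complex_of_real (mollifier n x)) \<longlonglongrightarrow> fourier F x" for x
  using tendsto_mult[OF tendsto_const tendsto_of_real[OF mollifier_tendsto], of "fourier F x" x] by simp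
qed

text \<open>The convolution of the Gaussian with \<open>decay\<close> dominates \<open>decay\<close>, while its Fourier transform decays like a Gaussian.\<close>

lemma decay_dominated:
 "\<exists>F c C. c > 0 \<and> integrable lborel F \<and> (\<forall>k :: real ^ 'd. decay k <= c * F k) \<and>
   (\<forall>y. norm (fourier (%k. complex_of_real (F k)) y) <= C * decay y)"
proof -
 define F :: "real ^ 'd => real" where "F k = (\<integral>s. gauss s * decay (k - s) \<partial>lborel)" for k
 define c where "c = (\<integral>s. gauss s * decay s \<partial>(lborel :: (real ^ 'd) measure))"
 have gd: "integrable lborel (%s :: real ^ 'd. gauss s * decay (k - s))" for k
 proof (rule integrable_bound_AE[OF integrable_gauss])
  show "AE s in lborel. norm (gauss s * decay (k - s)) <= norm (gauss s)"
   by (intro AE_I2) (simp add: mult_left_le decay_le_1)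
 qed measurable
 have gd0: "integrable lborel (%s :: real ^ 'd. gauss s * decay s)" using gd[of 0] by simp
 \<comment> \<open>The integral of a strictly positive function cannot vanish, because Lebesgue
   measure is not the null measure.\<close>
 have "c > 0"
 proof -
  have "c \<noteq> 0"
  proof
   assume "c = 0"
   then have "AE s in (lborel :: (real ^ 'd) measure). gauss s * decay s = 0"
   unfolding c_def by (subst (asm) integral_nonneg_eq_0_iff_AE[OF gd0]) auto
   then have "AE s in (lborel :: (real ^ 'd) measure). False"
   by (rule AE_mp) (auto intro!: AE_I2 simp: less_imp_neq[OF gauss_pos, symmetric] less_imp_neq[OF decay_pos, symmetric])
   then obtain N :: "(real ^ 'd) set" where "N \<in> null_sets lborel" "UNIV \<subseteq> N"
   by (auto simp: eventually_ae_filter)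
   then have "emeasure lborel (UNIV :: (real ^ 'd) set) = 0" by (auto simp: top_unique dest: null_setsD1)
   then show False by simp
  qed
  moreover have "c \<ge> 0" unfolding c_def by (intro integral_nonneg_AE) auto
  ultimately show ?thesis by simp
 qed
 have le: "c * decay k <= F k" for k
 proof -
  have "c * decay k = (\<integral>s. gauss s * decay s * decay k \<partial>(lborel :: (real ^ 'd) measure))" unfolding c_def by simp
  also have "\<dots> <= (\<integral>s. gauss s * decay (k - s) \<partial>lborel)"
  proof (intro integral_mono gd integrable_mult_left gd0)
   fix s :: "real ^ 'd"
   \<comment> \<open>Submultiplicativity separates the variables, so that the convolution is at
     least \<open>c * decay k\<close>.\<close>
   have "decay s * decay k <= decay (k - s)"
   using decay_submult[of "- s" k] by simp
   then show "gauss s * decay s * decay k <= gauss s * decay (k - s)"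
   by (simp add: mult.assoc mult_left_mono)
  qed
  finally show ?thesis unfolding F_def .
 qed
 let ?G = "%(s :: real ^ 'd) (k :: real ^ 'd). complex_of_real (gauss (k - s) * decay s)"
 have Feq: "F k = (\<integral>s. gauss (k - s) * decay s \<partial>lborel)" for k
  unfolding F_def using lborel_integral_reflect[of "%s. gauss (k - s) * decay s" k] by simp
 have shift: "integrable lborel (%k. gauss (k - s))" "(\<integral>k. gauss (k - s) \<partial>lborel) = 1" for s :: "real ^ 'd"
  using lborel_integrable_affine[OF integrable_gauss, of 1 "- s"] lborel_integral_shift[of gauss "- s"]
  by (simp_all add: integral_gauss)
 have pi: "integrable (lborel \<Otimes>\<^sub>M lborel) (%(s, k). gauss (k - s :: real ^ 'd) * decay s)"
 proof (rule lborel_pair.Fubini_integrable)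
  show "integrable lborel (%s :: real ^ 'd. \<integral>k. norm (case (s, k) of (s, k) => gauss (k - s) * decay s) \<partial>lborel)"
   using shift integrable_decay by simp
  show "AE s in lborel. integrable lborel (%k :: real ^ 'd. case (s, k) of (s, k) => gauss (k - s) * decay s)"
   using shift by simp
 qed measurable
 have Fi: "integrable lborel F" unfolding Feq using lborel_pair.integrable_snd[OF pi] by simp
 have ft: "fourier (%k. complex_of_real (F k)) y = of_real (gauss y) * fourier (%s. of_real (decay s)) y" for y
 proof -
  have pi': "integrable (lborel \<Otimes>\<^sub>M lborel) (%(s, k). cis (- 2 * pi * (k \<bullet> y)) * ?G s k)"
   by (rule integrable_bound_AE[OF pi]) (auto simp: norm_mult)
  have "fourier (%k. complex_of_real (F k)) y = (\<integral>k. (\<integral>s. cis (- 2 * pi * (k \<bullet> y)) * ?G s k \<partial>lborel) \<partial>lborel)"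
   unfolding fourier_def Feq by (simp only: integral_mult_right_zero integral_complex_of_real)
  also have "\<dots> = (\<integral>s. (\<integral>k. cis (- 2 * pi * (k \<bullet> y)) * ?G s k \<partial>lborel) \<partial>lborel)"
   by (rule lborel_pair.Fubini_integral[OF pi'])
  also have "\<dots> = (\<integral>s. of_real (gauss y) * (cis (- 2 * pi * (s \<bullet> y)) * of_real (decay s)) \<partial>lborel)"
  proof (intro lint_cong refl)
   fix s :: "real ^ 'd"
   have "(\<integral>k. cis (- 2 * pi * (k \<bullet> y)) * ?G s k \<partial>lborel) = (\<integral>k. cis (- 2 * pi * ((s + k) \<bullet> y)) * ?G s (s + k) \<partial>lborel)"
   by (rule lborel_integral_shift[symmetric]) measurable
   also have "\<dots> = (\<integral>k. (cis (- 2 * pi * (s \<bullet> y)) * of_real (decay s)) * (cis (- 2 * pi * (k \<bullet> y)) * of_real (gauss k)) \<partial>lborel)"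
   proof (intro lint_cong refl)
   fix k
   have "cis (- 2 * pi * ((s + k) \<bullet> y)) = cis (- 2 * pi * (s \<bullet> y)) * cis (- 2 * pi * (k \<bullet> y))"
   by (simp add: cis_mult inner_add_left algebra_simps)
   then show "cis (- 2 * pi * ((s + k) \<bullet> y)) * ?G s (s + k) = (cis (- 2 * pi * (s \<bullet> y)) * of_real (decay s)) * (cis (- 2 * pi * (k \<bullet> y)) * of_real (gauss k))"
   by (simp only: of_real_mult add_diff_cancel_left' mult.assoc mult.commute mult.left_commute)
   qed
   also have "\<dots> = (cis (- 2 * pi * (s \<bullet> y)) * of_real (decay s)) * of_real (gauss y)"
   by (simp only: integral_mult_right_zero gauss_fourier)
   finally show "(\<integral>k. cis (- 2 * pi * (k \<bullet> y)) * ?G s k \<partial>lborel) = of_real (gauss y) * (cis (- 2 * pi * (s \<bullet> y)) * of_real (decay s))"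
   by (simp only: mult.commute)
  qed
  finally show ?thesis unfolding fourier_def by (simp only: integral_mult_right_zero)
 qed
 obtain K where K: "K > 0" "\<And>x :: real ^ 'd. gauss x <= K * decay x ^ 1" using gauss_le_decay_power[of 1] by blast
 let ?I = "\<integral>x. decay x \<partial>(lborel :: (real ^ 'd) measure)"
 have "norm (fourier (%k. complex_of_real (F k)) y) <= (K * ?I) * decay y" for y
 proof -
  have "norm (fourier (%k. complex_of_real (F k)) y) = gauss y * norm (fourier (%s. complex_of_real (decay s)) y)"
   unfolding ft by (simp add: norm_mult)
  also have "\<dots> <= (K * decay y) * ?I"
   using norm_fourier_le[of "%s. complex_of_real (decay s)" y] K(1) K(2)[of y] by (intro mult_mono) auto
  finally show ?thesis by (simp add: mult.commute mult.left_commute)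
 qed
 moreover have "decay k <= (1 / c) * F k" for k using le[of k] \<open>c > 0\<close> by (simp add: field_simps)
 ultimately show ?thesis using Fi \<open>c > 0\<close> by (intro exI[of _ F] exI[of _ "1 / c"] exI[of _ "K * ?I"]) auto
qed

text \<open>A bound uniform in \<open>n\<close> comes from testing against an \<open>F\<close> above
  \<open>decay\<close> whose transform is again dominated by \<open>decay\<close>: pairing gives the
  functional of \<open>fourier F\<close> times the mollifier, and the mollifier is at most 1. The
  nonnegativity of the densities allows passing from \<open>F\<close> to
  \<open>decay\<close>.\<close>

lemma spectral_density_bounded:
 "\<exists>K. \<forall>n. integrable lborel (%k. decay k * spectral_density n k) \<and> (\<integral>k. decay k * spectral_density n k \<partial>lborel) <= K"
proof -
 obtain F c C where c: "c > 0" and F: "integrable lborel F" and le: "\<And>k :: real ^ 'd. decay k <= c * F k"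
  and b: "\<And>y. norm (fourier (%k. complex_of_real (F k)) y) <= C * decay y"
  using decay_dominated by metis
 have Fc: "integrable lborel (%k. complex_of_real (F k))" using F by (rule integrable_of_real)
 have [measurable]: "F \<in> borel_measurable borel" using F by auto
 have [measurable]: "spectral_density n \<in> borel_measurable borel" for n by (rule spectral_density_pairing(1)[OF Fc])
 have [measurable]: "fourier (%k. complex_of_real (F k)) \<in> borel_measurable borel" by (rule borel_measurable_fourier) measurable
 have "integrable lborel (%k. decay k * spectral_density n k) \<and> (\<integral>k. decay k * spectral_density n k \<partial>lborel) <= c * (C * total_decay)" for n
 proof
  have i: "integrable lborel (%k. F k * spectral_density n k)"
   using integrable_Re[OF spectral_density_pairing(2)[OF Fc, of n]] by simp
  have le': "decay k * spectral_density n k <= c * (F k * spectral_density n k)" for k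
   using mult_right_mono[OF le[of k] spectral_density(1)[of n k]] by (simp add: mult.assoc)
  show i': "integrable lborel (%k. decay k * spectral_density n k)"
  proof (rule integrable_bound_AE)
   show "integrable lborel (%k. c * (F k * spectral_density n k))" using i by simp
   show "AE k in lborel. norm (decay k * spectral_density n k) <= norm (c * (F k * spectral_density n k))"
   proof (intro AE_I2)
   fix k
   have "norm (decay k * spectral_density n k) = decay k * spectral_density n k"
   using spectral_density(1)[of n k] by (simp add: abs_mult)
   then show "norm (decay k * spectral_density n k) <= norm (c * (F k * spectral_density n k))"
   using le'[of k] abs_ge_self[of "c * (F k * spectral_density n k)"] unfolding real_norm_def by linarith
   qed
  qed measurable
  have "(\<integral>k. decay k * spectral_density n k \<partial>lborel) <= (\<integral>k. c * (F k * spectral_density n k) \<partial>lborel)"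
   using i i' by (intro integral_mono le') auto
  also have "\<dots> = c * (\<integral>k. F k * spectral_density n k \<partial>lborel)" by simp
  also have "(\<integral>k. F k * spectral_density n k \<partial>lborel) <= C * total_decay"
  proof -
   have "complex_of_real (\<integral>k. F k * spectral_density n k \<partial>lborel) = \<gamma> (%x. fourier (%k. complex_of_real (F k)) x * of_real (mollifier n x))"
   using spectral_density_pairing(3)[OF Fc, of n] by (simp flip: of_real_mult)
   moreover have "norm (\<gamma> (%x. fourier (%k. complex_of_real (F k)) x * of_real (mollifier n x))) <= C * total_decay"
   proof (rule norm_\<gamma>_le)
   fix x
   have "norm (fourier (%k. complex_of_real (F k)) x * of_real (mollifier n x)) <= norm (fourier (%k. complex_of_real (F k)) x)"
   using mollifier_bounds[of n x] by (simp add: norm_mult mult_left_le)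
   then show "norm (fourier (%k. complex_of_real (F k)) x * of_real (mollifier n x)) <= C * decay x" using b[of x] by linarith
   qed measurable
   ultimately have "norm (complex_of_real (\<integral>k. F k * spectral_density n k \<partial>lborel)) <= C * total_decay" by simp
   then show ?thesis by simp
  qed
  finally show "(\<integral>k. decay k * spectral_density n k \<partial>lborel) <= c * (C * total_decay)" using c by simp
 qed
 then show ?thesis by blast
qed

text \<open>The densities times the square of \<open>decay\<close> form a tight family of finite
  measures. A weak limit divided by the square of \<open>decay\<close> is the spectral measure. The
  admissible \<open>F\<close> are therefore those of order at most the square of
  \<open>decay\<close>: after the division they are bounded and continuous.\<close>

theorem spectral_measure_exists:
 "\<exists>\<nu>. sets \<nu> = sets borel \<and> (\<forall>K. compact K --> emeasure \<nu> K < \<infinity>) \<and>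
   (\<forall>F C. continuous_on UNIV F --> (\<forall>x. norm (F x) <= C * (decay x)\<^sup>2) --> (\<forall>y. norm (fourier F y) <= C * decay y) -->
   integrable \<nu> F \<and> integral\<^sup>L \<nu> F = \<gamma> (fourier F))"
proof -
 obtain K where Ki: "\<And>n. integrable lborel (%k. decay k * spectral_density n k)"
  and K: "\<And>n. (\<integral>k. decay k * spectral_density n k \<partial>lborel) <= K" using spectral_density_bounded by blast
 have zi: "integrable lborel (%k :: real ^ 'd. 0 :: complex)" by simp
 have [measurable]: "spectral_density n \<in> borel_measurable borel" for n by (rule spectral_density_pairing(1)[OF zi])
 define q where "q n k = (decay k)\<^sup>2 * spectral_density n k" for n k
 have [measurable]: "q n \<in> borel_measurable borel" for n unfolding q_def[abs_def] by measurable
 have q0: "0 <= q n k" for n k unfolding q_def using spectral_density(1) by simp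
 have qle: "q n k <= decay k * (decay k * spectral_density n k)" for n k
  unfolding q_def by (simp add: power2_eq_square mult.assoc)
 have dp0: "0 <= decay k * spectral_density n k" for n k using spectral_density(1) by simp
 define \<tau> where "\<tau> n = density lborel (%k. ennreal (q n k))" for n
 have s\<tau>: "sets (\<tau> n) = sets borel" for n unfolding \<tau>_def by simp
 \<comment> \<open>One of the two factors \<open>decay\<close> in \<open>q\<close> is bounded by
   \<open>a\<close> on \<open>A\<close>; the other integrates to at most \<open>K\<close>.\<close>
 have tail: "emeasure (\<tau> n) A <= ennreal (a * K)"
  if A: "A \<in> sets borel" and a: "a \<ge> 0" "\<And>k. k \<in> A ==> decay k <= a" for A a n
 proof -
  have "emeasure (\<tau> n) A = (\<integral>\<^sup>+k. ennreal (q n k) * indicator A k \<partial>lborel)"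
   unfolding \<tau>_def by (rule emeasure_density) (use A in auto)
  also have "\<dots> <= (\<integral>\<^sup>+k. ennreal (a * (decay k * spectral_density n k)) \<partial>lborel)"
  proof (intro nn_integral_mono)
   fix k
   have "q n k <= a * (decay k * spectral_density n k)" if "k \<in> A"
   using qle[of n k] mult_right_mono[OF a(2)[OF that] dp0[of k n]] by linarith
   then show "ennreal (q n k) * indicator A k <= ennreal (a * (decay k * spectral_density n k))"
   by (auto simp: indicator_def ennreal_leI)
  qed
  also have "\<dots> = ennreal (\<integral>k. a * (decay k * spectral_density n k) \<partial>lborel)"
   by (rule nn_integral_eq_integral) (use Ki dp0 a(1) in auto)
  also have "\<dots> <= ennreal (a * K)" using K a(1) by (intro ennreal_leI) (simp add: mult_left_mono)
  finally show ?thesis .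
 qed
 have tail1: "emeasure (\<tau> n) UNIV <= ennreal K" for n
  using tail[of UNIV 1 n] by (simp add: decay_le_1)
 have fin: "finite_measure (\<tau> n)" for n
  using tail1[of n] by (intro finite_measureI) (auto simp: \<tau>_def top_unique)
 have K0: "0 <= K" using order_trans[OF integral_nonneg_AE K] dp0 by auto
 have mass: "measure (\<tau> n) UNIV <= K" for n
  using tail1[of n] K0 by (simp add: measure_def enn2real_leI)
 have tight: "\<exists>R. \<forall>n. measure (\<tau> n) {x. norm x \<ge> R} < \<epsilon>" if "\<epsilon> > 0" for \<epsilon>
 proof -
  \<comment> \<open>Outside radius \<open>R\<close> the weight is at most
    \<open>1 / (1 + R)\<close>, so the mass there is at most
    \<open>K / (1 + R) < \<epsilon>\<close>.\<close>
  define R where "R = K / \<epsilon>"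
  have R0: "R \<ge> 0" unfolding R_def using K0 \<open>\<epsilon> > 0\<close> by simp
  have "measure (\<tau> n) {x. norm x \<ge> R} < \<epsilon>" for n
  proof -
   have dR: "decay k <= 1 / (1 + R)" if "norm k \<ge> R" for k :: "real ^ 'd"
   proof -
   have "1 + R <= (1 + norm k) ^ 1" using that by simp
   also have "\<dots> <= (1 + norm k) ^ (2 * CARD('d))" by (rule power_increasing) (auto simp: Suc_leI)
   finally show ?thesis unfolding decay_def using R0 by (intro divide_left_mono) auto
   qed
   have "emeasure (\<tau> n) {x. norm x \<ge> R} <= ennreal (1 / (1 + R) * K)"
   by (rule tail) (use dR R0 in auto)
   then have "measure (\<tau> n) {x. norm x \<ge> R} <= 1 / (1 + R) * K"
   unfolding measure_def using K0 R0 by (intro enn2real_leI) auto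
   also have "\<dots> < \<epsilon>"
   proof -
   have "K = R * \<epsilon>" unfolding R_def using \<open>\<epsilon> > 0\<close> by simp
   then have "K < \<epsilon> * (1 + R)" using \<open>\<epsilon> > 0\<close> by (simp add: algebra_simps)
   then show ?thesis using R0 by (simp add: divide_less_eq)
   qed
   finally show ?thesis .
  qed
  then show ?thesis by blast
 qed
 obtain r \<rho> where r: "strict_mono (r :: nat => nat)" and \<rho>: "sets \<rho> = sets borel" and f\<rho>: "finite_measure \<rho>"
  and conv: "\<And>F :: real ^ 'd => complex. \<And>C. continuous_on UNIV F ==> (\<And>x. norm (F x) <= C) ==>
   (%n. integral\<^sup>L (\<tau> (r n)) F) \<longlonglongrightarrow> integral\<^sup>L \<rho> F"
  using finite_measure_weak_compactness[OF s\<tau> fin mass tight] by blast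
 note [measurable_cong] = \<rho>
 interpret \<rho>: finite_measure \<rho> by (rule f\<rho>)
 define \<nu> where "\<nu> = density \<rho> (%x. ennreal (1 / (decay x)\<^sup>2))"
 have d2: "(decay x)\<^sup>2 > 0" for x :: "real ^ 'd" using decay_pos[of x] by simp
 have "emeasure \<nu> A < \<infinity>" if A: "compact A" for A
 proof -
  have [measurable]: "A \<in> sets borel" using A by (rule borel_compact)
  obtain B where B: "\<And>x. x \<in> A ==> norm x <= B" using compact_imp_bounded[OF A] unfolding bounded_iff by blast
  let ?c = "(1 + \<bar>B\<bar>) ^ (2 * CARD('d))"
  have c: "1 / (decay x)\<^sup>2 <= ?c\<^sup>2" if "x \<in> A" for x
  proof -
   have "norm x <= \<bar>B\<bar>" using B[OF that] by linarith
   then have "(1 + norm x) ^ (2 * CARD('d)) <= ?c" by (intro power_mono) auto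
   then have "((1 + norm x) ^ (2 * CARD('d)))\<^sup>2 <= ?c\<^sup>2" by (intro power_mono) auto
   then show ?thesis unfolding decay_def by (simp add: power_divide)
  qed
  have "emeasure \<nu> A = (\<integral>\<^sup>+x. ennreal (1 / (decay x)\<^sup>2) * indicator A x \<partial>\<rho>)"
   unfolding \<nu>_def by (rule emeasure_density) auto
  also have "\<dots> <= (\<integral>\<^sup>+x. ennreal (?c\<^sup>2) \<partial>\<rho>)"
   by (intro nn_integral_mono) (use c in \<open>auto simp: indicator_def intro!: ennreal_leI\<close>)
  also have "\<dots> < \<infinity>" by (simp add: ennreal_mult_eq_top_iff less_top[symmetric])
  finally show ?thesis .
 qed
 moreover have "integrable \<nu> F \<and> integral\<^sup>L \<nu> F = \<gamma> (fourier F)"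
  if c: "continuous_on UNIV F" and b: "\<And>x. norm (F x) <= C * (decay x)\<^sup>2" and bf: "\<And>y. norm (fourier F y) <= C * decay y"
  for F :: "real ^ 'd => complex" and C
 proof
  have [measurable]: "F \<in> borel_measurable borel" using c by (rule borel_measurable_continuous_onI)
  \<comment> \<open>The quotient is the function actually tested against the weak limit
    \<open>\<rho>\<close>; both the density of \<open>\<nu>\<close> and the weight in
    \<open>q\<close> cancel against it.\<close>
  define F' where "F' x = (1 / (decay x)\<^sup>2) *\<^sub>R F x" for x
  have nz: "decay x \<noteq> 0" for x :: "real ^ 'd" using decay_pos[of x] by simp
  have c': "continuous_on UNIV F'" unfolding F'_def[abs_def]
   by (intro continuous_intros c continuous_decay) (use nz in auto)
  have b': "norm (F' x) <= C" for x
   using b[of x] d2[of x] unfolding F'_def by (simp add: pos_divide_le_eq)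
  have [measurable]: "F' \<in> borel_measurable borel" using c' by (rule borel_measurable_continuous_onI)
  have F'i: "integrable \<rho> F'" by (rule \<rho>.integrable_const_bound[of _ C]) (use b' in auto)
  show "integrable \<nu> F" unfolding \<nu>_def
   by (subst integrable_density) (use F'i in \<open>auto simp: F'_def[abs_def]\<close>)
  have "integral\<^sup>L \<nu> F = integral\<^sup>L \<rho> F'" unfolding \<nu>_def
   by (subst integral_density) (auto simp: F'_def[abs_def])
  have \<tau>F: "integral\<^sup>L (\<tau> n) F' = (\<integral>k. F k * of_real (spectral_density n k) \<partial>lborel)" for n
  proof -
   have "integral\<^sup>L (\<tau> n) F' = (\<integral>k. q n k *\<^sub>R F' k \<partial>lborel)" unfolding \<tau>_def
   by (rule integral_density) (use q0 in auto)
   also have "\<dots> = (\<integral>k. F k * of_real (spectral_density n k) \<partial>lborel)"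
   unfolding q_def F'_def using nz by (intro lint_cong) (auto simp: scaleR_conv_of_real)
   finally show ?thesis .
  qed
  have C: "0 <= C" using order_trans[OF norm_ge_zero b'] .
  have "norm (F x) <= C * decay x" for x
  proof (rule order_trans[OF b mult_left_mono[OF _ C]])
   show "(decay x)\<^sup>2 <= decay x"
   unfolding power2_eq_square by (intro mult_left_le_one_le decay_le_1 decay_nonneg)
  qed
  then have Fi: "integrable lborel F" by (intro integrable_decay_bound[of _ C]) auto
  have "(%n. integral\<^sup>L (\<tau> n) F') \<longlonglongrightarrow> \<gamma> (fourier F)"
   unfolding \<tau>F by (rule spectral_density_tendsto[OF Fi bf])
  from LIMSEQ_subseq_LIMSEQ[OF this r] have "(%n. integral\<^sup>L (\<tau> (r n)) F') \<longlonglongrightarrow> \<gamma> (fourier F)" by (simp add: comp_def)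
  from LIMSEQ_unique[OF this conv[OF c' b']] \<open>integral\<^sup>L \<nu> F = integral\<^sup>L \<rho> F'\<close>
  show "integral\<^sup>L \<nu> F = \<gamma> (fourier F)" by simp
 qed
 moreover have "sets \<nu> = sets borel" unfolding \<nu>_def by (simp add: \<rho>)
 ultimately show ?thesis by blast
qed

end

section \<open>Uniformly discrete configurations as counting measures\<close>

text \<open>Half-open cubes of edge \<open>r / 2\<close>. They partition the space, and each fits
  into a translate of the open cube of edge \<open>r\<close>, so a uniformly discrete configuration
  has at most one point in each.\<close>

definition grid_cell :: "real => ('d => int) => (real ^ 'd::finite) set" where
 "grid_cell r g = {x. \<forall>i. \<lfloor>2 * x $ i / r\<rfloor> = g i}"

lemma grid_cell_iff:
 assumes "r > 0"
 shows "x \<in> grid_cell r g \<longleftrightarrow> (\<forall>i. of_int (g i) * (r / 2) <= x $ i \<and> x $ i < (of_int (g i) + 1) * (r / 2))"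
proof -
 have "\<lfloor>2 * x $ i / r\<rfloor> = g i \<longleftrightarrow> of_int (g i) * (r / 2) <= x $ i \<and> x $ i < (of_int (g i) + 1) * (r / 2)" for i
  unfolding floor_eq_iff using assms by (simp add: pos_le_divide_eq pos_divide_less_eq mult.commute)
 then show ?thesis unfolding grid_cell_def by simp
qed

lemma borel_grid_cell[measurable]: "grid_cell r g \<in> sets (borel :: (real ^ 'd::finite) measure)"
proof -
 have [measurable]: "(%x :: real ^ 'd. x $ i) \<in> borel_measurable borel" for i
  by (intro borel_measurable_continuous_onI continuous_intros)
 have "grid_cell r g = (\<Inter>i. {x :: real ^ 'd. of_int (g i) <= 2 * x $ i / r \<and> 2 * x $ i / r < of_int (g i) + 1})"
  unfolding grid_cell_def floor_eq_iff by auto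
 moreover have "{x :: real ^ 'd. of_int (g i) <= 2 * x $ i / r \<and> 2 * x $ i / r < of_int (g i) + 1} \<in> sets borel" for i
  by measurable
 ultimately show ?thesis by (simp only:) (intro sets.finite_INT, auto)
qed

lemma borel_Times_nat: "A \<in> sets borel ==> A \<times> (J :: nat set) \<in> sets (borel :: ('a::second_countable_topology \<times> nat) measure)"
 by (rule borel_Times) (auto intro: sets.countable)

lemma grid_cell_disjoint: "x \<in> grid_cell r g ==> x \<in> grid_cell r h ==> g = h"
 unfolding grid_cell_def by (auto simp: fun_eq_iff)

lemma grid_cell_cover: "x \<in> grid_cell r (%i. \<lfloor>2 * x $ i / r\<rfloor>)"
 unfolding grid_cell_def by simp

lemma grid_cell_subset_cube:
 fixes g :: "'d::finite => int"
 assumes r: "r > 0"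
 shows "\<exists>a. grid_cell r g \<subseteq> (+) a ` open_cube r"
proof -
 define a :: "real ^ 'd" where "a = (\<chi> i. (of_int (g i) + 1/2) * (r / 2))"
 have "x \<in> (+) a ` open_cube r" if "x \<in> grid_cell r g" for x
 proof (rule image_eqI)
  show "x - a \<in> open_cube r" unfolding open_cube_def
  proof (intro CollectI allI)
   fix i
   have "of_int (g i) * (r / 2) <= x $ i" "x $ i < (of_int (g i) + 1) * (r / 2)"
   using that unfolding grid_cell_iff[OF r] by auto
   moreover have "a $ i = of_int (g i) * (r / 2) + r / 4" by (simp add: a_def algebra_simps)
   ultimately show "\<bar>(x - a) $ i\<bar> < r / 2"
   unfolding vector_minus_component abs_less_iff distrib_right mult_1_left using r by linarith
  qed
 qed simp
 then show ?thesis by blast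
qed

lemma grid_cell_bounded:
 fixes g :: "'d::finite => int"
 assumes r: "r > 0"
 shows "\<exists>R. grid_cell r g \<subseteq> ball 0 R"
proof -
 have "norm x < (\<Sum>i\<in>UNIV. (\<bar>of_int (g i)\<bar> + 1) * (r / 2)) + 1" if x: "x \<in> grid_cell r g" for x
 proof -
  have "norm x <= (\<Sum>i\<in>UNIV. \<bar>x $ i\<bar>)" by (rule norm_le_l1_cart)
  also have "\<dots> <= (\<Sum>i\<in>UNIV. (\<bar>of_int (g i)\<bar> + 1) * (r / 2))"
  proof (intro sum_mono)
   fix i
   have "of_int (g i) * (r / 2) <= x $ i" "x $ i < (of_int (g i) + 1) * (r / 2)"
   using x unfolding grid_cell_iff[OF r] by auto
   moreover have "(- (\<bar>of_int (g i)\<bar> + 1)) * (r / 2) <= of_int (g i) * (r / 2)"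
   "(of_int (g i) + 1) * (r / 2) <= (\<bar>of_int (g i)\<bar> + 1) * (r / 2)"
   using r by (intro mult_right_mono; linarith)+
   ultimately show "\<bar>x $ i\<bar> <= (\<bar>of_int (g i)\<bar> + 1) * (r / 2)" unfolding abs_le_iff minus_mult_left[symmetric] by linarith
  qed
  finally show ?thesis by simp
 qed
 then show ?thesis by (intro exI[of _ "(\<Sum>i\<in>UNIV. (\<bar>of_int (g i)\<bar> + 1) * (r / 2)) + 1"]) (auto simp: dist_norm)
qed

lemma closed_coloured_space: "closed (coloured_space m)"
 unfolding coloured_space_def by (rule closed_Times[OF closed_UNIV finite_imp_closed]) simp

lemma borel_coloured_space[measurable]: "coloured_space m \<in> sets borel"
 by (rule borel_closed[OF closed_coloured_space])

lemma infsum_eq_integral_count_space: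
 fixes f :: "'a => 'b::{banach, second_countable_topology}"
 assumes "integrable (count_space A) f"
 shows "infsum f A = (\<integral>x. f x \<partial>count_space A)"
 using infsetsum_infsum[of f A] assms unfolding abs_summable_on_def infsetsum_def by simp

definition atoms :: "((real ^ 'd::finite) \<times> nat) measure => ((real ^ 'd) \<times> nat) set" where
 "atoms \<xi> = {z \<in> space \<xi>. emeasure \<xi> {z} \<noteq> 0}"

locale point_configuration =
 fixes m :: nat and \<xi> :: "'d::finite config"
 assumes point_measure: "\<xi> \<in> point_measures m"
begin

lemma sets_\<xi>[measurable_cong]: "sets \<xi> = sets (restrict_space borel (coloured_space m))"
 using point_measure unfolding point_measures_def by simp

lemma sets_\<xi>_iff: "A \<in> sets \<xi> \<longleftrightarrow> A \<in> sets borel \<and> A \<subseteq> coloured_space m"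
 unfolding sets_\<xi> by (subst sets_restrict_space_iff) auto

lemma space_\<xi>: "space \<xi> = coloured_space m"
 using sets_eq_imp_space_eq[OF sets_\<xi>] by (simp add: space_restrict_space)

lemma emeasure_natural:
 assumes "A \<in> sets \<xi>" "A \<subseteq> cball 0 R \<times> {1..m}"
 shows "\<exists>n::nat. emeasure \<xi> A = of_nat n"
proof -
 have K: "compact (cball (0 :: real ^ 'd) R \<times> {1..m})"
  by (intro compact_Times compact_cball finite_imp_compact) auto
 have "closure A \<subseteq> cball 0 R \<times> {1..m}"
  using assms(2) compact_imp_closed[OF K] by (rule closure_minimal)
 then have "closure A = (cball 0 R \<times> {1..m}) \<inter> closure A" by blast
 then have "compact (closure A)" using compact_Int_closed[OF K closed_closure, of A] by simp
 then show ?thesis using point_measure assms(1) unfolding point_measures_def by blast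
qed

lemma singleton_sets: "z \<in> coloured_space m ==> {z} \<in> sets \<xi>"
 unfolding sets_\<xi>_iff by auto

end

locale ud_configuration = point_configuration m \<xi>
 for m :: nat and \<xi> :: "'d::finite config" +
 fixes r :: real
 assumes r: "r > 0" and uniformly_discrete: "\<xi> \<in> uniformly_discrete_measures m r"
begin

definition cell :: "('d => int) => ((real ^ 'd) \<times> nat) set" where
 "cell g = grid_cell r g \<times> {1..m}"

lemma cell_sets[measurable]: "cell g \<in> sets \<xi>"
 unfolding sets_\<xi>_iff cell_def coloured_space_def
 by (auto intro!: borel_Times_nat)

text \<open>The mass is a natural number because the cell is bounded, and at most 1 because the cell
  lies in a translated open cube. All colours share the cell, so the bound is for the colours
  together.\<close>

lemma emeasure_cell_01:
 assumes A: "A \<in> sets \<xi>" "A \<subseteq> cell g"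
 shows "emeasure \<xi> A = 0 \<or> emeasure \<xi> A = 1"
proof -
 obtain R where "grid_cell r g \<subseteq> ball 0 R" using grid_cell_bounded[OF r] by blast
 then have "A \<subseteq> cball 0 R \<times> {1..m}" using A(2) ball_subset_cball[of 0 R] unfolding cell_def by blast
 then obtain n :: nat where n: "emeasure \<xi> A = of_nat n" using emeasure_natural[OF A(1)] by blast
 obtain a where a: "grid_cell r g \<subseteq> (+) a ` open_cube r" using grid_cell_subset_cube[OF r] by blast
 have op: "open ((+) a ` open_cube r)"
 proof -
  have "open_cube r = (\<Inter>i. {x :: real ^ 'd. \<bar>x $ i\<bar> < r / 2})" unfolding open_cube_def by auto
  moreover have "open {x :: real ^ 'd. \<bar>x $ i\<bar> < r / 2}" for i
   by (intro open_Collect_less continuous_intros)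
  ultimately have "open (open_cube r :: (real ^ 'd) set)" by (simp only:) (intro open_INT, auto)
  then show ?thesis by (rule open_translation)
 qed
 have "emeasure \<xi> A <= emeasure \<xi> (((+) a ` open_cube r) \<times> {1..m})"
 proof (rule emeasure_mono)
  show "A \<subseteq> ((+) a ` open_cube r) \<times> {1..m}" using A(2) a unfolding cell_def by blast
  show "((+) a ` open_cube r) \<times> {1..m} \<in> sets \<xi>"
   unfolding sets_\<xi>_iff coloured_space_def using op
   by (auto intro!: borel_Times_nat)
 qed
 also have "\<dots> <= 1" using uniformly_discrete unfolding uniformly_discrete_measures_def by blast
 finally have "(of_nat n :: ennreal) <= of_nat 1" using n by simp
 then have "n <= 1" by (simp only: of_nat_le_iff)
 then show ?thesis using n by (cases n) auto
qed

lemma atoms_subset: "atoms \<xi> \<subseteq> coloured_space m"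
 unfolding atoms_def space_\<xi> by auto

lemma in_some_cell: "z \<in> coloured_space m ==> \<exists>g. z \<in> cell g"
 unfolding cell_def coloured_space_def using grid_cell_cover by (cases z) blast

lemma emeasure_atom: "z \<in> atoms \<xi> ==> emeasure \<xi> {z} = 1"
proof -
 assume z: "z \<in> atoms \<xi>"
 then obtain g where "z \<in> cell g" using in_some_cell atoms_subset by blast
 then show ?thesis using emeasure_cell_01[OF singleton_sets, of z g] z atoms_subset unfolding atoms_def by auto
qed

lemma atom_unique:
 assumes "z \<in> atoms \<xi>" "z' \<in> atoms \<xi>" "z \<in> cell g" "z' \<in> cell g"
 shows "z = z'"
proof (rule ccontr)
 assume ne: "z \<noteq> z'"
 have s: "{z} \<in> sets \<xi>" "{z'} \<in> sets \<xi>" using assms(1,2) atoms_subset by (blast intro: singleton_sets)+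
 have "emeasure \<xi> {z, z'} = emeasure \<xi> {z} + emeasure \<xi> {z'}"
  using plus_emeasure[OF s] ne by (simp add: insert_commute)
 then have "emeasure \<xi> {z, z'} = 2" using assms emeasure_atom by (simp add: one_add_one)
 moreover have "emeasure \<xi> {z, z'} = 0 \<or> emeasure \<xi> {z, z'} = 1"
  using sets.Un[OF s] assms by (intro emeasure_cell_01[of _ g]) (auto simp: insert_commute)
 ultimately show False by auto
qed

text \<open>A configuration restricted to a cell of mass 1 has mass 0 or 1 on every Borel set, so it is
 concentrated on a decreasing intersection of smaller and smaller cells, that is, in a point.\<close>

lemma atom_in_cell:
 assumes K: "emeasure \<xi> (cell g) = 1"
 shows "\<exists>z\<in>cell g. z \<in> atoms \<xi>"
proof -
 \<comment> \<open>Pieces of one colour and edge \<open>1 / real (Suc n)\<close>, since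
   \<open>grid_cell\<close> halves its parameter.\<close>
 define Q where "Q n = (%(h, j). cell g \<inter> (grid_cell (2 / real (Suc n)) h \<times> {j}))" for n :: nat
 have Qs[measurable]: "Q n p \<in> sets \<xi>" for n p
 proof -
  have "Q n p \<in> sets borel" using cell_sets[of g] unfolding sets_\<xi>_iff Q_def
   by (auto split: prod.splits intro!: sets.Int borel_Times_nat)
  then show ?thesis using cell_sets[of g] unfolding sets_\<xi>_iff Q_def by (auto split: prod.splits)
 qed
 have Qsub: "Q n p \<subseteq> cell g" for n p unfolding Q_def by (auto split: prod.splits)
 \<comment> \<open>Countably many pieces cover the cell, so they cannot all be null, and a piece
   that is not null has mass 1.\<close>
 have ex: "\<exists>p. emeasure \<xi> (Q n p) = 1" for n
 proof (rule ccontr)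
  assume "\<not> ?thesis"
  then have z: "emeasure \<xi> (Q n p) = 0" for p
   using emeasure_cell_01[OF Qs, of n p g] unfolding Q_def by (auto split: prod.splits)
  have "(\<Union>p. Q n p) \<in> null_sets \<xi>"
   by (rule null_sets_UN) (use z Qs in \<open>auto simp: null_sets_def\<close>)
  moreover have "cell g = (\<Union>p. Q n p)"
   unfolding Q_def using grid_cell_cover by fastforce
  ultimately show False using K by (simp add: null_sets_def)
 qed
 then obtain p where p: "\<And>n. emeasure \<xi> (Q n (p n)) = 1" by metis
 define I where "I = (\<Inter>n. Q n (p n))"
 have Is: "I \<in> sets \<xi>" unfolding I_def by (intro sets.countable_INT') auto
 have Isub: "I \<subseteq> cell g" unfolding I_def Q_def by (auto split: prod.splits)
 have null: "cell g - Q n (p n) \<in> null_sets \<xi>" for n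
 proof -
  have "emeasure \<xi> (cell g - Q n (p n)) = emeasure \<xi> (cell g) - emeasure \<xi> (Q n (p n))"
   using p[of n] Qsub[of n "p n"] by (intro emeasure_Diff) auto
  then show ?thesis using p[of n] K by (auto simp: null_sets_def)
 qed
 have "(\<Union>n. cell g - Q n (p n)) \<in> null_sets \<xi>" by (rule null_sets_UN) (rule null)
 moreover have "(\<Union>n. cell g - Q n (p n)) = cell g - I" unfolding I_def by auto
 ultimately have "cell g - I \<in> null_sets \<xi>" by simp
 then have "emeasure \<xi> (cell g - (cell g - I)) = emeasure \<xi> (cell g)" by (intro emeasure_Diff_null_set) auto
 moreover have "cell g - (cell g - I) = I" using Isub by auto
 ultimately have I1: "emeasure \<xi> I = 1" using K by simp
 then have "I \<noteq> {}" by auto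
 then obtain z where z: "z \<in> I" by blast
 have "I = {z}"
 proof (intro set_eqI iffI)
  fix y assume y: "y \<in> I"
  \<comment> \<open>For every \<open>n\<close> both points lie in a common piece, so their
    coordinates differ by less than \<open>1 / real (Suc n)\<close>.\<close>
  have "fst y $ i = fst z $ i" for i
  proof (rule ccontr)
   assume ne: "fst y $ i \<noteq> fst z $ i"
   then obtain n where n: "1 / real (Suc n) < \<bar>fst y $ i - fst z $ i\<bar>"
   using reals_Archimedean[of "\<bar>fst y $ i - fst z $ i\<bar>"] by (auto simp: inverse_eq_divide)
   obtain h j where hj: "p n = (h, j)" by (cases "p n")
   have "fst y \<in> grid_cell (2 / real (Suc n)) h" "fst z \<in> grid_cell (2 / real (Suc n)) h"
   using y z hj unfolding I_def Q_def by (auto dest!: spec[of _ n])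
   moreover have "0 < 2 / real (Suc n)" by simp
   moreover have "2 / real (Suc n) / 2 = 1 / real (Suc n)" by (simp add: field_simps)
   ultimately have "of_int (h i) * (1 / real (Suc n)) <= fst y $ i" "fst y $ i < (of_int (h i) + 1) * (1 / real (Suc n))"
   "of_int (h i) * (1 / real (Suc n)) <= fst z $ i" "fst z $ i < (of_int (h i) + 1) * (1 / real (Suc n))"
   by (metis grid_cell_iff)+
   then have "\<bar>fst y $ i - fst z $ i\<bar> < 1 / real (Suc n)" unfolding distrib_right mult_1_left abs_less_iff by linarith
   with n show False by simp
  qed
  then have "fst y = fst z" by (simp add: vec_eq_iff)
  moreover have "snd y = snd z"
  proof -
   obtain h j where hj: "p 0 = (h, j)" by (cases "p 0")
   have "v \<in> Q 0 (p 0)" if "v \<in> I" for v using that unfolding I_def by blast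
   then have "snd v = j" if "v \<in> I" for v
   using that by (cases v) (auto simp: hj Q_def)
   then show ?thesis using y z by simp
  qed
  ultimately show "y \<in> {z}" by (simp add: prod_eq_iff)
 qed (use z in auto)
 then have "z \<in> atoms \<xi>" unfolding atoms_def using I1 z Isub sets.sets_into_space[OF cell_sets] by auto
 then show ?thesis using z Isub by blast
qed

lemma emeasure_cell: "emeasure \<xi> (cell g) = (if \<exists>z\<in>cell g. z \<in> atoms \<xi> then 1 else 0)"
proof (cases "\<exists>z\<in>cell g. z \<in> atoms \<xi>")
 case True
 then obtain z where "z \<in> cell g" "z \<in> atoms \<xi>" by blast
 then have "emeasure \<xi> {z} <= emeasure \<xi> (cell g)" by (intro emeasure_mono) auto
 then have "emeasure \<xi> (cell g) \<noteq> 0" using emeasure_atom[OF \<open>z \<in> atoms \<xi>\<close>] by auto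
 then show ?thesis using True emeasure_cell_01[OF cell_sets, of g g] by auto
next
 case False
 then show ?thesis using atom_in_cell[of g] emeasure_cell_01[OF cell_sets, of g g] by auto
qed

lemma countable_atoms: "countable (atoms \<xi>)"
proof -
 define G where "G z = (%i. \<lfloor>2 * fst z $ i / r\<rfloor>)" for z :: "(real ^ 'd) \<times> nat"
 have "z \<in> cell (G z)" if "z \<in> atoms \<xi>" for z
  using that atoms_subset grid_cell_cover[of "fst z" r] unfolding cell_def G_def coloured_space_def by (cases z) auto
 then have "inj_on G (atoms \<xi>)" by (intro inj_onI) (metis atom_unique)
 then show ?thesis by (rule countable_image_inj_on[rotated]) simp
qed

lemma countable_sets: "countable A ==> A \<subseteq> coloured_space m ==> A \<in> sets \<xi>"
 by (rule sets.countable) (auto intro: singleton_sets)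

text \<open>Inside a cell of mass 1 the atom already exhausts the mass, and a cell without an atom
  is null. Countably many cells cover the space.\<close>

lemma null_non_atoms: "coloured_space m - atoms \<xi> \<in> null_sets \<xi>"
proof -
 have as: "atoms \<xi> \<in> sets \<xi>" by (rule countable_sets[OF countable_atoms atoms_subset])
 have "cell g - atoms \<xi> \<in> null_sets \<xi>" for g
 proof (cases "\<exists>z\<in>cell g. z \<in> atoms \<xi>")
  case True
  then obtain z where z: "z \<in> cell g" "z \<in> atoms \<xi>" by blast
  have zs: "{z} \<in> sets \<xi>" using z atoms_subset singleton_sets by blast
  have "emeasure \<xi> (cell g - {z}) = emeasure \<xi> (cell g) - emeasure \<xi> {z}"
   using z zs emeasure_atom by (intro emeasure_Diff) auto
  also have "\<dots> = 0" using emeasure_cell[of g] z emeasure_atom by auto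
  finally have "cell g - {z} \<in> null_sets \<xi>" using zs by (auto simp: null_sets_def)
  then show ?thesis by (rule null_sets_subset) (use as z in auto)
 next
  case False
  then have "emeasure \<xi> (cell g) = 0" using emeasure_cell[of g] by simp
  then have "cell g \<in> null_sets \<xi>" by (auto simp: null_sets_def)
  then show ?thesis by (rule null_sets_subset) (use as in auto)
 qed
 then have "(\<Union>g. cell g - atoms \<xi>) \<in> null_sets \<xi>" by (intro null_sets_UN) auto
 moreover have "(\<Union>g. cell g - atoms \<xi>) = coloured_space m - atoms \<xi>"
  using in_some_cell sets.sets_into_space[OF cell_sets] unfolding space_\<xi> by blast
 ultimately show ?thesis by simp
qed

lemma emeasure_eq_count:
 assumes A: "A \<in> sets \<xi>"
 shows "emeasure \<xi> A = emeasure (count_space (atoms \<xi>)) (A \<inter> atoms \<xi>)"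
proof -
 have as: "atoms \<xi> \<in> sets \<xi>" by (rule countable_sets[OF countable_atoms atoms_subset])
 have "A - (coloured_space m - atoms \<xi>) = A \<inter> atoms \<xi>" using A unfolding sets_\<xi>_iff by auto
 then have "emeasure \<xi> A = emeasure \<xi> (A \<inter> atoms \<xi>)"
  using emeasure_Diff_null_set[OF null_non_atoms A] by simp
 also have "\<dots> = (\<integral>\<^sup>+z. emeasure \<xi> {z} \<partial>count_space (A \<inter> atoms \<xi>))"
  using atoms_subset singleton_sets countable_atoms by (intro emeasure_countable_singleton) auto
 also have "\<dots> = (\<integral>\<^sup>+z. 1 \<partial>count_space (A \<inter> atoms \<xi>))"
  by (intro nn_integral_cong) (auto simp: emeasure_atom)
 also have "\<dots> = emeasure (count_space (atoms \<xi>)) (A \<inter> atoms \<xi>)"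
  by (simp add: emeasure_count_space)
 finally show ?thesis .
qed

text \<open>Turns integrals against a configuration into sums over its atoms, each of which has mass
  exactly 1.\<close>

lemma config_eq_count: "\<xi> = distr (count_space (atoms \<xi>)) \<xi> (%z. z)"
proof (rule measure_eqI)
 fix A assume A: "A \<in> sets \<xi>"
 have "(%z. z) \<in> count_space (atoms \<xi>) \<rightarrow>\<^sub>M \<xi>" using atoms_subset by (auto simp: space_\<xi>)
 then have "emeasure (distr (count_space (atoms \<xi>)) \<xi> (%z. z)) A = emeasure (count_space (atoms \<xi>)) (A \<inter> atoms \<xi>)"
  using A by (subst emeasure_distr) auto
 then show "emeasure \<xi> A = emeasure (distr (count_space (atoms \<xi>)) \<xi> (%z. z)) A"
  using emeasure_eq_count[OF A] by simp
qed simp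

lemma nn_integral_eq_count:
 assumes f: "f \<in> borel_measurable \<xi>"
 shows "(\<integral>\<^sup>+z. f z \<partial>\<xi>) = (\<integral>\<^sup>+z. f z \<partial>count_space (atoms \<xi>))"
proof -
 have "(%z. z) \<in> count_space (atoms \<xi>) \<rightarrow>\<^sub>M \<xi>" using atoms_subset by (auto simp: space_\<xi>)
 then show ?thesis using f by (subst config_eq_count) (simp add: nn_integral_distr)
qed

text \<open>A position carries one colour at most, because cells contain all colours over their
  positions. Hence sums over positions and sums over coloured points agree.\<close>

lemma atoms_inj_fst: "inj_on fst (atoms \<xi>)"
proof (rule inj_onI)
 fix z z' assume z: "z \<in> atoms \<xi>" "z' \<in> atoms \<xi>" "fst z = fst z'"
 then have "z \<in> coloured_space m" "z' \<in> coloured_space m" using atoms_subset by auto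
 moreover then obtain g where g: "z \<in> cell g" using in_some_cell by blast
 ultimately have "z' \<in> cell g" using z(3) unfolding cell_def coloured_space_def by (cases z, cases z') auto
 then show "z = z'" using atom_unique z g by blast
qed

lemma weighted_mass_atom:
 assumes "(x, i) \<in> atoms \<xi>"
 shows "weighted_mass m w \<xi> x = w i"
proof -
 have i: "i \<in> {1..m}" using assms atoms_subset unfolding coloured_space_def by auto
 have "measure \<xi> ({x} \<times> {j}) = (if j = i then 1 else 0)" if "j \<in> {1..m}" for j
 proof (cases "j = i")
  case True then show ?thesis using emeasure_atom[OF assms] by (simp add: measure_def)
 next
  case False
  then have "(x, j) \<notin> atoms \<xi>" using inj_onD[OF atoms_inj_fst _ assms, of "(x, j)"] by auto
  then have "emeasure \<xi> {(x, j)} = 0" using that unfolding atoms_def space_\<xi> coloured_space_def by auto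
  then show ?thesis using False by (simp add: measure_def)
 qed
 then have "weighted_mass m w \<xi> x = (\<Sum>j = 1..m. w j * (if j = i then 1 else 0))"
  unfolding weighted_mass_def by (intro sum.cong) auto
 also have "\<dots> = (\<Sum>j = 1..m. if j = i then w j else 0)" by (intro sum.cong) auto
 also have "\<dots> = w i" using i by simp
 finally show ?thesis .
qed

lemma weighted_mass_no_atom:
 assumes "x \<notin> fst ` atoms \<xi>"
 shows "weighted_mass m w \<xi> x = 0"
proof -
 have "measure \<xi> ({x} \<times> {j}) = 0" if "j \<in> {1..m}" for j
 proof -
  have "(x, j) \<notin> atoms \<xi>" using assms by force
  then have "emeasure \<xi> {(x, j)} = 0" using that unfolding atoms_def space_\<xi> coloured_space_def by auto
  then show ?thesis by (simp add: measure_def)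
 qed
 then show ?thesis unfolding weighted_mass_def by (intro sum.neutral) auto
qed

text \<open>The link between the sums over all of space in the definitions and the sums over
  coloured points used below.\<close>

lemma infsum_weighted_mass:
 fixes f :: "real ^ 'd => 'b::{banach, second_countable_topology, real_normed_algebra_1}"
 assumes i: "integrable (count_space (atoms \<xi>)) (%z. of_real (w (snd z)) * f (fst z))"
 shows "(\<Sum>\<^sub>\<infinity>x\<in>UNIV. of_real (weighted_mass m w \<xi> x) * f x) = (\<integral>z. of_real (w (snd z)) * f (fst z) \<partial>count_space (atoms \<xi>))"
proof -
 have "(\<Sum>\<^sub>\<infinity>x\<in>UNIV. of_real (weighted_mass m w \<xi> x) * f x) = (\<Sum>\<^sub>\<infinity>x\<in>fst ` atoms \<xi>. of_real (weighted_mass m w \<xi> x) * f x)"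
  by (rule infsum_cong_neutral) (auto simp: weighted_mass_no_atom)
 also have "\<dots> = (\<Sum>\<^sub>\<infinity>z\<in>atoms \<xi>. of_real (weighted_mass m w \<xi> (fst z)) * f (fst z))"
  by (subst infsum_reindex[OF atoms_inj_fst]) (simp add: comp_def)
 also have "\<dots> = (\<Sum>\<^sub>\<infinity>z\<in>atoms \<xi>. of_real (w (snd z)) * f (fst z))"
  by (rule infsum_cong) (auto simp: weighted_mass_atom)
 also have "\<dots> = (\<integral>z. of_real (w (snd z)) * f (fst z) \<partial>count_space (atoms \<xi>))"
  by (rule infsum_eq_integral_count_space[OF i])
 finally show ?thesis .
qed

lemma sigma_finite: "sigma_finite_measure \<xi>"
proof
 have "emeasure \<xi> (cell g) \<noteq> \<infinity>" for g using emeasure_cell_01[OF cell_sets, of g g] by auto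
 moreover have "\<Union> (range cell) = space \<xi>"
  using in_some_cell sets.sets_into_space[OF cell_sets] unfolding space_\<xi> by blast
 ultimately show "\<exists>A. countable A \<and> A \<subseteq> sets \<xi> \<and> \<Union> A = space \<xi> \<and> (\<forall>a\<in>A. emeasure \<xi> a \<noteq> \<infinity>)"
  by (intro exI[of _ "range cell"]) auto
qed

end

text \<open>Averaging over the position of a cube that contains at most one point bounds the sum of
 \<open>decay\<close> over the points by an integral.\<close>

lemma ud_decay_bound:
 assumes r: "r > 0"
 shows "\<exists>K. \<forall>\<xi> \<in> uniformly_discrete_measures m r. \<forall>y :: real ^ 'd::finite.
   (\<integral>\<^sup>+z. ennreal (decay (fst z - y)) \<partial>count_space (atoms \<xi>)) <= ennreal K"
proof -
 let ?Q = "open_cube r :: (real ^ 'd) set"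
 have opQ: "open ?Q"
 proof -
  have "?Q = (\<Inter>i. {x. \<bar>x $ i\<bar> < r / 2})" unfolding open_cube_def by auto
  moreover have "open {x :: real ^ 'd. \<bar>x $ i\<bar> < r / 2}" for i
   by (intro open_Collect_less continuous_intros)
  ultimately show ?thesis by (simp only:) (intro open_INT, auto)
 qed
 have [measurable]: "?Q \<in> sets borel" using opQ by auto
 have Qb: "norm x <= real CARD('d) * r" if "x \<in> ?Q" for x
 proof -
  have "norm x <= (\<Sum>i\<in>UNIV. \<bar>x $ i\<bar>)" by (rule norm_le_l1_cart)
  also have "\<dots> <= (\<Sum>i\<in>(UNIV :: 'd set). r)"
  proof (intro sum_mono)
   fix i
   have "\<bar>x $ i\<bar> < r / 2" using that unfolding open_cube_def by auto
   then show "\<bar>x $ i\<bar> <= r" using r by linarith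
  qed
  finally show ?thesis by simp
 qed
 define c where "c = (1 + real CARD('d) * r) ^ (2 * CARD('d))"
 have cpos: "c > 0" unfolding c_def using r by (intro zero_less_power) (simp add: add_pos_nonneg)
 \<comment> \<open>Moving within one cube changes \<open>decay\<close> by at most the factor
   \<open>c\<close>, so the value at a point may be replaced by the value at the centre of a cube
   containing it.\<close>
 have near: "decay x <= c * decay (x - q)" if "q \<in> ?Q" for x q :: "real ^ 'd"
 proof -
  have "1 / c <= decay q" unfolding decay_def c_def using Qb[OF that] r
   by (intro divide_left_mono power_mono mult_pos_pos zero_less_power) (auto simp: add_pos_nonneg)
  then have "1 <= c * decay q" using cpos by (simp add: divide_le_eq mult.commute)
  then have "decay x <= c * decay q * decay x" using mult_right_mono[of 1 "c * decay q" "decay x"] by simp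
  also have "\<dots> = c * (decay (- q) * decay x)" by simp
  also have "\<dots> <= c * decay (- q + x)" using cpos by (intro mult_left_mono decay_submult) auto
  finally show ?thesis by simp
 qed
 define v where "v = measure lborel ?Q"
 have Qfin: "emeasure lborel ?Q < \<infinity>"
  by (rule emeasure_bounded_finite) (use Qb in \<open>auto simp: bounded_iff\<close>)
 have Q0: "0 \<in> ?Q" unfolding open_cube_def using r by simp
 have vpos: "v > 0"
 proof -
  have "emeasure lborel ?Q \<noteq> 0"
  proof
   assume "emeasure lborel ?Q = 0"
   then have "?Q \<in> null_sets lborel" by (auto simp: null_sets_def)
   then have "negligible ?Q" unfolding negligible_iff_null_sets by (rule null_sets_completionI)
   then show False using open_not_negligible[OF opQ] Q0 by blast
  qed
  then show ?thesis unfolding v_def using Qfin by (simp add: measure_def enn2real_positive_iff zero_less_iff_neq_zero)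
 qed
 have ev: "emeasure lborel ?Q = ennreal v" unfolding v_def using Qfin by (simp add: emeasure_eq_ennreal_measure)
 let ?I = "\<integral>x. decay x \<partial>(lborel :: (real ^ 'd) measure)"
 have main: "(\<integral>\<^sup>+z. ennreal (decay (fst z - y)) \<partial>count_space (atoms \<xi>)) <= ennreal (c * ?I / v)"
  if \<xi>: "\<xi> \<in> uniformly_discrete_measures m r" for \<xi> and y :: "real ^ 'd"
 proof -
  interpret ud_configuration m \<xi> r
   by unfold_locales (use r \<xi> in \<open>auto simp: uniformly_discrete_measures_def\<close>)
  interpret pair_sigma_finite lborel \<xi>
   by (intro pair_sigma_finite.intro sigma_finite sigma_finite_lborel)
  have [measurable]: "fst \<in> \<xi> \<rightarrow>\<^sub>M borel"
   unfolding measurable_cong_sets[OF sets_\<xi> refl]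
   by (intro measurable_restrict_space1) (simp add: borel_measurable_continuous_onI continuous_on_fst continuous_on_id)
  have [measurable]: "(%p. indicator ?Q (fst (snd p) - fst p) :: ennreal) \<in> borel_measurable (lborel \<Otimes>\<^sub>M \<xi>)"
   by measurable
  \<comment> \<open>The centres \<open>a\<close> whose cube contains a given point form a reflected
    cube, again of volume \<open>v\<close>.\<close>
  have "ennreal v * (\<integral>\<^sup>+z. ennreal (decay (fst z - y)) \<partial>\<xi>) = (\<integral>\<^sup>+z. (\<integral>\<^sup>+a. indicator ?Q (fst z - a) * ennreal (decay (fst z - y)) \<partial>lborel) \<partial>\<xi>)"
  proof -
   have "(\<integral>\<^sup>+a. indicator ?Q (x - a) \<partial>lborel) = ennreal v" for x :: "real ^ 'd"
   proof -
   have "(\<integral>\<^sup>+a. indicator ?Q (x - a) \<partial>lborel) = (\<integral>\<^sup>+a. indicator ?Q a \<partial>distr lborel borel (%a. x + (-1) *\<^sub>R a))"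
   by (subst nn_integral_distr) auto
   also have "distr lborel borel (%a. x + (-1) *\<^sub>R a) = (lborel :: (real ^ 'd) measure)"
   using lborel_affine[of "-1" x] by (simp add: density_1 )
   finally show ?thesis by (simp add: ev)
   qed
   then show ?thesis by (simp add: nn_integral_multc nn_integral_cmult)
  qed
  also have "\<dots> = (\<integral>\<^sup>+a. (\<integral>\<^sup>+z. indicator ?Q (fst z - a) * ennreal (decay (fst z - y)) \<partial>\<xi>) \<partial>lborel)"
   by (rule Fubini') measurable
  also have "\<dots> <= (\<integral>\<^sup>+a. ennreal (c * decay (a - y)) \<partial>lborel)"
  proof (intro nn_integral_mono)
   fix a :: "real ^ 'd"
   have "(\<integral>\<^sup>+z. indicator ?Q (fst z - a) * ennreal (decay (fst z - y)) \<partial>\<xi>)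
   <= (\<integral>\<^sup>+z. ennreal (c * decay (a - y)) * indicator (((+) a ` ?Q) \<times> {1..m}) z \<partial>\<xi>)"
   proof (intro nn_integral_mono)
   fix z assume z: "z \<in> space \<xi>"
   show "indicator ?Q (fst z - a) * ennreal (decay (fst z - y)) <= ennreal (c * decay (a - y)) * indicator (((+) a ` ?Q) \<times> {1..m}) z"
   proof (cases "fst z - a \<in> ?Q")
   case True
   have "fst z \<in> (+) a ` ?Q" using True by (intro image_eqI[of _ _ "fst z - a"]) auto
   then have "z \<in> ((+) a ` ?Q) \<times> {1..m}" using z unfolding space_\<xi> coloured_space_def by (cases z) auto
   moreover have "decay (fst z - y) <= c * decay (a - y)" using near[OF True, of "fst z - y"] by (simp add: algebra_simps)
   ultimately show ?thesis using True by (simp add: ennreal_leI)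
   qed simp
   qed
   also have "\<dots> = ennreal (c * decay (a - y)) * emeasure \<xi> (((+) a ` ?Q) \<times> {1..m})"
   proof (rule nn_integral_cmult_indicator)
   show "((+) a ` ?Q) \<times> {1..m} \<in> sets \<xi>"
   unfolding sets_\<xi>_iff coloured_space_def using open_translation[OF opQ, of a]
   by (auto intro!: borel_Times_nat)
   qed
   also have "\<dots> <= ennreal (c * decay (a - y)) * 1"
   using \<xi> unfolding uniformly_discrete_measures_def by (intro mult_left_mono) auto
   finally show "(\<integral>\<^sup>+z. indicator ?Q (fst z - a) * ennreal (decay (fst z - y)) \<partial>\<xi>) <= ennreal (c * decay (a - y))" by simp
  qed
  also have "\<dots> = ennreal (\<integral>a. c * decay (a - y) \<partial>lborel)"
   using lborel_integrable_affine[OF integrable_decay, of 1 "- y"] cpos by (intro nn_integral_eq_integral) auto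
  also have "(\<integral>a. c * decay (a - y) \<partial>lborel) = c * ?I"
   using lborel_integral_shift[of decay "- y"] by simp
  finally have le: "ennreal v * (\<integral>\<^sup>+z. ennreal (decay (fst z - y)) \<partial>\<xi>) <= ennreal (c * ?I)" .
  have "(\<integral>\<^sup>+z. ennreal (decay (fst z - y)) \<partial>\<xi>) = ennreal (1 / v) * (ennreal v * (\<integral>\<^sup>+z. ennreal (decay (fst z - y)) \<partial>\<xi>))"
   using vpos by (simp add: mult.assoc[symmetric] ennreal_mult[symmetric])
  also have "\<dots> <= ennreal (1 / v) * ennreal (c * ?I)" by (intro mult_left_mono le) auto
  also have "\<dots> = ennreal (c * ?I / v)" using vpos cpos by (simp add: ennreal_mult[symmetric])
  finally have "(\<integral>\<^sup>+z. ennreal (decay (fst z - y)) \<partial>\<xi>) <= ennreal (c * ?I / v)" .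
  then show ?thesis by (subst nn_integral_eq_count[symmetric]) auto
 qed
 then show ?thesis by blast
qed

section \<open>Integration against a difference of finite measures\<close>

lemma nn_integral_add_measure:
 assumes [measurable_cong]: "sets b = sets a" "sets c = sets a"
  and add: "\<And>A. A \<in> sets a ==> emeasure a A = emeasure b A + emeasure c A"
  and f: "f \<in> borel_measurable a"
 shows "(\<integral>\<^sup>+x. f x \<partial>a) = (\<integral>\<^sup>+x. f x \<partial>b) + (\<integral>\<^sup>+x. f x \<partial>c)"
 using f
proof (induction rule: borel_measurable_induct)
 case (cong f g)
 have "space b = space a" "space c = space a" using sets_eq_imp_space_eq[OF assms(1)] sets_eq_imp_space_eq[OF assms(2)] by auto
 then have "(\<integral>\<^sup>+x. f x \<partial>k) = (\<integral>\<^sup>+x. g x \<partial>k)" if "k \<in> {a, b, c}" for k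
  using that cong(3) by (intro nn_integral_cong) auto
 then show ?case using cong(4) by simp
next
 case (set A)
 then show ?case by (simp add: add assms(1,2))
next
 case (mult u c)
 then show ?case by (simp add: nn_integral_cmult distrib_left)
next
 case (add u v)
 then show ?case by (simp add: nn_integral_add ac_simps)
next
 case (seq U)
 have [measurable]: "U i \<in> borel_measurable a" for i by (rule seq)
 have "(\<integral>\<^sup>+x. (SUP i. U i) x \<partial>a) = (SUP i. (\<integral>\<^sup>+x. U i x \<partial>b) + (\<integral>\<^sup>+x. U i x \<partial>c))"
  unfolding SUP_apply using seq by (subst nn_integral_monotone_convergence_SUP) auto
 also have "\<dots> = (SUP i. \<integral>\<^sup>+x. U i x \<partial>b) + (SUP i. \<integral>\<^sup>+x. U i x \<partial>c)"
  using seq(3) by (intro ennreal_SUP_add) (auto simp: incseq_def le_fun_def intro!: nn_integral_mono)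
 also have "\<dots> = (\<integral>\<^sup>+x. (SUP i. U i) x \<partial>b) + (\<integral>\<^sup>+x. (SUP i. U i) x \<partial>c)"
  unfolding SUP_apply using seq by (subst (1 2) nn_integral_monotone_convergence_SUP) auto
 finally show ?case .
qed

lemma integral_add_measure:
 fixes f :: "'a => complex"
 assumes s: "sets b = sets a" "sets c = sets a"
  and add: "\<And>A. A \<in> sets a ==> emeasure a A = emeasure b A + emeasure c A"
  and fa: "integrable a f"
 shows "integrable b f" "integrable c f" "integral\<^sup>L a f = integral\<^sup>L b f + integral\<^sup>L c f"
proof -
 note nn = nn_integral_add_measure[OF s add]
 have m: "f \<in> borel_measurable a" using fa by auto
 have mb: "f \<in> borel_measurable b" "f \<in> borel_measurable c"
  using m by (simp_all add: measurable_cong_sets[OF s(1) refl] measurable_cong_sets[OF s(2) refl])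
 have "(\<integral>\<^sup>+x. norm (f x) \<partial>b) + (\<integral>\<^sup>+x. norm (f x) \<partial>c) < \<infinity>"
  using fa nn[of "%x. ennreal (norm (f x))"] m by (simp add: integrable_iff_bounded)
 then show fb: "integrable b f" and fc: "integrable c f"
  using mb by (auto simp: integrable_iff_bounded)
 have real: "integral\<^sup>L a g = integral\<^sup>L b g + integral\<^sup>L c g"
  if ga: "integrable a g" and gb: "integrable b g" and gc: "integrable c g" for g :: "'a => real"
 proof -
  have [measurable]: "g \<in> borel_measurable a" using ga by auto
  have fin: "(\<integral>\<^sup>+x. ennreal (g x) \<partial>k) < \<infinity>" "(\<integral>\<^sup>+x. ennreal (- g x) \<partial>k) < \<infinity>" if "integrable k g" for k
   using that unfolding real_integrable_def by (auto simp: less_top)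
  show ?thesis
   unfolding real_lebesgue_integral_def[OF ga] real_lebesgue_integral_def[OF gb] real_lebesgue_integral_def[OF gc]
   using fin[OF gb] fin[OF gc] by (simp add: nn enn2real_plus)
 qed
 show "integral\<^sup>L a f = integral\<^sup>L b f + integral\<^sup>L c f"
  unfolding complex_eq_iff plus_complex.sel
  using real[of "%x. Re (f x)"] real[of "%x. Im (f x)"] fa fb fc by simp
qed

text \<open>On a Hahn set \<open>Y\<close> of the difference the supremum over subsets of
  \<open>A\<close> is attained at \<open>A \<inter> Y\<close>. The relation is stated as a sum,
  since subtraction of extended nonnegative numbers is truncated.\<close>

lemma positive_variation_diff:
 assumes fin: "finite_measure p" "finite_measure q" and s: "sets p = sets M" "sets q = sets M"
  and \<sigma>: "\<And>D. D \<in> sets M ==> \<sigma> D = measure p D - measure q D"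
  and Y: "Y \<in> sets M" "\<And>D. D \<in> sets M ==> D \<subseteq> Y ==> measure q D <= measure p D"
   "\<And>D. D \<in> sets M ==> D \<inter> Y = {} ==> measure p D <= measure q D"
 shows "sets (positive_variation M \<sigma>) = sets M"
  and "A \<in> sets M ==> emeasure (positive_variation M \<sigma>) A + emeasure q (A \<inter> Y) = emeasure p (A \<inter> Y)"
proof -
 interpret p: finite_measure p by fact
 interpret q: finite_measure q by fact
 let ?v = "%A. SUP D \<in> {D \<in> sets M. D \<subseteq> A}. ennreal (\<sigma> D)"
 have v: "?v A = ennreal (measure p (A \<inter> Y) - measure q (A \<inter> Y))" if A: "A \<in> sets M" for A
 proof (rule antisym)
  show "?v A <= ennreal (measure p (A \<inter> Y) - measure q (A \<inter> Y))"
  proof (rule SUP_least)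
   fix D assume D: "D \<in> {D \<in> sets M. D \<subseteq> A}"
   have split: "measure k D = measure k (D \<inter> Y) + measure k (D - Y)" if "finite_measure k" "sets k = sets M" for k
   proof -
   have "D \<inter> Y \<in> sets M" "D - Y \<in> sets M" using D Y(1) by auto
   then show ?thesis using finite_measure.finite_measure_Union[OF that(1), of "D \<inter> Y" "D - Y"] that(2)
   by (simp add: Int_Diff_Un Int_Diff_disjoint)
   qed
   have split': "measure k (A \<inter> Y) = measure k (D \<inter> Y) + measure k ((A - D) \<inter> Y)" if "finite_measure k" "sets k = sets M" for k
   proof -
   have "A \<inter> Y = (D \<inter> Y) \<union> ((A - D) \<inter> Y)" using D by auto
   moreover have "measure k ((D \<inter> Y) \<union> ((A - D) \<inter> Y)) = measure k (D \<inter> Y) + measure k ((A - D) \<inter> Y)"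
   using D A Y(1) that(2) by (intro finite_measure.finite_measure_Union[OF that(1)]) auto
   ultimately show ?thesis by simp
   qed
   have DY: "(D - Y) \<inter> Y = {}" by auto
   have "\<sigma> D <= measure p (A \<inter> Y) - measure q (A \<inter> Y)"
   using split[OF fin(1) s(1)] split[OF fin(2) s(2)] split'[OF fin(1) s(1)] split'[OF fin(2) s(2)]
   Y(2)[of "(A - D) \<inter> Y"] Y(3)[OF _ DY] D A Y(1) \<sigma>[of D] by auto
   then show "ennreal (\<sigma> D) <= ennreal (measure p (A \<inter> Y) - measure q (A \<inter> Y))" by (rule ennreal_leI)
  qed
  show "ennreal (measure p (A \<inter> Y) - measure q (A \<inter> Y)) <= ?v A"
   using A Y(1) \<sigma>[of "A \<inter> Y"] by (intro SUP_upper2[of "A \<inter> Y"]) auto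
 qed
 have meas: "measure_space (space M) (sets M) ?v"
  unfolding measure_space_def
 proof (intro conjI)
  show "sigma_algebra (space M) (sets M)" ..
  show "positive (sets M) ?v" unfolding positive_def using v[of "{}"] by simp
  show "countably_additive (sets M) ?v"
  proof (rule countably_additiveI)
   fix F :: "nat => 'a set" assume F: "range F \<subseteq> sets M" "disjoint_family F" "(\<Union>i. F i) \<in> sets M"
   have FY: "range (%i. F i \<inter> Y) \<subseteq> sets M" "disjoint_family (%i. F i \<inter> Y)" "(\<Union>i. F i \<inter> Y) = (\<Union>i. F i) \<inter> Y"
   using F Y(1) by (auto simp: disjoint_family_on_def)
   have "(%i. measure p (F i \<inter> Y)) sums measure p ((\<Union>i. F i) \<inter> Y)"
   using p.finite_measure_UNION[of "%i. F i \<inter> Y"] FY s by auto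
   moreover have "(%i. measure q (F i \<inter> Y)) sums measure q ((\<Union>i. F i) \<inter> Y)"
   using q.finite_measure_UNION[of "%i. F i \<inter> Y"] FY s by auto
   ultimately have sm: "(%i. measure p (F i \<inter> Y) - measure q (F i \<inter> Y)) sums (measure p ((\<Union>i. F i) \<inter> Y) - measure q ((\<Union>i. F i) \<inter> Y))"
   by (rule sums_diff)
   have "(\<Sum>i. ?v (F i)) = (\<Sum>i. ennreal (measure p (F i \<inter> Y) - measure q (F i \<inter> Y)))"
   using F(1) by (intro arg_cong[where f=suminf] ext v) auto
   also have "\<dots> = ennreal (measure p ((\<Union>i. F i) \<inter> Y) - measure q ((\<Union>i. F i) \<inter> Y))"
   using F(1) Y by (intro suminf_ennreal_eq[OF _ sm]) auto
   also have "\<dots> = ?v (\<Union>i. F i)" using v[OF F(3)] by simp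
   finally show "(\<Sum>i. ?v (F i)) = ?v (\<Union>i. F i)" .
  qed
 qed
 show sp: "sets (positive_variation M \<sigma>) = sets M"
  unfolding positive_variation_def by (simp add: sets.sigma_sets_eq sets.space_closed)
 show "emeasure (positive_variation M \<sigma>) A + emeasure q (A \<inter> Y) = emeasure p (A \<inter> Y)" if A: "A \<in> sets M"
 proof -
  have "emeasure (positive_variation M \<sigma>) A = ?v A"
   using meas A unfolding positive_variation_def measure_space_def
   by (intro emeasure_measure_of_sigma) auto
  then have "emeasure (positive_variation M \<sigma>) A = ennreal (measure p (A \<inter> Y) - measure q (A \<inter> Y))" using v[OF A] by simp
  then show ?thesis
   using Y(2)[of "A \<inter> Y"] A Y(1) by (simp add: p.emeasure_eq_measure q.emeasure_eq_measure flip: ennreal_plus)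
 qed
qed

text \<open>Any representation as a difference of finite measures computes the integral, even if the
  two measures are not mutually singular: on the Hahn set and on its complement the common part
  cancels.\<close>

lemma signed_integral_diff:
 fixes F :: "'a => complex"
 assumes fin: "finite_measure p" "finite_measure q" and s: "sets p = sets M" "sets q = sets M"
  and \<sigma>: "\<And>D. D \<in> sets M ==> \<sigma> D = measure p D - measure q D"
  and F: "F \<in> borel_measurable M" and bd: "\<And>x. x \<in> space M ==> norm (F x) <= C"
 shows "signed_integral M \<sigma> F = integral\<^sup>L p F - integral\<^sup>L q F"
proof -
 interpret p: finite_measure p by fact
 interpret q: finite_measure q by fact
 have sp: "space p = space M" "space q = space M" using sets_eq_imp_space_eq[OF s(1)] sets_eq_imp_space_eq[OF s(2)] by auto
 obtain Y where Y: "Y \<in> sets M" "\<And>X. X \<in> sets M ==> X \<subseteq> Y ==> emeasure q X <= emeasure p X"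
  "\<And>X. X \<in> sets M ==> X \<inter> Y = {} ==> emeasure p X <= emeasure q X"
  using finite_unsigned_Hahn_decomposition[OF fin] s by auto
 have Y2: "measure q X <= measure p X" if "X \<in> sets M" "X \<subseteq> Y" for X
  using Y(2)[OF that] by (simp add: p.emeasure_eq_measure q.emeasure_eq_measure)
 have Y3: "measure p X <= measure q X" if "X \<in> sets M" "X \<inter> Y = {}" for X
  using Y(3)[OF that] by (simp add: p.emeasure_eq_measure q.emeasure_eq_measure)
 let ?Z = "space M - Y"
 have Z: "?Z \<in> sets M" using Y(1) by auto
 \<comment> \<open>The additive relation between restricted measures passes to integrals; a
   restriction is written as the density of an indicator.\<close>
 have part: "integral\<^sup>L a F + (\<integral>x. indicator E x * F x \<partial>k) = (\<integral>x. indicator E x * F x \<partial>j)"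
  if a: "sets a = sets M" and k: "finite_measure k" "sets k = sets M" and j: "finite_measure j" "sets j = sets M"
   and E: "E \<in> sets M" and eq: "\<And>A. A \<in> sets M ==> emeasure a A + emeasure k (A \<inter> E) = emeasure j (A \<inter> E)"
  for a k j :: "'a measure" and E
 proof -
  let ?r = "%k. density k (indicator E)"
  have er: "emeasure (?r k) A = emeasure k (A \<inter> E)" if "sets k = sets M" "A \<in> sets M" for k :: "'a measure" and A
  proof -
   have "emeasure (?r k) A = (\<integral>\<^sup>+x. indicator E x * indicator A x \<partial>k)"
   using that E by (intro emeasure_density) auto
   also have "\<dots> = (\<integral>\<^sup>+x. indicator (A \<inter> E) x \<partial>k)"
   by (rule nn_integral_cong) (auto split: split_indicator)
   also have "\<dots> = emeasure k (A \<inter> E)" using that E by (intro nn_integral_indicator) auto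
   finally show ?thesis .
  qed
  have ir: "integral\<^sup>L (?r k) F = (\<integral>x. indicator E x * F x \<partial>k)" if "sets k = sets M" for k :: "'a measure"
  proof -
   have "integral\<^sup>L (density k (%x. ennreal (indicator E x))) F = (\<integral>x. indicator E x *\<^sub>R F x \<partial>k)"
   using F E that by (intro integral_density) (auto simp: measurable_cong_sets[OF that refl])
   also have "\<dots> = (\<integral>x. indicator E x * F x \<partial>k)"
   by (intro lint_cong) (auto split: split_indicator)
   finally show ?thesis by (simp add: ennreal_indicator)
  qed
  have "integrable (?r j) F"
  proof (rule finite_measure.integrable_const_bound[of _ _ C])
   have "emeasure (?r j) (space M) < \<infinity>" using er[OF j(2), of "space M"] finite_measure.emeasure_finite[OF j(1)] by (simp add: less_top)
   then show "finite_measure (?r j)" using sets_eq_imp_space_eq[OF j(2)] by (intro finite_measureI) simp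
   show "AE x in ?r j. norm (F x) <= C" using bd sets_eq_imp_space_eq[OF j(2)] by (intro AE_I2) simp
   show "F \<in> borel_measurable (?r j)" using F j(2) by (simp add: measurable_cong_sets[OF j(2) refl])
  qed
  from integral_add_measure(3)[OF _ _ _ this, of a "?r k"]
  show ?thesis using a k j er[OF k(2)] er[OF j(2)] eq ir[OF k(2)] ir[OF j(2)] by simp
 qed
 have 1: "integral\<^sup>L (positive_variation M \<sigma>) F + (\<integral>x. indicator Y x * F x \<partial>q) = (\<integral>x. indicator Y x * F x \<partial>p)"
  by (rule part[OF positive_variation_diff(1)[OF fin s \<sigma> Y(1) Y2 Y3] fin(2) s(2) fin(1) s(1) Y(1) positive_variation_diff(2)[OF fin s \<sigma> Y(1) Y2 Y3]])
 have \<sigma>': "- \<sigma> D = measure q D - measure p D" if "D \<in> sets M" for D using \<sigma>[OF that] by simp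
 have Z2: "measure p X <= measure q X" if "X \<in> sets M" "X \<subseteq> ?Z" for X using that by (intro Y3) auto
 have Z3: "measure q X <= measure p X" if "X \<in> sets M" "X \<inter> ?Z = {}" for X
  using that sets.sets_into_space[OF that(1)] by (intro Y2) auto
 have 2: "integral\<^sup>L (positive_variation M (%D. - \<sigma> D)) F + (\<integral>x. indicator ?Z x * F x \<partial>p) = (\<integral>x. indicator ?Z x * F x \<partial>q)"
  by (rule part[OF positive_variation_diff(1)[OF fin(2,1) s(2,1) \<sigma>' Z Z2 Z3] fin(1) s(1) fin(2) s(2) Z positive_variation_diff(2)[OF fin(2,1) s(2,1) \<sigma>' Z Z2 Z3]])
 have whole: "integral\<^sup>L k F = (\<integral>x. indicator Y x * F x \<partial>k) + (\<integral>x. indicator ?Z x * F x \<partial>k)"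
  if k: "finite_measure k" "sets k = sets M" for k :: "'a measure"
 proof -
  have Fk: "F \<in> borel_measurable k" using F by (simp add: measurable_cong_sets[OF k(2) refl])
  have spk: "space k = space M" using sets_eq_imp_space_eq[OF k(2)] .
  have Fi: "integrable k F"
   by (rule finite_measure.integrable_const_bound[OF k(1), of _ C]) (use bd spk Fk in auto)
  have i: "integrable k (%x. indicator E x * F x)" if "E \<in> sets M" for E
  proof -
   have "(%x. indicator E x *\<^sub>R F x) = (%x. indicator E x * F x)" by (rule ext) (auto split: split_indicator)
   then show ?thesis using integrable_mult_indicator[OF _ Fi, of E] that k(2) by (simp only:)
  qed
  have "integral\<^sup>L k F = (\<integral>x. indicator Y x * F x + indicator ?Z x * F x \<partial>k)"
   using spk by (intro lint_cong) (auto split: split_indicator)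
  then show ?thesis using i[OF Y(1)] i[OF Z] by simp
 qed
 show ?thesis unfolding signed_integral_def whole[OF fin(1) s(1)] whole[OF fin(2) s(2)]
   1[unfolded eq_diff_eq[symmetric]] 2[unfolded eq_diff_eq[symmetric]] by simp
qed

section \<open>Stationary families of points and their second moments\<close>

definition pts :: "('g => 'x set) => ('g => 'x => 'z) => 'x => 'z set" where
 "pts A Z \<xi> = {Z g \<xi> | g. \<xi> \<in> A g}"

definition displace :: "real ^ 'd => (real ^ 'd) \<times> nat => (real ^ 'd::finite) \<times> nat" where
 "displace t = (%(x, i). (t + x, i))"

lemma displace_simps[simp]: "fst (displace t z) = t + fst z" "snd (displace t z) = snd z"
 unfolding displace_def by (auto split: prod.splits)

lemma inj_displace: "inj_on (displace t) S"
 unfolding displace_def by (auto simp: inj_on_def)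

lemma borel_measurable_fst_snd[measurable]:
 "fst \<in> borel_measurable (borel :: ((real ^ 'd::finite) \<times> nat) measure)"
 "snd \<in> (borel :: ((real ^ 'd::finite) \<times> nat) measure) \<rightarrow>\<^sub>M borel"
 by (intro borel_measurable_continuous_onI continuous_on_fst continuous_on_snd continuous_on_id)+

lemma measurable_nat_borel[measurable (raw)]:
 fixes w :: "nat => 'b::topological_space"
 assumes "f \<in> M \<rightarrow>\<^sub>M borel"
 shows "(%x. w (f x)) \<in> borel_measurable M"
proof -
 have "w \<in> borel \<rightarrow>\<^sub>M borel"
  by (rule measurableI) (auto intro: sets.countable)
 then show ?thesis by (rule measurable_compose[OF assms])
qed

lemma borel_measurable_displace[measurable (raw)]:
 assumes [measurable]: "f \<in> borel_measurable M" "g \<in> borel_measurable M"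
 shows "(%x. displace (f x :: real ^ 'd::finite) (g x)) \<in> borel_measurable M"
proof -
 have "(%x. (f x + fst (g x), snd (g x))) \<in> borel_measurable M"
  by (intro borel_measurable_Pair) measurable
 then show ?thesis unfolding displace_def by (simp add: case_prod_unfold)
qed

abbreviation decay2 :: "(real ^ 'd::finite) \<times> nat => (real ^ 'd) \<times> nat => real" where
 "decay2 z z' \<equiv> decay (fst z) * decay (fst z')"

text \<open>A random set of points, presented through a fixed countable index set: index
  \<open>g\<close> contributes the measurable point \<open>Z g \<xi>\<close> on the event
  \<open>A g\<close>. Random sums thereby become countable sums of random variables, and the
  probability space may be arbitrary.\<close>

locale point_family =
 fixes P :: "'x measure" and A :: "'g::countable => 'x set"
  and Z :: "'g => 'x => (real ^ 'd::finite) \<times> nat" and K :: real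
  and \<tau> :: "real ^ 'd => 'x => 'x"
 assumes prob: "prob_space P"
  and A[measurable]: "A g \<in> sets P" and Z[measurable]: "Z g \<in> borel_measurable P"
  and inj: "\<xi> \<in> A g ==> \<xi> \<in> A h ==> Z g \<xi> = Z h \<xi> ==> g = h"
  and decay_sum: "\<xi> \<in> space P ==> (\<integral>\<^sup>+z. ennreal (decay (fst z)) \<partial>count_space (pts A Z \<xi>)) <= ennreal K"
  and \<tau>_measurable: "(%(t, \<xi>). \<tau> t \<xi>) \<in> borel \<Otimes>\<^sub>M P \<rightarrow>\<^sub>M P"
  and stationary: "distr P P (\<tau> t) = P"
  and equivariant: "\<xi> \<in> space P ==> pts A Z (\<tau> t \<xi>) = displace t ` pts A Z \<xi>"
begin

sublocale prob_space P by (rule prob)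

sublocale GP: pair_sigma_finite "count_space (UNIV :: 'g set)" P
 by (intro pair_sigma_finite.intro sigma_finite_measure_count_space_countable) (auto intro: sigma_finite_measure_axioms)

sublocale GGP: pair_sigma_finite "count_space (UNIV :: ('g \<times> 'g) set)" P
 by (intro pair_sigma_finite.intro sigma_finite_measure_count_space_countable) (auto intro: sigma_finite_measure_axioms)

lemma \<tau>_apply[measurable (raw)]:
 assumes [measurable]: "f \<in> borel_measurable M" "h \<in> M \<rightarrow>\<^sub>M P"
 shows "(%x. \<tau> (f x) (h x)) \<in> M \<rightarrow>\<^sub>M P"
 using measurable_compose[OF measurable_Pair[OF assms] \<tau>_measurable] by simp

lemma \<tau>_meas[measurable]: "\<tau> t \<in> P \<rightarrow>\<^sub>M P"
 by measurable

lemma bij_pts: "bij_betw (%g. Z g \<xi>) {g. \<xi> \<in> A g} (pts A Z \<xi>)"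
 unfolding bij_betw_def pts_def by (auto intro!: inj_onI dest: inj)

lemma countable_pts: "countable (pts A Z \<xi>)"
 using bij_pts[of \<xi>] unfolding bij_betw_def by (metis countable_image countableI_type)

lemma bij_pts2: "bij_betw (%(g, h). (Z g \<xi>, Z h \<xi>)) {(g, h). \<xi> \<in> A g \<and> \<xi> \<in> A h} (pts A Z \<xi> \<times> pts A Z \<xi>)"
 unfolding bij_betw_def
proof
 show "inj_on (%(g, h). (Z g \<xi>, Z h \<xi>)) {(g, h). \<xi> \<in> A g \<and> \<xi> \<in> A h}"
  by (rule inj_onI) (auto dest: inj)
 show "(%(g, h). (Z g \<xi>, Z h \<xi>)) ` {(g, h). \<xi> \<in> A g \<and> \<xi> \<in> A h} = pts A Z \<xi> \<times> pts A Z \<xi>"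
  unfolding pts_def by force
qed

lemma nn_pts: "(\<integral>\<^sup>+z. \<phi> z \<partial>count_space (pts A Z \<xi>)) = (\<integral>\<^sup>+g. indicator (A g) \<xi> * \<phi> (Z g \<xi>) \<partial>count_space UNIV)"
proof -
 have "(\<integral>\<^sup>+z. \<phi> z \<partial>count_space (pts A Z \<xi>)) = (\<integral>\<^sup>+g. \<phi> (Z g \<xi>) \<partial>count_space {g. \<xi> \<in> A g})"
  by (rule nn_integral_bij_count_space[OF bij_pts, symmetric])
 also have "\<dots> = (\<integral>\<^sup>+g. \<phi> (Z g \<xi>) * indicator {g. \<xi> \<in> A g} g \<partial>count_space UNIV)"
  by (rule nn_integral_count_space_indicator) simp
 also have "\<dots> = (\<integral>\<^sup>+g. indicator (A g) \<xi> * \<phi> (Z g \<xi>) \<partial>count_space UNIV)"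
  by (rule nn_integral_cong) (auto split: split_indicator)
 finally show ?thesis .
qed

lemma nn_pts2: "(\<integral>\<^sup>+p. \<Phi> p \<partial>count_space (pts A Z \<xi> \<times> pts A Z \<xi>))
  = (\<integral>\<^sup>+(g, h). indicator (A g) \<xi> * indicator (A h) \<xi> * \<Phi> (Z g \<xi>, Z h \<xi>) \<partial>count_space UNIV)"
proof -
 have "(\<integral>\<^sup>+p. \<Phi> p \<partial>count_space (pts A Z \<xi> \<times> pts A Z \<xi>)) = (\<integral>\<^sup>+p. \<Phi> ((%(g, h). (Z g \<xi>, Z h \<xi>)) p) \<partial>count_space {(g, h). \<xi> \<in> A g \<and> \<xi> \<in> A h})"
  by (rule nn_integral_bij_count_space[OF bij_pts2, symmetric])
 also have "\<dots> = (\<integral>\<^sup>+p. \<Phi> ((%(g, h). (Z g \<xi>, Z h \<xi>)) p) * indicator {(g, h). \<xi> \<in> A g \<and> \<xi> \<in> A h} p \<partial>count_space UNIV)"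
  by (rule nn_integral_count_space_indicator) simp
 also have "\<dots> = (\<integral>\<^sup>+(g, h). indicator (A g) \<xi> * indicator (A h) \<xi> * \<Phi> (Z g \<xi>, Z h \<xi>) \<partial>count_space UNIV)"
  by (rule nn_integral_cong) (auto simp: indicator_def)
 finally show ?thesis .
qed

lemma nn_decay2:
 assumes "\<xi> \<in> space P"
 shows "(\<integral>\<^sup>+(z, z'). ennreal (decay2 z z') \<partial>count_space (pts A Z \<xi> \<times> pts A Z \<xi>)) <= ennreal (K * K)"
proof -
 let ?C = "count_space (pts A Z \<xi>)"
 have "(\<integral>\<^sup>+(z, z'). ennreal (decay2 z z') \<partial>count_space (pts A Z \<xi> \<times> pts A Z \<xi>))
   = (\<integral>\<^sup>+z. (\<integral>\<^sup>+z'. ennreal (decay (fst z)) * ennreal (decay (fst z')) \<partial>?C) \<partial>?C)"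
 proof -
  interpret C: sigma_finite_measure ?C by (rule sigma_finite_measure_count_space_countable[OF countable_pts])
  note pc = pair_measure_countable[OF countable_pts countable_pts, of \<xi> \<xi>]
  have "(%p. ennreal (decay2 (fst p) (snd p))) \<in> borel_measurable (?C \<Otimes>\<^sub>M ?C)" unfolding pc by simp
  from C.nn_integral_fst[OF this] show ?thesis unfolding pc by (simp add: ennreal_mult case_prod_unfold)
 qed
 also have "\<dots> = (\<integral>\<^sup>+z. ennreal (decay (fst z)) \<partial>?C) * (\<integral>\<^sup>+z. ennreal (decay (fst z)) \<partial>?C)"
  by (simp add: nn_integral_cmult nn_integral_multc)
 also have "\<dots> <= ennreal K * ennreal K" using decay_sum[OF assms] by (intro mult_mono) auto
 also have "\<dots> <= ennreal (K * K)" by (cases "0 <= K") (auto simp: ennreal_mult ennreal_neg)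
 finally show ?thesis .
qed

lemma integrable_pts:
 fixes \<phi> :: "(real ^ 'd) \<times> nat => complex"
 assumes \<xi>: "\<xi> \<in> space P" and b: "\<And>z. norm (\<phi> z) <= C * decay (fst z)"
 shows "integrable (count_space (pts A Z \<xi>)) \<phi>"
proof (rule integrable_bound_AE[of _ "%z. C * decay (fst z)"])
 have "integrable (count_space (pts A Z \<xi>)) (%z. decay (fst z))"
  using decay_sum[OF \<xi>] by (auto simp: integrable_iff_bounded le_less_trans)
 then show "integrable (count_space (pts A Z \<xi>)) (%z. C * decay (fst z))" by simp
 show "AE z in count_space (pts A Z \<xi>). norm (\<phi> z) <= norm (C * decay (fst z))"
  by (intro AE_I2) (metis b abs_ge_self order_trans real_norm_def)
qed simp

lemma norm_sum_pts_le:
 fixes \<phi> :: "(real ^ 'd) \<times> nat => complex"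
 assumes \<xi>: "\<xi> \<in> space P" and C: "0 <= C" and b: "\<And>z. norm (\<phi> z) <= C * decay (fst z)"
 shows "norm (\<integral>z. \<phi> z \<partial>count_space (pts A Z \<xi>)) <= C * \<bar>K\<bar>"
proof -
 have "ennreal (norm (\<integral>z. \<phi> z \<partial>count_space (pts A Z \<xi>))) <= (\<integral>\<^sup>+z. norm (\<phi> z) \<partial>count_space (pts A Z \<xi>))"
  by (rule integral_norm_bound_ennreal[OF integrable_pts[OF \<xi> b]])
 also have "\<dots> <= (\<integral>\<^sup>+z. ennreal C * ennreal (decay (fst z)) \<partial>count_space (pts A Z \<xi>))"
  using b C by (intro nn_integral_mono) (simp add: ennreal_mult[symmetric] ennreal_leI)
 also have "\<dots> <= ennreal C * ennreal K"
  using decay_sum[OF \<xi>] by (simp add: nn_integral_cmult mult_left_mono)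
 also have "\<dots> <= ennreal (C * \<bar>K\<bar>)" using C by (simp add: ennreal_mult mult_left_mono ennreal_leI)
 finally show ?thesis using C by (simp add: ennreal_le_iff)
qed

lemma sum_pts_index:
 fixes \<phi> :: "(real ^ 'd) \<times> nat => complex"
 shows "(\<integral>z. \<phi> z \<partial>count_space (pts A Z \<xi>)) = (\<integral>g. indicator (A g) \<xi> *\<^sub>R \<phi> (Z g \<xi>) \<partial>count_space UNIV)"
proof -
 have "(\<integral>z. \<phi> z \<partial>count_space (pts A Z \<xi>)) = (\<integral>g. \<phi> (Z g \<xi>) \<partial>count_space {g. \<xi> \<in> A g})"
  by (rule integral_bij_count_space[OF bij_pts, symmetric])
 also have "count_space {g. \<xi> \<in> A g} = restrict_space (count_space UNIV) {g. \<xi> \<in> A g}"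
  by (simp add: restrict_count_space)
 also have "(\<integral>g. \<phi> (Z g \<xi>) \<partial>restrict_space (count_space UNIV) {g. \<xi> \<in> A g}) = (\<integral>g. indicator {g. \<xi> \<in> A g} g *\<^sub>R \<phi> (Z g \<xi>) \<partial>count_space UNIV)"
  by (rule integral_restrict_space) simp
 also have "\<dots> = (\<integral>g. indicator (A g) \<xi> *\<^sub>R \<phi> (Z g \<xi>) \<partial>count_space UNIV)"
  by (intro lint_cong) (auto split: split_indicator)
 finally show ?thesis .
qed

lemma measurable_index[measurable (raw)]:
 assumes [measurable]: "\<And>g. F g \<in> M \<rightarrow>\<^sub>M N"
 shows "(%(g, \<xi>). F (g :: 'i::countable) \<xi>) \<in> count_space UNIV \<Otimes>\<^sub>M M \<rightarrow>\<^sub>M N"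
 by (rule measurable_pair_measure_countable1) auto

lemma borel_measurable_sum_pts:
 fixes \<Phi> :: "'y => (real ^ 'd) \<times> nat => complex"
 assumes [measurable]: "(%(y, z). \<Phi> y z) \<in> borel_measurable (M \<Otimes>\<^sub>M borel)" and h[measurable]: "h \<in> M \<rightarrow>\<^sub>M P"
 shows "(%y. \<integral>z. \<Phi> y z \<partial>count_space (pts A Z (h y))) \<in> borel_measurable M"
proof -
 have "(%(g, y). indicator (A g) (h y) *\<^sub>R \<Phi> y (Z g (h y))) \<in> borel_measurable (count_space UNIV \<Otimes>\<^sub>M M)"
  by (rule measurable_index) measurable
 then have "(%(y, g). indicator (A g) (h y) *\<^sub>R \<Phi> y (Z g (h y))) \<in> borel_measurable (M \<Otimes>\<^sub>M count_space UNIV)"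
  by (subst measurable_pair_swap_iff) (simp add: case_prod_unfold)
 then show ?thesis unfolding sum_pts_index by (rule GP.M1.borel_measurable_lebesgue_integral)
qed

text \<open>The expected sum over the random set is one integral over indices times configurations.
  The bound on \<open>decay_sum\<close> makes it absolutely convergent, which later allows densities
  and image measures to be formed from it.\<close>

lemma Campbell_index:
 fixes \<Phi> :: "(real ^ 'd) \<times> nat => 'x => complex"
 assumes m[measurable]: "(%(z, \<xi>). \<Phi> z \<xi>) \<in> borel_measurable (borel \<Otimes>\<^sub>M P)"
  and b: "\<And>z \<xi>. \<xi> \<in> space P ==> norm (\<Phi> z \<xi>) <= C * decay (fst z)" and C: "0 <= C"
 shows "integrable (count_space UNIV \<Otimes>\<^sub>M P) (%(g, \<xi>). indicator (A g) \<xi> *\<^sub>R \<Phi> (Z g \<xi>) \<xi>)" (is ?I)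
  and "(\<integral>\<xi>. (\<integral>z. \<Phi> z \<xi> \<partial>count_space (pts A Z \<xi>)) \<partial>P) = (\<integral>(g, \<xi>). indicator (A g) \<xi> *\<^sub>R \<Phi> (Z g \<xi>) \<xi> \<partial>(count_space UNIV \<Otimes>\<^sub>M P))"
proof -
 have mm[measurable]: "(%(g, \<xi>). indicator (A g) \<xi> *\<^sub>R \<Phi> (Z g \<xi>) \<xi>) \<in> borel_measurable (count_space UNIV \<Otimes>\<^sub>M P)"
  by (rule measurable_index) measurable
 show i: ?I
 proof (rule integrableI_bounded[OF mm])
  have "(\<integral>\<^sup>+p. ennreal (norm (case p of (g, \<xi>) => indicator (A g) \<xi> *\<^sub>R \<Phi> (Z g \<xi>) \<xi>)) \<partial>(count_space UNIV \<Otimes>\<^sub>M P))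
   = (\<integral>\<^sup>+\<xi>. (\<integral>\<^sup>+g. ennreal (norm (indicator (A g) \<xi> *\<^sub>R \<Phi> (Z g \<xi>) \<xi>)) \<partial>count_space UNIV) \<partial>P)"
   by (subst GP.nn_integral_snd[symmetric]) (auto simp: case_prod_unfold)
  also have "\<dots> <= (\<integral>\<^sup>+\<xi>. ennreal C * (\<integral>\<^sup>+g. indicator (A g) \<xi> * ennreal (decay (fst (Z g \<xi>))) \<partial>count_space UNIV) \<partial>P)"
  proof -
   have "ennreal (norm (indicator (A g) \<xi> *\<^sub>R \<Phi> (Z g \<xi>) \<xi>)) <= ennreal C * (indicator (A g) \<xi> * ennreal (decay (fst (Z g \<xi>))))"
   if "\<xi> \<in> space P" for g \<xi>
   using b[OF that, of "Z g \<xi>"] C by (cases "\<xi> \<in> A g") (auto simp: ennreal_mult[symmetric] ennreal_leI)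
   then show ?thesis by (subst nn_integral_cmult[symmetric]) (auto intro!: nn_integral_mono)
  qed
  also have "\<dots> = (\<integral>\<^sup>+\<xi>. ennreal C * (\<integral>\<^sup>+z. ennreal (decay (fst z)) \<partial>count_space (pts A Z \<xi>)) \<partial>P)"
   by (simp add: nn_pts)
  also have "\<dots> <= (\<integral>\<^sup>+\<xi>. ennreal C * ennreal K \<partial>P)"
   using decay_sum by (intro nn_integral_mono mult_left_mono) auto
  also have "\<dots> < \<infinity>" by (simp add: emeasure_space_1 ennreal_mult_less_top)
  finally show "(\<integral>\<^sup>+p. ennreal (norm (case p of (g, \<xi>) => indicator (A g) \<xi> *\<^sub>R \<Phi> (Z g \<xi>) \<xi>)) \<partial>(count_space UNIV \<Otimes>\<^sub>M P)) < \<infinity>" .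
 qed
 show "(\<integral>\<xi>. (\<integral>z. \<Phi> z \<xi> \<partial>count_space (pts A Z \<xi>)) \<partial>P) = (\<integral>(g, \<xi>). indicator (A g) \<xi> *\<^sub>R \<Phi> (Z g \<xi>) \<xi> \<partial>(count_space UNIV \<Otimes>\<^sub>M P))"
  unfolding sum_pts_index using GP.integral_snd[OF i] by simp
qed

text \<open>The expected number of ordered pairs of points in a set, pairs of equal points included.
  Indexing by pairs \<open>(g, h)\<close> makes it an image of an honest product measure.\<close>

definition second_moment :: "(((real ^ 'd) \<times> nat) \<times> ((real ^ 'd) \<times> nat)) measure" where
 "second_moment = distr (density (count_space UNIV \<Otimes>\<^sub>M P) (%((g, h), \<xi>). indicator (A g) \<xi> * indicator (A h) \<xi>))
   (borel \<Otimes>\<^sub>M borel) (%((g, h), \<xi>). (Z g \<xi>, Z h \<xi>))"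

lemma sets_second_moment[measurable_cong, simp]: "sets second_moment = sets (borel \<Otimes>\<^sub>M borel)"
 unfolding second_moment_def by simp

lemma measurable_index2:
 fixes F :: "'g => 'g => 'x => 'b"
 assumes [measurable]: "\<And>g h. F g h \<in> P \<rightarrow>\<^sub>M N"
 shows "(%((g, h), \<xi>). F g h \<xi>) \<in> count_space UNIV \<Otimes>\<^sub>M P \<rightarrow>\<^sub>M N"
 by (rule measurable_pair_measure_countable1) (auto simp: case_prod_unfold)

lemma nn_second_moment:
 assumes [measurable]: "\<Phi> \<in> borel_measurable (borel \<Otimes>\<^sub>M borel)"
 shows "(\<integral>\<^sup>+p. \<Phi> p \<partial>second_moment) = (\<integral>\<^sup>+\<xi>. (\<integral>\<^sup>+p. \<Phi> p \<partial>count_space (pts A Z \<xi> \<times> pts A Z \<xi>)) \<partial>P)"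
proof -
 have m1: "(%((g, h), \<xi>). (Z g \<xi>, Z h \<xi>)) \<in> count_space UNIV \<Otimes>\<^sub>M P \<rightarrow>\<^sub>M borel \<Otimes>\<^sub>M borel"
  by (rule measurable_index2) measurable
 have m2: "(%((g, h), \<xi>). indicator (A g) \<xi> * indicator (A h) \<xi> :: ennreal) \<in> borel_measurable (count_space UNIV \<Otimes>\<^sub>M P)"
  by (rule measurable_index2) measurable
 have m3: "(%((g, h), \<xi>). indicator (A g) \<xi> * indicator (A h) \<xi> * \<Phi> (Z g \<xi>, Z h \<xi>)) \<in> borel_measurable (count_space UNIV \<Otimes>\<^sub>M P)"
  by (rule measurable_index2) measurable
 have m4: "(%((g, h), \<xi>). \<Phi> (Z g \<xi>, Z h \<xi>)) \<in> borel_measurable (count_space UNIV \<Otimes>\<^sub>M P)"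
  by (rule measurable_index2) measurable
 have "(\<integral>\<^sup>+p. \<Phi> p \<partial>second_moment) = (\<integral>\<^sup>+((g, h), \<xi>). \<Phi> (Z g \<xi>, Z h \<xi>) \<partial>density (count_space UNIV \<Otimes>\<^sub>M P) (%((g, h), \<xi>). indicator (A g) \<xi> * indicator (A h) \<xi>))"
  unfolding second_moment_def using m1 by (subst nn_integral_distr) (auto simp: case_prod_unfold)
 also have "\<dots> = (\<integral>\<^sup>+((g, h), \<xi>). indicator (A g) \<xi> * indicator (A h) \<xi> * \<Phi> (Z g \<xi>, Z h \<xi>) \<partial>(count_space UNIV \<Otimes>\<^sub>M P))"
  by (subst nn_integral_density[OF m2 m4]) (simp add: case_prod_unfold)
 also have "\<dots> = (\<integral>\<^sup>+\<xi>. (\<integral>\<^sup>+(g, h). indicator (A g) \<xi> * indicator (A h) \<xi> * \<Phi> (Z g \<xi>, Z h \<xi>) \<partial>count_space UNIV) \<partial>P)"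
  using GGP.nn_integral_snd[OF m3] by (simp add: case_prod_unfold)
 finally show ?thesis unfolding nn_pts2 .
qed

lemma integrable_decay2: "integrable second_moment (%(z, z'). decay2 z z')"
proof (rule integrableI_bounded)
 have "(\<integral>\<^sup>+p. ennreal (norm (case p of (z, z') => decay2 z z')) \<partial>second_moment)
   = (\<integral>\<^sup>+\<xi>. (\<integral>\<^sup>+(z, z'). ennreal (decay2 z z') \<partial>count_space (pts A Z \<xi> \<times> pts A Z \<xi>)) \<partial>P)"
  by (subst nn_second_moment) (auto simp: case_prod_unfold abs_mult)
 also have "\<dots> <= (\<integral>\<^sup>+\<xi>. ennreal (K * K) \<partial>P)" by (intro nn_integral_mono nn_decay2)
 also have "\<dots> < \<infinity>" by (simp add: emeasure_space_1)
 finally show "(\<integral>\<^sup>+p. ennreal (norm (case p of (z, z') => decay2 z z')) \<partial>second_moment) < \<infinity>" .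
qed measurable

lemma sigma_finite_second_moment: "sigma_finite_measure second_moment"
proof
 have sp: "space second_moment = UNIV"
  using sets_eq_imp_space_eq[OF sets_second_moment] by (simp add: space_pair_measure)
 let ?f = "%(z, z'). decay2 z z' :: real"
 define E :: "nat => (((real ^ 'd) \<times> nat) \<times> ((real ^ 'd) \<times> nat)) set"
  where "E n = {p \<in> space second_moment. 1 / real (Suc n) <= ?f p}" for n
 have Es: "E n \<in> sets second_moment" for n unfolding E_def by measurable
 have fin: "(\<integral>\<^sup>+p. ennreal (?f p) \<partial>second_moment) < \<infinity>"
  using integrable_decay2 by (simp add: integrable_iff_bounded abs_mult case_prod_unfold)
 have "emeasure second_moment (E n) < \<infinity>" for n
 proof -
  have "emeasure second_moment (E n) = (\<integral>\<^sup>+p. indicator (E n) p \<partial>second_moment)" using Es by simp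
  also have "\<dots> <= (\<integral>\<^sup>+p. ennreal (real (Suc n)) * ennreal (?f p) \<partial>second_moment)"
  proof (intro nn_integral_mono)
   fix p
   have "1 <= real (Suc n) * ?f p" if "p \<in> E n"
   using that unfolding E_def by (simp add: divide_le_eq mult.commute)
   then have "ennreal 1 <= ennreal (real (Suc n) * ?f p)" if "p \<in> E n" using that by (intro ennreal_leI) auto
   then show "indicator (E n) p <= ennreal (real (Suc n)) * ennreal (?f p)"
   by (auto simp: indicator_def ennreal_mult' split: prod.splits)
  qed
  also have "\<dots> = ennreal (real (Suc n)) * (\<integral>\<^sup>+p. ennreal (?f p) \<partial>second_moment)" by (rule nn_integral_cmult) measurable
  also have "\<dots> < \<infinity>" using fin by (simp add: ennreal_mult_less_top)
  finally show ?thesis .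
 qed
 moreover have "(\<Union>n. E n) = space second_moment"
 proof (intro set_eqI iffI)
  fix p assume p: "p \<in> space second_moment"
  have "0 < ?f p" by (auto split: prod.splits simp: decay_pos)
  then obtain n where "1 / real (Suc n) < ?f p" using reals_Archimedean by (auto simp: inverse_eq_divide)
  then show "p \<in> (\<Union>n. E n)" using p unfolding E_def by (auto intro!: exI[of _ n] less_imp_le)
 qed (auto simp: E_def)
 ultimately show "\<exists>F. countable F \<and> F \<subseteq> sets second_moment \<and> \<Union> F = space second_moment \<and> (\<forall>a\<in>F. emeasure second_moment a \<noteq> \<infinity>)"
  using Es by (intro exI[of _ "range E"]) (auto simp: less_top)
qed

lemma integrable_second_moment:
 fixes \<Theta> :: "(real ^ 'd) \<times> nat => (real ^ 'd) \<times> nat => complex"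
 assumes m: "case_prod \<Theta> \<in> borel_measurable (borel \<Otimes>\<^sub>M borel)" and b: "\<And>z z'. norm (\<Theta> z z') <= C * decay2 z z'"
 shows "integrable second_moment (case_prod \<Theta>)"
proof (rule integrable_bound_AE[of _ "%(z, z'). C * decay2 z z'"])
 show "integrable second_moment (%(z, z'). C * decay2 z z')"
  using integrable_mult_right[OF integrable_decay2, of C] by (simp add: case_prod_unfold)
 show "case_prod \<Theta> \<in> borel_measurable second_moment" using m by measurable
 show "AE p in second_moment. norm (case_prod \<Theta> p) <= norm (case p of (z, z') => C * decay2 z z')"
  by (intro AE_I2) (simp add: case_prod_unfold order_trans[OF b abs_ge_self])
qed

text \<open>All three parts come from lifting the integral to index pairs, where the product
  structure provides Fubini and measurability.\<close>

lemma integral_second_moment: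
 fixes \<Theta> :: "(real ^ 'd) \<times> nat => (real ^ 'd) \<times> nat => complex"
 assumes m[measurable]: "case_prod \<Theta> \<in> borel_measurable (borel \<Otimes>\<^sub>M borel)" and b: "\<And>z z'. norm (\<Theta> z z') <= C * decay2 z z'"
 shows "(\<integral>p. case_prod \<Theta> p \<partial>second_moment) = (\<integral>\<xi>. (\<integral>p. case_prod \<Theta> p \<partial>count_space (pts A Z \<xi> \<times> pts A Z \<xi>)) \<partial>P)"
  and "\<xi> \<in> space P ==> integrable (count_space (pts A Z \<xi> \<times> pts A Z \<xi>)) (case_prod \<Theta>)"
  and "(%\<xi>. \<integral>p. case_prod \<Theta> p \<partial>count_space (pts A Z \<xi> \<times> pts A Z \<xi>)) \<in> borel_measurable P"
proof -
 let ?w = "%((g, h), \<xi>). indicator (A g) \<xi> * indicator (A h) \<xi> :: real"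
 let ?G = "%((g, h), \<xi>). (indicator (A g) \<xi> * indicator (A h) \<xi>) *\<^sub>R \<Theta> (Z g \<xi>) (Z h \<xi>)"
 have m1: "(%((g, h), \<xi>). (Z g \<xi>, Z h \<xi>)) \<in> count_space UNIV \<Otimes>\<^sub>M P \<rightarrow>\<^sub>M borel \<Otimes>\<^sub>M borel"
  by (rule measurable_index2) measurable
 have m2: "?w \<in> borel_measurable (count_space UNIV \<Otimes>\<^sub>M P)"
  by (rule measurable_index2) measurable
 have m4: "(%((g, h), \<xi>). \<Theta> (Z g \<xi>) (Z h \<xi>)) \<in> borel_measurable (count_space UNIV \<Otimes>\<^sub>M P)"
  by (rule measurable_index2) measurable
 have m5: "?G \<in> borel_measurable (count_space UNIV \<Otimes>\<^sub>M P)"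
  by (rule measurable_index2) measurable
 have sm: "second_moment = distr (density (count_space UNIV \<Otimes>\<^sub>M P) (%p. ennreal (?w p))) (borel \<Otimes>\<^sub>M borel) (%((g, h), \<xi>). (Z g \<xi>, Z h \<xi>))"
  unfolding second_moment_def by (simp add: case_prod_unfold ennreal_mult ennreal_indicator)
 have "integrable (density (count_space UNIV \<Otimes>\<^sub>M P) (%p. ennreal (?w p))) (%p. case_prod \<Theta> (case p of ((g, h), \<xi>) => (Z g \<xi>, Z h \<xi>)))"
  using integrable_second_moment[OF m b] unfolding sm using m1 by (subst (asm) integrable_distr_eq) (auto simp: case_prod_unfold)
 then have i: "integrable (count_space UNIV \<Otimes>\<^sub>M P) ?G"
  using m2 m4 by (subst (asm) integrable_density) (auto simp: case_prod_unfold)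
 have "(\<integral>p. case_prod \<Theta> p \<partial>second_moment) = (\<integral>p. case_prod \<Theta> (case p of ((g, h), \<xi>) => (Z g \<xi>, Z h \<xi>)) \<partial>density (count_space UNIV \<Otimes>\<^sub>M P) (%p. ennreal (?w p)))"
  unfolding sm using m1 by (subst integral_distr) (auto simp: case_prod_unfold)
 also have "\<dots> = (\<integral>p. ?G p \<partial>(count_space UNIV \<Otimes>\<^sub>M P))"
  using m2 m4 by (subst integral_density) (auto simp: case_prod_unfold)
 also have "\<dots> = (\<integral>\<xi>. (\<integral>q. ?G (q, \<xi>) \<partial>count_space UNIV) \<partial>P)"
  using GGP.integral_snd[of "%q \<xi>. ?G (q, \<xi>)"] i by (simp add: case_prod_unfold)
 finally have "(\<integral>p. case_prod \<Theta> p \<partial>second_moment) = (\<integral>\<xi>. (\<integral>q. ?G (q, \<xi>) \<partial>count_space UNIV) \<partial>P)" .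
 moreover have index: "(\<integral>q. ?G (q, \<xi>) \<partial>count_space UNIV) = (\<integral>p. case_prod \<Theta> p \<partial>count_space (pts A Z \<xi> \<times> pts A Z \<xi>))" for \<xi>
 proof -
  let ?S = "{(g, h). \<xi> \<in> A g \<and> \<xi> \<in> A h}"
  have "(\<integral>p. case_prod \<Theta> p \<partial>count_space (pts A Z \<xi> \<times> pts A Z \<xi>)) = (\<integral>q. case_prod \<Theta> ((%(g, h). (Z g \<xi>, Z h \<xi>)) q) \<partial>count_space ?S)"
   by (rule integral_bij_count_space[OF bij_pts2, symmetric])
  also have "count_space ?S = restrict_space (count_space UNIV) ?S"
   by (simp add: restrict_count_space)
  also have "(\<integral>q. case_prod \<Theta> ((%(g, h). (Z g \<xi>, Z h \<xi>)) q) \<partial>restrict_space (count_space UNIV) ?S)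
   = (\<integral>q. indicator ?S q *\<^sub>R case_prod \<Theta> ((%(g, h). (Z g \<xi>, Z h \<xi>)) q) \<partial>count_space UNIV)"
   by (rule integral_restrict_space) simp
  also have "\<dots> = (\<integral>q. ?G (q, \<xi>) \<partial>count_space UNIV)"
   by (intro lint_cong) (auto simp: indicator_def)
  finally show ?thesis by simp
 qed
 ultimately show "(\<integral>p. case_prod \<Theta> p \<partial>second_moment) = (\<integral>\<xi>. (\<integral>p. case_prod \<Theta> p \<partial>count_space (pts A Z \<xi> \<times> pts A Z \<xi>)) \<partial>P)"
  by simp
 have "(%\<xi>. \<integral>q. ?G (q, \<xi>) \<partial>count_space UNIV) \<in> borel_measurable P"
  using GGP.integrable_snd[of "%q \<xi>. ?G (q, \<xi>)"] i by (auto dest: borel_measurable_integrable)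
 then show "(%\<xi>. \<integral>p. case_prod \<Theta> p \<partial>count_space (pts A Z \<xi> \<times> pts A Z \<xi>)) \<in> borel_measurable P"
  unfolding index .
 show "integrable (count_space (pts A Z \<xi> \<times> pts A Z \<xi>)) (case_prod \<Theta>)" if "\<xi> \<in> space P"
 proof (rule integrable_bound_AE[of _ "%(z, z'). C * decay2 z z'"])
  have "integrable (count_space (pts A Z \<xi> \<times> pts A Z \<xi>)) (%(z, z'). decay2 z z')"
   using nn_decay2[OF that] by (auto simp: integrable_iff_bounded abs_mult case_prod_unfold le_less_trans)
  from integrable_mult_right[OF this, of C]
  show "integrable (count_space (pts A Z \<xi> \<times> pts A Z \<xi>)) (%(z, z'). C * decay2 z z')" by (simp add: case_prod_unfold)
  show "AE p in count_space (pts A Z \<xi> \<times> pts A Z \<xi>). norm (case_prod \<Theta> p) <= norm (case p of (z, z') => C * decay2 z z')"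
   by (intro AE_I2) (simp add: case_prod_unfold order_trans[OF b abs_ge_self])
 qed simp
qed

text \<open>Moving both points by \<open>u\<close> is the same as replacing \<open>\<xi>\<close> by
  \<open>\<tau> u \<xi>\<close>, whose distribution is that of \<open>\<xi>\<close>.\<close>

lemma second_moment_shift:
 fixes \<Theta> :: "(real ^ 'd) \<times> nat => (real ^ 'd) \<times> nat => complex"
 assumes m[measurable]: "case_prod \<Theta> \<in> borel_measurable (borel \<Otimes>\<^sub>M borel)" and b: "\<And>z z'. norm (\<Theta> z z') <= C * decay2 z z'"
 shows "(\<integral>(z, z'). \<Theta> (displace u z) (displace u z') \<partial>second_moment) = (\<integral>p. case_prod \<Theta> p \<partial>second_moment)"
proof -
 let ?c = "1 / decay u * (1 / decay u)"
 \<comment> \<open>Keeps the translated integrand under a multiple of \<open>decay2\<close>, with a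
   constant depending on \<open>u\<close>.\<close>
 have dle: "decay (u + x) <= 1 / decay u * decay x" for x
  using decay_submult[of "- u" "u + x"] decay_pos[of u] by (simp add: field_simps)
 have "0 <= C"
 proof (rule ccontr)
  assume "\<not> 0 <= C"
  then have "C * decay2 (0 :: real ^ 'd, 0) (0 :: real ^ 'd, 0) < 0"
   by (intro mult_neg_pos mult_pos_pos decay_pos) auto
  then show False using order_trans[OF norm_ge_zero b[of "(0, 0)" "(0, 0)"]] by simp
 qed
 note C = this
 have b': "norm (\<Theta> (displace u z) (displace u z')) <= (C * ?c) * decay2 z z'" for z z'
 proof -
  have "norm (\<Theta> (displace u z) (displace u z')) <= C * (decay (u + fst z) * decay (u + fst z'))" using b[of "displace u z" "displace u z'"] by simp
  also have "\<dots> <= C * ((1 / decay u * decay (fst z)) * (1 / decay u * decay (fst z')))"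
   using C by (intro mult_left_mono mult_mono dle) auto
  finally show ?thesis by (simp only: mult.assoc mult.commute mult.left_commute)
 qed
 have "(\<integral>(z, z'). \<Theta> (displace u z) (displace u z') \<partial>second_moment)
   = (\<integral>\<xi>. (\<integral>(z, z'). \<Theta> (displace u z) (displace u z') \<partial>count_space (pts A Z \<xi> \<times> pts A Z \<xi>)) \<partial>P)"
  by (rule integral_second_moment(1)[OF _ b']) measurable
 also have "\<dots> = (\<integral>\<xi>. (\<integral>p. case_prod \<Theta> p \<partial>count_space (pts A Z (\<tau> u \<xi>) \<times> pts A Z (\<tau> u \<xi>))) \<partial>P)"
 proof -
  have "(\<integral>(z, z'). \<Theta> (displace u z) (displace u z') \<partial>count_space (pts A Z \<xi> \<times> pts A Z \<xi>)) = (\<integral>p. case_prod \<Theta> p \<partial>count_space (pts A Z (\<tau> u \<xi>) \<times> pts A Z (\<tau> u \<xi>)))"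
   if \<xi>: "\<xi> \<in> space P" for \<xi>
  proof -
   have "bij_betw (map_prod (displace u) (displace u)) (pts A Z \<xi> \<times> pts A Z \<xi>) (pts A Z (\<tau> u \<xi>) \<times> pts A Z (\<tau> u \<xi>))"
   unfolding equivariant[OF \<xi>] by (intro bij_betw_map_prod inj_on_imp_bij_betw inj_displace)
   from integral_bij_count_space[OF this, of "case_prod \<Theta>"] show ?thesis by (simp add: case_prod_unfold map_prod_def)
  qed
  then show ?thesis by (rule lint_cong[OF refl])
 qed
 also have "\<dots> = (\<integral>\<xi>. (\<integral>p. case_prod \<Theta> p \<partial>count_space (pts A Z \<xi> \<times> pts A Z \<xi>)) \<partial>distr P P (\<tau> u))"
  by (rule integral_distr[symmetric]) (auto intro: integral_second_moment(3)[OF m b])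
 also have "\<dots> = (\<integral>p. case_prod \<Theta> p \<partial>second_moment)"
  unfolding stationary by (rule integral_second_moment(1)[OF m b, symmetric])
 finally show ?thesis .
qed

end

section \<open>The correlation functional\<close>

locale weighted_point_family = point_family P A Z K \<tau>
 for P :: "'x measure" and A :: "'g::countable => 'x set"
  and Z :: "'g => 'x => (real ^ 'd::finite) \<times> nat" and K :: real
  and \<tau> :: "real ^ 'd => 'x => 'x" +
 fixes w :: "nat => real" and W :: real and B :: "(real ^ 'd) set"
 assumes W: "\<bar>w i\<bar> <= W" and B[measurable]: "B \<in> sets borel" and bounded_B: "bounded B"
  and B_pos: "emeasure lborel B > 0"
begin

definition vol :: real where "vol = measure lborel B"

lemma B_finite: "emeasure lborel B < \<infinity>"
 by (rule emeasure_bounded_finite[OF bounded_B])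

lemma emeasure_B: "emeasure lborel B = ennreal vol"
 unfolding vol_def using B_finite by (simp add: emeasure_eq_ennreal_measure)

lemma vol_pos: "vol > 0"
 using B_pos unfolding emeasure_B by simp

lemma W_nonneg: "0 <= W" using order_trans[OF abs_ge_zero W] .

text \<open>The inverse of a lower bound of \<open>decay\<close> on the bounded set
  \<open>B\<close>. It converts the condition that a point lies in \<open>B\<close> into a factor
  \<open>decay\<close>.\<close>

definition \<beta> :: real where "\<beta> = (SOME c. c \<ge> 1 \<and> (\<forall>x\<in>B. 1 <= c * decay x))"

lemma \<beta>: "\<beta> \<ge> 1" "x \<in> B ==> 1 <= \<beta> * decay x"
proof -
 obtain R where R: "\<And>x. x \<in> B ==> norm x <= R" using bounded_B unfolding bounded_iff by blast
 let ?c = "(1 + \<bar>R\<bar>) ^ (2 * CARD('d))"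
 have "1 <= ?c * decay x" if "x \<in> B" for x
 proof -
  have "norm x <= \<bar>R\<bar>" using R[OF that] by linarith
  then have "(1 + norm x) ^ (2 * CARD('d)) <= ?c" by (intro power_mono) auto
  then show ?thesis unfolding decay_def by (simp add: pos_le_divide_eq add_pos_nonneg)
 qed
 moreover have "?c \<ge> 1" by (intro one_le_power) simp
 ultimately have "\<exists>c. c \<ge> 1 \<and> (\<forall>x\<in>B. 1 <= c * decay x)" by blast
 from someI_ex[OF this] show "\<beta> \<ge> 1" "x \<in> B ==> 1 <= \<beta> * decay x" unfolding \<beta>_def by auto
qed

lemma indicator_B_le: "indicator B x <= \<beta> * decay x"
 using \<beta>(2)[of x] \<beta>(1) by (auto simp: indicator_def)

text \<open>A function of the difference of two points is not summable over all pairs, but it is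
  once the first point is confined to \<open>B\<close>: the difference is then comparable to the
  second point.\<close>

lemma decay_diff_B: "indicator B x * decay (y - x) <= \<beta>\<^sup>2 * (decay x * decay y)"
proof (cases "x \<in> B")
 case True
 have "1 * decay (y - x) <= (\<beta> * decay x) * decay (y - x)" using \<beta>(2)[OF True] by (intro mult_right_mono) auto
 also have "\<dots> = \<beta> * (decay x * decay (y - x))" by simp
 also have "\<dots> <= \<beta> * decay y" using decay_submult[of x "y - x"] \<beta>(1) by (intro mult_left_mono) auto
 also have "\<dots> <= \<beta> * ((\<beta> * decay x) * decay y)"
  using \<beta>(1) mult_right_mono[OF \<beta>(2)[OF True], of "decay y"] by (intro mult_left_mono) auto
 finally show ?thesis using True by (simp add: power2_eq_square mult.assoc mult.left_commute)
qed simp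

text \<open>Compares \<open>decay\<close> at \<open>u + x\<close> with \<open>decay\<close> at
  \<open>u\<close>; this gives integrability in the translation \<open>u\<close>.\<close>

lemma decay_shift_B: "indicator B x * decay (u + x) <= \<beta> * decay u"
proof (cases "x \<in> B")
 case True
 have "1 * decay (u + x) <= (\<beta> * decay x) * decay (u + x)" using \<beta>(2)[OF True] by (intro mult_right_mono) auto
 also have "\<dots> = \<beta> * (decay (u + x) * decay (- x))" by simp
 also have "\<dots> <= \<beta> * decay (u + x + - x)" using \<beta>(1) by (intro mult_left_mono decay_submult) auto
 finally show ?thesis using True by simp
qed (use \<beta>(1) in simp)

definition count :: "(real ^ 'd => complex) => 'x => complex" where
 "count f \<xi> = (\<integral>z. of_real (w (snd z)) * f (fst z) \<partial>count_space (pts A Z \<xi>))"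

text \<open>The Palm first moment in explicit form. Working with pairs of points avoids the signed
  Palm measure until the two are identified in \<open>signed_integral_palm\<close>.\<close>

definition corr :: "(real ^ 'd => complex) => complex" where
 "corr \<psi> = (1 / of_real vol) * (\<integral>(z, z'). indicator B (fst z) * of_real (w (snd z) * w (snd z')) * \<psi> (fst z' - fst z) \<partial>second_moment)"

lemma ww_le: "\<bar>w i * w j\<bar> <= W\<^sup>2"
 unfolding abs_mult power2_eq_square by (intro mult_mono W W_nonneg) auto

lemma corr_integrand:
 fixes \<psi> :: "real ^ 'd => complex"
 assumes [measurable]: "\<psi> \<in> borel_measurable borel" and b: "\<And>x. norm (\<psi> x) <= C * decay x"
 shows "(%(z, z'). indicator B (fst z) * of_real (w (snd z) * w (snd z')) * \<psi> (fst z' - fst z))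
   \<in> borel_measurable (borel \<Otimes>\<^sub>M (borel :: ((real ^ 'd) \<times> nat) measure))"
  and "norm (indicator B (fst z) * of_real (w (snd z) * w (snd z')) * \<psi> (fst z' - fst z)) <= (W\<^sup>2 * (C * \<beta>\<^sup>2)) * decay2 z z'"
proof -
 show "(%(z, z'). indicator B (fst z) * of_real (w (snd z) * w (snd z')) * \<psi> (fst z' - fst z))
   \<in> borel_measurable (borel \<Otimes>\<^sub>M (borel :: ((real ^ 'd) \<times> nat) measure))" by measurable
 have C: "0 <= C"
 proof (rule ccontr)
  assume "\<not> 0 <= C"
  then have "C * decay (0 :: real ^ 'd) < 0" by (intro mult_neg_pos decay_pos) auto
  then show False using order_trans[OF norm_ge_zero b[of 0]] by simp
 qed
 have "norm (indicator B (fst z) * of_real (w (snd z) * w (snd z')) * \<psi> (fst z' - fst z))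
   = \<bar>w (snd z) * w (snd z')\<bar> * (indicator B (fst z) * norm (\<psi> (fst z' - fst z)))"
  by (simp add: norm_mult abs_mult split: split_indicator)
 also have "\<dots> <= W\<^sup>2 * (indicator B (fst z) * (C * decay (fst z' - fst z)))"
  by (intro mult_mono ww_le mult_left_mono b mult_nonneg_nonneg) auto
 also have "\<dots> = W\<^sup>2 * (C * (indicator B (fst z) * decay (fst z' - fst z)))" by simp
 also have "\<dots> <= W\<^sup>2 * (C * (\<beta>\<^sup>2 * decay2 z z'))"
  using C by (intro mult_left_mono decay_diff_B) auto
 finally show "norm (indicator B (fst z) * of_real (w (snd z) * w (snd z')) * \<psi> (fst z' - fst z)) <= (W\<^sup>2 * (C * \<beta>\<^sup>2)) * decay2 z z'"
  by (simp add: mult.assoc)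
qed

lemma integral_pts2:
 assumes i: "integrable (count_space (pts A Z \<xi> \<times> pts A Z \<xi>)) (case_prod \<Theta>)"
 shows "(\<integral>p. case_prod \<Theta> p \<partial>count_space (pts A Z \<xi> \<times> pts A Z \<xi>))
  = (\<integral>z. (\<integral>z'. (\<Theta> z z' :: complex) \<partial>count_space (pts A Z \<xi>)) \<partial>count_space (pts A Z \<xi>))"
proof -
 interpret C: pair_sigma_finite "count_space (pts A Z \<xi>)" "count_space (pts A Z \<xi>)"
  by (intro pair_sigma_finite.intro sigma_finite_measure_count_space_countable countable_pts)
 note pc = pair_measure_countable[OF countable_pts countable_pts, of \<xi> \<xi>]
 show ?thesis using C.integral_fst[of \<Theta>] i unfolding pc by simp
qed

text \<open>Averaging the identity \<open>\<integral> 1\<^sub>B(x - u) du = vol\<close> against the second moment and shifting by \<open>u\<close>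
 expresses the variance through pairs of points the first of which lies in \<open>B\<close>.\<close>

lemma expectation_count_square:
 assumes m[measurable]: "f \<in> borel_measurable borel" and b: "\<And>x. norm (f x) <= C * (decay x)\<^sup>2"
 shows "(\<integral>\<xi>. of_real ((cmod (count f \<xi>))\<^sup>2) \<partial>P) = corr (autocorrelation f)"
proof -
 have C: "0 <= C"
 proof (rule ccontr)
  assume "\<not> 0 <= C"
  then have "C * (decay (0 :: real ^ 'd))\<^sup>2 < 0" by (intro mult_neg_pos zero_less_power decay_pos) auto
  then show False using order_trans[OF norm_ge_zero b[of 0]] by simp
 qed
 have d2: "(decay x)\<^sup>2 <= decay x" for x :: "real ^ 'd"
  unfolding power2_eq_square by (intro mult_left_le_one_le decay_le_1 decay_nonneg)
 have b1: "norm (f x) <= C * decay x" for x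
  by (rule order_trans[OF b mult_left_mono[OF d2 C]])
 interpret SM: sigma_finite_measure second_moment by (rule sigma_finite_second_moment)
 let ?ww = "%z z'. complex_of_real (w (snd z) * w (snd z'))"
 let ?T = "%z z'. ?ww z z' * (f (fst z) * cnj (f (fst z')))"
 have Tm: "case_prod ?T \<in> borel_measurable (borel \<Otimes>\<^sub>M (borel :: ((real ^ 'd) \<times> nat) measure))" by measurable
 have Tb: "norm (?T z z') <= (W\<^sup>2 * (C * C)) * decay2 z z'" for z z'
 proof -
  have "norm (?T z z') = \<bar>w (snd z) * w (snd z')\<bar> * (norm (f (fst z)) * norm (f (fst z')))" by (simp add: norm_mult abs_mult)
  also have "\<dots> <= W\<^sup>2 * ((C * decay (fst z)) * (C * decay (fst z')))"
   using C by (intro mult_mono ww_le b1) auto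
  finally show ?thesis by (simp only: mult.assoc mult.left_commute)
 qed
 have "(\<integral>\<xi>. of_real ((cmod (count f \<xi>))\<^sup>2) \<partial>P) = (\<integral>\<xi>. (\<integral>p. case_prod ?T p \<partial>count_space (pts A Z \<xi> \<times> pts A Z \<xi>)) \<partial>P)"
 proof (rule lint_cong[OF refl])
  fix \<xi> assume \<xi>: "\<xi> \<in> space P"
  have "(\<integral>p. case_prod ?T p \<partial>count_space (pts A Z \<xi> \<times> pts A Z \<xi>))
   = (\<integral>z. (\<integral>z'. (of_real (w (snd z)) * f (fst z)) * cnj (of_real (w (snd z')) * f (fst z')) \<partial>count_space (pts A Z \<xi>)) \<partial>count_space (pts A Z \<xi>))"
   by (subst integral_pts2[OF integral_second_moment(2)[OF Tm Tb \<xi>]]) (simp add: mult.assoc mult.left_commute)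
  also have "\<dots> = count f \<xi> * cnj (count f \<xi>)"
   unfolding integral_mult_right_zero integral_mult_left_zero Bochner_Integration.integral_cnj count_def ..
  finally show "of_real ((cmod (count f \<xi>))\<^sup>2) = (\<integral>p. case_prod ?T p \<partial>count_space (pts A Z \<xi> \<times> pts A Z \<xi>))"
   by (simp add: complex_norm_square del: of_real_power)
 qed
 also have "\<dots> = (\<integral>p. case_prod ?T p \<partial>second_moment)" by (rule integral_second_moment(1)[OF Tm Tb, symmetric])
 finally have var: "(\<integral>\<xi>. of_real ((cmod (count f \<xi>))\<^sup>2) \<partial>P) = (\<integral>p. case_prod ?T p \<partial>second_moment)" .
 have id: "integrable lborel (%u :: real ^ 'd. decay u)" by (rule integrable_decay)
 let ?M = "lborel :: (real ^ 'd) measure"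
 \<comment> \<open>\<open>?G\<close> keeps the first point in \<open>u + B\<close>;
   \<open>?H\<close> is \<open>?G\<close> after both points have been moved by \<open>u\<close>, so
   that the first point lies in \<open>B\<close>.\<close>
 let ?G = "%u p. indicator B (fst (fst p) - u) * ?T (fst p) (snd p)"
 let ?H = "%u p. indicator B (fst (fst p)) * ?T (displace u (fst p)) (displace u (snd p))"
 have id2: "integrable second_moment (%p. c * decay2 (fst p) (snd p))" for c
  using integrable_mult_right[OF integrable_decay2, of c] by (simp add: case_prod_unfold)
 have Gm: "case_prod ?G \<in> borel_measurable (?M \<Otimes>\<^sub>M second_moment)" by measurable
 \<comment> \<open>The square in the bound on \<open>f\<close> is spent here: one factor
   \<open>decay\<close> of the first point is traded for \<open>decay u\<close>, the rest forms
   \<open>decay2\<close>.\<close>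
 have Gb: "norm (?G u p) <= decay u * ((W\<^sup>2 * (C * C) * \<beta>) * decay2 (fst p) (snd p))" for u p
 proof -
  let ?x = "fst (fst p)" and ?y = "fst (snd p)"
  have 1: "indicator B (?x - u) * decay ?x <= \<beta> * decay u" using decay_shift_B[of "?x - u" u] by simp
  have "norm (?G u p) = \<bar>w (snd (fst p)) * w (snd (snd p))\<bar> * ((indicator B (?x - u) * norm (f ?x)) * norm (f ?y))"
   by (simp add: norm_mult abs_mult split: split_indicator)
  also have "\<dots> <= W\<^sup>2 * ((indicator B (?x - u) * (C * (decay ?x)\<^sup>2)) * (C * decay ?y))"
   using C by (intro mult_mono ww_le b b1 mult_left_mono mult_nonneg_nonneg) auto
  also have "\<dots> = (W\<^sup>2 * (C * C)) * ((indicator B (?x - u) * decay ?x) * (decay ?x * decay ?y))"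
   by (simp add: power2_eq_square)
  also have "\<dots> <= (W\<^sup>2 * (C * C)) * ((\<beta> * decay u) * (decay ?x * decay ?y))"
   using C by (intro mult_left_mono mult_right_mono 1) auto
  finally show ?thesis by (simp only: mult.assoc mult.left_commute)
 qed
 have Hm: "case_prod ?H \<in> borel_measurable (?M \<Otimes>\<^sub>M second_moment)" by measurable
 have Hb: "norm (?H u p) <= decay u * ((W\<^sup>2 * (C * C) * (\<beta> * \<beta>\<^sup>2)) * decay2 (fst p) (snd p))" for u p
 proof -
  let ?x = "fst (fst p)" and ?y = "fst (snd p)"
  have 1: "indicator B ?x * decay (u + ?x) <= \<beta> * decay u" by (rule decay_shift_B)
  \<comment> \<open>The product of the two translated weights is bounded independently of
    \<open>u\<close> by the weight of the difference, to which \<open>decay_diff_B\<close>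
    applies.\<close>
  have 2: "indicator B ?x * (decay (u + ?x) * decay (u + ?y)) <= \<beta>\<^sup>2 * (decay ?x * decay ?y)"
  proof -
   have "decay (u + ?x) * decay (u + ?y) <= decay (?y - ?x)"
   using decay_submult[of "- (u + ?x)" "u + ?y"] unfolding decay_minus by simp
   then have "indicator B ?x * (decay (u + ?x) * decay (u + ?y)) <= indicator B ?x * decay (?y - ?x)"
   by (intro mult_left_mono) auto
   then show ?thesis using decay_diff_B[of ?x ?y] by linarith
  qed
  have "norm (?H u p) = \<bar>w (snd (fst p)) * w (snd (snd p))\<bar> * (indicator B ?x * (norm (f (u + ?x)) * norm (f (u + ?y))))"
   by (simp add: norm_mult abs_mult split: split_indicator)
  also have "\<dots> <= W\<^sup>2 * (indicator B ?x * ((C * (decay (u + ?x))\<^sup>2) * (C * decay (u + ?y))))"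
   using C by (intro mult_mono ww_le b b1 mult_left_mono mult_nonneg_nonneg) auto
  also have "\<dots> = (W\<^sup>2 * (C * C)) * ((indicator B ?x * decay (u + ?x)) * (indicator B ?x * (decay (u + ?x) * decay (u + ?y))))"
   by (simp add: power2_eq_square split: split_indicator)
  also have "\<dots> <= (W\<^sup>2 * (C * C)) * ((\<beta> * decay u) * (\<beta>\<^sup>2 * (decay ?x * decay ?y)))"
   using C \<beta>(1) by (intro mult_left_mono mult_mono 1 2) auto
  finally show ?thesis by (simp only: mult.assoc mult.left_commute)
 qed
 note FG = Fubini_dominated(2)[OF sigma_finite_lborel sigma_finite_second_moment Gm id id2 Gb]
 note FH = Fubini_dominated(2)[OF sigma_finite_lborel sigma_finite_second_moment Hm id id2 Hb]
 have "of_real vol * (\<integral>p. case_prod ?T p \<partial>second_moment) = (\<integral>p. (\<integral>u. ?G u p \<partial>?M) \<partial>second_moment)"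
 proof -
  have "(\<integral>u. indicator B (x - u) \<partial>?M) = complex_of_real vol" for x
  proof -
   have "(\<integral>u. indicator B (x - u) \<partial>?M) = (\<integral>u. (indicator B u :: complex) \<partial>?M)"
   by (rule lborel_integral_reflect) measurable
   also have "\<dots> = of_real (\<integral>u. indicator B u \<partial>?M)"
   by (subst integral_complex_of_real[symmetric], rule lint_cong) (auto split: split_indicator)
   also have "(\<integral>u. indicator B u \<partial>?M) = vol" unfolding vol_def by simp
   finally show ?thesis .
  qed
  then show ?thesis by (simp add: case_prod_unfold)
 qed
 also have "\<dots> = (\<integral>u. (\<integral>p. ?G u p \<partial>second_moment) \<partial>?M)" by (rule FG)
 also have "\<dots> = (\<integral>u. (\<integral>p. ?H u p \<partial>second_moment) \<partial>?M)"
 proof (rule lint_cong[OF refl])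
  fix u
  have "norm (indicator B (fst z - u) * ?T z z') <= (W\<^sup>2 * (C * C)) * decay2 z z'" for z z'
   using Tb[of z z'] order_trans[OF norm_ge_zero Tb[of z z']] by (simp add: norm_mult abs_mult split: split_indicator)
  from second_moment_shift[OF _ this, of u]
  show "(\<integral>p. ?G u p \<partial>second_moment) = (\<integral>p. ?H u p \<partial>second_moment)" by (simp add: case_prod_unfold)
 qed
 also have "\<dots> = (\<integral>p. (\<integral>u. ?H u p \<partial>?M) \<partial>second_moment)" by (rule FH[symmetric])
 \<comment> \<open>After the shift, \<open>u\<close> occurs in \<open>f\<close> only, and
   integrating it out leaves the autocorrelation at the difference of the points.\<close>
 also have "\<dots> = (\<integral>(z, z'). indicator B (fst z) * ?ww z z' * autocorrelation f (fst z' - fst z) \<partial>second_moment)"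
 proof (rule lint_cong[OF refl])
  fix p :: "((real ^ 'd) \<times> nat) \<times> ((real ^ 'd) \<times> nat)"
  let ?x = "fst (fst p)" and ?y = "fst (snd p)"
  have "(\<integral>u. ?H u p \<partial>?M) = (\<integral>u. (indicator B ?x * ?ww (fst p) (snd p)) * (f (?x + u) * cnj (f (?x + u + (?y - ?x)))) \<partial>?M)"
   by (intro lint_cong refl) (simp add: algebra_simps)
  also have "\<dots> = (indicator B ?x * ?ww (fst p) (snd p)) * (\<integral>u. f (?x + u) * cnj (f (?x + u + (?y - ?x))) \<partial>?M)"
   by (rule integral_mult_right_zero)
  also have "(\<integral>u. f (?x + u) * cnj (f (?x + u + (?y - ?x))) \<partial>?M) = autocorrelation f (?y - ?x)"
   unfolding autocorrelation_def by (rule lborel_integral_shift[of "%u. f u * cnj (f (u + (?y - ?x)))"]) measurable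
  finally show "(\<integral>u. ?H u p \<partial>?M) = (case p of (z, z') => indicator B (fst z) * ?ww z z' * autocorrelation f (fst z' - fst z))"
   by (simp add: case_prod_unfold)
 qed
 finally have "of_real vol * (\<integral>p. case_prod ?T p \<partial>second_moment) = of_real vol * corr (autocorrelation f)"
  unfolding corr_def using vol_pos by simp
 then show ?thesis unfolding var using vol_pos by simp
qed

text \<open>For \<open>s\<close> equal to 1 or -1, the image under differences of the part of the
  second moment on which the product of the weights has sign \<open>s\<close>. The weights may be
  negative, so the two parts are kept as separate positive measures.\<close>

definition split_moment :: "real => (real ^ 'd) measure" where
 "split_moment s = distr (density second_moment (%(z, z'). ennreal (1 / vol * indicator B (fst z) * max 0 (s * (w (snd z) * w (snd z')))))) borel
   (%(z, z'). fst z' - fst z)"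

lemma split_moment:
 fixes \<psi> :: "real ^ 'd => complex"
 assumes s: "\<bar>s\<bar> = 1" and m[measurable]: "\<psi> \<in> borel_measurable borel" and b: "\<And>x. norm (\<psi> x) <= C * decay x"
 shows "integrable second_moment (%(z, z'). (1 / vol * indicator B (fst z) * max 0 (s * (w (snd z) * w (snd z')))) *\<^sub>R \<psi> (fst z' - fst z))"
  and "integrable (split_moment s) \<psi>"
  and "integral\<^sup>L (split_moment s) \<psi> = (\<integral>(z, z'). (1 / vol * indicator B (fst z) * max 0 (s * (w (snd z) * w (snd z')))) *\<^sub>R \<psi> (fst z' - fst z) \<partial>second_moment)"
proof -
 let ?\<rho> = "%p. 1 / vol * indicator B (fst (fst p)) * max 0 (s * (w (snd (fst p)) * w (snd (snd p))))"
 have \<rho>0: "0 <= ?\<rho> p" for p using vol_pos by simp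
 have [measurable]: "?\<rho> \<in> borel_measurable second_moment" by measurable
 have d: "(%(z, z'). ennreal (1 / vol * indicator B (fst z) * max 0 (s * (w (snd z) * w (snd z'))))) = (%p. ennreal (?\<rho> p))"
  by (simp add: case_prod_unfold)
 have i: "integrable second_moment (%p. ?\<rho> p *\<^sub>R \<psi> (fst (snd p) - fst (fst p)))"
 proof (rule integrable_bound_AE)
  show "integrable second_moment (%p. (1 / vol) *\<^sub>R (indicator B (fst (fst p)) * complex_of_real (w (snd (fst p)) * w (snd (snd p))) * \<psi> (fst (snd p) - fst (fst p))))"
   using integrable_second_moment[OF corr_integrand[OF m b]] by (intro integrable_scaleR_right) (simp add: case_prod_unfold)
  show "AE p in second_moment. norm (?\<rho> p *\<^sub>R \<psi> (fst (snd p) - fst (fst p))) <= norm ((1 / vol) *\<^sub>R (indicator B (fst (fst p)) * complex_of_real (w (snd (fst p)) * w (snd (snd p))) * \<psi> (fst (snd p) - fst (fst p))))"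
  proof (rule AE_I2)
   fix p
   have "max 0 (s * v) <= \<bar>v\<bar>" for v using s by (auto simp: abs_if max_def split: if_splits)
   then have key: "max 0 (s * v) * norm y / vol <= \<bar>v\<bar> * norm y / vol" for v and y :: complex
   using vol_pos by (intro divide_right_mono mult_right_mono) auto
   show "norm (?\<rho> p *\<^sub>R \<psi> (fst (snd p) - fst (fst p))) <= norm ((1 / vol) *\<^sub>R (indicator B (fst (fst p)) * complex_of_real (w (snd (fst p)) * w (snd (snd p))) * \<psi> (fst (snd p) - fst (fst p))))"
   using vol_pos key[of "w (snd (fst p)) * w (snd (snd p))" "\<psi> (fst (snd p) - fst (fst p))"]
   by (cases "fst (fst p) \<in> B") (simp_all add: norm_mult abs_mult)
  qed
 qed measurable
 then show "integrable second_moment (%(z, z'). (1 / vol * indicator B (fst z) * max 0 (s * (w (snd z) * w (snd z')))) *\<^sub>R \<psi> (fst z' - fst z))"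
  by (simp add: case_prod_unfold)
 show "integrable (split_moment s) \<psi>"
  unfolding split_moment_def d using i \<rho>0
  by (subst integrable_distr_eq) (auto simp: integrable_density case_prod_unfold)
 show "integral\<^sup>L (split_moment s) \<psi> = (\<integral>(z, z'). (1 / vol * indicator B (fst z) * max 0 (s * (w (snd z) * w (snd z')))) *\<^sub>R \<psi> (fst z' - fst z) \<partial>second_moment)"
  unfolding split_moment_def d using \<rho>0
  by (subst integral_distr) (auto simp: integral_density case_prod_unfold)
qed

text \<open>Positivity is the second moment identity: on an autocorrelation \<open>corr\<close>
  equals the expectation of \<open>(cmod (count f \<xi>))^2\<close>.\<close>

sublocale positive_definite_difference "split_moment 1" "split_moment (- 1)" corr
proof
 have "sets (split_moment s) = sets borel" for s unfolding split_moment_def by simp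
 then show "sets (split_moment 1) = sets borel" "sets (split_moment (- 1)) = sets borel" by auto
 have "integrable (split_moment s) decay" if "\<bar>s\<bar> = 1" for s
 proof -
  have "integrable (split_moment s) (%x. complex_of_real (decay x))"
   by (rule split_moment(2)[OF that, of _ 1]) auto
  from integrable_Re[OF this] show ?thesis by simp
 qed
 then show "integrable (split_moment 1) decay" "integrable (split_moment (- 1)) decay" by auto
 fix \<psi> :: "real ^ 'd => complex" and C
 assume m: "\<psi> \<in> borel_measurable borel" and b: "\<And>x. norm (\<psi> x) <= C * decay x"
 have s: "\<bar>1 :: real\<bar> = 1" "\<bar>- 1 :: real\<bar> = 1" by auto
 have eq: "(1 / vol * indicator B x * max 0 (1 * v)) *\<^sub>R y - (1 / vol * indicator B x * max 0 (- 1 * v)) *\<^sub>R y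
   = (1 / of_real vol) * (indicator B x * of_real v * y)" for x :: "real ^ 'd" and v and y :: complex
  by (auto simp: max_def scaleR_conv_of_real split: split_indicator)
 have "integral\<^sup>L (split_moment 1) \<psi> - integral\<^sup>L (split_moment (- 1)) \<psi>
   = (\<integral>(z, z'). (1 / of_real vol) * (indicator B (fst z) * of_real (w (snd z) * w (snd z')) * \<psi> (fst z' - fst z)) \<partial>second_moment)"
  unfolding split_moment(3)[OF s(1) m b] split_moment(3)[OF s(2) m b]
  by (subst lint_diff[symmetric, OF split_moment(1)[OF s(1) m b] split_moment(1)[OF s(2) m b]])
   (simp only: case_prod_unfold eq)
 also have "\<dots> = corr \<psi>" unfolding corr_def case_prod_unfold by (rule integral_mult_right_zero)
 finally show "corr \<psi> = integral\<^sup>L (split_moment 1) \<psi> - integral\<^sup>L (split_moment (- 1)) \<psi>" by simp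
next
 fix f :: "real ^ 'd => complex" and C
 assume f: "f \<in> borel_measurable borel" "\<And>x. norm (f x) <= C * (decay x)\<^sup>2"
 show "\<exists>r\<ge>0. corr (autocorrelation f) = of_real r"
  unfolding expectation_count_square[OF f, symmetric] integral_complex_of_real
  by (intro exI[of _ "\<integral>\<xi>. (cmod (count f \<xi>))\<^sup>2 \<partial>P"]) simp
qed

lemma count_bound:
 assumes "\<xi> \<in> space P" "0 <= C" "\<And>x. norm (f x) <= C * decay x"
 shows "norm (count f \<xi>) <= (W * C) * \<bar>K\<bar>"
  and "integrable (count_space (pts A Z \<xi>)) (%z. of_real (w (snd z)) * f (fst z))"
proof -
 have b: "norm (of_real (w (snd z)) * f (fst z)) <= (W * C) * decay (fst z)" for z
  unfolding norm_mult mult.assoc norm_of_real using assms(2) by (intro mult_mono W assms(3) W_nonneg) auto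
 show "norm (count f \<xi>) <= (W * C) * \<bar>K\<bar>"
  unfolding count_def using W_nonneg assms(2) by (intro norm_sum_pts_le[OF assms(1) _ b]) auto
 show "integrable (count_space (pts A Z \<xi>)) (%z. of_real (w (snd z)) * f (fst z))"
  by (rule integrable_pts[OF assms(1) b])
qed

lemma borel_measurable_count:
 assumes [measurable]: "f \<in> borel_measurable borel"
 shows "count f \<in> borel_measurable P"
 unfolding count_def[abs_def] by (rule borel_measurable_sum_pts[where h="%\<xi>. \<xi>"]) measurable

section \<open>The weighted Palm measure as a difference of finite measures\<close>

definition palm :: "'x set => real" where
 "palm D = (1 / vol) * (\<integral>\<xi>. (\<integral>z. w (snd z) * indicator B (fst z) * indicator D (\<tau> (- fst z) \<xi>) \<partial>count_space (pts A Z \<xi>)) \<partial>P)"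

text \<open>The part of the Palm measure coming from weights of sign \<open>s\<close>, realised as
  the image of an index-configuration measure with a density. Only points in the bounded set
  \<open>B\<close> count, which makes it finite.\<close>

definition split_palm :: "real => 'x measure" where
 "split_palm s = distr (density (count_space UNIV \<Otimes>\<^sub>M P)
   (%(g, \<xi>). ennreal (1 / vol * indicator (A g) \<xi> * indicator B (fst (Z g \<xi>)) * max 0 (s * w (snd (Z g \<xi>)))))) P
   (%(g, \<xi>). \<tau> (- fst (Z g \<xi>)) \<xi>)"

lemma split_palm:
 assumes s: "\<bar>s\<bar> = 1"
 shows "finite_measure (split_palm s)" and "sets (split_palm s) = sets P"
  and "F \<in> borel_measurable P ==> (\<And>\<xi>. \<xi> \<in> space P ==> norm (F \<xi>) <= C) ==>
   integral\<^sup>L (split_palm s) F = (\<integral>\<xi>. (\<integral>z. of_real (1 / vol * indicator B (fst z) * max 0 (s * w (snd z))) * (F (\<tau> (- fst z) \<xi>) :: complex) \<partial>count_space (pts A Z \<xi>)) \<partial>P)"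
proof -
 let ?\<rho> = "%(g, \<xi>). 1 / vol * indicator (A g) \<xi> * indicator B (fst (Z g \<xi>)) * max 0 (s * w (snd (Z g \<xi>))) :: real"
 let ?v = "%z. 1 / vol * indicator B (fst z) * max 0 (s * w (snd z)) :: real"
 have \<rho>0: "0 <= ?\<rho> p" for p using vol_pos by (auto split: prod.splits)
 have \<rho>m: "?\<rho> \<in> borel_measurable (count_space UNIV \<Otimes>\<^sub>M P)" by (rule measurable_index) measurable
 have tm: "(%(g, \<xi>). \<tau> (- fst (Z g \<xi>)) \<xi>) \<in> count_space UNIV \<Otimes>\<^sub>M P \<rightarrow>\<^sub>M P" by (rule measurable_index) measurable
 have d: "(%(g, \<xi>). ennreal (1 / vol * indicator (A g) \<xi> * indicator B (fst (Z g \<xi>)) * max 0 (s * w (snd (Z g \<xi>))))) = (%p. ennreal (?\<rho> p))"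
  by (simp add: case_prod_unfold)
 show "sets (split_palm s) = sets P" unfolding split_palm_def by simp
 have v0: "0 <= ?v z" for z using vol_pos by simp
 have vb: "?v z <= (W / vol * \<beta>) * decay (fst z)" for z
 proof -
  have "max 0 (s * w (snd z)) <= W" using s W[of "snd z"] W_nonneg by (auto simp: abs_if split: if_splits)
  then have "?v z <= 1 / vol * (\<beta> * decay (fst z)) * W"
   using vol_pos W_nonneg \<beta>(1) indicator_B_le by (intro mult_mono mult_nonneg_nonneg) auto
  then show ?thesis by (simp add: mult.commute mult.left_commute)
 qed
 have Wv: "0 <= W / vol * \<beta>" using W_nonneg vol_pos \<beta>(1) by simp
 have Fi: "integrable (count_space UNIV \<Otimes>\<^sub>M P) (%(g, \<xi>). indicator (A g) \<xi> *\<^sub>R (of_real (?v (Z g \<xi>)) * F (\<tau> (- fst (Z g \<xi>)) \<xi>)))"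
  "(\<integral>\<xi>. (\<integral>z. of_real (?v z) * F (\<tau> (- fst z) \<xi>) \<partial>count_space (pts A Z \<xi>)) \<partial>P)
   = (\<integral>(g, \<xi>). indicator (A g) \<xi> *\<^sub>R (of_real (?v (Z g \<xi>)) * F (\<tau> (- fst (Z g \<xi>)) \<xi>)) \<partial>(count_space UNIV \<Otimes>\<^sub>M P))"
  if m[measurable]: "F \<in> borel_measurable P" and b: "\<And>\<xi>. \<xi> \<in> space P ==> norm (F \<xi>) <= C" for F :: "'x => complex" and C
 proof -
  have sp: "\<tau> t \<xi> \<in> space P" if "\<xi> \<in> space P" for t \<xi> using measurable_space[OF \<tau>_meas that] .
  have bb: "norm (of_real (?v z) * F (\<tau> (- fst z) \<xi>)) <= ((W / vol * \<beta>) * \<bar>C\<bar>) * decay (fst z)" if "\<xi> \<in> space P" for z \<xi>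
  proof -
   have "norm (of_real (?v z) * F (\<tau> (- fst z) \<xi>)) = ?v z * norm (F (\<tau> (- fst z) \<xi>))" by (simp only: norm_mult norm_of_real abs_of_nonneg[OF v0])
   also have "\<dots> <= ((W / vol * \<beta>) * decay (fst z)) * \<bar>C\<bar>"
   by (rule mult_mono[OF vb order_trans[OF b[OF sp[OF that]] abs_ge_self] mult_nonneg_nonneg[OF Wv decay_nonneg] norm_ge_zero])
   finally show ?thesis by (simp only: mult.assoc mult.left_commute mult.commute)
  qed
  have mm: "(%(z, \<xi>). of_real (?v z) * F (\<tau> (- fst z) \<xi>)) \<in> borel_measurable (borel \<Otimes>\<^sub>M P)" by measurable
  have C0: "0 <= (W / vol * \<beta>) * \<bar>C\<bar>" by (rule mult_nonneg_nonneg[OF Wv abs_ge_zero])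
  note CI = Campbell_index[of "%z \<xi>. of_real (?v z) * F (\<tau> (- fst z) \<xi>)", OF mm bb C0]
  show "integrable (count_space UNIV \<Otimes>\<^sub>M P) (%(g, \<xi>). indicator (A g) \<xi> *\<^sub>R (of_real (?v (Z g \<xi>)) * F (\<tau> (- fst (Z g \<xi>)) \<xi>)))"
   by (rule CI(1))
  show "(\<integral>\<xi>. (\<integral>z. of_real (?v z) * F (\<tau> (- fst z) \<xi>) \<partial>count_space (pts A Z \<xi>)) \<partial>P)
   = (\<integral>(g, \<xi>). indicator (A g) \<xi> *\<^sub>R (of_real (?v (Z g \<xi>)) * F (\<tau> (- fst (Z g \<xi>)) \<xi>)) \<partial>(count_space UNIV \<Otimes>\<^sub>M P))"
   by (rule CI(2))
 qed
 have \<rho>eq: "?\<rho> p *\<^sub>R y = (case p of (g, \<xi>) => indicator (A g) \<xi> *\<^sub>R (complex_of_real (?v (Z g \<xi>)) * y))" for p and y :: complex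
  by (auto simp: scaleR_conv_of_real split: prod.splits split_indicator)
 show "finite_measure (split_palm s)"
 proof (rule finite_measureI)
  have "integrable (count_space UNIV \<Otimes>\<^sub>M P) (%p. ?\<rho> p *\<^sub>R (1 :: complex))"
   using Fi(1)[of "%_. 1" 1] unfolding \<rho>eq by (simp add: case_prod_unfold)
  then have "integrable (count_space UNIV \<Otimes>\<^sub>M P) (%p. norm (?\<rho> p *\<^sub>R (1 :: complex)))" by (rule integrable_norm)
  then have "integrable (count_space UNIV \<Otimes>\<^sub>M P) ?\<rho>" using \<rho>0 by simp
  then have "(\<integral>\<^sup>+p. ennreal (?\<rho> p) \<partial>(count_space UNIV \<Otimes>\<^sub>M P)) < \<infinity>"
   using \<rho>0 by (simp add: integrable_iff_bounded)
  moreover have "emeasure (split_palm s) (space (split_palm s)) = (\<integral>\<^sup>+p. ennreal (?\<rho> p) \<partial>(count_space UNIV \<Otimes>\<^sub>M P))"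
  proof -
   have "(%(g, \<xi>). \<tau> (- fst (Z g \<xi>)) \<xi>) -` space P \<inter> space (count_space UNIV \<Otimes>\<^sub>M P) = space (count_space UNIV \<Otimes>\<^sub>M P)"
   using measurable_space[OF tm] by auto
   then show ?thesis
   unfolding split_palm_def d using tm \<rho>m
   by (simp add: emeasure_distr emeasure_density space_pair_measure[symmetric] cong: nn_integral_cong)
  qed
  ultimately show "emeasure (split_palm s) (space (split_palm s)) \<noteq> \<infinity>" by simp
 qed
 show "integral\<^sup>L (split_palm s) F = (\<integral>\<xi>. (\<integral>z. of_real (?v z) * (F (\<tau> (- fst z) \<xi>) :: complex) \<partial>count_space (pts A Z \<xi>)) \<partial>P)"
  if m[measurable]: "F \<in> borel_measurable P" and b: "\<And>\<xi>. \<xi> \<in> space P ==> norm (F \<xi>) <= C"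
 proof -
  have Ft: "(%p. F (case p of (g, \<xi>) => \<tau> (- fst (Z g \<xi>)) \<xi>)) \<in> borel_measurable (count_space UNIV \<Otimes>\<^sub>M P)"
   by (rule measurable_compose[OF tm m])
  have "integral\<^sup>L (split_palm s) F = (\<integral>p. F (case p of (g, \<xi>) => \<tau> (- fst (Z g \<xi>)) \<xi>) \<partial>density (count_space UNIV \<Otimes>\<^sub>M P) (%p. ennreal (?\<rho> p)))"
   unfolding split_palm_def d by (rule integral_distr) (use tm m in auto)
  also have "\<dots> = (\<integral>p. ?\<rho> p *\<^sub>R F (case p of (g, \<xi>) => \<tau> (- fst (Z g \<xi>)) \<xi>) \<partial>(count_space UNIV \<Otimes>\<^sub>M P))"
   using \<rho>m \<rho>0 Ft by (intro integral_density) auto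
  also have "\<dots> = (\<integral>(g, \<xi>). indicator (A g) \<xi> *\<^sub>R (of_real (?v (Z g \<xi>)) * F (\<tau> (- fst (Z g \<xi>)) \<xi>)) \<partial>(count_space UNIV \<Otimes>\<^sub>M P))"
   unfolding \<rho>eq by (simp add: case_prod_unfold)
  finally show ?thesis using Fi(2)[OF m b] by simp
 qed
qed

lemma split_palm_diff:
 assumes m[measurable]: "F \<in> borel_measurable P" and b: "\<And>\<xi>. \<xi> \<in> space P ==> norm (F \<xi>) <= C"
 shows "integral\<^sup>L (split_palm 1) F - integral\<^sup>L (split_palm (- 1)) F
  = (1 / of_real vol) * (\<integral>\<xi>. (\<integral>z. of_real (w (snd z)) * indicator B (fst z) * (F (\<tau> (- fst z) \<xi>) :: complex) \<partial>count_space (pts A Z \<xi>)) \<partial>P)"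
proof -
 have s: "\<bar>1 :: real\<bar> = 1" "\<bar>- 1 :: real\<bar> = 1" by auto
 let ?f = "%s \<xi> z. of_real (1 / vol * indicator B (fst z) * max 0 (s * w (snd z))) * (F (\<tau> (- fst z) \<xi>) :: complex)"
 have bb: "norm (?f s \<xi> z) <= ((W / vol * \<beta>) * \<bar>C\<bar>) * decay (fst z)" if "\<xi> \<in> space P" "\<bar>s\<bar> = 1" for s z \<xi>
 proof -
  have "norm (F (\<tau> (- fst z) \<xi>)) <= \<bar>C\<bar>" using order_trans[OF b[OF measurable_space[OF \<tau>_meas that(1)]] abs_ge_self] .
  moreover have "max 0 (s * w (snd z)) <= W" using that(2) W[of "snd z"] W_nonneg by (auto simp: abs_if split: if_splits)
  ultimately have "(1 / vol * indicator B (fst z) * max 0 (s * w (snd z))) * norm (F (\<tau> (- fst z) \<xi>)) <= (1 / vol * (\<beta> * decay (fst z)) * W) * \<bar>C\<bar>"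
   using vol_pos W_nonneg \<beta>(1) indicator_B_le by (intro mult_mono mult_nonneg_nonneg) auto
  moreover have "norm (?f s \<xi> z) = (1 / vol * indicator B (fst z) * max 0 (s * w (snd z))) * norm (F (\<tau> (- fst z) \<xi>))"
  proof -
   have "0 <= 1 / vol * indicator B (fst z) * max 0 (s * w (snd z))" using vol_pos by simp
   then show ?thesis by (simp only: norm_mult norm_of_real abs_of_nonneg)
  qed
  ultimately show ?thesis by (simp add: mult.assoc mult.commute mult.left_commute)
 qed
 have i: "integrable (count_space (pts A Z \<xi>)) (?f s \<xi>)" if "\<xi> \<in> space P" "\<bar>s\<bar> = 1" for s \<xi>
  by (rule integrable_pts[OF that(1) bb[OF that]])
 have Wv: "0 <= W / vol * \<beta> * \<bar>C\<bar>" using W_nonneg vol_pos \<beta>(1) by simp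
 have mS: "(%\<xi>. \<integral>z. ?f s \<xi> z \<partial>count_space (pts A Z \<xi>)) \<in> borel_measurable P" for s
  by (rule borel_measurable_sum_pts[where h="%\<xi>. \<xi>"]) measurable
 have iP: "integrable P (%\<xi>. \<integral>z. ?f s \<xi> z \<partial>count_space (pts A Z \<xi>))" if "\<bar>s\<bar> = 1" for s
  by (rule integrable_const_bound[of _ "((W / vol * \<beta>) * \<bar>C\<bar>) * \<bar>K\<bar>"])
   (use mS norm_sum_pts_le[OF _ Wv bb[OF _ that]] in auto)
 have "integral\<^sup>L (split_palm 1) F - integral\<^sup>L (split_palm (- 1)) F
   = (\<integral>\<xi>. (\<integral>z. ?f 1 \<xi> z \<partial>count_space (pts A Z \<xi>)) - (\<integral>z. ?f (- 1) \<xi> z \<partial>count_space (pts A Z \<xi>)) \<partial>P)"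
 proof -
  have e1: "integral\<^sup>L (split_palm 1) F = (\<integral>\<xi>. (\<integral>z. ?f 1 \<xi> z \<partial>count_space (pts A Z \<xi>)) \<partial>P)"
   by (rule split_palm(3)[OF s(1) m b])
  have e2: "integral\<^sup>L (split_palm (- 1)) F = (\<integral>\<xi>. (\<integral>z. ?f (- 1) \<xi> z \<partial>count_space (pts A Z \<xi>)) \<partial>P)"
   by (rule split_palm(3)[OF s(2) m b])
  show ?thesis unfolding e1 e2
   by (rule lint_diff[OF iP[OF s(1)] iP[OF s(2)], symmetric])
 qed
 also have "\<dots> = (\<integral>\<xi>. (1 / of_real vol) * (\<integral>z. of_real (w (snd z)) * indicator B (fst z) * F (\<tau> (- fst z) \<xi>) \<partial>count_space (pts A Z \<xi>)) \<partial>P)"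
 proof (rule lint_cong[OF refl])
  fix \<xi> assume \<xi>: "\<xi> \<in> space P"
  have "?f 1 \<xi> z - ?f (- 1) \<xi> z = (1 / of_real vol) * (of_real (w (snd z)) * indicator B (fst z) * F (\<tau> (- fst z) \<xi>))" for z
   by (auto simp: max_def split: split_indicator)
  then show "(\<integral>z. ?f 1 \<xi> z \<partial>count_space (pts A Z \<xi>)) - (\<integral>z. ?f (- 1) \<xi> z \<partial>count_space (pts A Z \<xi>))
   = (1 / of_real vol) * (\<integral>z. of_real (w (snd z)) * indicator B (fst z) * F (\<tau> (- fst z) \<xi>) \<partial>count_space (pts A Z \<xi>))"
   unfolding lint_diff[symmetric, OF i[OF \<xi> s(1)] i[OF \<xi> s(2)]] integral_mult_right_zero[symmetric]
   by (simp only:)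
 qed
 finally show ?thesis by (simp only: integral_mult_right_zero)
qed

text \<open>The Palm measure is the difference of the two \<open>split_palm\<close> measures, so its
  signed integral is an average over points \<open>x\<close> in \<open>B\<close> of
  \<open>count \<psi>\<close> seen from \<open>x\<close>. That count sums
  \<open>\<psi> (y - x)\<close> over the points \<open>y\<close>, and the two sums make up
  \<open>corr\<close>.\<close>

lemma signed_integral_palm:
 assumes [measurable]: "\<psi> \<in> borel_measurable borel" and b: "\<And>x. norm (\<psi> x) <= C * decay x" and C: "0 <= C"
 shows "signed_integral P palm (count \<psi>) = corr \<psi>"
proof -
 have s: "\<bar>1 :: real\<bar> = 1" "\<bar>- 1 :: real\<bar> = 1" by auto
 have pm: "palm D = measure (split_palm 1) D - measure (split_palm (- 1)) D" if D[measurable]: "D \<in> sets P" for D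
 proof -
  have ind: "(\<integral>\<xi>. (indicator D \<xi> :: complex) \<partial>split_palm s) = of_real (measure (split_palm s) D)" if "\<bar>s\<bar> = 1" for s
  proof -
   have "(\<integral>\<xi>. (indicator D \<xi> :: complex) \<partial>split_palm s) = (\<integral>\<xi>. complex_of_real (indicator D \<xi>) \<partial>split_palm s)"
   by (rule lint_cong) (auto split: split_indicator)
   also have "\<dots> = of_real (\<integral>\<xi>. indicator D \<xi> \<partial>split_palm s)" by (rule integral_complex_of_real)
   also have "(\<integral>\<xi>. indicator D \<xi> \<partial>split_palm s) = measure (split_palm s) D"
   using D split_palm(2)[OF that] sets.sets_into_space[of D "split_palm s"] by (simp add: Int_absorb1)
   finally show ?thesis .
  qed
  have "complex_of_real (measure (split_palm 1) D) - of_real (measure (split_palm (- 1)) D)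
   = (1 / of_real vol) * (\<integral>\<xi>. (\<integral>z. of_real (w (snd z)) * indicator B (fst z) * (indicator D (\<tau> (- fst z) \<xi>) :: complex) \<partial>count_space (pts A Z \<xi>)) \<partial>P)"
   unfolding ind[OF s(1), symmetric] ind[OF s(2), symmetric]
   by (rule split_palm_diff[of _ 1]) (auto simp: indicator_def)
  also have "\<dots> = of_real (palm D)"
  proof -
   have eq: "of_real (w (snd z)) * indicator B (fst z) * (indicator D (\<tau> (- fst z) \<xi>) :: complex)
   = of_real (w (snd z) * indicator B (fst z) * indicator D (\<tau> (- fst z) \<xi>))" for z \<xi>
   by (auto simp: indicator_def)
   show ?thesis unfolding palm_def eq integral_complex_of_real by simp
  qed
  finally show ?thesis by (simp only: of_real_diff[symmetric] of_real_eq_iff)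
 qed
 have cb: "norm (count \<psi> \<xi>) <= (W * C) * \<bar>K\<bar>" if "\<xi> \<in> space P" for \<xi> by (rule count_bound(1)[OF that C b])
 have cm: "count \<psi> \<in> borel_measurable P" by (rule borel_measurable_count) measurable
 have "signed_integral P palm (count \<psi>) = integral\<^sup>L (split_palm 1) (count \<psi>) - integral\<^sup>L (split_palm (- 1)) (count \<psi>)"
  by (rule signed_integral_diff[OF split_palm(1)[OF s(1)] split_palm(1)[OF s(2)] split_palm(2)[OF s(1)] split_palm(2)[OF s(2)] pm cm cb])
 also have "\<dots> = (1 / of_real vol) * (\<integral>\<xi>. (\<integral>z. of_real (w (snd z)) * indicator B (fst z) * count \<psi> (\<tau> (- fst z) \<xi>) \<partial>count_space (pts A Z \<xi>)) \<partial>P)"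
  by (rule split_palm_diff[OF cm cb])
 also have "\<dots> = corr \<psi>"
  unfolding corr_def integral_second_moment(1)[OF corr_integrand[OF assms(1) b]]
 proof (rule arg_cong[where f="%x. (1 / of_real vol) * x"], rule lint_cong[OF refl])
  fix \<xi> assume \<xi>: "\<xi> \<in> space P"
  \<comment> \<open>Equivariance: the points of the recentred configuration are the old ones
    displaced by \<open>- x\<close>.\<close>
  have ct: "count \<psi> (\<tau> (- x) \<xi>) = (\<integral>z'. of_real (w (snd z')) * \<psi> (fst z' - x) \<partial>count_space (pts A Z \<xi>))" for x
  proof -
   have "bij_betw (displace (- x)) (pts A Z \<xi>) (pts A Z (\<tau> (- x) \<xi>))"
   unfolding equivariant[OF \<xi>] by (intro inj_on_imp_bij_betw inj_displace)
   from integral_bij_count_space[OF this, of "%z. of_real (w (snd z)) * \<psi> (fst z)"]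
   show ?thesis unfolding count_def by simp
  qed
  show "(\<integral>z. of_real (w (snd z)) * indicator B (fst z) * count \<psi> (\<tau> (- fst z) \<xi>) \<partial>count_space (pts A Z \<xi>))
   = (\<integral>p. (case p of (z, z') => indicator B (fst z) * of_real (w (snd z) * w (snd z')) * \<psi> (fst z' - fst z)) \<partial>count_space (pts A Z \<xi> \<times> pts A Z \<xi>))"
   unfolding integral_pts2[OF integral_second_moment(2)[OF corr_integrand[OF assms(1) b] \<xi>]] ct
   unfolding integral_mult_right_zero[symmetric]
   by (simp add: mult.assoc mult.left_commute)
 qed
 finally show ?thesis .
qed

end

section \<open>Translations of configurations\<close>

lemma translate_eq_displace: "translate t \<xi> = distr \<xi> \<xi> (displace t)"
 unfolding translate_def displace_def ..

lemma displace_coloured_space[simp]: "displace t z \<in> coloured_space m \<longleftrightarrow> z \<in> coloured_space m"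
 unfolding displace_def coloured_space_def by (auto split: prod.splits)

lemma displace_displace[simp]: "displace s (displace t z) = displace (s + t) z"
 unfolding displace_def by (auto split: prod.splits)

lemma displace_0[simp]: "displace 0 z = z"
 unfolding displace_def by (auto split: prod.splits)

lemma continuous_displace: "continuous_on A (displace t)"
 unfolding displace_def case_prod_unfold by (intro continuous_intros)

text \<open>There are finitely many colours and the coloured space is closed, so compactness is a
  matter of the positions alone.\<close>

lemma relatively_compact_iff:
 fixes A :: "((real ^ 'd::finite) \<times> nat) set"
 assumes A: "A \<subseteq> coloured_space m"
 shows "compact (closure A) \<longleftrightarrow> bounded (fst ` A)"
proof
 assume "compact (closure A)"
 then have "compact (fst ` closure A)" by (intro compact_continuous_image continuous_on_fst continuous_on_id)
 then have "bounded (fst ` closure A)" by (rule compact_imp_bounded)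
 then show "bounded (fst ` A)" by (rule bounded_subset) (use closure_subset in blast)
next
 assume "bounded (fst ` A)"
 then obtain R where R: "\<And>x. x \<in> fst ` A ==> norm x <= R" unfolding bounded_iff by blast
 have K: "compact (cball (0 :: real ^ 'd) R \<times> {1..m})"
  by (intro compact_Times compact_cball finite_imp_compact) auto
 have "A \<subseteq> cball 0 R \<times> {1..m}"
 proof
  fix z assume z: "z \<in> A"
  then have "norm (fst z) <= R" by (intro R imageI)
  moreover have "snd z \<in> {1..m}" using z A unfolding coloured_space_def by auto
  ultimately show "z \<in> cball 0 R \<times> {1..m}" by (cases z) simp
 qed
 then have "closure A \<subseteq> cball 0 R \<times> {1..m}" using compact_imp_closed[OF K] by (rule closure_minimal)
 then have "closure A = (cball 0 R \<times> {1..m}) \<inter> closure A" by blast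
 then show "compact (closure A)" using compact_Int_closed[OF K closed_closure, of A] by simp
qed

context point_configuration
begin

lemma measurable_displace: "displace t \<in> \<xi> \<rightarrow>\<^sub>M \<xi>"
proof -
 have "displace t \<in> restrict_space borel (coloured_space m) \<rightarrow>\<^sub>M restrict_space borel (coloured_space m)"
  by (rule measurable_restrict_space3) (auto intro: borel_measurable_continuous_onI continuous_displace)
 then show ?thesis by (simp add: measurable_cong_sets[OF sets_\<xi> sets_\<xi>])
qed

lemma sets_translate: "sets (translate t \<xi>) = sets \<xi>"
 unfolding translate_eq_displace by simp

lemma emeasure_translate:
 assumes "A \<in> sets \<xi>" shows "emeasure (translate t \<xi>) A = emeasure \<xi> (displace t -` A \<inter> space \<xi>)"
 unfolding translate_eq_displace by (rule emeasure_distr[OF measurable_displace assms])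

lemma translate_point_measure: "translate t \<xi> \<in> point_measures m"
 unfolding point_measures_def
proof (intro CollectI conjI ballI impI)
 show "sets (translate t \<xi>) = sets (restrict_space borel (coloured_space m))" by (simp add: sets_translate sets_\<xi>)
 fix A assume A: "A \<in> sets (translate t \<xi>)" and c: "compact (closure A)"
 have As: "A \<in> sets \<xi>" using A by (simp add: sets_translate)
 let ?A = "displace t -` A \<inter> space \<xi>"
 have As': "?A \<in> sets \<xi>" using measurable_sets[OF measurable_displace As] .
 have sub: "A \<subseteq> coloured_space m" "?A \<subseteq> coloured_space m" using As As' unfolding sets_\<xi>_iff by auto
 have "bounded (fst ` A)" using c relatively_compact_iff[OF sub(1)] by simp
 then have "bounded ((%x. - t + x) ` fst ` A)" by (rule bounded_translation)
 moreover have "fst ` ?A \<subseteq> (%x. - t + x) ` fst ` A"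
 proof
  fix x assume "x \<in> fst ` ?A"
  then obtain z where "z \<in> ?A" "x = fst z" by blast
  then show "x \<in> (%x. - t + x) ` fst ` A"
   by (intro image_eqI[of _ _ "fst (displace t z)"] imageI) auto
 qed
 ultimately have "bounded (fst ` ?A)" by (rule bounded_subset)
 then have "compact (closure ?A)" using relatively_compact_iff[OF sub(2)] by simp
 then show "\<exists>n::nat. emeasure (translate t \<xi>) A = of_nat n"
  using point_measure As' unfolding emeasure_translate[OF As] point_measures_def by blast
qed

lemma integral_translate:
 fixes f :: "_ => real"
 assumes "f \<in> borel_measurable \<xi>"
 shows "(LINT z|translate t \<xi>. f z) = (LINT z|\<xi>. f (displace t z))"
 unfolding translate_eq_displace by (rule integral_distr[OF measurable_displace assms])

text \<open>Translation is an action. Its inverse is what later shows that configurations translated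
  into \<open>X\<close> were in \<open>X\<close> already.\<close>

lemma translate_translate: "translate s (translate t \<xi>) = translate (s + t) \<xi>"
proof -
 have m: "displace s \<in> distr \<xi> \<xi> (displace t) \<rightarrow>\<^sub>M \<xi>" for s using measurable_displace[of s] by simp
 have "translate s (translate t \<xi>) = distr (distr \<xi> \<xi> (displace t)) \<xi> (displace s)"
  unfolding translate_eq_displace by (rule distr_cong) auto
 also have "\<dots> = distr \<xi> \<xi> (displace s \<circ> displace t)" by (rule distr_distr[OF measurable_displace measurable_displace])
 finally show ?thesis unfolding translate_eq_displace by (simp add: comp_def)
qed

lemma translate_0: "translate 0 \<xi> = \<xi>"
proof -
 have "displace 0 = (%z. z)" by (rule ext) simp
 show ?thesis unfolding translate_eq_displace \<open>displace 0 = (%z. z)\<close> by (rule distr_id)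
qed

lemma test_function_measurable:
 assumes "f \<in> test_functions m" shows "f \<in> borel_measurable \<xi>"
 using assms borel_measurable_continuous_on_restrict[of "coloured_space m" f]
 unfolding test_functions_def by (simp add: measurable_cong_sets[OF sets_\<xi> refl])

end

lemma point_configurationI: "\<xi> \<in> point_measures m ==> point_configuration m \<xi>"
 by unfold_locales

lemma test_function_displace:
 assumes f: "f \<in> test_functions m"
 shows "(%z. f (displace t z)) \<in> test_functions m"
proof -
 let ?S = "{z \<in> coloured_space m. f z \<noteq> 0}" and ?S' = "{z \<in> coloured_space m. f (displace t z) \<noteq> 0}"
 have "continuous_on (coloured_space m) (%z. f (displace t z))"
  by (rule continuous_on_compose2[of "coloured_space m" f])
   (use f in \<open>auto simp: test_functions_def intro: continuous_displace\<close>)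
 moreover have "compact (closure ?S')"
 proof -
  have "bounded (fst ` ?S)" using f relatively_compact_iff[of ?S m] unfolding test_functions_def by auto
  then have "bounded ((%x. - t + x) ` fst ` ?S)" by (rule bounded_translation)
  moreover have "fst ` ?S' \<subseteq> (%x. - t + x) ` fst ` ?S"
  proof
   fix x assume "x \<in> fst ` ?S'"
   then obtain z where "z \<in> ?S'" "x = fst z" by blast
   then show "x \<in> (%x. - t + x) ` fst ` ?S"
   by (intro image_eqI[of _ _ "fst (displace t z)"] imageI) auto
  qed
  ultimately have "bounded (fst ` ?S')" by (rule bounded_subset)
  then show ?thesis using relatively_compact_iff[of ?S' m] by auto
 qed
 ultimately show ?thesis unfolding test_functions_def by simp
qed

section \<open>The vague topology, its Borel sets and translation\<close>

lemma vague_subbasis_open: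
 assumes "f \<in> test_functions m" "open V"
 shows "openin (vague_topology m) {\<xi> \<in> point_measures m. (LINT z|\<xi>. f z) \<in> V}"
 unfolding vague_topology_def by (rule topology_generated_by_Basis) (use assms in blast)

lemma zero_test_function: "(%_. 0) \<in> test_functions m"
 unfolding test_functions_def by simp

lemma topspace_vague: "topspace (vague_topology m) = point_measures m"
proof
 show "topspace (vague_topology m) \<subseteq> point_measures m"
  unfolding vague_topology_def topology_generated_by_topspace by blast
 show "point_measures m \<subseteq> topspace (vague_topology m)"
  using openin_subset[OF vague_subbasis_open[OF zero_test_function open_UNIV]] by auto
qed

text \<open>On the subbasis the preimage under translation is again a subbasic set, because a
  displaced test function is a test function.\<close>

lemma continuous_map_translate:
 fixes t :: "real ^ 'd::finite"
 shows "continuous_map (vague_topology m) (vague_topology m) (translate t)"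
 unfolding vague_topology_def[of m, THEN arg_cong[where f="continuous_map (vague_topology m)"]]
 unfolding continuous_on_generated_topo_iff
proof (intro conjI allI impI)
 fix U :: "'d config set" assume "U \<in> {{\<xi> \<in> point_measures m. (LINT z|\<xi>. f z) \<in> V} |f V. f \<in> test_functions m \<and> open V}"
 then obtain f V where U: "U = {\<xi> \<in> point_measures m. (LINT z|\<xi>. f z) \<in> V}" and f: "f \<in> test_functions m" and V: "open V" by blast
 have "translate t -` U \<inter> topspace (vague_topology m) = {\<xi> \<in> point_measures m. (LINT z|\<xi>. f (displace t z)) \<in> V}"
 proof -
  have "translate t \<xi> \<in> U \<longleftrightarrow> (LINT z|\<xi>. f (displace t z)) \<in> V" if "\<xi> \<in> point_measures m" for \<xi>
  proof -
   interpret point_configuration m \<xi> by (rule point_configurationI[OF that])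
   show ?thesis unfolding U using translate_point_measure integral_translate[OF test_function_measurable[OF f]] by simp
  qed
  then show ?thesis unfolding topspace_vague by auto
 qed
 then show "openin (vague_topology m) (translate t -` U \<inter> topspace (vague_topology m))"
  using vague_subbasis_open[OF test_function_displace[OF f] V] by simp
next
 have "translate t ` topspace (vague_topology m) \<subseteq> topspace (vague_topology m)"
  unfolding topspace_vague using point_configuration.translate_point_measure[OF point_configurationI] by blast
 then show "translate t ` topspace (vague_topology m) \<subseteq> \<Union> {{\<xi> \<in> point_measures m. (LINT z|\<xi>. f z) \<in> V} |f V. f \<in> test_functions m \<and> open V}"
  unfolding vague_topology_def topology_generated_by_topspace .
qed

lemma vague_borel_generators: "{V. openin (vague_topology m) V} \<subseteq> Pow (point_measures m)"
 using openin_subset topspace_vague by blast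

lemma sets_vague_borel: "sets (vague_borel m) = sigma_sets (point_measures m) {V. openin (vague_topology m) V}"
 unfolding vague_borel_def by (rule sets_measure_of[OF vague_borel_generators])

lemma space_vague_borel: "space (vague_borel m) = point_measures m"
 unfolding vague_borel_def by (rule space_measure_of[OF vague_borel_generators])

lemma vague_open_measurable: "openin (vague_topology m) V ==> V \<in> sets (vague_borel m)"
 unfolding sets_vague_borel by (rule sigma_sets.Basic) simp

lemma vague_closed_measurable: "closedin (vague_topology m) C ==> C \<in> sets (vague_borel m)"
proof -
 assume C: "closedin (vague_topology m) C"
 then have "C = space (vague_borel m) - (point_measures m - C)"
  using closedin_subset[OF C] unfolding topspace_vague space_vague_borel by blast
 moreover have "point_measures m - C \<in> sets (vague_borel m)"
  using C unfolding closedin_def topspace_vague by (intro vague_open_measurable) simp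
 ultimately show ?thesis by (metis sets.compl_sets)
qed

lemma measurable_translate:
 fixes t :: "real ^ 'd::finite"
 shows "translate t \<in> vague_borel m \<rightarrow>\<^sub>M vague_borel m"
proof (rule measurable_sigma_sets[OF sets_vague_borel vague_borel_generators])
 show "translate t \<in> space (vague_borel m) \<rightarrow> point_measures m"
  unfolding space_vague_borel using point_configuration.translate_point_measure[OF point_configurationI] by blast
 fix V :: "'d config set" assume "V \<in> {V. openin (vague_topology m) V}"
 then have "openin (vague_topology m) {\<xi> \<in> topspace (vague_topology m). translate t \<xi> \<in> V}"
  using continuous_map_translate[of m t] unfolding continuous_map by blast
 moreover have "{\<xi> \<in> topspace (vague_topology m). translate t \<xi> \<in> V} = translate t -` V \<inter> space (vague_borel m)"
  unfolding topspace_vague space_vague_borel by blast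
 ultimately show "translate t -` V \<inter> space (vague_borel m) \<in> sets (vague_borel m)"
  using vague_open_measurable by simp
qed

section \<open>The point process as a stationary family of points\<close>

locale ud_process =
 fixes m :: nat and X :: "'d::finite config set" and \<mu> :: "'d config measure" and r :: real
 assumes process: "uniformly_discrete_ergodic_process m X \<mu>"
  and r: "r > 0" and X_ud: "X \<subseteq> uniformly_discrete_measures m r"
begin

definition P :: "'d config measure" where "P = restrict_space \<mu> X"

lemma prob_\<mu>: "prob_space \<mu>"
 using process unfolding uniformly_discrete_ergodic_process_def by blast

lemma sets_\<mu>: "sets \<mu> = sets (vague_borel m)"
 using process unfolding uniformly_discrete_ergodic_process_def by blast

lemma stationary_\<mu>: "distr \<mu> (vague_borel m) (translate t) = \<mu>"
 using process unfolding uniformly_discrete_ergodic_process_def stationary_def by blast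

lemma support: "is_support m X \<mu>"
 using process unfolding uniformly_discrete_ergodic_process_def by blast

lemma space_\<mu>: "space \<mu> = point_measures m"
 using sets_eq_imp_space_eq[OF sets_\<mu>] by (simp add: space_vague_borel)

lemma X_subset: "X \<subseteq> point_measures m"
 using X_ud unfolding uniformly_discrete_measures_def by blast

lemma X_sets: "X \<in> sets \<mu>"
 unfolding sets_\<mu> using support unfolding is_support_def by (intro vague_closed_measurable) blast

lemma space_P: "space P = X"
 unfolding P_def space_restrict_space space_\<mu> using X_subset by blast

lemma sets_P_iff: "A \<in> sets P \<longleftrightarrow> A \<in> sets \<mu> \<and> A \<subseteq> X"
 unfolding P_def using X_sets by (subst sets_restrict_space_iff) (auto simp: sets.Int_space_eq1)

lemma emeasure_X: "emeasure \<mu> X = 1"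
proof -
 interpret prob_space \<mu> by (rule prob_\<mu>)
 have "emeasure \<mu> (space \<mu> - X) = 0" using support unfolding is_support_def space_\<mu> by blast
 then have "prob (space \<mu> - X) = 0" by (simp add: measure_def)
 then have "prob X = 1" using prob_compl[OF X_sets] by simp
 then show ?thesis by (simp add: emeasure_eq_measure)
qed

lemma prob_P: "prob_space P"
proof (rule prob_spaceI)
 show "emeasure P (space P) = 1"
  unfolding space_P unfolding P_def using X_sets emeasure_X by (subst emeasure_restrict_space) auto
qed

lemma ud: "\<xi> \<in> X ==> ud_configuration m \<xi> r"
 using X_ud X_subset r by unfold_locales blast+

text \<open>The support of an invariant measure is invariant: the preimage of \<open>X\<close> under
  a translation is closed and of full measure, hence contains the smallest such set.\<close>

lemma translate_X: "\<xi> \<in> X ==> translate t \<xi> \<in> X"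
proof -
 let ?C = "{\<xi> \<in> topspace (vague_topology m). translate t \<xi> \<in> X}"
 have cX: "closedin (vague_topology m) X" using support unfolding is_support_def by blast
 have "closedin (vague_topology m) ?C"
  by (rule closedin_continuous_map_preimage[OF continuous_map_translate cX])
 moreover have "emeasure \<mu> (point_measures m - ?C) = 0"
 proof -
  have mt: "translate t \<in> \<mu> \<rightarrow>\<^sub>M vague_borel m"
   using measurable_translate by (simp add: measurable_cong_sets[OF sets_\<mu> refl])
  have "point_measures m - X \<in> sets (vague_borel m)"
   using cX unfolding closedin_def topspace_vague by (intro vague_open_measurable) simp
  then have "emeasure (distr \<mu> (vague_borel m) (translate t)) (point_measures m - X) = emeasure \<mu> (translate t -` (point_measures m - X) \<inter> space \<mu>)"
   by (rule emeasure_distr[OF mt])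
  moreover have "translate t -` (point_measures m - X) \<inter> space \<mu> = point_measures m - ?C"
   unfolding space_\<mu> topspace_vague using point_configuration.translate_point_measure[OF point_configurationI] by blast
  ultimately show ?thesis using support unfolding stationary_\<mu> is_support_def by simp
 qed
 ultimately have "X \<subseteq> ?C" using support unfolding is_support_def by blast
 then show "\<xi> \<in> X ==> translate t \<xi> \<in> X" by blast
qed

definition D :: real where
 "D = (SOME K. K \<ge> 0 \<and> (\<forall>\<xi> \<in> uniformly_discrete_measures m r. \<forall>y :: real ^ 'd.
   (\<integral>\<^sup>+z. ennreal (decay (fst z - y)) \<partial>count_space (atoms \<xi>)) <= ennreal K))"

lemma D: "0 <= D" "\<xi> \<in> X ==> (\<integral>\<^sup>+z. ennreal (decay (fst z)) \<partial>count_space (atoms \<xi>)) <= ennreal D"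
proof -
 obtain K where K: "\<forall>\<xi> \<in> uniformly_discrete_measures m r. \<forall>y :: real ^ 'd.
   (\<integral>\<^sup>+z. ennreal (decay (fst z - y)) \<partial>count_space (atoms \<xi>)) <= ennreal K"
  using ud_decay_bound[OF r] by blast
 have "\<exists>K. K \<ge> 0 \<and> (\<forall>\<xi> \<in> uniformly_discrete_measures m r. \<forall>y :: real ^ 'd.
   (\<integral>\<^sup>+z. ennreal (decay (fst z - y)) \<partial>count_space (atoms \<xi>)) <= ennreal K)"
 proof (intro exI[of _ "\<bar>K\<bar>"] conjI ballI allI)
  fix \<xi> :: "'d config" and y :: "real ^ 'd" assume "\<xi> \<in> uniformly_discrete_measures m r"
  then have "(\<integral>\<^sup>+z. ennreal (decay (fst z - y)) \<partial>count_space (atoms \<xi>)) <= ennreal K" using K by blast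
  also have "\<dots> <= ennreal \<bar>K\<bar>" by (rule ennreal_leI) simp
  finally show "(\<integral>\<^sup>+z. ennreal (decay (fst z - y)) \<partial>count_space (atoms \<xi>)) <= ennreal \<bar>K\<bar>" .
 qed simp
 from someI_ex[OF this] have D': "0 <= D" "\<And>\<xi> y. \<xi> \<in> uniformly_discrete_measures m r ==>
   (\<integral>\<^sup>+z. ennreal (decay (fst z - (y :: real ^ 'd))) \<partial>count_space (atoms \<xi>)) <= ennreal D" unfolding D_def by blast+
 show "0 <= D" by (rule D')
 show "(\<integral>\<^sup>+z. ennreal (decay (fst z)) \<partial>count_space (atoms \<xi>)) <= ennreal D" if "\<xi> \<in> X"
  using D'(2)[of \<xi> 0] that X_ud by auto
qed

text \<open>The constant \<open>c * D\<close> is the same for all configurations in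
  \<open>X\<close>. Joint continuity of translation rests on this uniformity.\<close>

lemma integral_bound:
 fixes \<phi> :: "(real ^ 'd) \<times> nat => real"
 assumes \<xi>: "\<xi> \<in> X" and m: "\<phi> \<in> borel_measurable \<xi>" and b: "\<And>z. z \<in> coloured_space m ==> \<bar>\<phi> z\<bar> <= c * decay (fst z)" and c: "0 <= c"
 shows "integrable \<xi> \<phi>" "\<bar>LINT z|\<xi>. \<phi> z\<bar> <= c * D"
proof -
 interpret ud_configuration m \<xi> r by (rule ud[OF \<xi>])
 have [measurable]: "(%z. decay (fst z)) \<in> borel_measurable \<xi>"
  unfolding measurable_cong_sets[OF sets_\<xi> refl] by (intro measurable_restrict_space1) measurable
 have le: "(\<integral>\<^sup>+z. ennreal \<bar>\<phi> z\<bar> \<partial>\<xi>) <= ennreal (c * D)"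
 proof -
  have "(\<integral>\<^sup>+z. ennreal \<bar>\<phi> z\<bar> \<partial>\<xi>) <= (\<integral>\<^sup>+z. ennreal c * ennreal (decay (fst z)) \<partial>\<xi>)"
   using b c by (intro nn_integral_mono) (auto simp: space_\<xi> ennreal_mult[symmetric] intro!: ennreal_leI)
  also have "\<dots> = ennreal c * (\<integral>\<^sup>+z. ennreal (decay (fst z)) \<partial>\<xi>)" by (rule nn_integral_cmult) measurable
  also have "(\<integral>\<^sup>+z. ennreal (decay (fst z)) \<partial>\<xi>) = (\<integral>\<^sup>+z. ennreal (decay (fst z)) \<partial>count_space (atoms \<xi>))"
   by (rule nn_integral_eq_count) measurable
  also have "ennreal c * \<dots> <= ennreal c * ennreal D" by (intro mult_left_mono D(2)[OF \<xi>]) simp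
  also have "\<dots> = ennreal (c * D)" using c D(1) by (simp add: ennreal_mult)
  finally show ?thesis .
 qed
 show i: "integrable \<xi> \<phi>" using m le by (auto simp: integrable_iff_bounded intro: le_less_trans)
 have "ennreal (norm (LINT z|\<xi>. \<phi> z)) <= (\<integral>\<^sup>+z. ennreal (norm (\<phi> z)) \<partial>\<xi>)" by (rule integral_norm_bound_ennreal[OF i])
 then have "ennreal (norm (LINT z|\<xi>. \<phi> z)) <= ennreal (c * D)" by (rule order_trans) (use le in simp)
 then show "\<bar>LINT z|\<xi>. \<phi> z\<bar> <= c * D" using c D(1) by (simp add: ennreal_le_iff)
qed

section \<open>Joint measurability of translation\<close>

lemma bounded_le_decay: "bounded (S :: (real ^ 'd) set) ==> \<exists>c\<ge>0. \<forall>x\<in>S. 1 <= c * decay x"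
proof -
 assume "bounded S"
 then obtain R where R: "\<And>x. x \<in> S ==> norm x <= R" unfolding bounded_iff by blast
 let ?c = "(1 + \<bar>R\<bar>) ^ (2 * CARD('d))"
 have "1 <= ?c * decay x" if "x \<in> S" for x
 proof -
  have "norm x <= \<bar>R\<bar>" using R[OF that] by linarith
  then have "(1 + norm x) ^ (2 * CARD('d)) <= ?c" by (intro power_mono) auto
  then show ?thesis unfolding decay_def by (simp add: pos_le_divide_eq add_pos_nonneg)
 qed
 then show ?thesis by (intro exI[of _ ?c]) auto
qed

text \<open>A test function is uniformly continuous and vanishes outside a bounded set, so a small
  change of the translation vector changes it by a small multiple of \<open>decay\<close>, uniformly
  in the point.\<close>

lemma test_function_uniform:
 fixes f :: "(real ^ 'd) \<times> nat => real"
 assumes f: "f \<in> test_functions m" and \<epsilon>: "\<epsilon> > 0"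
 shows "\<exists>\<delta>>0. \<forall>t. dist t t\<^sub>0 < \<delta> --> (\<forall>z\<in>coloured_space m. \<bar>f (displace t z) - f (displace t\<^sub>0 z)\<bar> <= \<epsilon> * decay (fst z))"
proof -
 let ?S = "{z \<in> coloured_space m. f z \<noteq> 0}"
 have cf: "continuous_on (coloured_space m) f" using f unfolding test_functions_def by blast
 have "bounded (fst ` ?S)" using f relatively_compact_iff[of ?S m] unfolding test_functions_def by auto
 then obtain R where R: "\<And>x. x \<in> fst ` ?S ==> norm x <= R" unfolding bounded_iff by blast
 have R': "f z = 0" if "z \<in> coloured_space m" "norm (fst z) > R" for z
  using R[of "fst z"] that by force
 \<comment> \<open>The margin 1 is matched by the cap \<open>d <= 1\<close> below: either both
   translates of a point stay within \<open>R + 1\<close>, or both lie beyond \<open>R\<close>,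
   where \<open>f\<close> vanishes.\<close>
 have "bounded (cball (- t\<^sub>0) (R + 1))" by simp
 then obtain c where c: "c \<ge> 0" "\<And>x. x \<in> cball (- t\<^sub>0) (R + 1) ==> 1 <= c * decay x" using bounded_le_decay by blast
 define \<eta> where "\<eta> = \<epsilon> / (c + 1)"
 have \<eta>: "\<eta> > 0" "\<eta> * c <= \<epsilon>" unfolding \<eta>_def using \<epsilon> c(1) by (auto simp: field_simps)
 have "\<exists>\<delta>>0. \<forall>x\<in>cball 0 (R + 1). \<forall>y\<in>cball 0 (R + 1). dist y x < \<delta> --> dist (f (y, i)) (f (x, i)) < \<eta>" if i: "i \<in> {1..m}" for i
 proof -
  have "continuous_on (cball 0 (R + 1)) (%x. f (x, i))"
   by (rule continuous_on_compose2[OF cf]) (use i in \<open>auto simp: coloured_space_def intro!: continuous_intros\<close>)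
  then have "uniformly_continuous_on (cball 0 (R + 1)) (%x. f (x, i))" by (intro compact_uniformly_continuous) auto
  then show ?thesis using \<eta>(1) unfolding uniformly_continuous_on_def by blast
 qed
 then obtain \<delta> where \<delta>: "\<And>i. i \<in> {1..m} ==> \<delta> i > 0"
  "\<And>i x y. i \<in> {1..m} ==> x \<in> cball 0 (R + 1) ==> y \<in> cball 0 (R + 1) ==> dist y x < \<delta> i ==> dist (f (y, i)) (f (x, i)) < \<eta>" by metis
 define d where "d = Min (insert 1 (\<delta> ` {1..m}))"
 have d0: "d > 0" unfolding d_def using \<delta>(1) by (subst Min_gr_iff) auto
 have d1: "d <= 1" unfolding d_def by (rule Min_le) auto
 have di: "d <= \<delta> i" if "i \<in> {1..m}" for i unfolding d_def using that by (intro Min_le) auto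
 have "\<bar>f (displace t z) - f (displace t\<^sub>0 z)\<bar> <= \<epsilon> * decay (fst z)" if t: "dist t t\<^sub>0 < d" and z: "z \<in> coloured_space m" for t z
 proof -
  have tt: "norm (t - t\<^sub>0) < 1" using t d1 by (simp add: dist_norm)
  have n1: "norm (t + fst z) <= norm (t\<^sub>0 + fst z) + norm (t - t\<^sub>0)" using norm_triangle_ineq[of "t\<^sub>0 + fst z" "t - t\<^sub>0"] by (simp add: algebra_simps)
  have n2: "norm (t\<^sub>0 + fst z) <= norm (t + fst z) + norm (t - t\<^sub>0)"
   using norm_triangle_ineq[of "t + fst z" "t\<^sub>0 - t"] by (simp add: algebra_simps norm_minus_commute)
  show ?thesis
  proof (cases "norm (t + fst z) <= R + 1 \<and> norm (t\<^sub>0 + fst z) <= R + 1")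
   case True
   have i: "snd z \<in> {1..m}" using z unfolding coloured_space_def by auto
   have eq: "displace s z = (s + fst z, snd z)" for s unfolding displace_def by (simp add: case_prod_unfold)
   have "dist (t + fst z) (t\<^sub>0 + fst z) < \<delta> (snd z)" using t di[OF i] by (simp add: dist_norm)
   then have "dist (f (displace t z)) (f (displace t\<^sub>0 z)) < \<eta>" unfolding eq using True by (intro \<delta>(2)[OF i]) auto
   moreover have "1 <= c * decay (fst z)" using True by (intro c(2)) (simp add: dist_norm norm_minus_commute[of "- t\<^sub>0"] add.commute)
   moreover then have "\<eta> * 1 <= \<eta> * (c * decay (fst z))" using \<eta>(1) by (intro mult_left_mono) auto
   moreover have "\<eta> * (c * decay (fst z)) <= \<epsilon> * decay (fst z)" using mult_right_mono[OF \<eta>(2), of "decay (fst z)"] by (simp add: mult.assoc)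
   ultimately show ?thesis by (simp add: dist_real_def)
  next
   case False
   then have "norm (t + fst z) > R" "norm (t\<^sub>0 + fst z) > R" using n1 n2 tt by auto
   then have "f (displace t z) = 0" "f (displace t\<^sub>0 z) = 0" using R' z by auto
   then show ?thesis using \<epsilon> by simp
  qed
 qed
 then show ?thesis using d0 by blast
qed

lemma test_function_decay_bound:
 fixes f :: "(real ^ 'd) \<times> nat => real"
 assumes f: "f \<in> test_functions m"
 shows "\<exists>c\<ge>0. \<forall>z\<in>coloured_space m. \<bar>f z\<bar> <= c * decay (fst z)"
proof -
 let ?S = "{z \<in> coloured_space m. f z \<noteq> 0}"
 have S: "compact (closure ?S)" "?S \<subseteq> coloured_space m" using f unfolding test_functions_def by auto
 have cl: "closure ?S \<subseteq> coloured_space m" using S(2) closed_coloured_space by (rule closure_minimal)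
 have "continuous_on (closure ?S) f" using f cl unfolding test_functions_def by (auto intro: continuous_on_subset)
 then have "bounded (f ` closure ?S)" using S(1) by (intro compact_imp_bounded compact_continuous_image)
 then obtain M where M: "\<And>z. z \<in> closure ?S ==> \<bar>f z\<bar> <= M" unfolding bounded_iff by auto
 have bS: "bounded (fst ` ?S)" using S relatively_compact_iff[OF S(2)] by simp
 obtain c where c: "c \<ge> 0" "\<And>x. x \<in> fst ` ?S ==> 1 <= c * decay x" using bounded_le_decay[OF bS] by (elim exE conjE) (rule that, auto)
 have "\<bar>f z\<bar> <= (\<bar>M\<bar> * c) * decay (fst z)" if "z \<in> coloured_space m" for z
 proof (cases "f z = 0")
  case True then show ?thesis using c(1) by simp
 next
  case False
  then have z: "z \<in> ?S" using that by simp
  then have "\<bar>f z\<bar> <= \<bar>M\<bar> * 1" using M[of z] closure_subset[of ?S] by force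
  also have "\<dots> <= \<bar>M\<bar> * (c * decay (fst z))" using z by (intro mult_left_mono c(2) imageI) auto
  finally show ?thesis by (simp add: mult.assoc)
 qed
 then show ?thesis using c(1) by (intro exI[of _ "\<bar>M\<bar> * c"]) auto
qed

text \<open>Induction over the generation of the vague topology. On a subbasic set, the change in
  \<open>t\<close> is small uniformly over \<open>X\<close> by the bound on sums of
  \<open>decay\<close>, and the change in the configuration is controlled by one vague neighbourhood
  for the test function displaced by the fixed \<open>t\<^sub>0\<close>, written
  \<open>t\<^sub>0\<close> in the statement.\<close>

lemma joint_continuity:
 fixes U :: "'d config set"
 assumes "generate_topology_on {{\<xi> \<in> point_measures m. (LINT z|\<xi>. f z) \<in> V} |f V. f \<in> test_functions m \<and> open V} U"
  and "\<xi>\<^sub>0 \<in> X" "translate t\<^sub>0 \<xi>\<^sub>0 \<in> U"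
 shows "\<exists>\<delta> W. \<delta> > 0 \<and> openin (vague_topology m) W \<and> \<xi>\<^sub>0 \<in> W \<and> (\<forall>t. dist t t\<^sub>0 < \<delta> --> (\<forall>\<xi>\<in>W \<inter> X. translate t \<xi> \<in> U))"
 using assms
proof (induction arbitrary: t\<^sub>0 rule: generate_topology_on.induct)
 case Empty then show ?case by simp
next
 case (Int a b)
 obtain \<delta> W where 1: "\<delta> > 0" "openin (vague_topology m) W" "\<xi>\<^sub>0 \<in> W" "\<And>t \<xi>. dist t t\<^sub>0 < \<delta> ==> \<xi> \<in> W \<inter> X ==> translate t \<xi> \<in> a"
  using Int.IH(1)[OF Int.prems(1)] Int.prems(2) by (metis IntD1)
 obtain \<delta>' W' where 2: "\<delta>' > 0" "openin (vague_topology m) W'" "\<xi>\<^sub>0 \<in> W'" "\<And>t \<xi>. dist t t\<^sub>0 < \<delta>' ==> \<xi> \<in> W' \<inter> X ==> translate t \<xi> \<in> b"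
  using Int.IH(2)[OF Int.prems(1)] Int.prems(2) by (metis IntD2)
 show ?case using 1 2 by (intro exI[of _ "min \<delta> \<delta>'"] exI[of _ "W \<inter> W'"]) auto
next
 case (UN K)
 then obtain k where k: "k \<in> K" "translate t\<^sub>0 \<xi>\<^sub>0 \<in> k" by blast
 show ?case using UN.IH[OF k(1) UN.prems(1) k(2)] k(1) by blast
next
 case (Basis U)
 then obtain f V where U: "U = {\<xi> \<in> point_measures m. (LINT z|\<xi>. f z) \<in> V}" and f: "f \<in> test_functions m" and V: "open V" by blast
 have inU: "translate t \<xi> \<in> U \<longleftrightarrow> (LINT z|\<xi>. f (displace t z)) \<in> V" if "\<xi> \<in> X" for t \<xi>
 proof -
  interpret point_configuration m \<xi> using that X_subset by (intro point_configurationI) blast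
  show ?thesis unfolding U using translate_point_measure integral_translate[OF test_function_measurable[OF f]] by simp
 qed
 let ?L = "LINT z|\<xi>\<^sub>0. f (displace t\<^sub>0 z)"
 have "?L \<in> V" using Basis.prems inU by blast
 then obtain e where e: "e > 0" "ball ?L e \<subseteq> V" using V unfolding open_contains_ball by blast
 \<comment> \<open>Half of \<open>e\<close> is reserved for the change of the vector, with
   \<open>D + 1\<close> in the denominator since \<open>D\<close> may be 0; the other half is for
   the configuration.\<close>
 define \<epsilon> where "\<epsilon> = e / 2 / (D + 1)"
 have \<epsilon>: "\<epsilon> > 0" "\<epsilon> * D < e / 2" unfolding \<epsilon>_def using e(1) D(1) by (auto simp: field_simps)
 obtain \<delta> where \<delta>: "\<delta> > 0" "\<And>t z. dist t t\<^sub>0 < \<delta> ==> z \<in> coloured_space m ==> \<bar>f (displace t z) - f (displace t\<^sub>0 z)\<bar> <= \<epsilon> * decay (fst z)"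
  using test_function_uniform[OF f \<epsilon>(1)] by metis
 let ?W = "{\<xi> \<in> point_measures m. (LINT z|\<xi>. f (displace t\<^sub>0 z)) \<in> ball ?L (e / 2)}"
 have "translate t \<xi> \<in> U" if t: "dist t t\<^sub>0 < \<delta>" and \<xi>: "\<xi> \<in> ?W \<inter> X" for t \<xi>
 proof -
  have \<xi>X: "\<xi> \<in> X" using \<xi> by blast
  interpret ud_configuration m \<xi> r by (rule ud[OF \<xi>X])
  have m: "(%z. f (displace s z)) \<in> borel_measurable \<xi>" for s by (rule test_function_measurable[OF test_function_displace[OF f]])
  have i: "integrable \<xi> (%z. f (displace s z))" for s
  proof -
   obtain c where "c \<ge> 0" "\<And>z. z \<in> coloured_space m ==> \<bar>f (displace s z)\<bar> <= c * decay (fst z)"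
   using test_function_decay_bound[OF test_function_displace[OF f, of s]] by blast
   then show ?thesis by (intro integral_bound(1)[OF \<xi>X m])
  qed
  have "\<bar>LINT z|\<xi>. f (displace t z) - f (displace t\<^sub>0 z)\<bar> <= \<epsilon> * D"
   using \<delta>(2)[OF t] \<epsilon>(1) m by (intro integral_bound(2)[OF \<xi>X]) auto
  then have "\<bar>(LINT z|\<xi>. f (displace t z)) - (LINT z|\<xi>. f (displace t\<^sub>0 z))\<bar> < e / 2" using \<epsilon>(2) i by simp
  moreover have "\<bar>?L - (LINT z|\<xi>. f (displace t\<^sub>0 z))\<bar> < e / 2" using \<xi> by (simp add: dist_real_def)
  ultimately have "dist ?L (LINT z|\<xi>. f (displace t z)) < e" unfolding dist_real_def by linarith
  then show ?thesis using e(2) inU[OF \<xi>X] by auto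
 qed
 moreover have "openin (vague_topology m) ?W" by (rule vague_subbasis_open[OF test_function_displace[OF f] open_ball])
 moreover have "\<xi>\<^sub>0 \<in> ?W" using Basis.prems X_subset e(1) by auto
 ultimately show ?case using \<delta>(1) by blast
qed

text \<open>The preimage of an open set has to be a countable union of boxes. Countability comes
  from a basis of the space of vectors alone: for each basic \<open>b\<close> the second side
  \<open>W b\<close> is the union of all open sets that work for every \<open>t\<close> in
  \<open>b\<close>, so no countable basis of the vague topology enters.\<close>

lemma joint_measurable: "(%(t, \<xi>). translate t \<xi>) \<in> borel \<Otimes>\<^sub>M P \<rightarrow>\<^sub>M P"
proof -
 have "(%(t, \<xi>). translate t \<xi>) \<in> borel \<Otimes>\<^sub>M P \<rightarrow>\<^sub>M restrict_space \<mu> X"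
 proof (rule measurable_restrict_space2)
 have sp: "space (borel \<Otimes>\<^sub>M P) = UNIV \<times> X" by (simp add: space_pair_measure space_P)
 show "(%(t, \<xi>). translate t \<xi>) \<in> space (borel \<Otimes>\<^sub>M P) \<rightarrow> X" unfolding sp using translate_X by auto
 show "(%(t, \<xi>). translate t \<xi>) \<in> borel \<Otimes>\<^sub>M P \<rightarrow>\<^sub>M \<mu>"
 proof (rule measurable_sigma_sets[OF sets_\<mu>[unfolded sets_vague_borel] vague_borel_generators])
  show "(%(t, \<xi>). translate t \<xi>) \<in> space (borel \<Otimes>\<^sub>M P) \<rightarrow> point_measures m"
   unfolding sp using translate_X X_subset by auto
  fix U :: "'d config set" assume "U \<in> {V. openin (vague_topology m) V}"
  then have gU: "generate_topology_on {{\<xi> \<in> point_measures m. (LINT z|\<xi>. f z) \<in> V} |f V. f \<in> test_functions m \<and> open V} U"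
   unfolding vague_topology_def openin_topology_generated_by_iff by simp
  obtain \<B> :: "(real ^ 'd) set set" where \<B>: "countable \<B>" "topological_basis \<B>" using ex_countable_basis by blast
  define W where "W b = \<Union> {W. openin (vague_topology m) W \<and> (\<forall>t\<in>b. \<forall>\<xi>\<in>W \<inter> X. translate t \<xi> \<in> U)}" for b
  have W_open: "openin (vague_topology m) (W b)" for b unfolding W_def by (rule openin_Union) blast
  have "(%(t, \<xi>). translate t \<xi>) -` U \<inter> space (borel \<Otimes>\<^sub>M P) = (\<Union>b\<in>\<B>. b \<times> (W b \<inter> X))"
  proof (intro set_eqI iffI)
   fix p assume "p \<in> (%(t, \<xi>). translate t \<xi>) -` U \<inter> space (borel \<Otimes>\<^sub>M P)"
   then obtain t \<xi> where p: "p = (t, \<xi>)" "\<xi> \<in> X" "translate t \<xi> \<in> U" unfolding sp by auto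
   obtain \<delta> W' where \<delta>: "\<delta> > 0" and W': "openin (vague_topology m) W'" "\<xi> \<in> W'"
   and tr: "\<And>t' \<xi>'. dist t' t < \<delta> ==> \<xi>' \<in> W' \<inter> X ==> translate t' \<xi>' \<in> U"
   using joint_continuity[OF gU p(2,3)] by metis
   obtain b where b: "b \<in> \<B>" "t \<in> b" "b \<subseteq> ball t \<delta>"
   using topological_basisE[OF \<B>(2) open_ball, of t t \<delta>] \<delta> by auto
   have "W' \<subseteq> W b" unfolding W_def using W' b(3) tr by (intro Union_upper) (auto simp: dist_commute)
   then show "p \<in> (\<Union>b\<in>\<B>. b \<times> (W b \<inter> X))" using b p W' by blast
  next
   fix p assume "p \<in> (\<Union>b\<in>\<B>. b \<times> (W b \<inter> X))"
   then show "p \<in> (%(t, \<xi>). translate t \<xi>) -` U \<inter> space (borel \<Otimes>\<^sub>M P)" unfolding sp W_def by auto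
  qed
  moreover have "(\<Union>b\<in>\<B>. b \<times> (W b \<inter> X)) \<in> sets (borel \<Otimes>\<^sub>M P)"
  proof (rule sets.countable_UN''[OF \<B>(1)])
   fix b assume "b \<in> \<B>"
   then have "b \<in> sets borel" using topological_basis_open[OF \<B>(2)] by auto
   moreover have "W b \<inter> X \<in> sets P"
   unfolding sets_P_iff using X_sets vague_open_measurable[OF W_open] by (auto simp: sets_\<mu>)
   ultimately show "b \<times> (W b \<inter> X) \<in> sets (borel \<Otimes>\<^sub>M P)" by auto
  qed
  ultimately show "(%(t, \<xi>). translate t \<xi>) -` U \<inter> space (borel \<Otimes>\<^sub>M P) \<in> sets (borel \<Otimes>\<^sub>M P)" by simp
 qed
 qed
 then show ?thesis unfolding P_def[symmetric] .
qed

lemma stationary_P: "distr P P (translate t) = P"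
proof (rule measure_eqI)
 fix A assume "A \<in> sets (distr P P (translate t))"
 then have A: "A \<in> sets P" by simp
 have mP: "translate t \<in> P \<rightarrow>\<^sub>M P"
  using measurable_compose[OF measurable_Pair1' joint_measurable, of t] by simp
 have A\<mu>: "A \<in> sets \<mu>" "A \<subseteq> X" using A sets_P_iff by auto
 have mt: "translate t \<in> \<mu> \<rightarrow>\<^sub>M vague_borel m"
  using measurable_translate by (simp add: measurable_cong_sets[OF sets_\<mu> refl])
 \<comment> \<open>Translating back by \<open>- t\<close> shows that whatever is sent into
   \<open>A\<close> already lies in the invariant set \<open>X\<close>.\<close>
 have inX: "translate t -` A \<inter> space \<mu> = translate t -` A \<inter> X"
 proof -
  have "\<xi> \<in> X" if "translate t \<xi> \<in> A" "\<xi> \<in> point_measures m" for \<xi>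
  proof -
   interpret point_configuration m \<xi> by (rule point_configurationI[OF that(2)])
   have "translate (- t) (translate t \<xi>) \<in> X" by (rule translate_X[OF subsetD[OF A\<mu>(2) that(1)]])
   then show ?thesis by (simp add: translate_translate translate_0)
  qed
  then have "translate t -` A \<inter> point_measures m \<subseteq> X" by auto
  then show ?thesis unfolding space_\<mu> using X_subset by auto
 qed
 have "emeasure (distr P P (translate t)) A = emeasure P (translate t -` A \<inter> X)"
  using emeasure_distr[OF mP A] by (simp add: space_P)
 also have "\<dots> = emeasure \<mu> (translate t -` A \<inter> X)" unfolding P_def
  using X_sets by (intro emeasure_restrict_space) auto
 also have "\<dots> = emeasure (distr \<mu> (vague_borel m) (translate t)) A"
  using emeasure_distr[OF mt] A\<mu>(1) by (simp add: inX sets_\<mu>)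
 also have "\<dots> = emeasure P A" unfolding stationary_\<mu> unfolding P_def
  using X_sets A\<mu> by (intro emeasure_restrict_space[symmetric]) auto
 finally show "emeasure (distr P P (translate t)) A = emeasure P A" .
qed simp

text \<open>Open sets are reached as limits of test functions, whose integrals are vaguely
  continuous, and the other Borel sets by induction on disjoint unions and complements. The ball
  keeps all masses finite, as subtraction for complements demands.\<close>

lemma measurable_measure_ball:
 fixes A :: "(real ^ 'd) set"
 assumes A: "A \<in> sets borel" and i: "i \<in> {1..m}"
 shows "(%\<xi>. measure \<xi> ((A \<inter> ball 0 R) \<times> {i})) \<in> borel_measurable P"
proof -
 have sub: "(S \<inter> ball 0 R) \<times> {i} \<subseteq> coloured_space m" for S :: "(real ^ 'd) set" using i unfolding coloured_space_def by auto
 have Ss: "(S \<inter> ball 0 R) \<times> {i} \<in> sets \<xi>" if "\<xi> \<in> X" "S \<in> sets borel" for S \<xi>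
 proof -
  interpret ud_configuration m \<xi> r by (rule ud[OF that(1)])
  show ?thesis unfolding sets_\<xi>_iff using that(2) sub by (auto intro!: borel_Times_nat)
 qed
 have fin: "emeasure \<xi> ((S \<inter> ball 0 R) \<times> {i}) < \<infinity>" if "\<xi> \<in> X" "S \<in> sets borel" for S \<xi>
 proof -
  interpret ud_configuration m \<xi> r by (rule ud[OF that(1)])
  have "(S \<inter> ball 0 R) \<times> {i} \<subseteq> cball 0 R \<times> {1..m}" using i by auto
  then have "\<exists>n::nat. emeasure \<xi> ((S \<inter> ball 0 R) \<times> {i}) = of_nat n" by (rule emeasure_natural[OF Ss[OF that]])
  then obtain n :: nat where "emeasure \<xi> ((S \<inter> ball 0 R) \<times> {i}) = of_nat n" by blast
  then show ?thesis by (simp add: ennreal_of_nat_eq_real_of_nat)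
 qed
 have test: "(%\<xi>. LINT z|\<xi>. f z) \<in> borel_measurable P" if f: "f \<in> test_functions m" for f
 proof (rule borel_measurableI)
  fix V :: "real set" assume V: "open V"
  have "(%\<xi>. LINT z|\<xi>. f z) -` V \<inter> space P = {\<xi> \<in> point_measures m. (LINT z|\<xi>. f z) \<in> V} \<inter> X"
   unfolding space_P using X_subset by blast
  moreover have "{\<xi> \<in> point_measures m. (LINT z|\<xi>. f z) \<in> V} \<in> sets \<mu>"
   unfolding sets_\<mu> by (rule vague_open_measurable[OF vague_subbasis_open[OF f V]])
  ultimately show "(%\<xi>. LINT z|\<xi>. f z) -` V \<inter> space P \<in> sets P"
   using X_sets unfolding sets_P_iff by auto
 qed
 have opn: "(%\<xi>. measure \<xi> ((S \<inter> ball 0 R) \<times> {i})) \<in> borel_measurable P" if S: "open S" for S :: "(real ^ 'd) set"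
 proof -
  let ?O = "S \<inter> ball 0 R"
  define h where "h n z = (if snd z = i then min 1 (real n * infdist (fst z) (- ?O)) else 0)" for n :: nat and z :: "(real ^ 'd) \<times> nat"
  have ne: "- ?O \<noteq> {}"
  proof -
   have "bounded ?O" by (rule bounded_subset[OF bounded_ball]) auto
   then have "?O \<noteq> UNIV" using not_bounded_UNIV by metis
   then show ?thesis by auto
  qed
  have clO: "closed (- ?O)" using S by (simp add: closed_def open_Int)
  have h0: "h n z = 0" if "z \<notin> ?O \<times> {i}" for n z
   using that unfolding h_def by (cases z) auto
  have ht: "h n \<in> test_functions m" for n
   unfolding test_functions_def
  proof (intro CollectI conjI)
   have "continuous_on UNIV (%j::nat. if j = i then 1 else (0::real))" by simp
   then have "continuous_on UNIV (%z :: (real ^ 'd) \<times> nat. (if snd z = i then 1 else 0) * min 1 (real n * infdist (fst z) (- ?O)))"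
   by (intro continuous_on_mult continuous_on_compose2[of UNIV "%j. if j = i then 1 else 0" UNIV snd] continuous_intros) auto
   then have "continuous_on UNIV (h n)" unfolding h_def[abs_def] by (rule continuous_on_eq) auto
   then show "continuous_on (coloured_space m) (h n)" by (rule continuous_on_subset) simp
   have "bounded (fst ` {z \<in> coloured_space m. h n z \<noteq> 0})"
   by (rule bounded_subset[OF bounded_ball[of 0 R]]) (use h0 in force)
   then show "compact (closure {z \<in> coloured_space m. h n z \<noteq> 0})"
   using relatively_compact_iff[of "{z \<in> coloured_space m. h n z \<noteq> 0}" m] by auto
  qed
  have hlim: "(%n. h n z) \<longlonglongrightarrow> indicator (?O \<times> {i}) z" for z
  proof (cases "z \<in> ?O \<times> {i}")
   case True
   then have "infdist (fst z) (- ?O) \<noteq> 0" using in_closed_iff_infdist_zero[OF clO ne, of "fst z"] by auto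
   then have pos: "infdist (fst z) (- ?O) > 0" using infdist_nonneg[of "fst z" "- ?O"] by linarith
   obtain N :: nat where N: "1 / infdist (fst z) (- ?O) < real N" using reals_Archimedean2 by blast
   have "h n z = indicator (?O \<times> {i}) z" if "n \<ge> N" for n
   proof -
   have "1 / infdist (fst z) (- ?O) < real n" using N that by linarith
   then have "1 < real n * infdist (fst z) (- ?O)" using pos by (simp add: divide_less_eq)
   then show ?thesis using True unfolding h_def by (cases z) auto
   qed
   then show ?thesis by (intro tendsto_eventually) (auto simp: eventually_sequentially)
  next
   case False
   then show ?thesis by (simp add: h0 indicator_def)
  qed
  show ?thesis
  proof (rule borel_measurable_LIMSEQ_metric)
   show "(%\<xi>. LINT z|\<xi>. h n z) \<in> borel_measurable P" for n by (rule test[OF ht])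
   fix \<xi> assume "\<xi> \<in> space P"
   then have \<xi>: "\<xi> \<in> X" by (simp add: space_P)
   interpret ud_configuration m \<xi> r by (rule ud[OF \<xi>])
   have Os: "?O \<times> {i} \<in> sets \<xi>" using Ss[OF \<xi>] S by auto
   have "(%n. LINT z|\<xi>. h n z) \<longlonglongrightarrow> (LINT z|\<xi>. indicator (?O \<times> {i}) z)"
   proof (rule integral_dominated_convergence[where w="indicator (?O \<times> {i})"])
   show "integrable \<xi> (indicator (?O \<times> {i}) :: _ => real)"
   using Os fin[OF \<xi>, of S] S by (simp add: less_top[symmetric])
   show "AE z in \<xi>. norm (h n z) <= indicator (?O \<times> {i}) z" for n
   proof (rule AE_I2)
   fix z
   show "norm (h n z) <= indicator (?O \<times> {i}) z"
   proof (cases "z \<in> ?O \<times> {i}")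
   case True
   then show ?thesis by (auto simp: h_def infdist_nonneg abs_of_nonneg)
   next
   case False
   then show ?thesis unfolding h0[OF False] by simp
   qed
   qed
   show "h n \<in> borel_measurable \<xi>" for n by (rule test_function_measurable[OF ht])
   show "(%z. indicator (?O \<times> {i}) z :: real) \<in> borel_measurable \<xi>" using Os by simp
   qed (use hlim in auto)
   then show "(%n. LINT z|\<xi>. h n z) \<longlonglongrightarrow> measure \<xi> (?O \<times> {i})"
   using Os sets.sets_into_space[OF Os] by (simp add: Int_absorb2)
  qed
 qed
 have "Int_stable {S :: (real ^ 'd) set. open S}" by (auto simp: Int_stable_def)
 moreover have "{S :: (real ^ 'd) set. open S} \<subseteq> Pow UNIV" by simp
 moreover have "A \<in> sigma_sets UNIV {S. open S}" using A by (simp add: borel_def)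
 ultimately show ?thesis
 proof (induction rule: sigma_sets_induct_disjoint)
  case (basic A)
  then show ?case using opn by simp
 next
  case empty
  then show ?case by simp
 next
  \<comment> \<open>The complement is taken within the ball, where it becomes a difference of finite
    masses.\<close>
  case (compl A)
  have Ab: "A \<in> sets borel" using compl(1) by (simp add: borel_def)
  have "measure \<xi> (((UNIV - A) \<inter> ball 0 R) \<times> {i}) = measure \<xi> ((UNIV \<inter> ball 0 R) \<times> {i}) - measure \<xi> ((A \<inter> ball 0 R) \<times> {i})" if "\<xi> \<in> space P" for \<xi>
  proof -
   have \<xi>: "\<xi> \<in> X" using that by (simp add: space_P)
   have "((UNIV - A) \<inter> ball 0 R) \<times> {i} = ((UNIV \<inter> ball 0 R) \<times> {i}) - ((A \<inter> ball 0 R) \<times> {i})" by auto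
   then show ?thesis
   using fin[OF \<xi>, of UNIV] fin[OF \<xi> Ab] Ss[OF \<xi>, of UNIV] Ss[OF \<xi> Ab]
   by (simp only:) (intro measure_Diff, auto)
  qed
  moreover have "(%\<xi>. measure \<xi> ((UNIV \<inter> ball 0 R) \<times> {i}) - measure \<xi> ((A \<inter> ball 0 R) \<times> {i})) \<in> borel_measurable P"
   by (intro borel_measurable_diff opn compl(2) open_UNIV)
  ultimately show ?case by (subst measurable_cong) auto
 next
  case (union F)
  have Fb: "F n \<in> sets borel" for n using union(2) by (auto simp: borel_def)
  have "measure \<xi> ((\<Union> (range F) \<inter> ball 0 R) \<times> {i}) = (\<Sum>n. measure \<xi> ((F n \<inter> ball 0 R) \<times> {i}))" if "\<xi> \<in> space P" for \<xi>
  proof -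
   have \<xi>: "\<xi> \<in> X" using that by (simp add: space_P)
   have eq: "(\<Union> (range F) \<inter> ball 0 R) \<times> {i} = (\<Union>n. (F n \<inter> ball 0 R) \<times> {i})" by auto
   have "(%n. measure \<xi> ((F n \<inter> ball 0 R) \<times> {i})) sums measure \<xi> (\<Union>n. (F n \<inter> ball 0 R) \<times> {i})"
   proof (rule measure_UNION)
   show "range (%n. (F n \<inter> ball 0 R) \<times> {i}) \<subseteq> sets \<xi>" using Ss[OF \<xi> Fb] by auto
   show "disjoint_family (%n. (F n \<inter> ball 0 R) \<times> {i})"
   using union(1) unfolding disjoint_family_on_def by auto
   have "(\<Union>n. F n) \<in> sets borel" using Fb by auto
   from fin[OF \<xi> this] show "emeasure \<xi> (\<Union>n. (F n \<inter> ball 0 R) \<times> {i}) \<noteq> \<infinity>" using eq by simp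
   qed
   then show ?thesis unfolding eq by (rule sums_unique)
  qed
  moreover have "(%\<xi>. \<Sum>n. measure \<xi> ((F n \<inter> ball 0 R) \<times> {i})) \<in> borel_measurable P"
   using union(3) by (intro borel_measurable_suminf) auto
  ultimately show ?case by (subst measurable_cong) auto
 qed
qed

section \<open>A measurable enumeration of the points by grid cells\<close>

abbreviation "C g \<equiv> grid_cell r g \<times> {1..m}"

text \<open>Cutting \<open>S\<close> into its finitely many colour slices reduces the event to ball
  counts. Within a cell masses are 0 or 1, so vanishing of \<open>emeasure\<close> and of
  \<open>measure\<close> coincide.\<close>

lemma cell_charged_sets:
 assumes S: "S \<in> sets borel"
 shows "{\<xi> \<in> X. emeasure \<xi> (S \<inter> C g) \<noteq> 0} \<in> sets P"
proof -
 obtain R where R: "grid_cell r g \<subseteq> ball (0 :: real ^ 'd) R" using grid_cell_bounded[OF r] by blast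
 define T where "T i = {x. (x, i) \<in> S} \<inter> grid_cell r g" for i
 have Tb: "T i \<in> sets borel" for i
 proof -
  have "(%x :: real ^ 'd. (x, i)) -` S \<inter> space borel \<in> sets borel"
   by (rule measurable_sets[OF borel_measurable_continuous_onI S]) (intro continuous_intros)
  moreover have "(%x :: real ^ 'd. (x, i)) -` S \<inter> space borel = {x. (x, i) \<in> S}" by auto
  ultimately show ?thesis unfolding T_def by auto
 qed
 have charged: "{\<xi> \<in> X. emeasure \<xi> (S \<inter> C g) \<noteq> 0} = (\<Union>i\<in>{1..m}. {\<xi> \<in> space P. measure \<xi> ((T i \<inter> ball 0 R) \<times> {i}) \<noteq> 0})"
 proof -
  have "emeasure \<xi> (S \<inter> C g) \<noteq> 0 \<longleftrightarrow> (\<exists>i\<in>{1..m}. measure \<xi> ((T i \<inter> ball 0 R) \<times> {i}) \<noteq> 0)" if \<xi>: "\<xi> \<in> X" for \<xi>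
  proof -
   interpret ud_configuration m \<xi> r by (rule ud[OF \<xi>])
   have Ts: "(T i \<inter> ball 0 R) \<times> {i} \<in> sets \<xi>" if "i \<in> {1..m}" for i
   unfolding sets_\<xi>_iff using Tb that by (auto intro!: borel_Times_nat simp: coloured_space_def)
   have Tc: "(T i \<inter> ball 0 R) \<times> {i} \<subseteq> cell g" if "i \<in> {1..m}" for i
   using that unfolding cell_def T_def by auto
   have eq: "S \<inter> C g = (\<Union>i\<in>{1..m}. (T i \<inter> ball 0 R) \<times> {i})" unfolding T_def using R by auto
   have z: "measure \<xi> ((T i \<inter> ball 0 R) \<times> {i}) = 0 \<longleftrightarrow> emeasure \<xi> ((T i \<inter> ball 0 R) \<times> {i}) = 0" if "i \<in> {1..m}" for i
   using emeasure_cell_01[OF Ts[OF that] Tc[OF that]] by (auto simp: measure_def)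
   have "emeasure \<xi> (S \<inter> C g) = 0 \<longleftrightarrow> (\<forall>i\<in>{1..m}. emeasure \<xi> ((T i \<inter> ball 0 R) \<times> {i}) = 0)"
   proof
   assume 0: "emeasure \<xi> (S \<inter> C g) = 0"
   have "S \<inter> C g \<in> sets \<xi>" unfolding eq using Ts by auto
   then show "\<forall>i\<in>{1..m}. emeasure \<xi> ((T i \<inter> ball 0 R) \<times> {i}) = 0"
   using 0 eq by (intro ballI) (rule emeasure_eq_0, auto)
   next
   assume "\<forall>i\<in>{1..m}. emeasure \<xi> ((T i \<inter> ball 0 R) \<times> {i}) = 0"
   then have "(\<Union>i\<in>{1..m}. (T i \<inter> ball 0 R) \<times> {i}) \<in> null_sets \<xi>"
   using Ts by (intro null_sets.finite_UN) (auto simp: null_sets_def)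
   then show "emeasure \<xi> (S \<inter> C g) = 0" unfolding eq by auto
   qed
   then show ?thesis using z by blast
  qed
  then show ?thesis unfolding space_P by blast
 qed
 have meas: "{\<xi> \<in> space P. measure \<xi> ((T i \<inter> ball 0 R) \<times> {i}) \<noteq> 0} \<in> sets P" if "i \<in> {1..m}" for i
 proof -
  have "(%\<xi>. measure \<xi> ((T i \<inter> ball 0 R) \<times> {i})) -` (- {0}) \<inter> space P \<in> sets P"
   by (rule measurable_sets[OF measurable_measure_ball[OF Tb that]]) simp
  also have "(%\<xi>. measure \<xi> ((T i \<inter> ball 0 R) \<times> {i})) -` (- {0}) \<inter> space P = {\<xi> \<in> space P. measure \<xi> ((T i \<inter> ball 0 R) \<times> {i}) \<noteq> 0}"
   by blast
  finally show ?thesis .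
 qed
 show ?thesis unfolding charged by (rule sets.finite_UN[OF finite_atLeastAtMost meas])
qed

definition A :: "('d => int) => 'd config set" where
 "A g = {\<xi> \<in> X. emeasure \<xi> (C g) \<noteq> 0}"

text \<open>On \<open>A g\<close> the choice is forced, since a cell contains one atom at most.
  Elsewhere the value is a constant, which keeps \<open>Z g\<close> measurable.\<close>

definition Z :: "('d => int) => 'd config => (real ^ 'd) \<times> nat" where
 "Z g \<xi> = (if \<xi> \<in> A g then SOME z. z \<in> C g \<and> z \<in> atoms \<xi> else (0, 0))"

lemma Z_atom:
 assumes "\<xi> \<in> A g" shows "Z g \<xi> \<in> C g" "Z g \<xi> \<in> atoms \<xi>"
proof -
 have \<xi>: "\<xi> \<in> X" using assms unfolding A_def by blast
 interpret ud_configuration m \<xi> r by (rule ud[OF \<xi>])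
 have "C g \<inter> atoms \<xi> \<noteq> {}" using assms emeasure_cell[of g] unfolding A_def cell_def by (auto split: if_splits)
 then have "\<exists>z. z \<in> C g \<and> z \<in> atoms \<xi>" by blast
 from someI_ex[OF this] show "Z g \<xi> \<in> C g" "Z g \<xi> \<in> atoms \<xi>" using assms unfolding Z_def by auto
qed

lemma Z_unique:
 assumes "\<xi> \<in> X" "z \<in> atoms \<xi>" "z \<in> C g"
 shows "\<xi> \<in> A g" "Z g \<xi> = z"
proof -
 interpret ud_configuration m \<xi> r by (rule ud[OF assms(1)])
 show A: "\<xi> \<in> A g" using emeasure_cell[of g] assms unfolding A_def cell_def by (auto split: if_splits)
 show "Z g \<xi> = z" using atom_unique[OF Z_atom(2)[OF A] assms(2), of g] Z_atom(1)[OF A] assms(3) unfolding cell_def by blast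
qed

lemma pts_eq_atoms: "\<xi> \<in> X ==> pts A Z \<xi> = atoms \<xi>"
proof -
 assume \<xi>: "\<xi> \<in> X"
 interpret ud_configuration m \<xi> r by (rule ud[OF \<xi>])
 show "pts A Z \<xi> = atoms \<xi>"
 proof (intro set_eqI iffI)
  fix z assume "z \<in> atoms \<xi>"
  moreover then obtain g where "z \<in> cell g" using in_some_cell atoms_subset by blast
  ultimately have "\<xi> \<in> A g" "Z g \<xi> = z" using Z_unique[OF \<xi>, of z g] unfolding cell_def by auto
  then show "z \<in> pts A Z \<xi>" unfolding pts_def by blast
 qed (use Z_atom in \<open>auto simp: pts_def\<close>)
qed

lemma atoms_translate: "\<xi> \<in> X ==> atoms (translate t \<xi>) = displace t ` atoms \<xi>"
proof -
 assume \<xi>: "\<xi> \<in> X"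
 interpret ud_configuration m \<xi> r by (rule ud[OF \<xi>])
 have sp: "space (translate t \<xi>) = space \<xi>" using sets_eq_imp_space_eq[OF sets_translate] .
 have e: "emeasure (translate t \<xi>) {z} = emeasure \<xi> {displace (- t) z}" if "z \<in> space \<xi>" for z
 proof -
  have "y = displace (- t) z" if "displace t y = z" for y unfolding that[symmetric] by simp
  then have "displace t -` {z} \<inter> space \<xi> = {displace (- t) z}" using that unfolding space_\<xi> by auto
  then show ?thesis using emeasure_translate[OF singleton_sets, of z t] that unfolding space_\<xi> by simp
 qed
 show "atoms (translate t \<xi>) = displace t ` atoms \<xi>"
 proof (intro set_eqI iffI)
  fix z assume "z \<in> atoms (translate t \<xi>)"
  then have "z \<in> space \<xi>" "emeasure \<xi> {displace (- t) z} \<noteq> 0" using e[of z] unfolding atoms_def sp by auto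
  then have "displace (- t) z \<in> atoms \<xi>" unfolding atoms_def space_\<xi> by simp
  then show "z \<in> displace t ` atoms \<xi>" by (rule image_eqI[rotated]) simp
 next
  fix z assume "z \<in> displace t ` atoms \<xi>"
  then obtain y where "y \<in> atoms \<xi>" "z = displace t y" by blast
  then show "z \<in> atoms (translate t \<xi>)" using e[of z] unfolding atoms_def sp space_\<xi> by simp
 qed
qed

lemma borel_UNIV: "UNIV \<in> sets borel" by simp

lemma A_sets: "A g \<in> sets P"
 using cell_charged_sets[OF borel_UNIV, of g] unfolding A_def by (simp only: Int_UNIV_left)

text \<open>On \<open>A g\<close> the chosen atom lies in \<open>S\<close> exactly if the
  configuration charges \<open>S \<inter> C g\<close>, an event already known to be measurable; the
  choice operator disappears.\<close>

lemma Z_measurable: "Z g \<in> borel_measurable P"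
 proof (rule measurableI)
  fix S :: "((real ^ 'd) \<times> nat) set" assume S: "S \<in> sets borel"
  have in_A: "Z g \<xi> \<in> S \<longleftrightarrow> emeasure \<xi> (S \<inter> C g) \<noteq> 0" if "\<xi> \<in> A g" for \<xi>
  proof -
   have \<xi>: "\<xi> \<in> X" using that unfolding A_def by blast
   interpret ud_configuration m \<xi> r by (rule ud[OF \<xi>])
   have Sc: "S \<inter> cell g \<in> sets \<xi>" using S cell_sets[of g] unfolding sets_\<xi>_iff by auto
   show ?thesis
   proof
   assume "Z g \<xi> \<in> S"
   then have "emeasure \<xi> {Z g \<xi>} <= emeasure \<xi> (S \<inter> cell g)"
   using Z_atom[OF that] Sc unfolding cell_def by (intro emeasure_mono) auto
   then show "emeasure \<xi> (S \<inter> C g) \<noteq> 0" using emeasure_atom[OF Z_atom(2)[OF that]] unfolding cell_def by auto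
   next
   assume ne: "emeasure \<xi> (S \<inter> C g) \<noteq> 0"
   have "S \<inter> cell g \<inter> atoms \<xi> \<noteq> {}"
   using ne emeasure_eq_count[OF Sc] unfolding cell_def by auto
   then obtain z where z: "z \<in> S" "z \<in> C g" "z \<in> atoms \<xi>" unfolding cell_def by blast
   then show "Z g \<xi> \<in> S" using Z_unique(2)[OF \<xi> z(3,2)] by simp
   qed
  qed
  have charged: "emeasure \<xi> (S \<inter> C g) \<noteq> 0 ==> \<xi> \<in> A g" if "\<xi> \<in> X" for \<xi>
  proof -
   interpret ud_configuration m \<xi> r by (rule ud[OF that])
   assume "emeasure \<xi> (S \<inter> C g) \<noteq> 0"
   moreover have "emeasure \<xi> (S \<inter> C g) <= emeasure \<xi> (C g)" using cell_sets[of g] unfolding cell_def by (intro emeasure_mono) auto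
   ultimately show "\<xi> \<in> A g" using that unfolding A_def by auto
  qed
  have eq: "Z g -` S \<inter> space P = {\<xi> \<in> X. emeasure \<xi> (S \<inter> C g) \<noteq> 0} \<union> (if (0, 0) \<in> S then space P - A g else {})"
   unfolding space_P
  proof (intro set_eqI)
   fix \<xi>
   show "\<xi> \<in> Z g -` S \<inter> X \<longleftrightarrow> \<xi> \<in> {\<xi> \<in> X. emeasure \<xi> (S \<inter> C g) \<noteq> 0} \<union> (if (0, 0) \<in> S then X - A g else {})"
   proof (cases "\<xi> \<in> A g")
   case True
   then show ?thesis using in_A[OF True] by (simp add: conj_commute)
   next
   case False
   then have "Z g \<xi> = (0, 0)" by (simp add: Z_def)
   then show ?thesis using charged[of \<xi>] False by auto
   qed
  qed
  show "Z g -` S \<inter> space P \<in> sets P" unfolding eq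
   by (intro sets.Un cell_charged_sets[OF S]) (simp add: sets.Diff A_sets)
 qed simp

sublocale point_family P A Z D translate
proof (rule point_family.intro)
 show "prob_space P" by (rule prob_P)
 show "A g \<in> sets P" for g by (rule A_sets)
 show "Z g \<in> borel_measurable P" for g by (rule Z_measurable)
 show "g = h" if "\<xi> \<in> A g" "\<xi> \<in> A h" "Z g \<xi> = Z h \<xi>" for \<xi> g h
  using Z_atom(1)[OF that(1)] Z_atom(1)[OF that(2)] that(3) by (auto intro: grid_cell_disjoint)
 show "(\<integral>\<^sup>+z. ennreal (decay (fst z)) \<partial>count_space (pts A Z \<xi>)) <= ennreal D" if "\<xi> \<in> space P" for \<xi>
  using D(2)[of \<xi>] that unfolding space_P by (simp add: pts_eq_atoms)
 show "(%(t, \<xi>). translate t \<xi>) \<in> borel \<Otimes>\<^sub>M P \<rightarrow>\<^sub>M P" by (rule joint_measurable)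
 show "distr P P (translate t) = P" for t by (rule stationary_P)
 show "pts A Z (translate t \<xi>) = displace t ` pts A Z \<xi>" if "\<xi> \<in> space P" for \<xi> t
  using that translate_X[of \<xi> t] unfolding space_P by (simp only: pts_eq_atoms atoms_translate)
qed

end

section \<open>Extension of isometries between L2 spaces\<close>

text \<open>The squared distance. It generates the same closures and avoids roots of integrals, at
  the price of constants in the triangle inequality.\<close>

definition l2_dist :: "'a measure => ('a => complex) => ('a => complex) => real" where
 "l2_dist M f g = (LINT x|M. (cmod (f x - g x))\<^sup>2)"

lemma square_integrable_measurable: "f \<in> square_integrable M ==> f \<in> borel_measurable M"
 unfolding square_integrable_def by blast

text \<open>From \<open>2 * a * b <= \<eta> * a^2 + b^2 / \<eta>\<close>. The value
  \<open>\<eta> = 1\<close> gives the crude triangle inequality; small \<open>\<eta>\<close> is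
  needed where norms must be preserved exactly.\<close>

lemma cmod_add_square_le:
 assumes "\<eta> > 0"
 shows "(cmod (x + y))\<^sup>2 <= (1 + \<eta>) * (cmod x)\<^sup>2 + (1 + 1 / \<eta>) * (cmod y)\<^sup>2"
proof -
 have "0 <= (sqrt \<eta> * cmod x - cmod y / sqrt \<eta>)\<^sup>2" by simp
 also have "\<dots> = \<eta> * (cmod x)\<^sup>2 - 2 * (cmod x * cmod y) + (cmod y)\<^sup>2 / \<eta>"
  using assms by (simp add: power2_diff power_mult_distrib power_divide)
 finally have "2 * (cmod x * cmod y) <= \<eta> * (cmod x)\<^sup>2 + (cmod y)\<^sup>2 / \<eta>" by simp
 moreover have "(cmod (x + y))\<^sup>2 <= (cmod x + cmod y)\<^sup>2" by (intro power_mono norm_triangle_ineq) simp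
 ultimately show ?thesis by (simp add: power2_sum algebra_simps)
qed

lemma square_integrable_add:
 assumes f: "f \<in> square_integrable M" and g: "g \<in> square_integrable M"
 shows "(%x. f x + g x) \<in> square_integrable M"
proof -
 have i: "integrable M (%x. 2 * (cmod (f x))\<^sup>2 + 2 * (cmod (g x))\<^sup>2)"
  using f g unfolding square_integrable_def by simp
 have [measurable]: "f \<in> borel_measurable M" "g \<in> borel_measurable M" using f g by (auto dest: square_integrable_measurable)
 have "integrable M (%x. (cmod (f x + g x))\<^sup>2)"
  by (rule integrable_bound_AE[OF i]) (use cmod_add_square_le[of 1] in \<open>auto simp: abs_of_nonneg\<close>)
 then show ?thesis unfolding square_integrable_def by simp
qed

lemma square_integrable_scale:
 assumes "f \<in> square_integrable M"
 shows "(%x. c * f x) \<in> square_integrable M"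
proof -
 have f: "f \<in> borel_measurable M" "integrable M (%x. (cmod (f x))\<^sup>2)" using assms unfolding square_integrable_def by blast+
 show ?thesis unfolding square_integrable_def mem_Collect_eq norm_mult power_mult_distrib
  by (intro conjI integrable_mult_right f(2) borel_measurable_times borel_measurable_const f(1))
qed

lemma square_integrable_diff:
 assumes "f \<in> square_integrable M" "g \<in> square_integrable M"
 shows "(%x. f x - g x) \<in> square_integrable M"
 using square_integrable_add[OF assms(1) square_integrable_scale[OF assms(2), of "- 1"]] by simp

lemma square_integrable_zero: "(%_. 0) \<in> square_integrable M"
 unfolding square_integrable_def by simp

lemma square_integrableD: "f \<in> square_integrable M ==> integrable M (%x. (cmod (f x))\<^sup>2)"
 unfolding square_integrable_def by blast

lemma square_integrable_AE:
 assumes "f \<in> square_integrable M" "g \<in> borel_measurable M" "AE x in M. f x = g x"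
 shows "g \<in> square_integrable M"
proof -
 have [measurable]: "f \<in> borel_measurable M" using assms(1) by (rule square_integrable_measurable)
 have "integrable M (%x. (cmod (g x))\<^sup>2) \<longleftrightarrow> integrable M (%x. (cmod (f x))\<^sup>2)"
  using assms(2,3) by (intro integrable_cong_AE) auto
 then show ?thesis using assms unfolding square_integrable_def by simp
qed

lemma l2_dist_nonneg: "0 <= l2_dist M f g"
 unfolding l2_dist_def by (rule integral_nonneg_AE) simp

lemma l2_dist_commute: "l2_dist M f g = l2_dist M g f"
 unfolding l2_dist_def by (simp add: norm_minus_commute)

lemma l2_dist_self: "l2_dist M f f = 0"
 unfolding l2_dist_def by simp

lemma l2_dist_zero: "l2_dist M f (%_. 0) = (LINT x|M. (cmod (f x))\<^sup>2)"
 unfolding l2_dist_def by simp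

lemma l2_dist_triangle_weighted:
 assumes f: "f \<in> square_integrable M" and g: "g \<in> square_integrable M" and h: "h \<in> square_integrable M" and \<eta>: "\<eta> > 0"
 shows "l2_dist M f h <= (1 + \<eta>) * l2_dist M g h + (1 + 1 / \<eta>) * l2_dist M f g"
proof -
 note i = square_integrable_diff[OF g h, THEN square_integrableD] square_integrable_diff[OF f g, THEN square_integrableD]
  square_integrable_diff[OF f h, THEN square_integrableD]
 have "l2_dist M f h <= (LINT x|M. (1 + \<eta>) * (cmod (g x - h x))\<^sup>2 + (1 + 1 / \<eta>) * (cmod (f x - g x))\<^sup>2)"
  unfolding l2_dist_def
 proof (rule integral_mono)
  show "(cmod (f x - h x))\<^sup>2 <= (1 + \<eta>) * (cmod (g x - h x))\<^sup>2 + (1 + 1 / \<eta>) * (cmod (f x - g x))\<^sup>2" for x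
   using cmod_add_square_le[OF \<eta>, of "g x - h x" "f x - g x"] by (simp add: algebra_simps)
 qed (use i in simp_all)
 then show ?thesis unfolding l2_dist_def using i by simp
qed

lemma l2_dist_triangle:
 assumes "f \<in> square_integrable M" "g \<in> square_integrable M" "h \<in> square_integrable M"
 shows "l2_dist M f h <= 2 * l2_dist M f g + 2 * l2_dist M g h"
 using l2_dist_triangle_weighted[OF assms, of 1] by simp

lemma l2_dist_add:
 assumes "f \<in> square_integrable M" "g \<in> square_integrable M" "f' \<in> square_integrable M" "g' \<in> square_integrable M"
 shows "l2_dist M (%x. f x + f' x) (%x. g x + g' x) <= 2 * l2_dist M f g + 2 * l2_dist M f' g'"
proof -
 note d = square_integrable_diff[OF assms(1,2)] square_integrable_diff[OF assms(3,4)]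
 have "l2_dist M (%x. f x + f' x) (%x. g x + g' x) = l2_dist M (%x. f x - g x) (%x. - 1 * (f' x - g' x))"
  unfolding l2_dist_def by (simp add: algebra_simps)
 also have "\<dots> <= 2 * l2_dist M (%x. f x - g x) (%_. 0) + 2 * l2_dist M (%_. 0) (%x. - 1 * (f' x - g' x))"
  by (intro l2_dist_triangle d square_integrable_zero square_integrable_scale)
 also have "\<dots> = 2 * l2_dist M f g + 2 * l2_dist M f' g'" unfolding l2_dist_def by simp
 finally show ?thesis .
qed

lemma l2_dist_scale: "l2_dist M (%x. c * f x) (%x. c * g x) = (cmod c)\<^sup>2 * l2_dist M f g"
 unfolding l2_dist_def by (simp add: norm_mult power_mult_distrib flip: right_diff_distrib)

lemma l2_dist_cong_AE:
 assumes "f \<in> borel_measurable M" "f' \<in> borel_measurable M" "g \<in> borel_measurable M" "g' \<in> borel_measurable M"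
  and "AE x in M. f x = f' x" "AE x in M. g x = g' x"
 shows "l2_dist M f g = l2_dist M f' g'"
 unfolding l2_dist_def by (rule integral_cong_AE) (use assms in auto)

lemma l2_dist_eq_0:
 assumes "f \<in> square_integrable M" "g \<in> square_integrable M" "l2_dist M f g = 0"
 shows "AE x in M. f x = g x"
proof -
 have "AE x in M. (cmod (f x - g x))\<^sup>2 = 0"
  using integral_nonneg_eq_0_iff_AE[OF square_integrable_diff[OF assms(1,2), THEN square_integrableD]] assms(3)
  unfolding l2_dist_def by simp
 then show ?thesis by simp
qed

text \<open>The Riesz--Fischer argument for rapidly Cauchy sequences: the series
 \<open>\<Sum> 2^n |g (n+1) - g n|\<^sup>2\<close> has finite integral, which forces pointwise convergence almost
 everywhere, and Fatou's lemma controls the distance to the limit.\<close>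

lemma l2_limit:
 fixes g :: "nat => 'a => complex"
 assumes g: "\<And>n. g n \<in> square_integrable M"
  and d: "\<And>n k. n <= k ==> l2_dist M (g k) (g n) <= C / 4 ^ n"
 shows "\<exists>h\<in>square_integrable M. \<forall>n. l2_dist M h (g n) <= C / 4 ^ n"
proof -
 \<comment> \<open>\<open>lim\<close> also has a value where the sequence diverges, so
   \<open>h\<close> is a measurable function on the whole space.\<close>
 define h where "h x = lim (%n. g n x)" for x
 have [measurable]: "g n \<in> borel_measurable M" for n by (rule square_integrable_measurable[OF g])
 have [measurable]: "h \<in> borel_measurable M" unfolding h_def by measurable
 have C: "0 <= C" using order_trans[OF l2_dist_nonneg d[of 0 0]] by simp
 have nn: "(\<integral>\<^sup>+x. ennreal ((cmod (g k x - g n x))\<^sup>2) \<partial>M) = ennreal (l2_dist M (g k) (g n))" for k n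
  unfolding l2_dist_def
  by (rule nn_integral_eq_integral[OF square_integrable_diff[OF g g, THEN square_integrableD]]) simp
 have "(\<integral>\<^sup>+x. (\<Sum>n. ennreal (2 ^ n * (cmod (g (Suc n) x - g n x))\<^sup>2)) \<partial>M)
   = (\<Sum>n. \<integral>\<^sup>+x. ennreal (2 ^ n * (cmod (g (Suc n) x - g n x))\<^sup>2) \<partial>M)"
  by (rule nn_integral_suminf) measurable
 also have "\<dots> = (\<Sum>n. ennreal (2 ^ n * l2_dist M (g (Suc n)) (g n)))"
  by (simp add: ennreal_mult nn_integral_cmult nn l2_dist_nonneg)
 also have "\<dots> <= (\<Sum>n. ennreal (C * (1 / 2) ^ n))"
 proof (intro suminf_le ennreal_leI)
  fix n
  have "2 ^ n * l2_dist M (g (Suc n)) (g n) <= 2 ^ n * (C / 4 ^ n)" by (intro mult_left_mono d) auto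
  also have "\<dots> = C * (1 / 2) ^ n" by (simp add: power_divide field_simps flip: power_mult_distrib)
  finally show "2 ^ n * l2_dist M (g (Suc n)) (g n) <= C * (1 / 2) ^ n" .
 qed auto
 also have "\<dots> = ennreal (\<Sum>n. C * (1 / 2) ^ n)"
  using C by (intro suminf_ennreal2 summable_mult summable_geometric) auto
 also have "\<dots> < \<infinity>" by simp
 finally have "AE x in M. (\<Sum>n. ennreal (2 ^ n * (cmod (g (Suc n) x - g n x))\<^sup>2)) \<noteq> \<infinity>"
  by (intro nn_integral_noteq_infinite) auto
 then have AE: "AE x in M. (%n. g n x) \<longlonglongrightarrow> h x"
 proof eventually_elim
  case (elim x)
  then have "summable (%n. 2 ^ n * (cmod (g (Suc n) x - g n x))\<^sup>2)" by (intro summable_suminf_not_top) auto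
  then have "(%n. 2 ^ n * (cmod (g (Suc n) x - g n x))\<^sup>2) \<longlonglongrightarrow> 0" by (rule summable_LIMSEQ_zero)
  then have ev: "eventually (%n. 2 ^ n * (cmod (g (Suc n) x - g n x))\<^sup>2 < 1) sequentially" by (rule order_tendstoD) simp
  \<comment> \<open>Terms below 1 mean increments below \<open>(1 / sqrt 2) ^ n\<close>, a geometric
    bound; the telescoping series then converges.\<close>
  have "summable (%n. g (Suc n) x - g n x)"
  proof (rule summable_comparison_test_ev[where g="%n. (1 / sqrt 2) ^ n"])
   show "eventually (%n. norm (g (Suc n) x - g n x) <= (1 / sqrt 2) ^ n) sequentially"
   using ev
   proof eventually_elim
   case (elim n)
   have "((1 / sqrt 2) ^ n)\<^sup>2 = (1 / 2) ^ n" by (simp add: power_divide flip: power_mult power2_eq_square) (simp add: power_mult mult.commute[of n])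
   then have "(cmod (g (Suc n) x - g n x))\<^sup>2 <= ((1 / sqrt 2) ^ n)\<^sup>2" using elim by (simp add: field_simps power_divide)
   then show ?case by (rule power2_le_imp_le) simp
   qed
   show "summable (%n. (1 / sqrt 2) ^ n)" by (rule summable_geometric) (simp add: divide_less_eq)
  qed
  then have "convergent (%n. \<Sum>k<n. g (Suc k) x - g k x)" by (simp add: summable_iff_convergent)
  then have "convergent (%n. g n x - g 0 x)" unfolding sum_lessThan_telescope[of "%k. g k x"] .
  then have "convergent (%n. (g n x - g 0 x) + g 0 x)" by (intro convergent_add convergent_const)
  then show ?case unfolding h_def by (simp add: convergent_LIMSEQ_iff)
 qed
 have le: "(\<integral>\<^sup>+x. ennreal ((cmod (h x - g n x))\<^sup>2) \<partial>M) <= ennreal (C / 4 ^ n)" for n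
 proof -
  \<comment> \<open>Fatou's lemma in \<open>k\<close> transfers the Cauchy bound to the limit with
    the same constant.\<close>
  have "(\<integral>\<^sup>+x. ennreal ((cmod (h x - g n x))\<^sup>2) \<partial>M) = (\<integral>\<^sup>+x. liminf (%k. ennreal ((cmod (g k x - g n x))\<^sup>2)) \<partial>M)"
  proof (rule nn_integral_cong_AE, use AE in eventually_elim)
   case (elim x)
   then have "(%k. ennreal ((cmod (g k x - g n x))\<^sup>2)) \<longlonglongrightarrow> ennreal ((cmod (h x - g n x))\<^sup>2)"
   by (intro tendsto_ennrealI tendsto_intros)
   then show ?case by (intro lim_imp_Liminf[symmetric] trivial_limit_sequentially)
  qed
  also have "\<dots> <= liminf (%k. \<integral>\<^sup>+x. ennreal ((cmod (g k x - g n x))\<^sup>2) \<partial>M)" by (rule nn_integral_liminf) measurable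
  also have "\<dots> <= limsup (%k. \<integral>\<^sup>+x. ennreal ((cmod (g k x - g n x))\<^sup>2) \<partial>M)" by (rule Liminf_le_Limsup) simp
  also have "\<dots> <= ennreal (C / 4 ^ n)"
  proof (rule Limsup_bounded)
   show "\<forall>\<^sub>F k in sequentially. (\<integral>\<^sup>+x. ennreal ((cmod (g k x - g n x))\<^sup>2) \<partial>M) <= ennreal (C / 4 ^ n)"
   unfolding nn by (rule eventually_sequentiallyI[of n]) (rule ennreal_leI[OF d])
  qed
  finally show ?thesis .
 qed
 have sq: "(%x. h x - g n x) \<in> square_integrable M" for n
  unfolding square_integrable_def using le[of n] by (auto simp: integrable_iff_bounded le_less_trans)
 have "h \<in> square_integrable M" using square_integrable_add[OF sq[of 0] g[of 0]] by simp
 moreover have "l2_dist M h (g n) <= C / 4 ^ n" for n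
 proof -
  have "ennreal (l2_dist M h (g n)) <= ennreal (C / 4 ^ n)"
   using le[of n] unfolding l2_dist_def by (subst nn_integral_eq_integral[symmetric, OF square_integrableD[OF sq]]) auto
  then show ?thesis using C by (simp add: ennreal_le_iff)
 qed
 ultimately show ?thesis by blast
qed

text \<open>The maps are indexed by \<open>S\<close> so that no well-definedness of
  \<open>a s \<mapsto> b s\<close> is presupposed: it follows from linearity and isometry. Linearity
  of \<open>b\<close> is asked on \<open>space N\<close> only, since counts are computed
  there.\<close>

locale dense_l2_isometry =
 fixes M :: "'a measure" and N :: "'b measure" and S :: "'i set"
  and a :: "'i => 'a => complex" and b :: "'i => 'b => complex"
 assumes a: "s \<in> S ==> a s \<in> square_integrable M" and b: "s \<in> S ==> b s \<in> square_integrable N"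
  and add: "s \<in> S ==> t \<in> S ==> \<exists>u\<in>S. a u = (%x. a s x + a t x) \<and> (\<forall>y\<in>space N. b u y = b s y + b t y)"
  and scale: "s \<in> S ==> \<exists>u\<in>S. a u = (%x. c * a s x) \<and> (\<forall>y\<in>space N. b u y = c * b s y)"
  and isometry: "s \<in> S ==> (LINT y|N. (cmod (b s y))\<^sup>2) = (LINT x|M. (cmod (a s x))\<^sup>2)"
  and dense: "f \<in> square_integrable M ==> \<epsilon> > 0 ==> \<exists>s\<in>S. l2_dist M f (a s) < \<epsilon>"
begin

text \<open>The graph of the extension, as the closure of the graph of \<open>a s \<mapsto> b s\<close>.\<close>

definition graph :: "('a => complex) => ('b => complex) => bool" where
 "graph f g \<longleftrightarrow> f \<in> square_integrable M \<and> g \<in> square_integrable N \<and>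
   (\<forall>\<epsilon>>0. \<exists>s\<in>S. l2_dist M f (a s) < \<epsilon> \<and> l2_dist N g (b s) < \<epsilon>)"

lemma graphD: "graph f g ==> f \<in> square_integrable M" "graph f g ==> g \<in> square_integrable N"
 unfolding graph_def by auto

lemma graph_approx:
 assumes "graph f g" "\<epsilon> > 0"
 obtains s where "s \<in> S" "l2_dist M f (a s) < \<epsilon>" "l2_dist N g (b s) < \<epsilon>"
 using assms unfolding graph_def by blast

lemma l2_dist_isometry:
 assumes s: "s \<in> S" and t: "t \<in> S"
 shows "l2_dist N (b s) (b t) = l2_dist M (a s) (a t)"
proof -
 obtain t' where t': "t' \<in> S" "a t' = (%x. - 1 * a t x)" "\<forall>y\<in>space N. b t' y = - 1 * b t y" using scale[OF t] by blast
 obtain u where u: "u \<in> S" "a u = (%x. a s x + a t' x)" "\<forall>y\<in>space N. b u y = b s y + b t' y" using add[OF s t'(1)] by blast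
 have "l2_dist N (b s) (b t) = (LINT y|N. (cmod (b u y))\<^sup>2)"
  unfolding l2_dist_def by (rule lint_cong) (use u t' in auto)
 also have "\<dots> = (LINT x|M. (cmod (a u x))\<^sup>2)" by (rule isometry[OF u(1)])
 also have "\<dots> = l2_dist M (a s) (a t)" unfolding l2_dist_def u(2) t'(2) by simp
 finally show ?thesis .
qed

lemma graph_exists:
 assumes f: "f \<in> square_integrable M" shows "\<exists>g. graph f g"
proof -
 \<comment> \<open>The rate \<open>1 / 4 ^ n\<close> is the one that \<open>l2_limit\<close>
   expects; two uses of the triangle factor 2 give its constant 4.\<close>
 have "\<exists>s\<in>S. l2_dist M f (a s) < 1 / 4 ^ n" for n :: nat by (rule dense[OF f]) simp
 then obtain s where s: "\<And>n. s n \<in> S" "\<And>n. l2_dist M f (a (s n)) < 1 / 4 ^ n" by metis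
 have "l2_dist N (b (s k)) (b (s n)) <= 4 / 4 ^ n" if "n <= k" for n k
 proof -
  have "l2_dist N (b (s k)) (b (s n)) = l2_dist M (a (s k)) (a (s n))" by (rule l2_dist_isometry[OF s(1) s(1)])
  also have "\<dots> <= 2 * l2_dist M (a (s k)) f + 2 * l2_dist M f (a (s n))" by (intro l2_dist_triangle a s f)
  also have "\<dots> <= 2 * (1 / 4 ^ k) + 2 * (1 / 4 ^ n)"
   using s(2)[of k] s(2)[of n] by (intro add_mono mult_left_mono) (auto simp: l2_dist_commute[of M _ f])
  also have "(1::real) / 4 ^ k <= 1 / 4 ^ n" using that by (intro divide_left_mono power_increasing) auto
  finally show ?thesis by simp
 qed
 then obtain g where g: "g \<in> square_integrable N" "\<And>n. l2_dist N g (b (s n)) <= 4 / 4 ^ n"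
  using l2_limit[of "%n. b (s n)" N 4] b[OF s(1)] by blast
 have "\<exists>s\<in>S. l2_dist M f (a s) < \<epsilon> \<and> l2_dist N g (b s) < \<epsilon>" if \<epsilon>: "\<epsilon> > 0" for \<epsilon>
 proof -
  have "\<exists>n. (1 / 4 :: real) ^ n < \<epsilon> / 4" using \<epsilon> by (intro real_arch_pow_inv) auto
  then obtain n where "(1 / 4 :: real) ^ n < \<epsilon> / 4" by blast
  then have n: "4 / 4 ^ n < \<epsilon>" by (simp add: power_divide field_simps)
  moreover have "(1::real) / 4 ^ n <= 4 / 4 ^ n" by (rule divide_right_mono) auto
  ultimately have "l2_dist M f (a (s n)) < \<epsilon>" "l2_dist N g (b (s n)) < \<epsilon>" using s(2)[of n] g(2)[of n] by auto
  then show ?thesis using s(1) by blast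
 qed
 then show ?thesis using f g unfolding graph_def by blast
qed

lemma graph_unique:
 assumes "graph f g" "graph f h" shows "AE y in N. g y = h y"
proof -
 have "l2_dist N g h <= 0 + \<epsilon>" if \<epsilon>: "\<epsilon> > 0" for \<epsilon>
 proof -
  \<comment> \<open>The nested triangle inequalities add up to 22 small terms: 2 from the first, 4
    from the last and 16 from the middle distance, which is measured through
    \<open>f\<close>.\<close>
  obtain s where s: "s \<in> S" "l2_dist M f (a s) < \<epsilon> / 22" "l2_dist N g (b s) < \<epsilon> / 22"
   using graph_approx[OF assms(1), of "\<epsilon> / 22"] \<epsilon> by auto
  obtain t where t: "t \<in> S" "l2_dist M f (a t) < \<epsilon> / 22" "l2_dist N h (b t) < \<epsilon> / 22"
   using graph_approx[OF assms(2), of "\<epsilon> / 22"] \<epsilon> by auto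
  have "l2_dist N g h <= 2 * l2_dist N g (b s) + 2 * l2_dist N (b s) h"
   by (intro l2_dist_triangle graphD(2)[OF assms(1)] graphD(2)[OF assms(2)] b s t)
  moreover have "l2_dist N (b s) h <= 2 * l2_dist N (b s) (b t) + 2 * l2_dist N (b t) h"
   by (intro l2_dist_triangle graphD(2)[OF assms(2)] b s t)
  moreover have "l2_dist N (b s) (b t) = l2_dist M (a s) (a t)" by (rule l2_dist_isometry[OF s(1) t(1)])
  moreover have "l2_dist M (a s) (a t) <= 2 * l2_dist M (a s) f + 2 * l2_dist M f (a t)"
   by (intro l2_dist_triangle graphD(1)[OF assms(1)] a s t)
  ultimately show ?thesis using s t by (simp add: l2_dist_commute[of M _ f] l2_dist_commute[of N _ h])
 qed
 then have "l2_dist N g h <= 0" by (rule field_le_epsilon)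
 then have "l2_dist N g h = 0" using l2_dist_nonneg[of N g h] by simp
 then show ?thesis by (rule l2_dist_eq_0[OF graphD(2)[OF assms(1)] graphD(2)[OF assms(2)]])
qed

lemma graph_base: "s \<in> S ==> graph (a s) (b s)"
 unfolding graph_def using a b by (auto simp: l2_dist_self intro!: bexI[of _ s])

lemma graph_cong:
 assumes "graph f g" "h \<in> square_integrable M" "AE x in M. f x = h x" shows "graph h g"
proof -
 have "l2_dist M h (a s) = l2_dist M f (a s)" if "s \<in> S" for s
  by (rule l2_dist_cong_AE)
   (use assms a[OF that] graphD(1)[OF assms(1)] in \<open>auto dest: square_integrable_measurable\<close>)
 then show ?thesis using assms unfolding graph_def by (metis (lifting))
qed

lemma graph_add:
 assumes g: "graph f g" and g': "graph f' g'"
 shows "graph (%x. f x + f' x) (%y. g y + g' y)"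
 unfolding graph_def
proof (intro conjI allI impI square_integrable_add graphD(1)[OF g] graphD(1)[OF g'] graphD(2)[OF g] graphD(2)[OF g'])
 fix \<epsilon> :: real assume "\<epsilon> > 0"
 then have \<epsilon>: "\<epsilon> / 4 > 0" by simp
 obtain s where s: "s \<in> S" "l2_dist M f (a s) < \<epsilon> / 4" "l2_dist N g (b s) < \<epsilon> / 4" using graph_approx[OF g \<epsilon>] .
 obtain t where t: "t \<in> S" "l2_dist M f' (a t) < \<epsilon> / 4" "l2_dist N g' (b t) < \<epsilon> / 4" using graph_approx[OF g' \<epsilon>] .
 obtain u where u: "u \<in> S" "a u = (%x. a s x + a t x)" "\<forall>y\<in>space N. b u y = b s y + b t y" using add[OF s(1) t(1)] by blast
 have "l2_dist M (%x. f x + f' x) (a u) <= 2 * l2_dist M f (a s) + 2 * l2_dist M f' (a t)"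
  unfolding u(2) by (intro l2_dist_add graphD(1)[OF g] graphD(1)[OF g'] a s t)
 moreover have "l2_dist N (%x. g x + g' x) (b u) = l2_dist N (%x. g x + g' x) (%x. b s x + b t x)"
  unfolding l2_dist_def by (rule lint_cong) (use u(3) in auto)
 moreover have "\<dots> <= 2 * l2_dist N g (b s) + 2 * l2_dist N g' (b t)"
  by (intro l2_dist_add graphD(2)[OF g] graphD(2)[OF g'] b s t)
 ultimately have "l2_dist M (%x. f x + f' x) (a u) < \<epsilon> \<and> l2_dist N (%x. g x + g' x) (b u) < \<epsilon>"
  using s t by linarith
 then show "\<exists>s\<in>S. l2_dist M (%x. f x + f' x) (a s) < \<epsilon> \<and> l2_dist N (%x. g x + g' x) (b s) < \<epsilon>"
  using u(1) by blast
qed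

text \<open>The representations enter through pairs of maps multiplying distances by a constant.\<close>

lemma graph_image:
 assumes g: "graph f g" and C: "0 <= C"
  and U: "\<And>f. f \<in> square_integrable M ==> U f \<in> square_integrable M"
   "\<And>f h. f \<in> square_integrable M ==> h \<in> square_integrable M ==> l2_dist M (U f) (U h) = C * l2_dist M f h"
  and T: "\<And>f. f \<in> square_integrable N ==> T f \<in> square_integrable N"
   "\<And>f h. f \<in> square_integrable N ==> h \<in> square_integrable N ==> l2_dist N (T f) (T h) = C * l2_dist N f h"
  and S: "\<And>s. s \<in> S ==> \<exists>u\<in>S. a u = U (a s) \<and> (\<forall>y\<in>space N. b u y = T (b s) y)"
 shows "graph (U f) (T g)"
 unfolding graph_def
proof (intro conjI allI impI U(1) T(1) graphD(1)[OF g] graphD(2)[OF g])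
 fix \<epsilon> :: real assume "\<epsilon> > 0"
 then have \<epsilon>: "\<epsilon> / (C + 1) > 0" using C by simp
 obtain s where s: "s \<in> S" "l2_dist M f (a s) < \<epsilon> / (C + 1)" "l2_dist N g (b s) < \<epsilon> / (C + 1)" using graph_approx[OF g \<epsilon>] .
 obtain u where u: "u \<in> S" "a u = U (a s)" "\<forall>y\<in>space N. b u y = T (b s) y" using S[OF s(1)] by blast
 have lt: "C * x < \<epsilon>" if "x < \<epsilon> / (C + 1)" "0 <= x" for x
 proof -
  have "C * x <= (C + 1) * x" using that by (intro mult_right_mono) auto
  also have "\<dots> < \<epsilon>" using that C by (simp add: pos_less_divide_eq mult.commute)
  finally show ?thesis .
 qed
 have "l2_dist M (U f) (a u) < \<epsilon>"
  unfolding u(2) U(2)[OF graphD(1)[OF g] a[OF s(1)]] by (rule lt[OF s(2) l2_dist_nonneg])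
 moreover have "l2_dist N (T g) (b u) = l2_dist N (T g) (T (b s))"
  unfolding l2_dist_def by (rule lint_cong) (use u(3) in auto)
 moreover have "l2_dist N (T g) (T (b s)) < \<epsilon>"
  unfolding T(2)[OF graphD(2)[OF g] b[OF s(1)]] by (rule lt[OF s(3) l2_dist_nonneg])
 ultimately show "\<exists>s\<in>S. l2_dist M (U f) (a s) < \<epsilon> \<and> l2_dist N (T g) (b s) < \<epsilon>"
  using u(1) by auto
qed

lemma graph_scale: "graph f g ==> graph (%x. c * f x) (%y. c * g y)"
 by (rule graph_image[where C="(cmod c)\<^sup>2"])
   (auto simp: l2_dist_scale square_integrable_scale intro: scale)

text \<open>The crude triangle inequality would preserve norms only up to a constant. The weighted
  one loses a factor \<open>1 + \<eta>\<close> and an error that tends to 0 with the approximation,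
  for every \<open>\<eta>\<close>, and this yields both inequalities.\<close>

lemma graph_isometry:
 assumes g: "graph f g"
 shows "(LINT y|N. (cmod (g y))\<^sup>2) = (LINT x|M. (cmod (f x))\<^sup>2)"
proof -
 let ?n = "%M f. l2_dist M f (%_. 0)"
 \<comment> \<open>\<open>p\<close> and \<open>q\<close> are the squared norms to be compared, and
   \<open>z\<close> is that of the approximating element, common to both sides by isometry.\<close>
 have key: "p <= q" if pq: "0 <= q" "\<And>\<epsilon> \<eta>. \<epsilon> > 0 ==> 0 < \<eta> ==> \<eta> < 1 ==> \<exists>z. p <= (1 + \<eta>) * z + (1 + 1 / \<eta>) * \<epsilon> \<and> z <= (1 + \<eta>) * q + (1 + 1 / \<eta>) * \<epsilon>"
  for p q :: real
 proof (rule field_le_epsilon)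
  fix e :: real assume e: "e > 0"
  \<comment> \<open>First \<open>\<eta>\<close> is made small enough for
    \<open>3 * \<eta> * q <= e / 2\<close>, then \<open>\<epsilon>\<close> so that each error term
    is \<open>e / 6\<close>; the losses sum to \<open>e\<close>.\<close>
  define \<eta> where "\<eta> = min (1 / 2) (e / (6 * (q + 1)))"
  have \<eta>: "0 < \<eta>" "\<eta> < 1" unfolding \<eta>_def using e pq(1) by auto
  have "3 * \<eta> * q <= 3 * \<eta> * (q + 1)" using \<eta> by simp
  also have "\<dots> <= 3 * (e / (6 * (q + 1))) * (q + 1)" unfolding \<eta>_def using pq(1) by (intro mult_right_mono mult_left_mono) auto
  also have "\<dots> = e / 2" using pq(1) by (simp add: field_simps)
  finally have q3: "3 * \<eta> * q <= e / 2" .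
  define \<epsilon> where "\<epsilon> = e / (6 * (1 + 1 / \<eta>))"
  have "1 + 1 / \<eta> > 0" using \<eta> by (simp add: add_pos_pos)
  then have \<epsilon>: "\<epsilon> > 0" "(1 + 1 / \<eta>) * \<epsilon> = e / 6" unfolding \<epsilon>_def using e by (auto simp: divide_simps)
  obtain z where z: "p <= (1 + \<eta>) * z + e / 6" "z <= (1 + \<eta>) * q + e / 6" using pq(2)[OF \<epsilon>(1) \<eta>] unfolding \<epsilon>(2) by blast
  have "(1 + \<eta>) * z <= (1 + \<eta>) * ((1 + \<eta>) * q + e / 6)" using z(2) \<eta> by (intro mult_left_mono) auto
  also have "\<dots> = q + 2 * \<eta> * q + \<eta> * (\<eta> * q) + (1 + \<eta>) * (e / 6)" by (simp add: algebra_simps)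
  also have "\<dots> <= q + 2 * \<eta> * q + 1 * (\<eta> * q) + 2 * (e / 6)"
   using \<eta> e pq(1) by (intro add_mono order_refl mult_right_mono) auto
  also have "\<dots> <= q + e / 2 + 2 * (e / 6)" using q3 by simp
  finally show "p <= q + e" using z(1) by simp
 qed
 note sq = graphD(1)[OF g] graphD(2)[OF g]
 have n: "?n N (b s) = ?n M (a s)" if "s \<in> S" for s unfolding l2_dist_zero by (rule isometry[OF that])
 have "?n N g <= ?n M f"
 proof (rule key[OF l2_dist_nonneg])
  fix \<epsilon> \<eta> :: real assume \<epsilon>: "\<epsilon> > 0" and \<eta>: "0 < \<eta>"
  obtain s where s: "s \<in> S" "l2_dist M f (a s) < \<epsilon>" "l2_dist N g (b s) < \<epsilon>" using graph_approx[OF g \<epsilon>] .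
  have p: "0 <= 1 + 1 / \<eta>" using \<eta> by simp
  have "?n N g <= (1 + \<eta>) * ?n N (b s) + (1 + 1 / \<eta>) * l2_dist N g (b s)"
   by (rule l2_dist_triangle_weighted[OF sq(2) b[OF s(1)] square_integrable_zero \<eta>])
  moreover have "?n M (a s) <= (1 + \<eta>) * ?n M f + (1 + 1 / \<eta>) * l2_dist M (a s) f"
   by (rule l2_dist_triangle_weighted[OF a[OF s(1)] sq(1) square_integrable_zero \<eta>])
  moreover have "(1 + 1 / \<eta>) * l2_dist N g (b s) <= (1 + 1 / \<eta>) * \<epsilon>" "(1 + 1 / \<eta>) * l2_dist M (a s) f <= (1 + 1 / \<eta>) * \<epsilon>"
   using s p by (auto intro!: mult_left_mono simp: l2_dist_commute[of M _ f])
  ultimately show "\<exists>z. ?n N g <= (1 + \<eta>) * z + (1 + 1 / \<eta>) * \<epsilon> \<and> z <= (1 + \<eta>) * ?n M f + (1 + 1 / \<eta>) * \<epsilon>"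
   using n[OF s(1)] by (intro exI[of _ "?n M (a s)"]) simp
 qed
 moreover have "?n M f <= ?n N g"
 proof (rule key[OF l2_dist_nonneg])
  fix \<epsilon> \<eta> :: real assume \<epsilon>: "\<epsilon> > 0" and \<eta>: "0 < \<eta>"
  obtain s where s: "s \<in> S" "l2_dist M f (a s) < \<epsilon>" "l2_dist N g (b s) < \<epsilon>" using graph_approx[OF g \<epsilon>] .
  have p: "0 <= 1 + 1 / \<eta>" using \<eta> by simp
  have "?n M f <= (1 + \<eta>) * ?n M (a s) + (1 + 1 / \<eta>) * l2_dist M f (a s)"
   by (rule l2_dist_triangle_weighted[OF sq(1) a[OF s(1)] square_integrable_zero \<eta>])
  moreover have "?n N (b s) <= (1 + \<eta>) * ?n N g + (1 + 1 / \<eta>) * l2_dist N (b s) g"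
   by (rule l2_dist_triangle_weighted[OF b[OF s(1)] sq(2) square_integrable_zero \<eta>])
  moreover have "(1 + 1 / \<eta>) * l2_dist M f (a s) <= (1 + 1 / \<eta>) * \<epsilon>" "(1 + 1 / \<eta>) * l2_dist N (b s) g <= (1 + 1 / \<eta>) * \<epsilon>"
   using s p by (auto intro!: mult_left_mono simp: l2_dist_commute[of N _ g])
  ultimately show "\<exists>z. ?n M f <= (1 + \<eta>) * z + (1 + 1 / \<eta>) * \<epsilon> \<and> z <= (1 + \<eta>) * ?n N g + (1 + 1 / \<eta>) * \<epsilon>"
   using n[OF s(1)] by (intro exI[of _ "?n M (a s)"]) simp
 qed
 ultimately show ?thesis unfolding l2_dist_zero by simp
qed

definition extension :: "('a => complex) => 'b => complex" where
 "extension f = (SOME g. graph f g)"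

lemma graph_extension: "f \<in> square_integrable M ==> graph f (extension f)"
 unfolding extension_def by (rule someI_ex[OF graph_exists])

lemma extension_base: "s \<in> S ==> AE y in N. extension (a s) y = b s y"
 by (rule graph_unique[OF graph_extension[OF a] graph_base])

lemma extension_isometric: "L2_isometric_embedding M N extension"
 unfolding L2_isometric_embedding_def
proof (intro conjI ballI allI impI)
 fix f assume f: "f \<in> square_integrable M"
 note gf = graph_extension[OF f]
 show "extension f \<in> square_integrable N" by (rule graphD(2)[OF gf])
 show "(LINT y|N. (cmod (extension f y))\<^sup>2) = (LINT x|M. (cmod (f x))\<^sup>2)" by (rule graph_isometry[OF gf])
 show "AE y in N. extension (%x. c * f x) y = c * extension f y" for c
  by (rule graph_unique[OF graph_extension[OF square_integrable_scale[OF f]] graph_scale[OF gf]])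
 fix g assume g: "g \<in> square_integrable M"
 show "AE y in N. extension (%x. f x + g x) y = extension f y + extension g y"
  by (rule graph_unique[OF graph_extension[OF square_integrable_add[OF f g]] graph_add[OF gf graph_extension[OF g]]])
 show "AE y in N. extension f y = extension g y" if "AE x in M. f x = g x"
  by (rule graph_unique[OF graph_cong[OF gf g that] graph_extension[OF g]])
qed

text \<open>An isometric embedding that agrees with \<open>b\<close> has
  \<open>\<theta> f - b s = \<theta> (f - a s)\<close> almost everywhere, so the distance from
  \<open>\<theta> f\<close> to \<open>b s\<close> is that from \<open>f\<close> to
  \<open>a s\<close>. Hence \<open>\<theta> f\<close> lies over \<open>f\<close> in the closed
  graph.\<close>

lemma extension_unique:
 assumes \<theta>: "L2_isometric_embedding M N \<theta>" and ext: "\<And>s. s \<in> S ==> AE y in N. \<theta> (a s) y = b s y"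
  and f: "f \<in> square_integrable M"
 shows "AE y in N. \<theta> f y = extension f y"
proof (rule graph_unique[OF _ graph_extension[OF f]])
 note E = \<theta>[unfolded L2_isometric_embedding_def]
 have \<theta>sq: "\<theta> h \<in> square_integrable N" if "h \<in> square_integrable M" for h
  using E[THEN conjunct1] that by (rule bspec)
 have \<theta>m: "\<theta> h \<in> borel_measurable N" if "h \<in> square_integrable M" for h
  by (rule square_integrable_measurable[OF \<theta>sq[OF that]])
 have "l2_dist N (\<theta> f) (b s) = l2_dist M f (a s)" if s: "s \<in> S" for s
 proof -
  let ?h = "%x. - 1 * a s x"
  have h: "?h \<in> square_integrable M" "(%x. f x + ?h x) \<in> square_integrable M"
   by (intro square_integrable_scale square_integrable_add f a[OF s])+
  have "AE y in N. \<theta> (%x. f x + ?h x) y = \<theta> f y + \<theta> ?h y"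
   by (rule E[THEN conjunct2, THEN conjunct2, THEN conjunct1, THEN bspec, OF f, THEN bspec, OF h(1)])
  moreover have "AE y in N. \<theta> ?h y = - 1 * \<theta> (a s) y"
   using E[THEN conjunct2, THEN conjunct2, THEN conjunct2, THEN conjunct1, THEN spec] a[OF s] by (rule bspec)
  ultimately have AE: "AE y in N. \<theta> (%x. f x + ?h x) y = \<theta> f y - b s y"
   using ext[OF s] by eventually_elim simp
  have "l2_dist N (\<theta> f) (b s) = (LINT y|N. (cmod (\<theta> (%x. f x + ?h x) y))\<^sup>2)"
   unfolding l2_dist_def
   using AE \<theta>m[OF f] \<theta>m[OF h(2)] square_integrable_measurable[OF b[OF s]] by (intro integral_cong_AE) auto
  also have "\<dots> = (LINT x|M. (cmod (f x + ?h x))\<^sup>2)"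
   using E[THEN conjunct2, THEN conjunct2, THEN conjunct2, THEN conjunct2] h(2) by (rule bspec)
  finally show ?thesis unfolding l2_dist_def by simp
 qed
 then show "graph f (\<theta> f)" unfolding graph_def using f \<theta>sq[OF f] dense[OF f] by (metis (lifting))
qed

text \<open>Both orders of applying the maps lie over \<open>U f\<close> in the graph: the pair of
  isometries preserves the graph of the dense map and therefore its closure.\<close>

lemma extension_intertwines:
 assumes f: "f \<in> square_integrable M"
  and U: "\<And>f. f \<in> square_integrable M ==> U f \<in> square_integrable M"
   "\<And>f h. f \<in> square_integrable M ==> h \<in> square_integrable M ==> l2_dist M (U f) (U h) = l2_dist M f h"
  and T: "\<And>f. f \<in> square_integrable N ==> T f \<in> square_integrable N"
   "\<And>f h. f \<in> square_integrable N ==> h \<in> square_integrable N ==> l2_dist N (T f) (T h) = l2_dist N f h"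
  and S: "\<And>s. s \<in> S ==> \<exists>u\<in>S. a u = U (a s) \<and> (\<forall>y\<in>space N. b u y = T (b s) y)"
 shows "AE y in N. extension (U f) y = T (extension f) y"
proof (rule graph_unique[OF graph_extension[OF U(1)[OF f]]])
 show "graph (U f) (T (extension f))"
  by (rule graph_image[OF graph_extension[OF f], where C=1]) (simp_all only: U T S mult_1 zero_le_one)
qed

end

section \<open>Linear and translation structure of rapidly decreasing functions\<close>

lemma rapidly_decreasingI:
 fixes f :: "real ^ 'd::finite => complex"
 assumes d: "\<And>is x. iterated_partial is f differentiable at x"
  and b: "\<And>is k. \<exists>C\<ge>0. \<forall>x. norm (iterated_partial is f x) <= C * decay x ^ k"
 shows "f \<in> rapidly_decreasing"
 unfolding rapidly_decreasing_def
proof (intro CollectI allI conjI d)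
 fix "is" :: "'d list" and k :: nat
 obtain C where C: "C \<ge> 0" "\<And>x. norm (iterated_partial is f x) <= C * decay x ^ k" using b by blast
 have "norm x ^ k * decay x ^ k <= 1" for x :: "real ^ 'd"
 proof -
  have "norm x <= (1 + norm x) ^ 1" by simp
  also have "\<dots> <= (1 + norm x) ^ (2 * CARD('d))" by (rule power_increasing) (use zero_less_card_finite[where 'a='d] in linarith, simp)
  finally have "norm x * decay x <= 1" unfolding decay_def by (simp add: divide_le_eq add_pos_nonneg)
  then have "(norm x * decay x) ^ k <= 1" by (intro power_le_one) auto
  then show ?thesis by (simp add: power_mult_distrib)
 qed
 then have "norm (norm x ^ k *\<^sub>R iterated_partial is f x) <= C" for x
  using mult_left_mono[OF C(2)[of x], of "norm x ^ k"] mult_left_mono[of "norm x ^ k * decay x ^ k" 1 C] C(1)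
  by (simp add: mult.assoc mult.left_commute)
 then show "bounded (range (%x. norm x ^ k *\<^sub>R iterated_partial is f x))" unfolding bounded_iff by blast
qed

context
 fixes f g :: "real ^ 'd::finite => complex"
 assumes f: "f \<in> rapidly_decreasing" and g: "g \<in> rapidly_decreasing"
begin

lemma iterated_partial_linear:
 "iterated_partial is (%x. c * f x + g x) = (%x. c * iterated_partial is f x + iterated_partial is g x)"
proof (induction "is")
 case (Cons i "is")
 have "((%x. c * iterated_partial is f x + iterated_partial is g x) has_derivative
   (%v. c * frechet_derivative (iterated_partial is f) (at x) v + frechet_derivative (iterated_partial is g) (at x) v)) (at x)" for x
  by (intro has_derivative_add has_derivative_mult_right rapidly_decreasing_has_derivative f g)
 from frechet_derivative_at[OF this, symmetric] show ?case by (simp add: Cons)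
qed simp

lemma rapidly_decreasing_linear: "(%x. c * f x + g x) \<in> rapidly_decreasing"
proof (rule rapidly_decreasingI)
 fix "is" and x :: "real ^ 'd"
 show "iterated_partial is (%x. c * f x + g x) differentiable at x"
  unfolding iterated_partial_linear
  using f g unfolding rapidly_decreasing_def by (intro differentiable_add differentiable_mult) auto
next
 fix "is" and k
 obtain C where C: "C > 0" "\<And>x. norm (iterated_partial is f x) <= C * decay x ^ k"
  using rapidly_decreasing_bound[OF f] by blast
 obtain C' where C': "C' > 0" "\<And>x. norm (iterated_partial is g x) <= C' * decay x ^ k"
  using rapidly_decreasing_bound[OF g] by blast
 have "norm (iterated_partial is (%x. c * f x + g x) x) <= (norm c * C + C') * decay x ^ k" for x
 proof -
  have "norm (c * iterated_partial is f x + iterated_partial is g x) <= norm c * norm (iterated_partial is f x) + norm (iterated_partial is g x)"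
   by (metis norm_mult norm_triangle_ineq)
  also have "\<dots> <= norm c * (C * decay x ^ k) + C' * decay x ^ k" by (intro add_mono mult_left_mono C C') simp
  finally show ?thesis unfolding iterated_partial_linear by (simp add: algebra_simps)
 qed
 then show "\<exists>C\<ge>0. \<forall>x. norm (iterated_partial is (%x. c * f x + g x) x) <= C * decay x ^ k"
  using C C' by (intro exI[of _ "norm c * C + C'"]) auto
qed

lemma iterated_partial_shift: "iterated_partial is (%x. f (x - t)) = (%x. iterated_partial is f (x - t))"
proof (induction "is")
 case (Cons i "is")
 have "((%x. iterated_partial is f (x - t)) has_derivative (%v. frechet_derivative (iterated_partial is f) (at (x - t)) v)) (at x)" for x
  by (rule has_derivative_compose[where f="%x. x - t" and f'="%v. v"])
   (auto intro!: derivative_eq_intros rapidly_decreasing_has_derivative f)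
 from frechet_derivative_at[OF this, symmetric] show ?case by (simp add: Cons)
qed simp

lemma rapidly_decreasing_shift: "(%x. f (x - t)) \<in> rapidly_decreasing"
proof (rule rapidly_decreasingI)
 fix "is" and x :: "real ^ 'd"
 have "((%x. iterated_partial is f (x - t)) has_derivative (%v. frechet_derivative (iterated_partial is f) (at (x - t)) v)) (at x)"
  by (rule has_derivative_compose[where f="%x. x - t" and f'="%v. v"])
   (auto intro!: derivative_eq_intros rapidly_decreasing_has_derivative f)
 then show "iterated_partial is (%x. f (x - t)) differentiable at x"
  unfolding iterated_partial_shift differentiable_def by blast
next
 fix "is" and k
 obtain C where C: "C > 0" "\<And>x. norm (iterated_partial is f x) <= C * decay x ^ k"
  using rapidly_decreasing_bound[OF f] by blast
 have "norm (iterated_partial is (%x. f (x - t)) x) <= (C / decay t ^ k) * decay x ^ k" for x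
 proof -
  have "decay (x - t) * decay t <= decay x" using decay_submult[of "x - t" t] by simp
  then have "decay (x - t) <= decay x / decay t" using decay_pos[of t] by (simp add: pos_le_divide_eq)
  then have "C * decay (x - t) ^ k <= C * (decay x / decay t) ^ k" using C(1) by (intro mult_left_mono power_mono) auto
  then show ?thesis unfolding iterated_partial_shift using C(2)[of "x - t"] by (simp add: power_divide)
 qed
 then show "\<exists>C\<ge>0. \<forall>x. norm (iterated_partial is (%x. f (x - t)) x) <= C * decay x ^ k"
  using C(1) by (intro exI[of _ "C / decay t ^ k"]) auto
qed

end

lemma rapidly_decreasing_basic:
 assumes f: "f \<in> rapidly_decreasing"
 shows rapidly_decreasing_measurable: "f \<in> borel_measurable borel"
  and rapidly_decreasing_decay: "\<exists>C>0. \<forall>x. norm (f x) <= C * decay x"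
  and rapidly_decreasing_integrable: "integrable lborel f"
proof -
 show m: "f \<in> borel_measurable borel"
  using rapidly_decreasing_continuous[OF f, of _ "[]"] by (intro borel_measurable_continuous_onI) simp
 show "\<exists>C>0. \<forall>x. norm (f x) <= C * decay x" using rapidly_decreasing_bound[OF f, of "[]" 1] by simp
 then obtain C where "\<And>x. norm (f x) <= C * decay x" by blast
 then show "integrable lborel f" by (rule integrable_decay_bound[OF m])
qed

lemma fourier_linear:
 fixes f g :: "real ^ 'd::finite => complex"
 assumes "f \<in> rapidly_decreasing" "g \<in> rapidly_decreasing"
 shows "fourier (%x. c * f x + g x) = (%y. c * fourier f y + fourier g y)"
proof
 fix y :: "real ^ 'd"
 have i: "integrable lborel (%x. cis (- 2 * pi * (x \<bullet> y)) * h x)" if "h \<in> rapidly_decreasing" for h :: "real ^ 'd => complex"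
  by (rule integrable_cis_mult[OF rapidly_decreasing_integrable[OF that]]) measurable
 have "fourier (%x. c * f x + g x) y = (\<integral>x. c * (cis (- 2 * pi * (x \<bullet> y)) * f x) + cis (- 2 * pi * (x \<bullet> y)) * g x \<partial>lborel)"
  unfolding fourier_def by (simp add: algebra_simps)
 also have "\<dots> = (\<integral>x. c * (cis (- 2 * pi * (x \<bullet> y)) * f x) \<partial>lborel) + fourier g y"
  unfolding fourier_def by (intro lint_add integrable_mult_right i assms)
 also have "(\<integral>x. c * (cis (- 2 * pi * (x \<bullet> y)) * f x) \<partial>lborel) = c * fourier f y"
  unfolding fourier_def by (rule integral_mult_right_zero)
 finally show "fourier (%x. c * f x + g x) y = c * fourier f y + fourier g y" .
qed

text \<open>The origin of the intertwining relation: translating a function multiplies its transform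
  by the character in \<open>rep_U\<close>.\<close>

lemma fourier_shift:
 fixes f :: "real ^ 'd::finite => complex"
 assumes f: "f \<in> rapidly_decreasing"
 shows "fourier (%x. f (x - t)) = rep_U t (fourier f)"
proof
 fix y :: "real ^ 'd"
 have [measurable]: "f \<in> borel_measurable borel" by (rule rapidly_decreasing_measurable[OF f])
 have "fourier (%x. f (x - t)) y = (\<integral>x. cis (- 2 * pi * ((t + x) \<bullet> y)) * f (t + x - t) \<partial>lborel)"
  unfolding fourier_def by (rule lborel_integral_shift[symmetric]) measurable
 also have "\<dots> = (\<integral>x. cis (- 2 * pi * (t \<bullet> y)) * (cis (- 2 * pi * (x \<bullet> y)) * f x) \<partial>lborel)"
  by (rule lint_cong) (simp_all add: inner_add_left distrib_left mult.assoc[symmetric] cis_mult)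
 also have "\<dots> = rep_U t (fourier f) y" unfolding rep_U_def fourier_def by (rule integral_mult_right_zero)
 finally show "fourier (%x. f (x - t)) y = rep_U t (fourier f) y" .
qed

section \<open>The spectral isometry of a weighted point process\<close>

context weighted_point_family
begin

lemma count_linear:
 assumes \<xi>: "\<xi> \<in> space P" and "f \<in> rapidly_decreasing" "g \<in> rapidly_decreasing"
 shows "count (%x. c * f x + g x) \<xi> = c * count f \<xi> + count g \<xi>"
proof -
 have i: "integrable (count_space (pts A Z \<xi>)) (%z. of_real (w (snd z)) * h (fst z))" if "h \<in> rapidly_decreasing" for h
  using rapidly_decreasing_decay[OF that] count_bound(2)[OF \<xi>] by (meson less_imp_le)
 have "count (%x. c * f x + g x) \<xi> = (\<integral>z. c * (of_real (w (snd z)) * f (fst z)) + of_real (w (snd z)) * g (fst z) \<partial>count_space (pts A Z \<xi>))"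
  unfolding count_def by (simp add: algebra_simps)
 also have "\<dots> = (\<integral>z. c * (of_real (w (snd z)) * f (fst z)) \<partial>count_space (pts A Z \<xi>)) + count g \<xi>"
  unfolding count_def by (intro lint_add integrable_mult_right i assms)
 also have "(\<integral>z. c * (of_real (w (snd z)) * f (fst z)) \<partial>count_space (pts A Z \<xi>)) = c * count f \<xi>"
  unfolding count_def by (rule integral_mult_right_zero)
 finally show ?thesis .
qed

lemma count_shift:
 assumes \<xi>: "\<xi> \<in> space P"
 shows "count (%x. f (x - t)) \<xi> = count f (\<tau> (- t) \<xi>)"
proof -
 have "bij_betw (displace (- t)) (pts A Z \<xi>) (pts A Z (\<tau> (- t) \<xi>))"
  unfolding equivariant[OF \<xi>] by (intro inj_on_imp_bij_betw inj_displace)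
 from integral_bij_count_space[OF this, of "%z. of_real (w (snd z)) * f (fst z)"]
 show ?thesis unfolding count_def by simp
qed

text \<open>The spectral identity is applied to the power spectrum of \<open>f\<close>. Its
  transform is the autocorrelation of \<open>f\<close>, on which \<open>corr\<close> is the expected
  square of the count.\<close>

lemma spectral_isometry:
 assumes sets_\<nu>: "sets \<nu> = sets borel"
  and \<nu>: "\<forall>F C. continuous_on UNIV F --> (\<forall>x. norm (F x) <= C * (decay x)\<^sup>2) --> (\<forall>y. norm (fourier F y) <= C * decay y) -->
   integrable \<nu> F \<and> integral\<^sup>L \<nu> F = corr (fourier F)"
  and f: "f \<in> rapidly_decreasing"
 shows "fourier f \<in> square_integrable \<nu>" "count f \<in> square_integrable P"
  and "(LINT \<xi>|P. (cmod (count f \<xi>))\<^sup>2) = (LINT y|\<nu>. (cmod (fourier f y))\<^sup>2)"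
proof -
 have fm[measurable]: "f \<in> borel_measurable borel" by (rule rapidly_decreasing_measurable[OF f])
 have cf: "continuous_on UNIV f" using rapidly_decreasing_continuous[OF f, of UNIV "[]"] by simp
 obtain C where C: "C > 0" "\<And>x. norm (f x) <= C * (decay x)\<^sup>2"
  using rapidly_decreasing_bound[OF f, of "[]" 2] by auto
 obtain C' where C': "C' > 0" "\<And>y. norm (fourier f y) <= C' * decay y"
  using fourier_rapidly_decreasing_bound[OF f] by blast
 let ?F = "%y. complex_of_real ((cmod (fourier f y))\<^sup>2)"
 \<comment> \<open>The spectral identity takes one constant for the function and for its transform,
   so the larger of the two is used.\<close>
 let ?a = "C\<^sup>2 * (\<integral>t. decay t \<partial>(lborel :: (real ^ 'd) measure))" and ?M = "max (C'\<^sup>2) (C\<^sup>2 * (\<integral>t. decay t \<partial>(lborel :: (real ^ 'd) measure)))"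
 have fF: "fourier ?F = autocorrelation f" by (rule ext) (rule fourier_power_spectrum[OF cf C(2) C'(2)])
 have cF: "continuous_on UNIV (fourier f)" by (rule continuous_fourier[OF rapidly_decreasing_integrable[OF f]])
 have F: "integrable \<nu> ?F \<and> integral\<^sup>L \<nu> ?F = corr (fourier ?F)"
 proof (rule \<nu>[rule_format, of _ ?M])
  show "continuous_on UNIV ?F" using cF by (intro continuous_intros)
  fix y
  have "(cmod (fourier f y))\<^sup>2 <= (C' * decay y)\<^sup>2" by (intro power_mono C') simp
  also have "\<dots> <= ?M * (decay y)\<^sup>2" unfolding power_mult_distrib by (intro mult_right_mono) auto
  finally show "norm (?F y) <= ?M * (decay y)\<^sup>2" unfolding norm_of_real by simp
  have "norm (autocorrelation f y) <= ?a * decay y" by (rule autocorrelation_bound[OF fm C(2)])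
  also have "\<dots> <= ?M * decay y" by (intro mult_right_mono) auto
  finally show "norm (fourier ?F y) <= ?M * decay y" unfolding fF .
 qed
 have "integrable \<nu> (%y. Re (?F y))" using F by (intro integrable_Re) blast
 then show "fourier f \<in> square_integrable \<nu>"
  unfolding square_integrable_def using borel_measurable_fourier[OF fm] by (simp add: measurable_cong_sets[OF sets_\<nu> refl])
 have Cd: "norm (f x) <= C * decay x" for x
 proof -
  have "C * (decay x)\<^sup>2 <= C * (decay x * 1)" unfolding power2_eq_square using C(1) decay_le_1[of x] by (intro mult_left_mono) auto
  then show ?thesis using C(2)[of x] by simp
 qed
 have cm: "count f \<in> borel_measurable P" by (rule borel_measurable_count[OF fm])
 have "integrable P (%\<xi>. (cmod (count f \<xi>))\<^sup>2)"
 proof (rule integrable_const_bound[of _ "(W * C * \<bar>K\<bar>)\<^sup>2"])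
  show "AE \<xi> in P. norm ((cmod (count f \<xi>))\<^sup>2) <= (W * C * \<bar>K\<bar>)\<^sup>2"
  proof (rule AE_I2)
   fix \<xi> assume "\<xi> \<in> space P"
   from count_bound(1)[OF this _ Cd] C(1) have "cmod (count f \<xi>) <= W * C * \<bar>K\<bar>" by simp
   then have "(cmod (count f \<xi>))\<^sup>2 <= (W * C * \<bar>K\<bar>)\<^sup>2" by (rule power_mono) simp
   then show "norm ((cmod (count f \<xi>))\<^sup>2) <= (W * C * \<bar>K\<bar>)\<^sup>2" by simp
  qed
 qed (use cm in measurable)
 then show "count f \<in> square_integrable P" unfolding square_integrable_def using cm by simp
 have "complex_of_real (LINT \<xi>|P. (cmod (count f \<xi>))\<^sup>2) = corr (autocorrelation f)"
  unfolding expectation_count_square[OF fm C(2), symmetric] integral_complex_of_real ..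
 also have "\<dots> = integral\<^sup>L \<nu> ?F" using F unfolding fF by simp
 also have "\<dots> = complex_of_real (LINT y|\<nu>. (cmod (fourier f y))\<^sup>2)" unfolding integral_complex_of_real ..
 finally show "(LINT \<xi>|P. (cmod (count f \<xi>))\<^sup>2) = (LINT y|\<nu>. (cmod (fourier f y))\<^sup>2)" by (simp only: of_real_eq_iff)
qed

end

lemma signed_integral_cong:
 assumes "\<And>D. D \<in> sets M ==> \<sigma> D = \<sigma>' D" and F: "\<And>x. x \<in> space M ==> F x = F' x"
 shows "signed_integral M \<sigma> F = signed_integral M \<sigma>' F'"
proof -
 have p: "positive_variation M \<sigma> = positive_variation M \<sigma>'" if "\<And>D. D \<in> sets M ==> \<sigma> D = \<sigma>' D" for \<sigma> \<sigma>' :: "'a set => real"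
  unfolding positive_variation_def using that by (intro arg_cong[where f="measure_of (space M) (sets M)"] ext SUP_cong) auto
 have "space (positive_variation M \<sigma>) = space M" for \<sigma>
  unfolding positive_variation_def by (rule space_measure_of[OF sets.space_closed])
 then have "integral\<^sup>L (positive_variation M \<sigma>) F = integral\<^sup>L (positive_variation M \<sigma>) F'" for \<sigma>
  using F by (intro lint_cong) auto
 then show ?thesis unfolding signed_integral_def using p[of \<sigma> \<sigma>'] p[of "%D. - \<sigma> D" "%D. - \<sigma>' D"] assms(1) by simp
qed

locale weighted_ud_process = ud_process m X \<mu> r
 for m :: nat and X :: "'d::finite config set" and \<mu> :: "'d config measure" and r :: real +
 fixes w :: "nat => real" and B :: "(real ^ 'd) set"
 assumes B_borel: "B \<in> sets borel" and B_bounded: "bounded B" and B_pos: "emeasure lborel B > 0"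
begin

text \<open>\<open>w\<close> is an arbitrary sequence and may be unbounded beyond index
  \<open>m\<close>. Cutting it off changes nothing on the atoms and gives the uniform bound that the
  abstract setting requires.\<close>

definition v :: "nat => real" where "v i = (if i \<in> {1..m} then w i else 0)"

sublocale weighted_point_family P A Z D translate v "\<Sum>i = 1..m. \<bar>w i\<bar>" B
proof (intro weighted_point_family.intro weighted_point_family_axioms.intro B_borel B_bounded B_pos)
 show "point_family P A Z D translate" by (rule point_family_axioms)
 show "\<bar>v i\<bar> <= (\<Sum>i = 1..m. \<bar>w i\<bar>)" for i
 proof (cases "i \<in> {1..m}")
  case True
  have "\<bar>w i\<bar> <= (\<Sum>i = 1..m. \<bar>w i\<bar>)" by (rule member_le_sum[OF True]) auto
  then show ?thesis using True unfolding v_def by simp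
 next
  case False
  then have "v i = 0" unfolding v_def by (rule if_not_P)
  then show ?thesis by (simp add: sum_nonneg)
 qed
qed

lemma v_atom: "\<xi> \<in> X ==> z \<in> atoms \<xi> ==> v (snd z) = w (snd z)"
proof -
 assume \<xi>: "\<xi> \<in> X" and z: "z \<in> atoms \<xi>"
 interpret ud_configuration m \<xi> r by (rule ud[OF \<xi>])
 have "z \<in> coloured_space m" using z atoms_subset by blast
 then show ?thesis unfolding v_def coloured_space_def by auto
qed

lemma infsum_mass:
 assumes \<xi>: "\<xi> \<in> X" and f: "0 <= c" "\<And>x. norm (f x) <= c * decay x"
 shows "weighted_count m w f \<xi> = count f \<xi>"
proof -
 interpret ud_configuration m \<xi> r by (rule ud[OF \<xi>])
 have "integrable (count_space (pts A Z \<xi>)) (%z. of_real (v (snd z)) * f (fst z))"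
  by (rule count_bound(2)[OF _ f]) (simp only: space_P \<xi>)
 then have i: "integrable (count_space (atoms \<xi>)) (%z. of_real (v (snd z)) * f (fst z))"
  unfolding pts_eq_atoms[OF \<xi>] .
 have eq: "of_real (w (snd z)) * f (fst z) = of_real (v (snd z)) * f (fst z)" if "z \<in> atoms \<xi>" for z
  using v_atom[OF \<xi> that] by simp
 have i': "integrable (count_space (atoms \<xi>)) (%z. of_real (w (snd z)) * f (fst z))"
  using i by (subst integrable_cong_lint[OF refl eq]) auto
 show ?thesis unfolding weighted_count_def infsum_weighted_mass[OF i'] count_def pts_eq_atoms[OF \<xi>]
  by (rule lint_cong) (use eq in auto)
qed

lemma palm_measure_eq: "palm_measure m X \<mu> B w E = palm E"
proof -
 have "(\<Sum>\<^sub>\<infinity>x\<in>B. weighted_mass m w \<xi> x * indicator E (translate (- x) \<xi>))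
   = (\<integral>z. v (snd z) * indicator B (fst z) * indicator E (translate (- fst z) \<xi>) \<partial>count_space (pts A Z \<xi>))" (is "?S = _")
  if \<xi>: "\<xi> \<in> X" for \<xi>
 proof -
  interpret ud_configuration m \<xi> r by (rule ud[OF \<xi>])
  define h :: "real ^ 'd => real" where "h x = indicator B x * indicator E (translate (- x) \<xi>)" for x
  have h: "norm (complex_of_real (h x)) <= \<beta> * decay x" for x
   using indicator_B_le[of x] \<beta>(1) unfolding h_def by (auto simp: indicator_def)
  have "integrable (count_space (pts A Z \<xi>)) (%z. complex_of_real (v (snd z)) * complex_of_real (h (fst z)))"
   by (rule count_bound(2)[OF _ _ h]) (use \<beta>(1) in \<open>auto simp only: space_P \<xi>\<close>)
  from integrable_Re[OF this] have i: "integrable (count_space (atoms \<xi>)) (%z. v (snd z) * h (fst z))"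
   unfolding pts_eq_atoms[OF \<xi>] by simp
  have eq: "of_real (w (snd z)) * h (fst z) = v (snd z) * h (fst z)" if "z \<in> atoms \<xi>" for z
   using v_atom[OF \<xi> that] by simp
  have i': "integrable (count_space (atoms \<xi>)) (%z. of_real (w (snd z)) * h (fst z))"
   using i by (subst integrable_cong_lint[OF refl eq]) auto
  have "?S = (\<Sum>\<^sub>\<infinity>x\<in>UNIV. of_real (weighted_mass m w \<xi> x) * h x)"
   by (rule infsum_cong_neutral) (auto simp: h_def)
  also have "\<dots> = (\<integral>z. of_real (w (snd z)) * h (fst z) \<partial>count_space (atoms \<xi>))" by (rule infsum_weighted_mass[OF i'])
  also have "\<dots> = (\<integral>z. v (snd z) * h (fst z) \<partial>count_space (atoms \<xi>))"
   by (rule lint_cong) (use eq in auto)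
  finally show ?thesis unfolding h_def pts_eq_atoms[OF \<xi>] by (simp only: mult.assoc)
 qed
 then have "(LINT \<xi>|P. (\<Sum>\<^sub>\<infinity>x\<in>B. weighted_mass m w \<xi> x * indicator E (translate (- x) \<xi>)))
   = (\<integral>\<xi>. (\<integral>z. v (snd z) * indicator B (fst z) * indicator E (translate (- fst z) \<xi>) \<partial>count_space (pts A Z \<xi>)) \<partial>P)"
  by (intro lint_cong) (auto simp: space_P)
 moreover have "(LINT \<xi>:X|\<mu>. (\<Sum>\<^sub>\<infinity>x\<in>B. weighted_mass m w \<xi> x * indicator E (translate (- x) \<xi>)))
   = (LINT \<xi>|P. (\<Sum>\<^sub>\<infinity>x\<in>B. weighted_mass m w \<xi> x * indicator E (translate (- x) \<xi>)))"
  unfolding set_lebesgue_integral_def P_def using X_sets by (intro integral_restrict_space[symmetric]) auto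
 ultimately show ?thesis unfolding palm_measure_def palm_def vol_def by simp
qed

text \<open>Compact support of \<open>\<psi>\<close> is not assumed: the Fourier transform evaluates
  the first moment at transforms of rapidly decreasing functions, which are dominated by
  \<open>decay\<close> only.\<close>

lemma palm_first_moment_eq:
 assumes "\<psi> \<in> borel_measurable borel" "0 <= c" "\<And>x. norm (\<psi> x) <= c * decay x"
 shows "palm_first_moment m X \<mu> B w \<psi> = corr \<psi>"
proof -
 have "palm_first_moment m X \<mu> B w \<psi> = signed_integral P palm (count \<psi>)"
  unfolding palm_first_moment_def P_def[symmetric]
  by (rule signed_integral_cong) (use palm_measure_eq infsum_mass[OF _ assms(2,3)] in \<open>auto simp: space_P\<close>)
 also have "\<dots> = corr \<psi>" by (rule signed_integral_palm[OF assms(1,3,2)])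
 finally show ?thesis .
qed

lemma weighted_count_eq: "f \<in> rapidly_decreasing ==> \<xi> \<in> space P ==> weighted_count m w f \<xi> = count f \<xi>"
 using rapidly_decreasing_decay[of f] infsum_mass unfolding space_P by (meson less_imp_le)

end

lemma fourier_gauss: "fourier (%x :: real ^ 'd::finite. complex_of_real (gauss x)) = (%x. of_real (gauss x))"
 unfolding fourier_def by (rule ext) (rule gauss_fourier)

lemma gauss_rapidly_decreasing: "(%x :: real ^ 'd::finite. complex_of_real (gauss x)) \<in> rapidly_decreasing"
 using gauss_translate_rapidly_decreasing[of "0 :: real ^ 'd"] by simp

text \<open>Transforms of translated Gaussians are characters times \<open>gauss\<close>. By the
  monotone class principle the closure contains every bounded Borel function times
  \<open>gauss\<close>, and any square integrable \<open>f\<close> is a limit of truncations of this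
  form.\<close>

lemma fourier_dense:
 fixes \<nu> :: "(real ^ 'd::finite) measure"
 assumes sets_\<nu>: "sets \<nu> = sets borel"
  and sq: "\<And>f. f \<in> rapidly_decreasing ==> fourier f \<in> square_integrable \<nu>"
  and f: "f \<in> square_integrable \<nu>" and \<epsilon>: "\<epsilon> > 0"
 shows "\<exists>s\<in>rapidly_decreasing. l2_dist \<nu> f (fourier s) < \<epsilon>"
proof -
 define Cl where "Cl h \<longleftrightarrow> h \<in> square_integrable \<nu> \<and> (\<forall>\<epsilon>>0. \<exists>s\<in>rapidly_decreasing. l2_dist \<nu> h (fourier s) < \<epsilon>)" for h
 note meas = measurable_cong_sets[OF sets_\<nu> refl]
 have base: "Cl (fourier s)" if "s \<in> rapidly_decreasing" for s
  unfolding Cl_def using sq[OF that] that by (auto simp: l2_dist_self intro!: bexI[of _ s])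
 have lin: "Cl (%x. c * h x + k x)" if h: "Cl h" and k: "Cl k" for c h k
  unfolding Cl_def
 proof (intro conjI allI impI)
  have hk: "h \<in> square_integrable \<nu>" "k \<in> square_integrable \<nu>" using h k unfolding Cl_def by auto
  show "(%x. c * h x + k x) \<in> square_integrable \<nu>" by (intro square_integrable_add square_integrable_scale hk)
  fix e :: real assume e: "e > 0"
  \<comment> \<open>The estimate needs \<open>2 * (cmod c)^2 + 2\<close>; the extra 1 makes the
    final inequality strict.\<close>
  let ?K = "2 * (cmod c)\<^sup>2 + 3"
  have K: "?K > 0" by (rule add_nonneg_pos) simp_all
  define \<delta> where "\<delta> = e / ?K"
  have \<delta>: "\<delta> > 0" "\<delta> * ?K = e" unfolding \<delta>_def using e K by auto
  obtain s where s: "s \<in> rapidly_decreasing" "l2_dist \<nu> h (fourier s) < \<delta>" using h \<delta>(1) unfolding Cl_def by blast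
  obtain t where t: "t \<in> rapidly_decreasing" "l2_dist \<nu> k (fourier t) < \<delta>" using k \<delta>(1) unfolding Cl_def by blast
  have "l2_dist \<nu> (%x. c * h x + k x) (fourier (%x. c * s x + t x))
   <= 2 * l2_dist \<nu> (%x. c * h x) (%x. c * fourier s x) + 2 * l2_dist \<nu> k (fourier t)"
   unfolding fourier_linear[OF s(1) t(1)] by (intro l2_dist_add square_integrable_scale hk sq s t)
  also have "\<dots> = 2 * (cmod c)\<^sup>2 * l2_dist \<nu> h (fourier s) + 2 * l2_dist \<nu> k (fourier t)"
   unfolding l2_dist_scale by simp
  also have "\<dots> <= 2 * (cmod c)\<^sup>2 * \<delta> + 2 * \<delta>" using s(2) t(2) by (intro add_mono mult_left_mono) auto
  also have "\<dots> < \<delta> * ?K" using \<delta>(1) by (simp add: algebra_simps)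
  finally have "l2_dist \<nu> (%x. c * h x + k x) (fourier (%x. c * s x + t x)) < e" unfolding \<delta>(2) .
  then show "\<exists>s\<in>rapidly_decreasing. l2_dist \<nu> (%x. c * h x + k x) (fourier s) < e"
   by (rule bexI[OF _ rapidly_decreasing_linear[OF s(1) t(1)]])
 qed
 have dominated: "Cl h" if F: "\<And>n. Cl (F n)" and G: "\<And>n x. norm (F n x) <= G x" "integrable \<nu> (%x. (G x)\<^sup>2)"
  and l: "\<And>x. (%n. F n x) \<longlonglongrightarrow> h x" for F :: "nat => real ^ 'd => complex" and G h
 proof -
  have Fs: "F n \<in> square_integrable \<nu>" for n using F unfolding Cl_def by blast
  have Fm[measurable]: "F n \<in> borel_measurable \<nu>" for n by (rule square_integrable_measurable[OF Fs])
  have hm[measurable]: "h \<in> borel_measurable \<nu>" by (rule borel_measurable_LIMSEQ_metric[OF Fm l])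
  have hG: "norm (h x) <= G x" for x by (rule LIMSEQ_le_const2[OF tendsto_norm[OF l]]) (use G(1) in auto)
  have hs: "h \<in> square_integrable \<nu>"
   unfolding square_integrable_def
  proof (intro CollectI conjI hm)
   show "integrable \<nu> (%x. (cmod (h x))\<^sup>2)"
   proof (rule integrable_bound_AE[OF G(2)])
   show "AE x in \<nu>. norm ((cmod (h x))\<^sup>2) <= norm ((G x)\<^sup>2)"
   by (rule AE_I2) (use power_mono[OF hG norm_ge_zero, of _ 2] in simp)
   qed measurable
  qed
  have "(%n. LINT x|\<nu>. (cmod (h x - F n x))\<^sup>2) \<longlonglongrightarrow> (LINT x|\<nu>. (0 :: real))"
  proof (rule integral_dominated_convergence[where w="%x. 4 * (G x)\<^sup>2"])
   show "integrable \<nu> (%x. 4 * (G x)\<^sup>2)" using G(2) by (rule integrable_mult_right)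
   show "AE x in \<nu>. (%n. (cmod (h x - F n x))\<^sup>2) \<longlonglongrightarrow> 0"
   proof (rule AE_I2)
   fix x
   have "(%n. (cmod (h x - F n x))\<^sup>2) \<longlonglongrightarrow> (cmod (h x - h x))\<^sup>2" by (intro tendsto_intros l)
   then show "(%n. (cmod (h x - F n x))\<^sup>2) \<longlonglongrightarrow> 0" by simp
   qed
   show "AE x in \<nu>. norm ((cmod (h x - F n x))\<^sup>2) <= 4 * (G x)\<^sup>2" for n
   proof (rule AE_I2)
   fix x
   have "cmod (h x - F n x) <= 2 * G x" using norm_triangle_ineq4[of "h x" "F n x"] hG[of x] G(1)[of n x] by linarith
   then have "(cmod (h x - F n x))\<^sup>2 <= (2 * G x)\<^sup>2" by (rule power_mono) simp
   then show "norm ((cmod (h x - F n x))\<^sup>2) <= 4 * (G x)\<^sup>2" by (simp add: power_mult_distrib)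
   qed
  qed measurable
  then have l0: "(%n. l2_dist \<nu> h (F n)) \<longlonglongrightarrow> 0" unfolding l2_dist_def by simp
  have "\<exists>s\<in>rapidly_decreasing. l2_dist \<nu> h (fourier s) < e" if e: "e > 0" for e
  proof -
   have e4: "e / 4 > 0" using e by simp
   obtain n where n: "l2_dist \<nu> h (F n) < e / 4"
   using eventually_happens[OF order_tendstoD(2)[OF l0 e4]] by auto
   obtain s where s: "s \<in> rapidly_decreasing" "l2_dist \<nu> (F n) (fourier s) < e / 4" using F[of n] e4 unfolding Cl_def by blast
   have "l2_dist \<nu> h (fourier s) <= 2 * l2_dist \<nu> h (F n) + 2 * l2_dist \<nu> (F n) (fourier s)"
   by (intro l2_dist_triangle hs Fs sq s)
   also have "\<dots> < e" using n s(2) by simp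
   finally show ?thesis using s(1) by blast
  qed
  then show "Cl h" unfolding Cl_def using hs by blast
 qed
 have g2: "integrable \<nu> (%x. (gauss x)\<^sup>2)"
  using square_integrableD[OF sq[OF gauss_rapidly_decreasing]] unfolding fourier_gauss by simp
 define Q where "Q h \<longleftrightarrow> Cl (%x. h x * of_real (gauss x))" for h
 interpret character_class Q
 proof
  fix h k assume "Q h" "Q k"
  then have "Cl (%x. 1 * (h x * of_real (gauss x)) + k x * of_real (gauss x))" unfolding Q_def by (rule lin)
  then show "Q (%x. h x + k x)" unfolding Q_def by (simp add: distrib_right)
 next
  fix h c assume h: "Q h"
  \<comment> \<open>Scaling is obtained from the combined closure rule \<open>c * h + k\<close> by
    splitting off one copy of \<open>h\<close>.\<close>
  then have "Cl (%x. (c - 1) * (h x * of_real (gauss x)) + h x * of_real (gauss x))" unfolding Q_def by (intro lin)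
  moreover have "(%x. (c - 1) * (h x * of_real (gauss x)) + h x * of_real (gauss x)) = (%x. c * h x * of_real (gauss x))"
   by (rule ext) (simp add: algebra_simps)
  ultimately show "Q (%x. c * h x)" unfolding Q_def by simp
 next
  fix F :: "nat => real ^ 'd => complex" and h and c
  assume F: "\<And>n. Q (F n)" and c: "\<And>n x. norm (F n x) <= c" and l: "\<And>x. (%n. F n x) \<longlonglongrightarrow> h x"
  show "Q h" unfolding Q_def
  proof (rule dominated[where G="%x. c * gauss x" and F="%n x. F n x * of_real (gauss x)"])
   show "Cl (%x. F n x * of_real (gauss x))" for n using F unfolding Q_def .
   show "norm (F n x * of_real (gauss x)) <= c * gauss x" for n x
   using mult_right_mono[OF c[of n x] gauss_nonneg[of x]] by (simp add: norm_mult)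
   show "integrable \<nu> (%x. (c * gauss x)\<^sup>2)" unfolding power_mult_distrib by (intro integrable_mult_right g2)
   show "(%n. F n x * of_real (gauss x)) \<longlonglongrightarrow> h x * of_real (gauss x)" for x by (intro tendsto_intros l)
  qed
 next
  fix a :: "real ^ 'd"
  \<comment> \<open>Chosen so that translating the Gaussian by \<open>?t\<close> multiplies its
    transform by the character of frequency \<open>a\<close>.\<close>
  let ?t = "- (a /\<^sub>R (2 * pi))"
  have "- 2 * pi * (?t \<bullet> x) = a \<bullet> x" for x by simp
  then have "rep_U ?t (%x. of_real (gauss x)) = (%x. cis (a \<bullet> x) * of_real (gauss x))"
   unfolding rep_U_def[abs_def] by (simp only:)
  then show "Q (%x. cis (a \<bullet> x))"
   using base[OF rapidly_decreasing_shift[OF gauss_rapidly_decreasing gauss_rapidly_decreasing], of ?t]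
   unfolding Q_def fourier_shift[OF gauss_rapidly_decreasing] fourier_gauss by simp
 qed
 have fm: "f \<in> borel_measurable borel" using square_integrable_measurable[OF f] unfolding meas .
 \<comment> \<open>Cutting where \<open>f\<close> exceeds \<open>n\<close> times
   \<open>gauss\<close> makes the quotient by \<open>gauss\<close> bounded; every point is
   eventually kept because \<open>gauss\<close> is positive.\<close>
 define h where "h n x = (if cmod (f x) <= real n * gauss x then f x / of_real (gauss x) else 0)" for n :: nat and x
 have hg: "h n x * of_real (gauss x) = (if cmod (f x) <= real n * gauss x then f x else 0)" for n x
  unfolding h_def using gauss_pos[of x] by auto
 have "Cl f"
 proof (rule dominated[where G="%x. cmod (f x)" and F="%n x. h n x * of_real (gauss x)"])
  fix n
  have "norm (h n x) <= real n" for x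
  proof (cases "cmod (f x) <= real n * gauss x")
   case True
   then show ?thesis unfolding h_def using gauss_pos[of x] by (simp add: norm_divide pos_divide_le_eq)
  next
   case False
   then show ?thesis unfolding h_def by simp
  qed
  note bounded = this
  have "h n \<in> borel_measurable borel" unfolding h_def[abs_def]
  proof (rule measurable_If)
   show "{x \<in> space borel. cmod (f x) <= real n * gauss x} \<in> sets borel"
   by (rule borel_measurable_le[OF measurable_compose[OF fm borel_measurable_norm] borel_measurable_times[OF borel_measurable_const borel_measurable_gauss]])
   show "(%x. f x / complex_of_real (gauss x)) \<in> borel_measurable borel"
   by (rule borel_measurable_divide[OF fm]) (intro borel_measurable_continuous_onI continuous_on_of_real continuous_gauss)
  qed (rule borel_measurable_const)
  then have "Q (h n)" by (rule borel_complex[OF _ bounded])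
  then show "Cl (%x. h n x * of_real (gauss x))" unfolding Q_def .
  show "norm (h n x * of_real (gauss x)) <= cmod (f x)" for x unfolding hg by simp
 next
  show "integrable \<nu> (%x. (cmod (f x))\<^sup>2)" by (rule square_integrableD[OF f])
  fix x
  obtain N :: nat where N: "cmod (f x) / gauss x <= real N" using real_arch_simple by blast
  have "h n x * of_real (gauss x) = f x" if "n \<ge> N" for n
  proof -
   have "cmod (f x) <= real N * gauss x" using N gauss_pos[of x] by (simp add: divide_le_eq)
   also have "\<dots> <= real n * gauss x" using that by (intro mult_right_mono) auto
   finally show ?thesis unfolding hg by simp
  qed
  then show "(%n. h n x * of_real (gauss x)) \<longlonglongrightarrow> f x"
   by (intro tendsto_eventually eventually_sequentiallyI[of N])
 qed
 then show ?thesis unfolding Cl_def using \<epsilon> by blast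
qed

context weighted_ud_process
begin

lemma spectral_measure:
 "\<exists>\<nu>. is_fourier_transform (palm_first_moment m X \<mu> B w) \<nu> \<and>
   (\<forall>f\<in>rapidly_decreasing. fourier f \<in> square_integrable \<nu> \<and> count f \<in> square_integrable P \<and>
   (LINT \<xi>|P. (cmod (count f \<xi>))\<^sup>2) = (LINT y|\<nu>. (cmod (fourier f y))\<^sup>2))"
proof -
 obtain \<nu> where \<nu>: "sets \<nu> = sets borel" "\<forall>K. compact K --> emeasure \<nu> K < \<infinity>"
  "\<forall>F c. continuous_on UNIV F --> (\<forall>x. norm (F x) <= c * (decay x)\<^sup>2) --> (\<forall>y. norm (fourier F y) <= c * decay y) -->
   integrable \<nu> F \<and> integral\<^sup>L \<nu> F = corr (fourier F)"
  using spectral_measure_exists by blast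
 have "is_fourier_transform (palm_first_moment m X \<mu> B w) \<nu>"
  unfolding is_fourier_transform_def
 proof (intro conjI \<nu>(1,2) ballI)
  fix f :: "real ^ 'd => complex" assume f: "f \<in> rapidly_decreasing"
  obtain c where c: "c > 0" "\<And>x. norm (f x) <= c * (decay x)\<^sup>2" using rapidly_decreasing_bound[OF f, of "[]" 2] by auto
  obtain c' where c': "c' > 0" "\<And>y. norm (fourier f y) <= c' * decay y" using fourier_rapidly_decreasing_bound[OF f] by blast
  have i: "integrable \<nu> f \<and> integral\<^sup>L \<nu> f = corr (fourier f)"
  proof (rule \<nu>(3)[rule_format, of f "c + c'"])
   show "continuous_on UNIV f" using rapidly_decreasing_continuous[OF f, of UNIV "[]"] by simp
   show "norm (f x) <= (c + c') * (decay x)\<^sup>2" for x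
   using order_trans[OF c(2)[of x] mult_right_mono[of c "c + c'" "(decay x)\<^sup>2"]] c'(1) by simp
   show "norm (fourier f y) <= (c + c') * decay y" for y
   using order_trans[OF c'(2)[of y] mult_right_mono[of c' "c + c'" "decay y"]] c(1) by simp
  qed
  moreover have "palm_first_moment m X \<mu> B w (fourier f) = corr (fourier f)"
   by (rule palm_first_moment_eq[OF borel_measurable_fourier[OF rapidly_decreasing_measurable[OF f]] less_imp_le[OF c'(1)] c'(2)])
  ultimately show "integrable \<nu> f" "integral\<^sup>L \<nu> f = palm_first_moment m X \<mu> B w (fourier f)" by simp_all
 qed
 then show ?thesis using spectral_isometry[OF \<nu>(1,3)] by (intro exI[of _ \<nu>] conjI ballI)
qed

lemma spectral_embedding:
 defines "\<nu> \<equiv> fourier_transform_measure (palm_first_moment m X \<mu> B w)"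
 shows "\<exists>\<theta>. L2_isometric_embedding \<nu> P \<theta> \<and> extends_count_map m w \<nu> P \<theta> \<and> intertwines_U_T \<nu> P \<theta> \<and>
   (\<forall>\<theta>'. L2_isometric_embedding \<nu> P \<theta>' \<and> extends_count_map m w \<nu> P \<theta>' -->
   (\<forall>f \<in> square_integrable \<nu>. AE \<xi> in P. \<theta>' f \<xi> = \<theta> f \<xi>))"
proof -
 obtain \<nu>' where \<nu>': "is_fourier_transform (palm_first_moment m X \<mu> B w) \<nu>'"
  "\<And>f. f \<in> rapidly_decreasing ==> fourier f \<in> square_integrable \<nu>' \<and> count f \<in> square_integrable P \<and>
   (LINT \<xi>|P. (cmod (count f \<xi>))\<^sup>2) = (LINT y|\<nu>'. (cmod (fourier f y))\<^sup>2)"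
  using spectral_measure by blast
 \<comment> \<open>Uniqueness makes the described measure equal to the constructed one, so that all
   its properties become available.\<close>
 have "\<nu> = \<nu>'" unfolding \<nu>_def fourier_transform_measure_def
  by (rule the_equality, rule \<nu>'(1), rule fourier_transform_measure_unique[OF _ \<nu>'(1)])
 then have sets_\<nu>: "sets \<nu> = sets borel" using \<nu>'(1) unfolding is_fourier_transform_def by blast
 have sq: "fourier f \<in> square_integrable \<nu>" "weighted_count m w f \<in> square_integrable P"
  "(LINT \<xi>|P. (cmod (weighted_count m w f \<xi>))\<^sup>2) = (LINT y|\<nu>. (cmod (fourier f y))\<^sup>2)"
  if f: "f \<in> rapidly_decreasing" for f
 proof -
  note eq = weighted_count_eq[OF f]
  have cnt: "count f \<in> square_integrable P" using \<nu>'(2)[OF f] by blast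
  have "weighted_count m w f \<in> borel_measurable P"
   by (subst measurable_cong[OF eq]) (assumption, rule square_integrable_measurable[OF cnt])
  then show "weighted_count m w f \<in> square_integrable P"
   by (rule square_integrable_AE[OF cnt]) (rule AE_I2, rule eq[symmetric])
  have "(LINT \<xi>|P. (cmod (weighted_count m w f \<xi>))\<^sup>2) = (LINT \<xi>|P. (cmod (count f \<xi>))\<^sup>2)"
   by (rule lint_cong[OF refl]) (simp only: eq)
  also have "\<dots> = (LINT y|\<nu>'. (cmod (fourier f y))\<^sup>2)" by (rule \<nu>'(2)[OF f, THEN conjunct2, THEN conjunct2])
  finally show "(LINT \<xi>|P. (cmod (weighted_count m w f \<xi>))\<^sup>2) = (LINT y|\<nu>. (cmod (fourier f y))\<^sup>2)"
   unfolding \<open>\<nu> = \<nu>'\<close> .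
  show "fourier f \<in> square_integrable \<nu>" unfolding \<open>\<nu> = \<nu>'\<close> by (rule \<nu>'(2)[OF f, THEN conjunct1])
 qed
 have lin: "\<exists>u\<in>rapidly_decreasing. fourier u = (%x. c * fourier f x + fourier g x) \<and>
   (\<forall>\<xi>\<in>space P. weighted_count m w u \<xi> = c * weighted_count m w f \<xi> + weighted_count m w g \<xi>)"
  if f: "f \<in> rapidly_decreasing" and g: "g \<in> rapidly_decreasing" for f g and c
 proof (rule bexI[OF _ rapidly_decreasing_linear[OF f g, of c]], intro conjI ballI)
  show "fourier (%x. c * f x + g x) = (%x. c * fourier f x + fourier g x)" by (rule fourier_linear[OF f g])
  fix \<xi> assume \<xi>: "\<xi> \<in> space P"
  show "weighted_count m w (%x. c * f x + g x) \<xi> = c * weighted_count m w f \<xi> + weighted_count m w g \<xi>"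
   unfolding weighted_count_eq[OF rapidly_decreasing_linear[OF f g] \<xi>] weighted_count_eq[OF f \<xi>] weighted_count_eq[OF g \<xi>]
   by (rule count_linear[OF \<xi> f g])
 qed
 interpret L: dense_l2_isometry \<nu> P "rapidly_decreasing :: (real ^ 'd => complex) set" fourier "weighted_count m w"
 proof
  fix f :: "real ^ 'd => complex" and c :: complex assume f: "f \<in> rapidly_decreasing"
  show "fourier f \<in> square_integrable \<nu>" "weighted_count m w f \<in> square_integrable P"
   "(LINT \<xi>|P. (cmod (weighted_count m w f \<xi>))\<^sup>2) = (LINT y|\<nu>. (cmod (fourier f y))\<^sup>2)"
   by (rule sq[OF f])+
  show "\<exists>u\<in>rapidly_decreasing. fourier u = (%x. c * fourier f x) \<and>
   (\<forall>\<xi>\<in>space P. weighted_count m w u \<xi> = c * weighted_count m w f \<xi>)"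
  proof -
   \<comment> \<open>As for the closure above, scaling by \<open>c\<close> is the combination of
     \<open>f\<close> with itself with coefficient \<open>c - 1\<close>.\<close>
   have "(c - 1) * z + z = c * z" for z by (simp add: left_diff_distrib)
   then show ?thesis using lin[OF f f, of "c - 1"] by (simp only:)
  qed
 next
  fix f g :: "real ^ 'd => complex" assume "f \<in> rapidly_decreasing" "g \<in> rapidly_decreasing"
  from lin[OF this, of 1]
  show "\<exists>u\<in>rapidly_decreasing. fourier u = (%x. fourier f x + fourier g x) \<and>
   (\<forall>\<xi>\<in>space P. weighted_count m w u \<xi> = weighted_count m w f \<xi> + weighted_count m w g \<xi>)" by (simp only: mult_1)
 next
  fix f :: "real ^ 'd => complex" and \<epsilon> :: real assume f: "f \<in> square_integrable \<nu>" "\<epsilon> > 0"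
  show "\<exists>s\<in>rapidly_decreasing. l2_dist \<nu> f (fourier s) < \<epsilon>" by (rule fourier_dense[OF sets_\<nu> _ f]) (rule sq(1))
 qed
 have "intertwines_U_T \<nu> P L.extension"
  unfolding intertwines_U_T_def
 proof (intro allI ballI)
  fix t :: "real ^ 'd" and f assume f: "f \<in> square_integrable \<nu>"
  note tr = \<tau>_meas[of "- t"]
  show "AE \<xi> in P. L.extension (rep_U t f) \<xi> = rep_T t (L.extension f) \<xi>"
  proof (rule L.extension_intertwines[OF f])
   fix g assume g: "g \<in> square_integrable \<nu>"
   have gm: "g \<in> borel_measurable borel" using square_integrable_measurable[OF g] unfolding measurable_cong_sets[OF sets_\<nu> refl] .
   have "rep_U t g \<in> borel_measurable borel" unfolding rep_U_def[abs_def]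
   by (rule borel_measurable_times[OF borel_measurable_continuous_onI gm]) (intro continuous_on_cis continuous_intros)
   then show "rep_U t g \<in> square_integrable \<nu>"
   using square_integrableD[OF g] unfolding square_integrable_def measurable_cong_sets[OF sets_\<nu> refl]
   by (simp add: rep_U_def norm_mult)
   show "l2_dist \<nu> (rep_U t g) (rep_U t h) = l2_dist \<nu> g h" for h
   unfolding l2_dist_def rep_U_def by (simp add: norm_mult flip: right_diff_distrib)
  next
   fix F assume F: "F \<in> square_integrable P"
   note Fm = square_integrable_measurable[OF F]
   \<comment> \<open>Stationarity: \<open>F\<close> and its translate have the same distribution, so
     \<open>rep_T t\<close> is an isometry of L2.\<close>
   have "integrable (distr P P (translate (- t))) (%\<xi>. (cmod (F \<xi>))\<^sup>2)"
   unfolding stationary by (rule square_integrableD[OF F])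
   then have "integrable P (%\<xi>. (cmod (F (translate (- t) \<xi>)))\<^sup>2)"
   by (rule integrable_distr[OF tr])
   then show "rep_T t F \<in> square_integrable P"
   unfolding square_integrable_def rep_T_def[abs_def] using measurable_compose[OF tr Fm] by simp
   fix H assume H: "H \<in> square_integrable P"
   have "l2_dist P F H = (LINT \<xi>|distr P P (translate (- t)). (cmod (F \<xi> - H \<xi>))\<^sup>2)"
   unfolding stationary l2_dist_def ..
   also have "\<dots> = (LINT \<xi>|P. (cmod (F (translate (- t) \<xi>) - H (translate (- t) \<xi>)))\<^sup>2)"
   by (rule integral_distr[OF tr square_integrableD[OF square_integrable_diff[OF F H], THEN borel_measurable_integrable]])
   finally show "l2_dist P (rep_T t F) (rep_T t H) = l2_dist P F H" by (simp only: l2_dist_def rep_T_def)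
  next
   fix g :: "real ^ 'd => complex" assume g: "g \<in> rapidly_decreasing"
   note sh = rapidly_decreasing_shift[OF g g, of t]
   \<comment> \<open>The translate of \<open>g\<close> by \<open>t\<close> realises both actions:
     \<open>rep_U t\<close> on its transform and \<open>rep_T t\<close> on its count.\<close>
   show "\<exists>u\<in>rapidly_decreasing. fourier u = rep_U t (fourier g) \<and>
   (\<forall>\<xi>\<in>space P. weighted_count m w u \<xi> = rep_T t (weighted_count m w g) \<xi>)"
   proof (rule bexI[OF _ sh], intro conjI ballI)
   show "fourier (%x. g (x - t)) = rep_U t (fourier g)" by (rule fourier_shift[OF g])
   fix \<xi> assume \<xi>: "\<xi> \<in> space P"
   then have "translate (- t) \<xi> \<in> space P" by (rule measurable_space[OF tr])
   then show "weighted_count m w (%x. g (x - t)) \<xi> = rep_T t (weighted_count m w g) \<xi>"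
   unfolding rep_T_def weighted_count_eq[OF sh \<xi>] count_shift[OF \<xi>] by (rule weighted_count_eq[OF g, symmetric])
   qed
  qed
 qed
 note intertwines = this
 have ext: "extends_count_map m w \<nu> P L.extension"
  unfolding extends_count_map_def by (intro ballI conjI sq L.extension_base)
 have uniq: "AE \<xi> in P. \<theta> f \<xi> = L.extension f \<xi>"
  if "L2_isometric_embedding \<nu> P \<theta>" "extends_count_map m w \<nu> P \<theta>" "f \<in> square_integrable \<nu>" for \<theta> f
  by (rule L.extension_unique[OF that(1) _ that(3)]) (use that(2) in \<open>simp add: extends_count_map_def\<close>)
 show ?thesis
  by (intro exI[of _ L.extension] conjI allI impI ballI L.extension_isometric ext intertwines)
   (elim conjE, rule uniq, assumption+)
qed

end

theorem theorem3:
  fixes m :: nat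
    and X :: "'d::finite config set"
    and \<mu> :: "'d config measure"
    and B :: "(real ^ 'd) set"
    and w :: "nat \<Rightarrow> real"
  assumes "1 \<le> m"
    and "uniformly_discrete_ergodic_process m X \<mu>"
    and "B \<in> sets borel" and "bounded B" and "emeasure lborel B > 0"
  defines "\<nu> \<equiv> fourier_transform_measure (palm_first_moment m X \<mu> B w)"
    and "P \<equiv> restrict_space \<mu> X"
  shows "\<exists>\<theta>. L2_isometric_embedding \<nu> P \<theta> \<and> extends_count_map m w \<nu> P \<theta> \<and>
           intertwines_U_T \<nu> P \<theta> \<and>
           (\<forall>\<theta>'. L2_isometric_embedding \<nu> P \<theta>' \<and> extends_count_map m w \<nu> P \<theta>' \<longrightarrow>
              (\<forall>f \<in> square_integrable \<nu>. AE \<xi> in P. \<theta>' f \<xi> = \<theta> f \<xi>))"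
proof -
  obtain r where r: "r > 0" "X \<subseteq> uniformly_discrete_measures m r"
    using assms(2) unfolding uniformly_discrete_ergodic_process_def by blast
  interpret Q: weighted_ud_process m X \<mu> r w B
    by (intro weighted_ud_process.intro ud_process.intro weighted_ud_process_axioms.intro assms r)
  show ?thesis using Q.spectral_embedding unfolding \<nu>_def P_def Q.P_def .
qed

end
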